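(* Fix $0<\underline\alpha\le\overline\alpha<\infty$ and $K,M_0,M>0$. For all sufficiently large $n$, the adaptive center--outer dyadic estimator $\hat\Sigma^{\mathsf{Ada}}_{\mathcal G,\mathrm F}$ described in the context (it uses $[\underline\alpha,\overline\alpha]$ but not $\alpha$) is $\rho$-zCDP and, uniformly over $\alpha\in[\underline\alpha,\overline\alpha]$, $$ \sup_{P\in\mathcal P_\alpha^{\mathcal G}}\frac1d\,\mathbb E_P\|\hat\Sigma^{\mathsf{Ada}}_{\mathcal G,\mathrm F}-\Sigma(P)\|_F^2\;\lesssim_{\log}\;\Bigl(n^{-\frac{2\alpha+1}{2\alpha+2}}\wedge\frac dn\Bigr)+\Bigl(\bigl(\tfrac d{\rho n^2}\bigr)^{\frac{2\alpha+1}{2\alpha+3}}\wedge\frac{d^3}{\rho n^2}\Bigr). $$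
   Context: Norms and notation: $\|\cdot\|_F$ Frobenius norm, $a\wedge b=\min(a,b)$. $\|X\|_{\psi_2}=\sup_{\|v\|_2=1}\inf\{t>0:\mathbb E e^{\langle X,v\rangle^2/t^2}\le2\}$. $\chi_R(z)=z\min\{1,R/\|z\|_2\}$, $\chi_R(0)=0$ (for vectors and scalars). $A[B]$ is $A$ with entries outside $B$ set to zero. $\Pi_{M_0}$ is the spectral projection of a symmetric matrix that clips its eigenvalues to $[0,M_0]$. Privacy. Datasets are adjacent if they differ in one observation. For $\lambda>1$, $D_\lambda(P\|Q)=\frac1{\lambda-1}\log\int(\frac{dP}{dQ})^\lambda dQ$. A randomized algorithm $A$ is $\rho$-zCDP if $D_\lambda(A(S)\|A(S'))\le\rho\lambda$ for all adjacent $S,S'$ and all $\lambda\in(1,\infty)$. The exponential mechanism over a finite candidate set with privacy parameter $\varepsilon$ and scores of replacement sensitivity at most $\Delta$ selects a candidate with probability proportional to $\exp(\varepsilon\cdot\mathrm{score}/(2\Delta))$; below $\Delta=2L/n$. All randomizations are fresh. Model and class. Data are i.i.d. with mean $0$ (standing assumption). $\mathcal G_\alpha(M_0,M)$: $d\times d$ covariance matrices with $0\preceq\Sigma\preceq M_0I_d$ and $\max_j\sum_{i:|i-j|>k}|\Sigma_{ij}|\le Mk^{-\alpha}$ for all $k\ge1$. $\mathcal P^{\mathcal G}_\alpha$: (mean-zero) distributions $P$ on $\mathbb R^d$ with $\|X\|_{\psi_2}\le K$ and covariance $\Sigma(P)\in\mathcal G_\alpha(M_0,M)$. Regime. Sequences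 $(n,d,\rho)$, $n\to\infty$, with $d\gtrsim\log n$, $0<\rho\lesssim1$ (fixed upper bound), $d/(\rho n^2)\to0$. $a\lesssim_{\log}b$ means $a\le C\log^A(edn/\rho)\,b$ with $C,A$ not depending on $n,d,\rho$; "uniformly over $\alpha$" means that $C,A$ (and the threshold on $n$) do not depend on $\alpha\in[\underline\alpha,\overline\alpha]$. Blocks. The data are padded with deterministic zero coordinates so that $d$ is a power of two (the estimate of the original $\Sigma$ being the corresponding principal submatrix). For dyadic $k$, $N_k=d/k$, $I_{k,\ell}=\{1+(\ell-1)k,\dots,\ell k\}$, $B_{k;\ell,r}=I_{k,\ell}\times I_{k,\ell+r}$, and $\mathcal B_k=\{B_{k;2\ell-1,2},B_{k;2\ell-1,3},B_{k;2\ell,2}:1\le\ell<N_{2k}\}$. Below, $C,C_1,C_{\mathcal G}$ denote suitable sufficiently large fixed constants, $C$ possibly different at each occurrence ($C_{\mathcal G}$ depends only on the class and model bounds); $L=CK^2\log n$. Dense release $\mathsf{DPCovBlock}(X,B;\rho_B,R)$, $B=I\times J$: return $\frac1n\sum_i\chi_R(X_{i,I})\chi_R(X_{i,J})^\top+\sigma_BM_B$, $\sigma_B^2=18R^4/(\rho_Bn^2)$, $M_B$ the $B$-block of a symmetric $d\times d$ matrix with i.i.d. $N(0,1)$ upper triangular entries. Peeling release (block $B=I\times J$ of side $k$, radius $a$, budget $\rho_B$): choose $r\in\arg\min_{1\le r\le k}\{a^2/r+r/n+kr^2/(\rho_Bn^2)\}$. Set $\widetilde A_{uv}=\frac1n\sum_i\chi_L(X_{i,I(u)}X_{i,J(v)})$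 for $u,v\in[k]$, where $I(u)$, $J(v)$ are the $u$-th and $v$-th elements of $I$, $J$. Starting with all $k^2$ coordinates available, perform $kr$ successive exponential-mechanism selections (without replacement) with score $|\widetilde A_{uv}|$ and privacy parameter $\sqrt{\rho_B/(kr)}$; let $\hat S$ be the selected set. Return the matrix with entries $\widetilde A_{uv}+G_{uv}$ on $\hat S$, $G_{uv}$ i.i.d. $N(0,4L^2kr/(\rho_Bn^2))$, and zero elsewhere. The adaptive estimator. Let $J_{\mathrm{sq}}=\log_2d-1$. (1) Center: with $R_0=K\sqrt{C_1(1+\log n)}$, set $\hat\Sigma[B_{1;\ell,r}]=\mathsf{DPCovBlock}(X,B_{1;\ell,r};(\rho/4)/(2d),R_0)$ for $r\in\{0,1\}$, $\ell+r\le d$; all other entries start at zero. (2) For $k=1,2,4,\dots,d/4$: let $J_k=\lceil(\overline\alpha-\underline\alpha)\log_2k\rceil$, $a_j=C_{\mathcal G}k^{-\underline\alpha}2^{-j}$ and $\rho_{k,j}=\rho/\{4J_{\mathrm{sq}}N_{2k}(J_k+1)\}$ for $0\le j\le J_k$. For each $j$ put $$W_{k,j,0}=ka_j^2,\quad W_{k,j,\mathrm{str}}=k\min_{1\le r\le k}\Bigl\{\frac{a_j^2}r+\frac rn+\frac{kr^2}{\rho_{k,j}n^2}\Bigr\},\quad W_{k,j,\mathrm{dense}}=\frac{k^2}n+\frac{k^4}{\rho_{k,j}n^2}.$$ Choose $t_{k,j}\in\arg\min_{t\in\{0,\mathrm{str},\mathrm{dense}\}}W_{k,j,t}$ (fixed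 tie-breaking) and $D_{k,j}=\{C(\log n)^CW_{k,j,t_{k,j}}\}^{1/2}$. For each $B\in\mathcal B_k$ compute a candidate: $0$ if $t_{k,j}=0$; the peeling release with radius $a_j$ and budget $\rho_{k,j}$ if $t_{k,j}=\mathrm{str}$; $\mathsf{DPCovBlock}(X,B;\rho_{k,j},R_k)$ with $R_k^2=CK^2(k+\log n)$ if $t_{k,j}=\mathrm{dense}$. Radially clip it to the Frobenius-norm ball of radius $\sqrt k\,a_0$, giving $Z_{B,k,j}$. Let $\hat j_k=\max\{j:\max_{B\in\mathcal B_k}\|Z_{B,k,j}-Z_{B,k,i}\|_F\le D_{k,j}+D_{k,i}\ \forall i<j\}$ and set $\hat\Sigma[B]=Z_{B,k,\hat j_k}$ for $B\in\mathcal B_k$. (3) Fill the lower triangular part by symmetry and return $\hat\Sigma^{\mathsf{Ada}}_{\mathcal G,\mathrm F}=\Pi_{M_0}(\hat\Sigma)$. *)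

theory Defs
  imports "HOL-Probability.Probability"
begin

text \<open>A point of $R^d$ is a function on \<open>{1..d}\<close>, a $d \times d$ matrix is a function on
  \<open>{1..d} \<times> {1..d}\<close>, and both spaces carry the product Borel sigma-algebra \<open>PiM _ (\<lambda>_. borel)\<close>.
  Euclidean and Frobenius norms are \<open>L2_set\<close>. A dataset of size \<open>n\<close> is a family of
  points indexed by \<open>{1..n}\<close>.\<close>

section \<open>Model and class\<close>

abbreviation vec_space :: "nat \<Rightarrow> (nat \<Rightarrow> real) measure" where
  "vec_space d \<equiv> PiM {1..d} (\<lambda>_. borel)"

abbreviation mat_space :: "nat \<Rightarrow> (nat \<times> nat \<Rightarrow> real) measure" where
  "mat_space d \<equiv> PiM ({1..d} \<times> {1..d}) (\<lambda>_. borel)"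

definition psi2_norm :: "nat \<Rightarrow> (nat \<Rightarrow> real) measure \<Rightarrow> ennreal" where
  "psi2_norm d P =
    (SUP v\<in>{v. L2_set v {1..d} = 1}.
      INF t\<in>{t::real. 0 < t \<and> (\<integral>\<^sup>+x. ennreal (exp ((\<Sum>i=1..d. x i * v i)\<^sup>2 / t\<^sup>2)) \<partial>P) \<le> 2}. ennreal t)"

definition covariance :: "(nat \<Rightarrow> real) measure \<Rightarrow> nat \<times> nat \<Rightarrow> real" where
  "covariance P = (\<lambda>(i, j). \<integral>x. (x i - (\<integral>y. y i \<partial>P)) * (x j - (\<integral>y. y j \<partial>P)) \<partial>P)"

definition G_class :: "nat \<Rightarrow> real \<Rightarrow> real \<Rightarrow> real \<Rightarrow> (nat \<times> nat \<Rightarrow> real) set" where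
  "G_class d \<alpha> M\<^sub>0 M = {S.
     (\<forall>i\<in>{1..d}. \<forall>j\<in>{1..d}. S (i, j) = S (j, i)) \<and>
     (\<forall>v :: nat \<Rightarrow> real. 0 \<le> (\<Sum>i=1..d. \<Sum>j=1..d. v i * S (i, j) * v j)
        \<and> (\<Sum>i=1..d. \<Sum>j=1..d. v i * S (i, j) * v j) \<le> M\<^sub>0 * (\<Sum>i=1..d. (v i)\<^sup>2)) \<and>
     (\<forall>k\<ge>1. \<forall>j\<in>{1..d}.
        (\<Sum>i | i \<in> {1..d} \<and> \<bar>int i - int j\<bar> > int k. \<bar>S (i, j)\<bar>) \<le> M * real k powr (- \<alpha>))}"

definition P_class ::
  "nat \<Rightarrow> real \<Rightarrow> real \<Rightarrow> real \<Rightarrow> real \<Rightarrow> (nat \<Rightarrow> real) measure set" where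
  "P_class d \<alpha> K M\<^sub>0 M = {P.
     prob_space P \<and> sets P = sets (vec_space d) \<and>
     (\<forall>i\<in>{1..d}. integrable P (\<lambda>x. x i) \<and> (\<integral>x. x i \<partial>P) = 0) \<and>
     psi2_norm d P \<le> ennreal K \<and>
     covariance P \<in> G_class d \<alpha> M\<^sub>0 M}"

definition risk ::
  "nat \<Rightarrow> nat \<Rightarrow> ((nat \<Rightarrow> nat \<Rightarrow> real) \<Rightarrow> (nat \<times> nat \<Rightarrow> real) measure)
    \<Rightarrow> (nat \<Rightarrow> real) measure \<Rightarrow> ennreal" where
  "risk n d A P = ennreal (1 / real d) *
     (\<integral>\<^sup>+X. (\<integral>\<^sup>+Y. ennreal ((L2_set (\<lambda>q. Y q - covariance P q) ({1..d} \<times> {1..d}))\<^sup>2) \<partial>A X)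
       \<partial>PiM {1..n} (\<lambda>_. P))"

section \<open>Privacy\<close>

definition renyi_divergence :: "real \<Rightarrow> 'a measure \<Rightarrow> 'a measure \<Rightarrow> ereal" where
  "renyi_divergence l P Q =
    (let I = (\<integral>\<^sup>+x. ennreal (enn2real (RN_deriv Q P x) powr l) \<partial>Q) in
     if absolutely_continuous Q P \<and> I < \<infinity> then ereal (1 / (l - 1) * ln (enn2real I)) else \<infinity>)"

definition adjacent :: "nat \<Rightarrow> (nat \<Rightarrow> 'a) \<Rightarrow> (nat \<Rightarrow> 'a) \<Rightarrow> bool" where
  "adjacent n X X' \<longleftrightarrow> (\<exists>i\<in>{1..n}. \<forall>j\<in>{1..n} - {i}. X j = X' j)"

text \<open>A randomized algorithm is a Markov kernel from datasets with observations in \<open>D\<close> to outputs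
  in \<open>T\<close>.\<close>

definition zCDP ::
  "nat \<Rightarrow> 'a measure \<Rightarrow> 'b measure \<Rightarrow> real \<Rightarrow> ((nat \<Rightarrow> 'a) \<Rightarrow> 'b measure) \<Rightarrow> bool" where
  "zCDP n D T \<rho> A \<longleftrightarrow>
     A \<in> measurable (PiM {1..n} (\<lambda>_. D)) (prob_algebra T) \<and>
     (\<forall>X\<in>space (PiM {1..n} (\<lambda>_. D)). \<forall>X'\<in>space (PiM {1..n} (\<lambda>_. D)).
        adjacent n X X' \<longrightarrow> (\<forall>l>1. renyi_divergence l (A X) (A X') \<le> ereal (\<rho> * l)))"

section \<open>Private releases of a block\<close>

text \<open>Radial clipping of a vector, or of a matrix, with index set \<open>A\<close>; and of a scalar. The value
  at zero is zero since \<open>x / 0 = 0\<close>.\<close>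

definition vclip :: "'i set \<Rightarrow> real \<Rightarrow> ('i \<Rightarrow> real) \<Rightarrow> 'i \<Rightarrow> real" where
  "vclip A R z = (\<lambda>i. z i * min 1 (R / L2_set z A))"

definition sclip :: "real \<Rightarrow> real \<Rightarrow> real" where
  "sclip R z = z * min 1 (R / \<bar>z\<bar>)"

text \<open>The block \<open>I \<times> J\<close> of the symmetric \<open>p \<times> p\<close> noise matrix is read off its upper
  triangular entries \<open>g\<close>.\<close>

definition dp_cov_block ::
  "nat \<Rightarrow> nat \<Rightarrow> (nat \<Rightarrow> nat \<Rightarrow> real) \<Rightarrow> nat set \<Rightarrow> nat set \<Rightarrow> real \<Rightarrow> real
    \<Rightarrow> (nat \<times> nat \<Rightarrow> real) measure" where
  "dp_cov_block n p X I J \<rho>B R =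
     distr (PiM {(u, v). 1 \<le> u \<and> u \<le> v \<and> v \<le> p} (\<lambda>_. std_normal_distribution))
       (PiM (I \<times> J) (\<lambda>_. borel))
       (\<lambda>g. \<lambda>(u, v)\<in>I \<times> J.
          (\<Sum>i=1..n. vclip I R (X i) u * vclip J R (X i) v) / real n
          + sqrt (18 * R ^ 4 / (\<rho>B * (real n)\<^sup>2)) * g (min u v, max u v))"

definition exp_mechanism :: "real \<Rightarrow> real \<Rightarrow> 'c set \<Rightarrow> ('c \<Rightarrow> real) \<Rightarrow> 'c pmf" where
  "exp_mechanism \<epsilon> \<Delta> Q s =
     embed_pmf (\<lambda>c. if c \<in> Q then exp (\<epsilon> * s c / (2 * \<Delta>)) / (\<Sum>c'\<in>Q. exp (\<epsilon> * s c' / (2 * \<Delta>)))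
                    else 0)"

primrec peel_select :: "real \<Rightarrow> real \<Rightarrow> 'c set \<Rightarrow> ('c \<Rightarrow> real) \<Rightarrow> nat \<Rightarrow> 'c set pmf" where
  "peel_select \<epsilon> \<Delta> Q s 0 = return_pmf {}"
| "peel_select \<epsilon> \<Delta> Q s (Suc m) =
     bind_pmf (peel_select \<epsilon> \<Delta> Q s m)
       (\<lambda>S. map_pmf (\<lambda>c. insert c S) (exp_mechanism \<epsilon> \<Delta> (Q - S) s))"

definition peel_objective :: "nat \<Rightarrow> nat \<Rightarrow> real \<Rightarrow> real \<Rightarrow> nat \<Rightarrow> real" where
  "peel_objective n k a \<rho>B r = a\<^sup>2 / real r + real r / real n + real k * (real r)\<^sup>2 / (\<rho>B * (real n)\<^sup>2)"

text \<open>Ties are broken by Hilbert choice inside \<open>arg_min\<close>. The entries of the block are indexed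
  by \<open>I \<times> J\<close> itself rather than by positions in \<open>[k] \<times> [k]\<close>. The Gaussian noise
  is drawn on all of \<open>I \<times> J\<close>, independently of the selection, and used only on the selected set.\<close>

definition peel_release ::
  "nat \<Rightarrow> real \<Rightarrow> (nat \<Rightarrow> nat \<Rightarrow> real) \<Rightarrow> nat set \<Rightarrow> nat set \<Rightarrow> real \<Rightarrow> real
    \<Rightarrow> (nat \<times> nat \<Rightarrow> real) measure" where
  "peel_release n L X I J a \<rho>B =
    (let k = card I;
         r = arg_min (peel_objective n k a \<rho>B) (\<lambda>r. 1 \<le> r \<and> r \<le> k);
         A = (\<lambda>(u, v). (\<Sum>i=1..n. sclip L (X i u * X i v)) / real n);
         sel = peel_select (sqrt (\<rho>B / real (k * r))) (2 * L / real n) (I \<times> J) (\<lambda>q. \<bar>A q\<bar>) (k * r)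
     in distr (measure_pmf sel \<Otimes>\<^sub>M PiM (I \<times> J) (\<lambda>_. std_normal_distribution))
          (PiM (I \<times> J) (\<lambda>_. borel))
          (\<lambda>(S, g). \<lambda>q\<in>I \<times> J.
             if q \<in> S then A q + sqrt (4 * L\<^sup>2 * real (k * r) / (\<rho>B * (real n)\<^sup>2)) * g q else 0))"

section \<open>The adaptive center--outer dyadic estimator\<close>

text \<open>The spectral decomposition of \<open>A\<close> has eigenvalues \<open>ev l\<close> and orthonormal
  eigenvectors \<open>w l\<close>; the clipped matrix does not depend on which decomposition is taken.\<close>

definition spectral_clip :: "nat \<Rightarrow> real \<Rightarrow> (nat \<times> nat \<Rightarrow> real) \<Rightarrow> nat \<times> nat \<Rightarrow> real" where
  "spectral_clip p M\<^sub>0 A = (THE B. \<exists>(ev :: nat \<Rightarrow> real) (w :: nat \<Rightarrow> nat \<Rightarrow> real).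
     (\<forall>l\<in>{1..p}. \<forall>l'\<in>{1..p}. (\<Sum>i=1..p. w l i * w l' i) = (if l = l' then 1 else 0)) \<and>
     (\<forall>i\<in>{1..p}. \<forall>j\<in>{1..p}. A (i, j) = (\<Sum>l=1..p. ev l * w l i * w l j)) \<and>
     B = (\<lambda>(i, j)\<in>{1..p} \<times> {1..p}. \<Sum>l=1..p. max 0 (min M\<^sub>0 (ev l)) * w l i * w l j))"

datatype candidate = Zero | Structured | Dense

text \<open>\<open>d\<close> is the original dimension and \<open>p\<close> the padded one. The constants written \<open>C\<close> in
  the definition of the estimator may differ between occurrences: \<open>C_L\<close> is the one in \<open>L\<close>, \<open>C_R\<close>
  the one in \<open>R\<^sub>k\<close>, and \<open>C_D\<close>, \<open>E_D\<close> are the factor and the exponent in \<open>D\<^sub>k\<^sub>,\<^sub>j\<close>.\<close>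

locale center_outer =
  fixes \<alpha>_lo \<alpha>_hi K M\<^sub>0 :: real
    and C_L C_1 C_G C_R C_D E_D :: real
    and n d :: nat and \<rho> :: real
begin

definition p :: nat where
  "p = 2 ^ nat \<lceil>log 2 (real d)\<rceil>"

definition pad :: "(nat \<Rightarrow> nat \<Rightarrow> real) \<Rightarrow> nat \<Rightarrow> nat \<Rightarrow> real" where
  "pad X i j = (if j \<in> {1..d} then X i j else 0)"

definition N :: "nat \<Rightarrow> nat" where
  "N k = p div k"

definition Idx :: "nat \<Rightarrow> nat \<Rightarrow> nat set" where
  "Idx k l = {1 + (l - 1) * k .. l * k}"

text \<open>The pair \<open>(l, r)\<close> is the label of the block \<open>B\<^sub>k\<^sub>;\<^sub>l\<^sub>,\<^sub>r\<close>.\<close>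

fun block :: "nat \<Rightarrow> nat \<times> nat \<Rightarrow> (nat \<times> nat) set" where
  "block k (l, r) = Idx k l \<times> Idx k (l + r)"

definition center_labels :: "(nat \<times> nat) set" where
  "center_labels = {(l, r). 1 \<le> l \<and> r \<in> {0, 1} \<and> l + r \<le> p}"

definition outer_labels :: "nat \<Rightarrow> (nat \<times> nat) set" where
  "outer_labels k = (\<Union>l\<in>{1..<N (2 * k)}. {(2 * l - 1, 2), (2 * l - 1, 3), (2 * l, 2)})"

definition scales :: "nat set" where
  "scales = {2 ^ s | s. 4 * 2 ^ s \<le> p}"

definition J_sq :: real where
  "J_sq = log 2 (real p) - 1"

definition J :: "nat \<Rightarrow> nat" where
  "J k = nat \<lceil>(\<alpha>_hi - \<alpha>_lo) * log 2 (real k)\<rceil>"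

definition a :: "nat \<Rightarrow> nat \<Rightarrow> real" where
  "a k j = C_G * real k powr (- \<alpha>_lo) / 2 ^ j"

definition budget :: "nat \<Rightarrow> real" where
  "budget k = \<rho> / (4 * J_sq * real (N (2 * k)) * (real (J k) + 1))"

definition L :: real where
  "L = C_L * K\<^sup>2 * ln (real n)"

definition R_center :: real where
  "R_center = K * sqrt (C_1 * (1 + ln (real n)))"

definition R :: "nat \<Rightarrow> real" where
  "R k = sqrt (C_R * K\<^sup>2 * (real k + ln (real n)))"

fun W :: "nat \<Rightarrow> nat \<Rightarrow> candidate \<Rightarrow> real" where
  "W k j Zero = real k * (a k j)\<^sup>2"
| "W k j Structured = real k * (MIN r\<in>{1..k}. peel_objective n k (a k j) (budget k) r)"
| "W k j Dense = (real k)\<^sup>2 / real n + real k ^ 4 / (budget k * (real n)\<^sup>2)"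

definition t :: "nat \<Rightarrow> nat \<Rightarrow> candidate" where
  "t k j = arg_min (W k j) (\<lambda>_. True)"

definition D :: "nat \<Rightarrow> nat \<Rightarrow> real" where
  "D k j = sqrt (C_D * ln (real n) powr E_D * W k j (t k j))"

fun center_law :: "(nat \<Rightarrow> nat \<Rightarrow> real) \<Rightarrow> nat \<times> nat \<Rightarrow> (nat \<times> nat \<Rightarrow> real) measure" where
  "center_law X (l, r) =
     dp_cov_block n p (pad X) (Idx 1 l) (Idx 1 (l + r)) ((\<rho> / 4) / (2 * real p)) R_center"

text \<open>The law of the unclipped candidate at scale \<open>k\<close>, block \<open>(l, r)\<close> and level \<open>j\<close>.\<close>

fun outer_law ::
  "(nat \<Rightarrow> nat \<Rightarrow> real) \<Rightarrow> nat \<times> (nat \<times> nat) \<times> nat \<Rightarrow> (nat \<times> nat \<Rightarrow> real) measure" where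
  "outer_law X (k, (l, r), j) =
     (case t k j of
        Zero \<Rightarrow> return (PiM (block k (l, r)) (\<lambda>_. borel)) (\<lambda>_\<in>block k (l, r). 0)
      | Structured \<Rightarrow> peel_release n L (pad X) (Idx k l) (Idx k (l + r)) (a k j) (budget k)
      | Dense \<Rightarrow> dp_cov_block n p (pad X) (Idx k l) (Idx k (l + r)) (budget k) (R k))"

definition outer_index :: "(nat \<times> (nat \<times> nat) \<times> nat) set" where
  "outer_index = {(k, b, j). k \<in> scales \<and> b \<in> outer_labels k \<and> j \<le> J k}"

text \<open>Below, \<open>c\<close> is the family of center releases and \<open>z\<close> the family of unclipped candidates.\<close>

definition Z :: "(nat \<times> (nat \<times> nat) \<times> nat \<Rightarrow> nat \<times> nat \<Rightarrow> real)
    \<Rightarrow> nat \<Rightarrow> nat \<times> nat \<Rightarrow> nat \<Rightarrow> nat \<times> nat \<Rightarrow> real" where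
  "Z z k b j = vclip (block k b) (sqrt (real k) * a k 0) (z (k, b, j))"

definition j_hat :: "(nat \<times> (nat \<times> nat) \<times> nat \<Rightarrow> nat \<times> nat \<Rightarrow> real) \<Rightarrow> nat \<Rightarrow> nat" where
  "j_hat z k = Max {j. j \<le> J k \<and> (\<forall>i<j. \<forall>b\<in>outer_labels k.
      L2_set (\<lambda>q. Z z k b j q - Z z k b i q) (block k b) \<le> D k j + D k i)}"

text \<open>The center blocks and the outer blocks of all scales are pairwise disjoint, so the sum
  places on each block its own release.\<close>

definition assemble :: "(nat \<times> nat \<Rightarrow> nat \<times> nat \<Rightarrow> real)
    \<Rightarrow> (nat \<times> (nat \<times> nat) \<times> nat \<Rightarrow> nat \<times> nat \<Rightarrow> real) \<Rightarrow> nat \<times> nat \<Rightarrow> real" where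
  "assemble c z q =
     (\<Sum>b\<in>center_labels. if q \<in> block 1 b then c b q else 0)
     + (\<Sum>k\<in>scales. \<Sum>b\<in>outer_labels k. if q \<in> block k b then Z z k b (j_hat z k) q else 0)"

text \<open>The law of the estimator given the dataset \<open>X\<close>; the releases are independent given \<open>X\<close>.\<close>

definition estimator :: "(nat \<Rightarrow> nat \<Rightarrow> real) \<Rightarrow> (nat \<times> nat \<Rightarrow> real) measure" where
  "estimator X =
     distr (PiM center_labels (center_law X) \<Otimes>\<^sub>M PiM outer_index (outer_law X))
       (mat_space d)
       (\<lambda>(c, z). \<lambda>q\<in>{1..d} \<times> {1..d}.
          spectral_clip p M\<^sub>0 (\<lambda>(u, v). assemble c z (min u v, max u v)) q)"

end

section \<open>Asymptotic regime and rate\<close>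

definition regime ::
  "real \<Rightarrow> real \<Rightarrow> (nat \<Rightarrow> nat) \<Rightarrow> (nat \<Rightarrow> nat) \<Rightarrow> (nat \<Rightarrow> real) \<Rightarrow> bool" where
  "regime c \<rho>max n d \<rho> \<longleftrightarrow>
     filterlim n at_top sequentially \<and>
     (\<forall>\<^sub>F m in sequentially. c * ln (real (n m)) \<le> real (d m)) \<and>
     (\<forall>\<^sub>F m in sequentially. 0 < \<rho> m \<and> \<rho> m \<le> \<rho>max) \<and>
     (\<lambda>m. real (d m) / (\<rho> m * (real (n m))\<^sup>2)) \<longlonglongrightarrow> 0"

definition rate :: "real \<Rightarrow> nat \<Rightarrow> nat \<Rightarrow> real \<Rightarrow> real" where
  "rate \<alpha> n d \<rho> =
     min (real n powr (- ((2 * \<alpha> + 1) / (2 * \<alpha> + 2)))) (real d / real n)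
     + min ((real d / (\<rho> * (real n)\<^sup>2)) powr ((2 * \<alpha> + 1) / (2 * \<alpha> + 3)))
           (real d ^ 3 / (\<rho> * (real n)\<^sup>2))"

end

theory Submission
  imports Defs
begin

text \<open>Privacy. Given the data, the estimator is a fixed measurable function of independent releases,
  so it suffices that every release is zCDP and that the budgets add up to at most
  \<open>\<rho>\<close>: the center blocks receive \<open>\<rho>/4\<close> and the scales share
  the remaining \<open>3\<rho>/4\<close>. Composition, mixing and post-processing are awkward
  for a divergence defined through Radon-Nikodym derivatives, and are therefore done for its
  dual form \<open>renyi_dominated\<close>, an inequality between integrals of test functions,
  which is converted back only once at the end
  (\<open>renyi_divergence_le_if_dominated\<close>). A peeling release splits its budget evenly
  between the selections and the Gaussian noise on the selected entries.

  Accuracy. With probability at least \<open>1 - 1/n\<close> no clipping of the data is active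
  and all truncated empirical second moments are within a logarithmic factor of
  \<open>1/\<surd>n\<close> of the covariances (\<open>data_bad_prob\<close>,
  \<open>mean_deviation\<close>). On such data a release for a block of side \<open>k\<close> at
  level \<open>j\<close> has squared error at most a logarithmic factor times its proxy
  \<open>W\<close>, provided that the radius \<open>a k j\<close> bounds the absolute row sums
  of the block (\<open>outer_release_good\<close>, \<open>center_release_good\<close>). For
  peeling this rests on \<open>peel_error\<close>: an unselected entry is smaller, up to the
  selection error, than the average of the \<open>k r\<close> selected ones, and the absolute
  sum of the block is at most \<open>k a\<close>.

  Adaptation. The radii decrease with \<open>j\<close>; up to the level \<open>jstar \<alpha>
  k\<close> they dominate the class bound \<open>M k powr - \<alpha>\<close>, and at that level
  they match it up to a constant. The proxies decrease with \<open>j\<close> as well, so the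
  pairwise comparison rule of Lepski selects a level whose error is at most three times the
  tolerance at \<open>jstar \<alpha> k\<close> (\<open>selected_block_error\<close>), without
  knowledge of \<open>\<alpha>\<close>.

  Rate. Summed over the \<open>O(d/k)\<close> blocks of a scale, the best proxy is at most
  \<open>d\<close> times a logarithmic factor times the rate. Put \<open>\<delta> = d/(\<rho>
  n\<^sup>2)\<close> and let \<open>m\<^sub>0\<close> be the smaller of the widths \<open>n powr
  (1/(2\<alpha> + 2))\<close> and \<open>\<delta> powr (- 1/(2\<alpha> + 3))\<close> at which
  the squared tail \<open>k powr - (2\<alpha> + 1)\<close> equals the sampling error
  \<open>k/n\<close> and the privacy error \<open>k\<^sup>2 \<delta>\<close>, respectively. For
  \<open>k \<le> m\<^sub>0\<close> the dense release attains the rate; for larger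
  \<open>k\<close> peeling with \<open>r\<close> of the order of \<open>m\<^sub>0\<close> does
  (\<open>scale_rate\<close>, \<open>best_W_rate\<close>). The blocks of all scales tile the
  upper triangle exactly once, and the spectral projection is a Frobenius projection onto a
  convex set that contains the padded covariance, so the block errors add up to the loss
  (\<open>assembled_loss_le\<close>, \<open>spectral_clip_contracts\<close>). On the exceptional
  events the clipped spectrum bounds the loss by \<open>8 d M\<^sub>0\<^sup>2\<close>, and their
  probability \<open>O(1/n)\<close> is below the rate.\<close>

section \<open>Renyi domination and its composition rules\<close>

text \<open>For a density \<open>f\<close> of \<open>P\<close> with respect to \<open>Q\<close>,
  Hoelder's inequality gives \<open>\<integral>h powr \<theta> dP \<le> (\<integral>f powr l dQ)
  powr (1/l) * (\<integral>h dQ) powr \<theta>\<close> for \<open>\<theta> = 1 - 1/l\<close>, with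
  equality when \<open>h\<close> is proportional to \<open>f powr l\<close>. So this is the bound
  \<open>c\<close> on the Renyi divergence of order \<open>l\<close> in dual form. It mentions no
  densities, which makes it stable under images, products and mixtures.\<close>

definition renyi_dominated :: "real \<Rightarrow> real \<Rightarrow> 'a measure \<Rightarrow> 'a measure \<Rightarrow> bool" where
  "renyi_dominated l c P Q \<longleftrightarrow> prob_space P \<and> prob_space Q \<and> sets P = sets Q \<and>
     (\<forall>h\<in>borel_measurable Q. (\<forall>x. 0 \<le> h x \<and> h x \<le> 1) \<longrightarrow>
        (\<integral>x. h x powr (1 - 1 / l) \<partial>P) \<le> exp ((1 - 1 / l) * c) * (\<integral>x. h x \<partial>Q) powr (1 - 1 / l))"

lemma renyi_dominatedD:
  assumes "renyi_dominated l c P Q" "h \<in> borel_measurable Q" "\<And>x. 0 \<le> h x" "\<And>x. h x \<le> 1"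
  shows "(\<integral>x. h x powr (1 - 1 / l) \<partial>P) \<le> exp ((1 - 1 / l) * c) * (\<integral>x. h x \<partial>Q) powr (1 - 1 / l)"
  using assms unfolding renyi_dominated_def by blast

lemma integrable_unit_interval:
  assumes "prob_space P" "h \<in> borel_measurable P" "\<And>x. 0 \<le> h x" "\<And>x. h x \<le> (1::real)"
  shows "integrable P h"
proof -
  interpret prob_space P by fact
  show ?thesis by (rule integrable_const_bound[where B = 1]) (use assms in \<open>auto simp: abs_le_iff intro: order_trans[of _ 0]\<close>)
qed

lemma integral_unit_interval:
  assumes "prob_space P" "\<And>x. 0 \<le> h x" "\<And>x. h x \<le> (1::real)"
  shows "0 \<le> (\<integral>x. h x \<partial>P) \<and> (\<integral>x. h x \<partial>P) \<le> 1"
proof -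
  interpret prob_space P by fact
  have "(\<integral>x. h x \<partial>P) \<le> 1"
  proof (cases "integrable P h")
    case True
    then show ?thesis using integral_mono[of P h "\<lambda>_. 1"] assms by (simp add: prob_space)
  qed (simp add: not_integrable_integral_eq)
  then show ?thesis using assms by (simp add: integral_nonneg)
qed

lemma weighted_AM_GM:
  assumes "0 \<le> (x::real)" "0 \<le> y" "0 < a" "0 < b" "a + b = 1"
  shows "x powr a * y powr b \<le> a * x + b * y"
  using Youngs_inequality_0[of a b x y] assms by (cases "x = 0 \<or> y = 0") auto

text \<open>For equal measures the defining inequality is Jensen's inequality for the concave
  function \<open>\<lambda>t. t powr \<theta>\<close>, here in the form of the tangent bound given
  by Young's inequality.\<close>

lemma renyi_dominated_refl:
  assumes "prob_space P" "1 < l" "0 \<le> c"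
  shows "renyi_dominated l c P P"
  unfolding renyi_dominated_def
proof (intro conjI ballI impI)
  fix h :: "'a \<Rightarrow> real" assume h: "h \<in> borel_measurable P" "\<forall>x. 0 \<le> h x \<and> h x \<le> 1"
  interpret prob_space P by fact
  define \<theta> where "\<theta> = 1 - 1 / l"
  have \<theta>: "0 < \<theta>" "\<theta> < 1" using assms by (auto simp: \<theta>_def)
  let ?A = "\<integral>x. h x \<partial>P"
  have int: "integrable P h" "integrable P (\<lambda>x. h x powr \<theta>)"
    using h \<theta> by (auto intro!: integrable_unit_interval[OF assms(1)] powr_le1)
  have A: "0 \<le> ?A" using h by (auto intro: integral_nonneg)
  have "(\<integral>x. h x powr \<theta> \<partial>P) \<le> ?A powr \<theta>"
  proof (cases "?A = 0")
    case True
    then have "AE x in P. h x = 0" using int(1) h by (subst (asm) integral_nonneg_eq_0_iff_AE) auto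
    then have "(\<integral>x. h x powr \<theta> \<partial>P) = (\<integral>x. 0 \<partial>P)"
      using int h by (intro integral_cong_AE) auto
    then show ?thesis by simp
  next
    case False
    with A have A: "0 < ?A" by simp
    have "h x powr \<theta> \<le> ?A powr \<theta> * (\<theta> * (h x / ?A) + (1 - \<theta>))" for x
    proof -
      have "h x powr \<theta> = ?A powr \<theta> * ((h x / ?A) powr \<theta> * 1 powr (1 - \<theta>))"
        using A h by (simp add: powr_divide)
      also have "\<dots> \<le> ?A powr \<theta> * (\<theta> * (h x / ?A) + (1 - \<theta>) * 1)"
        using weighted_AM_GM[of "h x / ?A" 1 \<theta> "1 - \<theta>"] A h \<theta>
        by (intro mult_left_mono) auto
      finally show ?thesis by simp
    qed
    then have "(\<integral>x. h x powr \<theta> \<partial>P) \<le> (\<integral>x. ?A powr \<theta> * (\<theta> * (h x / ?A) + (1 - \<theta>)) \<partial>P)"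
      using int by (intro integral_mono) auto
    also have "\<dots> = ?A powr \<theta>" using int A by (simp add: prob_space)
    finally show ?thesis .
  qed
  also have "\<dots> \<le> exp (\<theta> * c) * ?A powr \<theta>"
    using \<theta> assms mult_right_mono[of 1 "exp (\<theta> * c)" "?A powr \<theta>"] by simp
  finally show "(\<integral>x. h x powr (1 - 1 / l) \<partial>P) \<le> exp ((1 - 1 / l) * c) * ?A powr (1 - 1 / l)"
    by (simp add: \<theta>_def)
qed (use assms in auto)

lemma renyi_dominated_mono:
  assumes "renyi_dominated l c P Q" "c \<le> c'" "1 < l"
  shows "renyi_dominated l c' P Q"
  unfolding renyi_dominated_def
proof (intro conjI ballI impI)
  fix h :: "'a \<Rightarrow> real" assume h: "h \<in> borel_measurable Q" "\<forall>x. 0 \<le> h x \<and> h x \<le> 1"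
  have "(\<integral>x. h x powr (1 - 1 / l) \<partial>P) \<le> exp ((1 - 1 / l) * c) * (\<integral>x. h x \<partial>Q) powr (1 - 1 / l)"
    using renyi_dominatedD[OF assms(1)] h by blast
  also have "\<dots> \<le> exp ((1 - 1 / l) * c') * (\<integral>x. h x \<partial>Q) powr (1 - 1 / l)"
    using assms by (intro mult_right_mono) auto
  finally show "(\<integral>x. h x powr (1 - 1 / l) \<partial>P) \<le> exp ((1 - 1 / l) * c') * (\<integral>x. h x \<partial>Q) powr (1 - 1 / l)" .
qed (use assms in \<open>auto simp: renyi_dominated_def\<close>)

text \<open>Post-processing: a test function of the output is a test function of the
  input.\<close>

lemma renyi_dominated_distr:
  assumes "renyi_dominated l c P Q" and f: "f \<in> measurable Q N"
  shows "renyi_dominated l c (distr P N f) (distr Q N f)"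
proof -
  have s: "sets P = sets Q" and PQ: "prob_space P" "prob_space Q"
    using assms(1) by (auto simp: renyi_dominated_def)
  have f': "f \<in> measurable P N" using f by (simp add: measurable_cong_sets[OF s refl])
  show ?thesis unfolding renyi_dominated_def
  proof (intro conjI ballI impI)
    fix h :: "_ \<Rightarrow> real" assume h: "h \<in> borel_measurable (distr Q N f)" "\<forall>x. 0 \<le> h x \<and> h x \<le> 1"
    then have hN: "h \<in> borel_measurable N" by simp
    show "(\<integral>x. h x powr (1 - 1 / l) \<partial>distr P N f)
        \<le> exp ((1 - 1 / l) * c) * (\<integral>x. h x \<partial>distr Q N f) powr (1 - 1 / l)"
      using renyi_dominatedD[OF assms(1), of "\<lambda>x. h (f x)"] hN h(2) f f'
      by (simp add: integral_distr)
  qed (use PQ f f' in \<open>auto intro: prob_space.prob_space_distr\<close>)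
qed

text \<open>Adaptive composition. Integrating a test function against the second kernel yields a
  test function for the first stage. The disintegrations of \<open>P\<close> and \<open>Q\<close>
  are stated through integrals of bounded functions, a form that covers both the monadic bind of
  probability mass functions and the image of a product measure.\<close>

lemma renyi_dominated_mixture:
  assumes pq: "renyi_dominated l c p q" and l: "1 < l"
    and K: "\<And>x. renyi_dominated l c' (K x) (K' x)"
    and P: "prob_space P" and Q: "prob_space Q" "sets P = sets Q" and sK: "\<And>x. sets (K' x) = sets Q"
    and intP: "\<And>f. f \<in> borel_measurable Q \<Longrightarrow> (\<And>x. 0 \<le> f x) \<Longrightarrow> (\<And>x. f x \<le> (1::real)) \<Longrightarrow>
        (\<lambda>x. \<integral>y. f y \<partial>K x) \<in> borel_measurable p \<and> (\<integral>y. f y \<partial>P) = (\<integral>x. (\<integral>y. f y \<partial>K x) \<partial>p)"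
    and intQ: "\<And>f. f \<in> borel_measurable Q \<Longrightarrow> (\<And>x. 0 \<le> f x) \<Longrightarrow> (\<And>x. f x \<le> (1::real)) \<Longrightarrow>
        (\<lambda>x. \<integral>y. f y \<partial>K' x) \<in> borel_measurable q \<and> (\<integral>y. f y \<partial>Q) = (\<integral>x. (\<integral>y. f y \<partial>K' x) \<partial>q)"
  shows "renyi_dominated l (c + c') P Q"
  unfolding renyi_dominated_def
proof (intro conjI ballI impI)
  fix h :: "'b \<Rightarrow> real" assume h: "h \<in> borel_measurable Q" "\<forall>x. 0 \<le> h x \<and> h x \<le> 1"
  define \<theta> where "\<theta> = 1 - 1 / l"
  have \<theta>: "0 < \<theta>" "\<theta> < 1" using l by (auto simp: \<theta>_def)
  have pr: "prob_space p" "prob_space q" "sets p = sets q" "\<And>x. prob_space (K x)" "\<And>x. prob_space (K' x)"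
    using pq K by (auto simp: renyi_dominated_def)
  define H where "H x = (\<integral>y. h y \<partial>K' x)" for x
  have H01: "0 \<le> H x" "H x \<le> 1" for x
    using integral_unit_interval[OF pr(5), of h] h by (auto simp: H_def)
  have H: "H \<in> borel_measurable q" "(\<integral>y. h y \<partial>Q) = (\<integral>x. H x \<partial>q)"
    using intQ[OF h(1)] h(2) by (auto simp: H_def[abs_def])
  have h\<theta>: "(\<lambda>x. h x powr \<theta>) \<in> borel_measurable Q" using h by simp
  have h\<theta>01: "0 \<le> h x powr \<theta>" "h x powr \<theta> \<le> 1" for x using h \<theta> by (auto intro: powr_le1)
  have m: "H \<in> borel_measurable p" using H(1) by (simp add: measurable_cong_sets[OF pr(3) refl])
  have "(\<integral>y. h y powr \<theta> \<partial>P) = (\<integral>x. (\<integral>y. h y powr \<theta> \<partial>K x) \<partial>p)"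
    using intP[OF h\<theta>] h\<theta>01 by simp
  also have "\<dots> \<le> (\<integral>x. exp (\<theta> * c') * H x powr \<theta> \<partial>p)"
  proof (rule integral_mono)
    show "integrable p (\<lambda>x. \<integral>y. h y powr \<theta> \<partial>K x)"
      using intP[OF h\<theta>] h\<theta>01 integral_unit_interval[OF pr(4), of "\<lambda>y. h y powr \<theta>"]
      by (intro integrable_unit_interval pr) auto
    show "integrable p (\<lambda>x. exp (\<theta> * c') * H x powr \<theta>)"
      using m H01 \<theta> by (intro integrable_mult_right integrable_unit_interval pr) (auto intro: powr_le1)
    show "(\<integral>y. h y powr \<theta> \<partial>K x) \<le> exp (\<theta> * c') * H x powr \<theta>" for x
    proof -
      have "h \<in> borel_measurable (K' x)" using h(1) by (simp add: measurable_cong_sets[OF sK refl])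
      then show ?thesis using renyi_dominatedD[OF K, of h x] h by (simp add: \<theta>_def H_def)
    qed
  qed
  also have "\<dots> = exp (\<theta> * c') * (\<integral>x. H x powr \<theta> \<partial>p)" by simp
  also have "\<dots> \<le> exp (\<theta> * c') * (exp (\<theta> * c) * (\<integral>x. H x \<partial>q) powr \<theta>)"
    using renyi_dominatedD[OF pq H(1)] H01 by (intro mult_left_mono) (auto simp: \<theta>_def)
  finally show "(\<integral>x. h x powr (1 - 1 / l) \<partial>P)
      \<le> exp ((1 - 1 / l) * (c + c')) * (\<integral>x. h x \<partial>Q) powr (1 - 1 / l)"
    by (simp add: \<theta>_def H(2) distrib_left exp_add mult.assoc mult.left_commute)
qed (use assms in auto)

lemma renyi_dominated_pair:
  assumes 1: "renyi_dominated l c P Q" and 2: "renyi_dominated l c' P' Q'" and l: "1 < l"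
  shows "renyi_dominated l (c + c') (P \<Otimes>\<^sub>M P') (Q \<Otimes>\<^sub>M Q')"
proof -
  have pr: "prob_space P" "prob_space P'" "prob_space Q" "prob_space Q'" "sets P = sets Q" "sets P' = sets Q'"
    using 1 2 by (auto simp: renyi_dominated_def)
  interpret P: pair_prob_space P P' unfolding pair_prob_space_def pair_sigma_finite_def
    using pr by (auto simp: prob_space_imp_sigma_finite)
  interpret Q: pair_prob_space Q Q' unfolding pair_prob_space_def pair_sigma_finite_def
    using pr by (auto simp: prob_space_imp_sigma_finite)
  have sPQ: "sets (P \<Otimes>\<^sub>M P') = sets (Q \<Otimes>\<^sub>M Q')" using pr by (intro sets_pair_measure_cong) auto
  have spQ: "space P = space Q" using pr sets_eq_imp_space_eq by blast
  show ?thesis unfolding renyi_dominated_def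
  proof (intro conjI ballI impI)
    show "prob_space (P \<Otimes>\<^sub>M P')" "prob_space (Q \<Otimes>\<^sub>M Q')" by unfold_locales
    show "sets (P \<Otimes>\<^sub>M P') = sets (Q \<Otimes>\<^sub>M Q')" by fact
    fix h :: "_ \<Rightarrow> real" assume h: "h \<in> borel_measurable (Q \<Otimes>\<^sub>M Q')" "\<forall>x. 0 \<le> h x \<and> h x \<le> 1"
    define \<theta> where "\<theta> = 1 - 1 / l"
    have \<theta>: "0 < \<theta>" "\<theta> < 1" using l by (auto simp: \<theta>_def)
    note hm[measurable] = h(1)
    have hP[measurable]: "h \<in> borel_measurable (P \<Otimes>\<^sub>M P')"
      using h(1) by (simp add: measurable_cong_sets[OF sPQ refl])
    define H where "H x = (\<integral>y. h (x, y) \<partial>Q')" for x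
    have H01: "0 \<le> H x" "H x \<le> 1" for x
      using integral_unit_interval[OF pr(4), of "\<lambda>y. h (x, y)"] h by (auto simp: H_def)
    have Hm[measurable]: "H \<in> borel_measurable Q" unfolding H_def by measurable
    have HmP: "H \<in> borel_measurable P" using Hm by (simp add: measurable_cong_sets[OF pr(5) refl])
    have h\<theta>01: "0 \<le> h x powr \<theta>" "h x powr \<theta> \<le> 1" for x
      using spec[OF h(2), of x] \<theta> by (auto intro: powr_le1)
    have iQ: "integrable (Q \<Otimes>\<^sub>M Q') h" using h by (intro integrable_unit_interval) (auto intro: Q.prob_space_axioms)
    have iP: "integrable (P \<Otimes>\<^sub>M P') (\<lambda>x. h x powr \<theta>)"
      using h\<theta>01 by (intro integrable_unit_interval) (auto intro: P.prob_space_axioms)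
    have "(\<integral>x. h x powr \<theta> \<partial>(P \<Otimes>\<^sub>M P')) = (\<integral>x. (\<integral>y. h (x, y) powr \<theta> \<partial>P') \<partial>P)"
      using P.integral_fst'[OF iP] by simp
    also have "\<dots> \<le> (\<integral>x. exp (\<theta> * c') * H x powr \<theta> \<partial>P)"
    proof (rule integral_mono)
      show "integrable P (\<lambda>x. \<integral>y. h (x, y) powr \<theta> \<partial>P')"
        by (rule P.integrable_fst'[OF iP])
      show "integrable P (\<lambda>x. exp (\<theta> * c') * H x powr \<theta>)"
        using HmP H01 \<theta> by (intro integrable_mult_right integrable_unit_interval pr) (auto intro: powr_le1)
      show "(\<integral>y. h (x, y) powr \<theta> \<partial>P') \<le> exp (\<theta> * c') * H x powr \<theta>" if "x \<in> space P" for x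
        using renyi_dominatedD[OF 2, of "\<lambda>y. h (x, y)"] h(2) that spQ
        by (simp add: \<theta>_def H_def)
    qed
    also have "\<dots> = exp (\<theta> * c') * (\<integral>x. H x powr \<theta> \<partial>P)" by simp
    also have "\<dots> \<le> exp (\<theta> * c') * (exp (\<theta> * c) * (\<integral>x. H x \<partial>Q) powr \<theta>)"
      using renyi_dominatedD[OF 1 Hm] H01 by (intro mult_left_mono) (auto simp: \<theta>_def)
    also have "(\<integral>x. H x \<partial>Q) = (\<integral>x. h x \<partial>(Q \<Otimes>\<^sub>M Q'))" using Q.integral_fst'[OF iQ] by (simp add: H_def)
    finally show "(\<integral>x. h x powr (1 - 1 / l) \<partial>(P \<Otimes>\<^sub>M P'))
        \<le> exp ((1 - 1 / l) * (c + c')) * (\<integral>x. h x \<partial>(Q \<Otimes>\<^sub>M Q')) powr (1 - 1 / l)"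
      by (simp add: \<theta>_def distrib_left exp_add mult.assoc mult.left_commute)
  qed
qed

lemma renyi_dominated_PiM:
  assumes "finite I" and l: "1 < l"
    and "\<And>i. i \<in> I \<Longrightarrow> renyi_dominated l (c i) (M i) (M' i)"
  shows "renyi_dominated l (\<Sum>i\<in>I. c i) (PiM I M) (PiM I M')"
  using assms(1,3)
proof (induction I rule: finite_induct)
  case empty
  have "PiM {} M = PiM {} M'" unfolding PiM_empty ..
  moreover have "prob_space (PiM {} M')" by (rule prob_space_PiM) auto
  ultimately show ?case using renyi_dominated_refl[OF _ l, of "PiM {} M'" 0] by simp
next
  case (insert i I)
  have s: "sets (PiM (insert i I) M) = sets (PiM (insert i I) M')"
    using insert.prems by (intro sets_PiM_cong) (auto simp: renyi_dominated_def)
  let ?f = "\<lambda>(y, x). x(i := y)"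
  have "renyi_dominated l (c i + (\<Sum>i\<in>I. c i))
      (distr (M i \<Otimes>\<^sub>M PiM I M) (PiM (insert i I) M') ?f) (distr (M' i \<Otimes>\<^sub>M PiM I M') (PiM (insert i I) M') ?f)"
    using insert by (intro renyi_dominated_distr renyi_dominated_pair l) auto
  also have "distr (M i \<Otimes>\<^sub>M PiM I M) (PiM (insert i I) M') ?f = distr (M i \<Otimes>\<^sub>M PiM I M) (PiM (insert i I) M) ?f"
    using s by (intro distr_cong) auto
  also have "\<dots> = PiM (insert i I) M"
    using insert.prems by (intro distr_pair_PiM_eq_PiM) (auto simp: renyi_dominated_def)
  also have "distr (M' i \<Otimes>\<^sub>M PiM I M') (PiM (insert i I) M') ?f = PiM (insert i I) M'"
    using insert.prems by (intro distr_pair_PiM_eq_PiM) (auto simp: renyi_dominated_def)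
  finally show ?case using insert.hyps by simp
qed

text \<open>Lets the Hoelder argument below divide by an integral that may vanish.\<close>

lemma le_of_le_powr_perturbed:
  assumes "\<And>e::real. 0 < e \<Longrightarrow> x \<le> B * (A + e) powr \<theta>" "0 \<le> A" "0 < \<theta>"
  shows "x \<le> B * A powr \<theta>"
proof (rule tendsto_lowerbound)
  have "((\<lambda>e. (A + e) powr \<theta>) \<longlongrightarrow> (A + 0) powr \<theta>) (at_right 0)"
    using assms by (intro tendsto_powr' tendsto_intros) (auto simp: eventually_at_filter intro!: always_eventually)
  then show "((\<lambda>e. B * (A + e) powr \<theta>) \<longlongrightarrow> B * A powr \<theta>) (at_right 0)"
    by (auto intro: tendsto_mult_left)
  show "\<forall>\<^sub>F e in at_right 0. x \<le> B * (A + e) powr \<theta>"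
    using assms(1) by (auto simp: eventually_at_filter intro!: always_eventually)
qed auto

text \<open>Hoelder's inequality, obtained by integrating Young's inequality between
  \<open>h/\<integral>h dQ\<close> and \<open>f powr l\<close>, both normalised.\<close>

lemma renyi_dominated_density:
  assumes Q: "prob_space Q" and P: "prob_space (density Q (\<lambda>x. ennreal (f x)))" and l: "1 < l"
    and f: "f \<in> borel_measurable Q" "\<And>x. 0 < f x"
    and int: "integrable Q (\<lambda>x. f x powr l)" and le: "(\<integral>x. f x powr l \<partial>Q) \<le> exp ((l - 1) * c)"
  shows "renyi_dominated l c (density Q (\<lambda>x. ennreal (f x))) Q"
  unfolding renyi_dominated_def
proof (intro conjI ballI impI)
  fix h :: "'a \<Rightarrow> real" assume h: "h \<in> borel_measurable Q" "\<forall>x. 0 \<le> h x \<and> h x \<le> 1"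
  interpret Q: prob_space Q by fact
  interpret P: prob_space "density Q (\<lambda>x. ennreal (f x))" by fact
  define \<theta> where "\<theta> = 1 - 1 / l"
  have \<theta>: "0 < \<theta>" "\<theta> < 1" "1 - \<theta> = 1 / l" using l by (auto simp: \<theta>_def)
  note [measurable] = h(1) f(1)
  have h\<theta>01: "0 \<le> h x powr \<theta>" "h x powr \<theta> \<le> 1" for x using h \<theta> by (auto intro: powr_le1)
  let ?A = "\<integral>x. h x \<partial>Q"
  have A0: "0 \<le> ?A" using h by (auto intro: integral_nonneg)
  have ih: "integrable Q h" using h by (intro integrable_unit_interval Q) auto
  have "integrable (density Q (\<lambda>x. ennreal (f x))) (\<lambda>x. h x powr \<theta>)"
    using h\<theta>01 by (intro integrable_unit_interval P) auto
  then have i1: "integrable Q (\<lambda>x. f x * h x powr \<theta>)"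
    using f by (subst (asm) integrable_density) (auto simp: less_imp_le)
  have eq: "(\<integral>x. h x powr \<theta> \<partial>density Q (\<lambda>x. ennreal (f x))) = (\<integral>x. f x * h x powr \<theta> \<partial>Q)"
    using f by (subst integral_density) (auto simp: less_imp_le)
  define B where "B = exp ((l - 1) * c)"
  have B: "0 < B" "B powr (1 / l) = exp (\<theta> * c)"
    using l by (auto simp: B_def \<theta>_def powr_def field_simps)
  have "(\<integral>x. f x * h x powr \<theta> \<partial>Q) \<le> exp (\<theta> * c) * (?A + e) powr \<theta>" if e: "0 < e" for e
  proof -
    (* Young's inequality needs a positive divisor, whereas the integral of h may be zero. *)
    define \<alpha> where "\<alpha> = ?A + e"
    have \<alpha>: "0 < \<alpha>" using A0 e by (auto simp: \<alpha>_def)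
    let ?w = "\<alpha> powr \<theta> * B powr (1 / l)"
    have "f x * h x powr \<theta> \<le> ?w * (\<theta> / \<alpha> * h x + (1 / l) / B * f x powr l)" for x
    proof -
      have "f x * h x powr \<theta> = ?w * ((h x / \<alpha>) powr \<theta> * (f x powr l / B) powr (1 / l))"
        using \<alpha> B(1) h f(2)[of x] l by (simp add: powr_divide powr_powr)
      also have "\<dots> \<le> ?w * (\<theta> * (h x / \<alpha>) + (1 / l) * (f x powr l / B))"
        using weighted_AM_GM[of "h x / \<alpha>" "f x powr l / B" \<theta> "1 / l"] \<alpha> B(1) h \<theta> l
        by (intro mult_left_mono) auto
      finally show ?thesis by simp
    qed
    then have "(\<integral>x. f x * h x powr \<theta> \<partial>Q) \<le> (\<integral>x. ?w * (\<theta> / \<alpha> * h x + (1 / l) / B * f x powr l) \<partial>Q)"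
      using ih int by (intro integral_mono i1 integrable_mult_right Bochner_Integration.integrable_add) auto
    also have "\<dots> = ?w * (\<theta> / \<alpha> * ?A + (1 / l) / B * (\<integral>x. f x powr l \<partial>Q))"
      using ih int by (simp add: Bochner_Integration.integral_add)
    also have "\<dots> \<le> ?w * (\<theta> * 1 + (1 / l) * 1)"
    proof -
      have "?A / \<alpha> \<le> 1" using e \<alpha> by (simp add: \<alpha>_def)
      moreover have "(\<integral>x. f x powr l \<partial>Q) / B \<le> 1" using le B(1) by (simp add: B_def)
      ultimately have "\<theta> * (?A / \<alpha>) + (1 / l) * ((\<integral>x. f x powr l \<partial>Q) / B) \<le> \<theta> * 1 + (1 / l) * 1"
        using \<theta> l by (intro add_mono mult_left_mono) auto
      then show ?thesis by (intro mult_left_mono) auto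
    qed
    also have "\<dots> = exp (\<theta> * c) * (?A + e) powr \<theta>" using B by (simp add: \<theta>_def \<alpha>_def)
    finally show ?thesis .
  qed
  then have "(\<integral>x. f x * h x powr \<theta> \<partial>Q) \<le> exp (\<theta> * c) * ?A powr \<theta>"
    by (rule le_of_le_powr_perturbed) (use A0 \<theta> in auto)
  then show "(\<integral>x. h x powr (1 - 1 / l) \<partial>density Q (\<lambda>x. ennreal (f x)))
      \<le> exp ((1 - 1 / l) * c) * ?A powr (1 - 1 / l)"
    unfolding eq[unfolded \<theta>_def] \<theta>_def .
qed (use assms in auto)

section \<open>Gaussian noise, pure differential privacy and Renyi divergence\<close>

text \<open>The converse of Hoelder's inequality. Indicators of null sets give absolute
  continuity. For the divergence, the extremal test function \<open>f powr l\<close> is made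
  bounded by truncating the density at \<open>m\<close>; the bound for the truncated moment does
  not depend on \<open>m\<close>, and monotone convergence finishes.\<close>

lemma renyi_divergence_le_if_dominated:
  assumes dom: "renyi_dominated l c P Q" and l: "1 < l" and c: "0 \<le> c"
  shows "renyi_divergence l P Q \<le> ereal c"
proof -
  have pr: "prob_space P" "prob_space Q" and s: "sets P = sets Q"
    using dom by (auto simp: renyi_dominated_def)
  interpret P: prob_space P by fact
  interpret Q: prob_space Q by fact
  define \<theta> where "\<theta> = 1 - 1 / l"
  have \<theta>: "0 < \<theta>" "\<theta> < 1" "l * \<theta> = l - 1" using l by (auto simp: \<theta>_def field_simps)
  have ac: "absolutely_continuous Q P"
    unfolding absolutely_continuous_def
  proof
    fix A assume A: "A \<in> null_sets Q"
    then have [measurable]: "A \<in> sets Q" "A \<in> sets P" using s by auto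
    have "(\<integral>x. indicator A x powr \<theta> \<partial>P) \<le> exp (\<theta> * c) * (\<integral>x. indicator A x \<partial>Q) powr \<theta>"
      using renyi_dominatedD[OF dom, of "indicator A"] by (simp add: \<theta>_def)
    also have "(\<lambda>x. indicator A x powr \<theta>) = (indicator A :: _ \<Rightarrow> real)"
      by (auto simp: indicator_def)
    also have "(\<integral>x. indicator A x \<partial>Q) = (0::real)" using A by (simp add: measure_eq_0_null_sets)
    finally have "measure P A \<le> 0" using \<theta> by simp
    then have "measure P A = 0" by (simp add: measure_le_0_iff)
    then show "A \<in> null_sets P" by (simp add: null_sets_def P.emeasure_eq_measure)
  qed
  define f where "f x = enn2real (RN_deriv Q P x)" for x
  have f[measurable]: "f \<in> borel_measurable Q" unfolding f_def by measurable
  have f0: "0 \<le> f x" for x by (simp add: f_def)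
  have "AE x in Q. RN_deriv Q P x \<noteq> \<infinity>"
    using Q.RN_deriv_finite[OF P.sigma_finite_measure_axioms ac s] by simp
  then have "AE x in Q. RN_deriv Q P x = ennreal (f x)"
    by eventually_elim (auto simp: f_def less_top)
  then have "density Q (RN_deriv Q P) = density Q (\<lambda>x. ennreal (f x))"
    by (intro density_cong) auto
  then have Pf: "P = density Q (\<lambda>x. ennreal (f x))"
    using Q.density_RN_deriv[OF ac s] by simp
  have trunc: "(\<integral>\<^sup>+x. ennreal (min (f x) (real m) powr l) \<partial>Q) \<le> ennreal (exp ((l - 1) * c))" for m
  proof (cases "m = 0")
    case True
    then have "min (f x) (real m) powr l = 0" for x using f0[of x] by simp
    then show ?thesis by simp
  next
    case False
    (* The extremal test function, truncated at m and scaled into the unit interval. *)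
    define h where "h x = (min (f x) (real m) / real m) powr l" for x
    have h01: "0 \<le> h x" "h x \<le> 1" for x
      using False f0[of x] l by (auto simp: h_def intro!: powr_le1)
    have [measurable]: "h \<in> borel_measurable Q" unfolding h_def[abs_def] by measurable
    let ?A = "\<integral>x. h x \<partial>Q"
    have h\<theta>: "h x powr \<theta> = (min (f x) (real m) / real m) powr (l - 1)" for x
      by (simp add: h_def powr_powr \<theta>)
    have ih: "integrable Q h" using h01 by (intro integrable_unit_interval Q.prob_space_axioms) auto
    have "integrable P (\<lambda>x. h x powr \<theta>)"
      using h01 \<theta> measurable_cong_sets[OF s refl, of borel]
      by (intro integrable_unit_interval P.prob_space_axioms) (auto intro!: powr_le1)
    then have i1: "integrable Q (\<lambda>x. f x * h x powr \<theta>)"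
      unfolding Pf by (subst (asm) integrable_density) (auto simp: f0)
    have "real m * ?A = (\<integral>x. real m * h x \<partial>Q)" by simp
    also have "\<dots> \<le> (\<integral>x. f x * h x powr \<theta> \<partial>Q)"
    proof (intro integral_mono i1 integrable_mult_right ih)
      fix x
      let ?y = "min (f x) (real m) / real m"
      have y: "0 \<le> ?y" "real m * ?y \<le> f x" using False f0[of x] by auto
      have "real m * h x = real m * (?y * ?y powr (l - 1))"
        unfolding powr_mult_base[OF y(1)] h_def by simp
      also have "\<dots> = real m * ?y * ?y powr (l - 1)" by (simp only: mult.assoc)
      also have "\<dots> \<le> f x * ?y powr (l - 1)" using y by (intro mult_right_mono) auto
      finally show "real m * h x \<le> f x * h x powr \<theta>" by (simp add: h\<theta>)
    qed
    also have "\<dots> = (\<integral>x. h x powr \<theta> \<partial>P)"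
      unfolding Pf by (subst integral_density) (auto simp: f0)
    also have "\<dots> \<le> exp (\<theta> * c) * ?A powr \<theta>"
      using renyi_dominatedD[OF dom, of h] h01 by (simp add: \<theta>_def)
    finally have le: "real m * ?A \<le> exp (\<theta> * c) * ?A powr \<theta>" .
    have A0: "0 \<le> ?A" using h01 by (auto intro: integral_nonneg)
    have "real m powr l * ?A \<le> exp ((l - 1) * c)"
    proof (cases "?A = 0")
      case False
      with A0 have A: "0 < ?A" by simp
      have "real m * ?A powr (1 - \<theta>) = real m * ?A / ?A powr \<theta>"
        using A by (simp add: powr_diff)
      also have "\<dots> \<le> exp (\<theta> * c)" using le A by (simp add: divide_le_eq)
      finally have "(real m * ?A powr (1 - \<theta>)) powr l \<le> exp (\<theta> * c) powr l"
        using l by (intro powr_mono2) auto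
      also have "(real m * ?A powr (1 - \<theta>)) powr l = real m powr l * ?A"
        using A l by (simp add: powr_mult powr_powr \<theta>_def)
      also have "exp (\<theta> * c) powr l = exp ((l - 1) * c)"
        using \<theta>(3) by (simp add: powr_def mult.assoc[symmetric])
      finally show ?thesis .
    qed simp
    moreover have "(\<integral>x. min (f x) (real m) powr l \<partial>Q) = real m powr l * ?A"
      using False f0 by (subst integral_mult_right_zero[symmetric]) (simp add: h_def powr_divide)
    moreover have "integrable Q (\<lambda>x. min (f x) (real m) powr l)"
    proof -
      have "integrable Q (\<lambda>x. real m powr l * h x)" using ih by simp
      also have "(\<lambda>x. real m powr l * h x) = (\<lambda>x. min (f x) (real m) powr l)"
        using False f0 by (simp add: h_def powr_divide)
      finally show ?thesis .
    qed
    ultimately show ?thesis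
      by (subst nn_integral_eq_integral) auto
  qed
  define I where "I = (\<integral>\<^sup>+x. ennreal (f x powr l) \<partial>Q)"
  have "I = (\<integral>\<^sup>+x. (SUP m. ennreal (min (f x) (real m) powr l)) \<partial>Q)"
    unfolding I_def
  proof (intro nn_integral_cong antisym)
    fix x
    obtain m where "f x \<le> real m" using real_arch_simple by blast
    then show "ennreal (f x powr l) \<le> (SUP m. ennreal (min (f x) (real m) powr l))"
      by (intro SUP_upper2[of m]) (auto simp: min_def)
    show "(SUP m. ennreal (min (f x) (real m) powr l)) \<le> ennreal (f x powr l)"
      using l f0[of x] by (intro SUP_least ennreal_leI powr_mono2) auto
  qed
  also have "\<dots> = (SUP m. \<integral>\<^sup>+x. ennreal (min (f x) (real m) powr l) \<partial>Q)"
    using l f0 by (intro nn_integral_monotone_convergence_SUP)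
      (auto simp: incseq_def le_fun_def intro!: ennreal_leI powr_mono2)
  also have "\<dots> \<le> ennreal (exp ((l - 1) * c))" by (intro SUP_least trunc)
  finally have I: "I \<le> ennreal (exp ((l - 1) * c))" .
  then have fin: "I < \<infinity>" using le_less_trans by fastforce
  have "enn2real I \<le> exp ((l - 1) * c)" using I by (simp add: enn2real_leI)
  then have "ln (enn2real I) \<le> (l - 1) * c"
  proof (cases "enn2real I = 0")
    case False
    then have "0 < enn2real I" by (simp add: order_less_le)
    then show ?thesis using \<open>enn2real I \<le> _\<close> by (metis ln_exp ln_le_cancel_iff exp_gt_zero)
  qed (use l c in simp)
  then have "1 / (l - 1) * ln (enn2real I) \<le> c" using l by (simp add: field_simps)
  then show ?thesis
    using ac fin unfolding renyi_divergence_def I_def f_def Let_def by simp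
qed

text \<open>Tilting a Gaussian density by a power of a likelihood ratio gives a Gaussian density
  with shifted mean, so the moment of the ratio can be read off from the normalisation.\<close>

lemma renyi_dominated_normal:
  assumes \<sigma>: "0 < \<sigma>" and l: "1 < l"
  shows "renyi_dominated l (l * (m - m')\<^sup>2 / (2 * \<sigma>\<^sup>2))
    (density lborel (normal_density m \<sigma>)) (density lborel (normal_density m' \<sigma>))"
proof -
  let ?p = "normal_density m \<sigma>" and ?q = "normal_density m' \<sigma>"
  define f where "f x = ?p x / ?q x" for x
  have q0: "0 < ?q x" "0 < ?p x" for x using \<sigma> normal_density_pos by auto
  have f0: "0 < f x" for x using q0 by (simp add: f_def)
  have [measurable]: "f \<in> borel_measurable borel" by (simp add: f_def[abs_def])
  let ?Q = "density lborel ?q"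
  let ?c = "l * (m - m')\<^sup>2 / (2 * \<sigma>\<^sup>2)"
  have dens: "density ?Q (\<lambda>x. ennreal (f x)) = density lborel ?p"
    using q0 by (subst density_density_eq) (auto simp: f_def less_imp_le ennreal_mult[symmetric] less_imp_neq[THEN not_sym])
  have key: "?q x * f x powr l = exp ((l - 1) * ?c) * normal_density (m' + l * (m - m')) \<sigma> x" for x
  proof -
    have "f x = exp (((x - m')\<^sup>2 - (x - m)\<^sup>2) / (2 * \<sigma>\<^sup>2))"
      using \<sigma> by (simp add: f_def normal_density_def exp_diff[symmetric] diff_divide_distrib)
    then have "f x powr l = exp (l * (((x - m')\<^sup>2 - (x - m)\<^sup>2) / (2 * \<sigma>\<^sup>2)))"
      by (simp add: powr_def)
    moreover have "- (x - m')\<^sup>2 / (2 * \<sigma>\<^sup>2) + l * (((x - m')\<^sup>2 - (x - m)\<^sup>2) / (2 * \<sigma>\<^sup>2))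
        = (l - 1) * ?c + (- (x - (m' + l * (m - m')))\<^sup>2 / (2 * \<sigma>\<^sup>2))"
      using \<sigma> by (simp add: divide_simps power2_eq_square) algebra
    ultimately show ?thesis
      by (simp add: normal_density_def exp_add[symmetric] mult.left_commute)
  qed
  have i: "integrable lborel (\<lambda>x. ?q x * f x powr l)"
    unfolding key using \<sigma> by simp
  show ?thesis
    unfolding dens[symmetric]
  proof (rule renyi_dominated_density[OF _ _ l])
    show "prob_space ?Q" "prob_space (density ?Q (\<lambda>x. ennreal (f x)))"
      unfolding dens using prob_space_normal_density[OF \<sigma>] by auto
    show "integrable ?Q (\<lambda>x. f x powr l)"
      using i by (subst integrable_density) auto
    show "(\<integral>x. f x powr l \<partial>?Q) \<le> exp ((l - 1) * ?c)"
      using \<sigma> by (subst integral_density) (auto simp: key)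
  qed (use f0 in auto)
qed

lemma distr_std_normal_affine:
  assumes "0 < \<sigma>"
  shows "distr std_normal_distribution borel (\<lambda>x. m + \<sigma> * x) = density lborel (normal_density m \<sigma>)"
proof -
  interpret prob_space std_normal_distribution by (rule prob_space_normal_density) simp
  have "distributed std_normal_distribution lborel (\<lambda>x. x) std_normal_density"
    by (auto simp: distributed_def distr_id2)
  from normal_density_affine[OF this, of \<sigma> m] assms
  have "distributed std_normal_distribution lborel (\<lambda>x. m + \<sigma> * x) (normal_density m \<sigma>)" by simp
  then have "distr std_normal_distribution lborel (\<lambda>x. m + \<sigma> * x) = density lborel (normal_density m \<sigma>)"
    by (simp add: distributed_def)
  then show ?thesis by (metis distr_cong sets_lborel)
qed

lemma distr_PiM_coordinatewise:
  assumes "finite I" "\<And>i. i \<in> I \<Longrightarrow> prob_space (M i)" "\<And>i. i \<in> I \<Longrightarrow> f i \<in> measurable (M i) (N i)"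
  shows "distr (PiM I M) (PiM I N) (\<lambda>g. \<lambda>i\<in>I. f i (g i)) = PiM I (\<lambda>i. distr (M i) (N i) (f i))"
proof -
  note [measurable] = assms(3)
  have m: "(\<lambda>g. \<lambda>i\<in>I. f i (g i)) \<in> measurable (PiM I M) (PiM I N)" by measurable
  (* Product probability spaces ask for a probability measure at every index, also outside I. *)
  define M' where "M' i = (if i \<in> I then M i else return (count_space UNIV) undefined)" for i
  have M': "prob_space (M' i)" for i using assms(2) by (auto simp: M'_def intro: prob_space_return)
  interpret P: product_prob_space M' I by (intro product_prob_spaceI M')
  define D where "D i = (if i \<in> I then distr (M i) (N i) (f i) else return (count_space UNIV) undefined)" for i
  have D: "prob_space (D i)" for i
    using assms(2,3) by (auto simp: D_def intro: prob_space_return prob_space.prob_space_distr)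
  interpret D: product_prob_space D I by (intro product_prob_spaceI D)
  have PM: "PiM I M = PiM I M'" "PiM I (\<lambda>i. distr (M i) (N i) (f i)) = PiM I D"
    by (auto intro!: PiM_cong simp: M'_def D_def)
  have "distr (PiM I M) (PiM I N) (\<lambda>g. \<lambda>i\<in>I. f i (g i)) = PiM I D"
  proof (rule D.PiM_eqI[OF assms(1)])
    show "sets (distr (PiM I M) (PiM I N) (\<lambda>g. \<lambda>i\<in>I. f i (g i))) = sets (PiM I D)"
      by (auto intro!: sets_PiM_cong simp: D_def)
    fix A assume "\<And>i. i \<in> I \<Longrightarrow> A i \<in> sets (D i)"
    then have A: "A i \<in> sets (N i)" if "i \<in> I" for i using that by (auto simp: D_def)
  have "emeasure (distr (PiM I M) (PiM I N) (\<lambda>g. \<lambda>i\<in>I. f i (g i))) (PiE I A)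
      = emeasure (PiM I M) (PiE I (\<lambda>i. f i -` A i \<inter> space (M i)))"
    using A assms(1) by (subst emeasure_distr[OF m])
      (auto intro!: sets_PiM_I_finite arg_cong2[where f = emeasure] simp: space_PiM PiE_iff extensional_def)
  also have "\<dots> = (\<Prod>i\<in>I. emeasure (M i) (f i -` A i \<inter> space (M i)))"
    unfolding PM using assms(1) A measurable_sets[OF assms(3)]
    by (subst P.emeasure_PiM) (auto simp: M'_def intro!: prod.cong)
  also have "\<dots> = (\<Prod>i\<in>I. emeasure (D i) (A i))"
    using assms(1,3) A by (auto simp: D_def emeasure_distr intro!: prod.cong)
  finally show "emeasure (distr (PiM I M) (PiM I N) (\<lambda>g. \<lambda>i\<in>I. f i (g i))) (PiE I A)
     = (\<Prod>i\<in>I. emeasure (D i) (A i))" .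
  qed
  then show ?thesis unfolding PM(2) .
qed

text \<open>The divergences of the coordinates add up, and each is proportional to a squared
  difference of means; so only the squared Euclidean sensitivity matters.\<close>

lemma renyi_dominated_gaussian_mechanism:
  assumes I: "finite I" and \<sigma>: "0 < \<sigma>" and l: "1 < l"
    and sens: "(\<Sum>q\<in>I. (m q - m' q)\<^sup>2) \<le> 2 * \<sigma>\<^sup>2 * \<rho>"
  shows "renyi_dominated l (\<rho> * l)
     (distr (PiM I (\<lambda>_. std_normal_distribution)) (PiM I (\<lambda>_. borel)) (\<lambda>g. \<lambda>q\<in>I. m q + \<sigma> * g q))
     (distr (PiM I (\<lambda>_. std_normal_distribution)) (PiM I (\<lambda>_. borel)) (\<lambda>g. \<lambda>q\<in>I. m' q + \<sigma> * g q))"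
proof -
  have pr: "prob_space std_normal_distribution" by (rule prob_space_normal_density) simp
  have "renyi_dominated l (\<Sum>q\<in>I. l * (m q - m' q)\<^sup>2 / (2 * \<sigma>\<^sup>2))
    (PiM I (\<lambda>q. distr std_normal_distribution borel (\<lambda>x. m q + \<sigma> * x)))
    (PiM I (\<lambda>q. distr std_normal_distribution borel (\<lambda>x. m' q + \<sigma> * x)))"
    using renyi_dominated_normal[OF \<sigma> l]
    by (intro renyi_dominated_PiM I l) (simp add: distr_std_normal_affine[OF \<sigma>])
  moreover have "(\<Sum>q\<in>I. l * (m q - m' q)\<^sup>2 / (2 * \<sigma>\<^sup>2)) \<le> \<rho> * l"
  proof -
    have "(\<Sum>q\<in>I. l * (m q - m' q)\<^sup>2 / (2 * \<sigma>\<^sup>2)) = l / (2 * \<sigma>\<^sup>2) * (\<Sum>q\<in>I. (m q - m' q)\<^sup>2)"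
      by (simp add: sum_distrib_left sum_divide_distrib[symmetric])
    also have "\<dots> \<le> l / (2 * \<sigma>\<^sup>2) * (2 * \<sigma>\<^sup>2 * \<rho>)" using sens l by (intro mult_left_mono) auto
    also have "\<dots> = \<rho> * l" using \<sigma> by simp
    finally show ?thesis .
  qed
  ultimately show ?thesis
    using renyi_dominated_mono l pr I
    by (subst (1 2) distr_PiM_coordinatewise) auto
qed

text \<open>Pure \<open>\<epsilon>\<close>-privacy implies
  \<open>\<epsilon>\<^sup>2/2\<close>-zCDP. The log-likelihood ratio \<open>g\<close> lies in
  \<open>[-\<epsilon>, \<epsilon>]\<close>, so Hoeffding's lemma applies to it twice: for
  \<open>-g\<close>, whose exponential moment under \<open>P\<close> is one, it bounds the mean of
  \<open>g\<close> by \<open>\<epsilon>\<^sup>2/2\<close>, and for \<open>(l - 1) g\<close> it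
  bounds the moment of order \<open>l\<close>.\<close>

lemma renyi_dominated_pure_dp:
  assumes Q: "prob_space Q" and P: "prob_space (density Q (\<lambda>x. ennreal (exp (g x))))"
    and g[measurable]: "g \<in> borel_measurable Q" and gb: "\<And>x. \<bar>g x\<bar> \<le> \<epsilon>" and l: "1 < l"
  shows "renyi_dominated l (l * \<epsilon>\<^sup>2 / 2) (density Q (\<lambda>x. ennreal (exp (g x)))) Q"
proof -
  let ?P = "density Q (\<lambda>x. ennreal (exp (g x)))"
  interpret Q: prob_space Q by fact
  interpret P: prob_space ?P by fact
  have g': "\<bar>g x\<bar> \<le> \<epsilon>" for x using gb by auto
  interpret U: interval_bounded_random_variable ?P g "-\<epsilon>" \<epsilon>
    by unfold_locales (use gb in \<open>auto simp: abs_le_iff minus_le_iff\<close>)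
  interpret V: interval_bounded_random_variable ?P "\<lambda>x. - g x" "-\<epsilon>" \<epsilon>
    by unfold_locales (use gb in \<open>auto simp: abs_le_iff minus_le_iff\<close>)
  define \<mu> where "\<mu> = (\<integral>x. g x \<partial>?P)"
  have ag: "a * g x \<le> \<bar>a\<bar> * \<epsilon>" for a x
    using mult_left_mono[OF gb[of x], of "\<bar>a\<bar>"] abs_ge_self[of "a * g x"] by (simp add: abs_mult)
  have bP: "integrable ?P (\<lambda>x. exp (a * g x))" for a
    by (rule P.integrable_const_bound[where B = "exp (\<bar>a\<bar> * \<epsilon>)"]) (auto intro!: AE_I2 ag)
  have bQ: "integrable Q (\<lambda>x. exp (a * g x))" for a
    by (rule Q.integrable_const_bound[where B = "exp (\<bar>a\<bar> * \<epsilon>)"]) (auto intro!: AE_I2 ag)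
  (* The relative entropy of the two measures. *)
  have \<mu>: "\<mu> \<le> \<epsilon>\<^sup>2 / 2"
  proof -
    have e: "exp (1 * (- g x - (\<integral>x. - g x \<partial>?P))) = exp \<mu> * exp (- 1 * g x)" for x
      by (simp add: \<mu>_def exp_add[symmetric])
    have "(\<integral>\<^sup>+x. ennreal (exp \<mu> * exp (- 1 * g x)) \<partial>?P) \<le> ennreal (exp (1\<^sup>2 * (\<epsilon> - - \<epsilon>)\<^sup>2 / 8))"
      using V.Hoeffdings_lemma_nn_integral[of 1] unfolding e by simp
    moreover have "(\<integral>\<^sup>+x. ennreal (exp \<mu> * exp (- 1 * g x)) \<partial>?P)
        = ennreal (\<integral>x. exp \<mu> * exp (- 1 * g x) \<partial>?P)"
      by (intro nn_integral_eq_integral integrable_mult_right bP) auto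
    ultimately have "exp \<mu> * (\<integral>x. exp (- 1 * g x) \<partial>?P) \<le> exp (\<epsilon>\<^sup>2 / 2)"
      by (simp add: power2_eq_square)
    also have "(\<integral>x. exp (- 1 * g x) \<partial>?P) = (\<integral>x. 1 \<partial>Q)"
      by (subst integral_density) (auto simp: exp_minus)
    finally show ?thesis by (simp add: Q.prob_space)
  qed
  show ?thesis
  proof (rule renyi_dominated_density[OF Q P l])
    show "integrable Q (\<lambda>x. exp (g x) powr l)" using bQ[of l] by (simp add: powr_def)
    have e: "exp ((l - 1) * (g x - (\<integral>x. g x \<partial>?P))) = exp (- (l - 1) * \<mu>) * exp ((l - 1) * g x)" for x
      by (simp add: \<mu>_def exp_add[symmetric] algebra_simps)
    have "(\<integral>\<^sup>+x. ennreal (exp (- (l - 1) * \<mu>) * exp ((l - 1) * g x)) \<partial>?P)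
        \<le> ennreal (exp ((l - 1)\<^sup>2 * (\<epsilon> - - \<epsilon>)\<^sup>2 / 8))"
      using U.Hoeffdings_lemma_nn_integral[of "l - 1"] l unfolding e by simp
    moreover have "(\<integral>\<^sup>+x. ennreal (exp (- (l - 1) * \<mu>) * exp ((l - 1) * g x)) \<partial>?P)
        = ennreal (\<integral>x. exp (- (l - 1) * \<mu>) * exp ((l - 1) * g x) \<partial>?P)"
      by (intro nn_integral_eq_integral integrable_mult_right bP) auto
    ultimately have le: "exp (- (l - 1) * \<mu>) * (\<integral>x. exp ((l - 1) * g x) \<partial>?P) \<le> exp ((l - 1)\<^sup>2 * \<epsilon>\<^sup>2 / 2)"
      by (simp add: power_mult_distrib mult.commute)
    have "(\<integral>x. exp (g x) powr l \<partial>Q) = (\<integral>x. exp ((l - 1) * g x) \<partial>?P)"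
      by (subst integral_density) (auto simp: powr_def exp_add[symmetric] algebra_simps)
    also have "\<dots> = exp ((l - 1) * \<mu>) * (exp (- (l - 1) * \<mu>) * (\<integral>x. exp ((l - 1) * g x) \<partial>?P))"
      by (simp add: mult.assoc[symmetric] exp_add[symmetric] algebra_simps)
    also have "\<dots> \<le> exp ((l - 1) * \<mu>) * exp ((l - 1)\<^sup>2 * \<epsilon>\<^sup>2 / 2)"
      using le by (intro mult_left_mono) auto
    also have "\<dots> \<le> exp ((l - 1) * (\<epsilon>\<^sup>2 / 2)) * exp ((l - 1)\<^sup>2 * \<epsilon>\<^sup>2 / 2)"
      using \<mu> l by (intro mult_right_mono) auto
    also have "\<dots> = exp ((l - 1) * (l * \<epsilon>\<^sup>2 / 2))"
      by (simp add: exp_add[symmetric]) (simp add: power2_eq_square field_simps)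
    finally show "(\<integral>x. exp (g x) powr l \<partial>Q) \<le> exp ((l - 1) * (l * \<epsilon>\<^sup>2 / 2))" .
  qed auto
qed

section \<open>Privacy of the dense and the peeling release\<close>

lemma pmf_exp_mechanism:
  assumes "finite Q" "Q \<noteq> {}"
  shows "pmf (exp_mechanism \<epsilon> \<Delta> Q s) c =
    (if c \<in> Q then exp (\<epsilon> * s c / (2 * \<Delta>)) / (\<Sum>c'\<in>Q. exp (\<epsilon> * s c' / (2 * \<Delta>))) else 0)"
  unfolding exp_mechanism_def
proof (rule pmf_embed_pmf)
  let ?w = "\<lambda>c. exp (\<epsilon> * s c / (2 * \<Delta>))"
  have pos: "0 < (\<Sum>c\<in>Q. ?w c)" using assms by (intro sum_pos) auto
  then show "0 \<le> (if c \<in> Q then ?w c / (\<Sum>c\<in>Q. ?w c) else 0)" for c by simp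
  have "(\<integral>\<^sup>+c. ennreal (if c \<in> Q then ?w c / (\<Sum>c\<in>Q. ?w c) else 0) \<partial>count_space UNIV)
      = (\<Sum>c\<in>Q. ennreal (?w c / (\<Sum>c\<in>Q. ?w c)))"
    using assms by (subst nn_integral_count_space'[of Q]) auto
  also have "\<dots> = 1"
    using pos by (simp add: sum_ennreal sum_divide_distrib[symmetric])
  finally show "(\<integral>\<^sup>+c. ennreal (if c \<in> Q then ?w c / (\<Sum>c\<in>Q. ?w c) else 0) \<partial>count_space UNIV) = 1" .
qed

lemma set_pmf_exp_mechanism:
  assumes "finite Q" "Q \<noteq> {}"
  shows "set_pmf (exp_mechanism \<epsilon> \<Delta> Q s) = Q"
proof -
  have "0 < (\<Sum>c\<in>Q. exp (\<epsilon> * s c / (2 * \<Delta>)))" using assms by (intro sum_pos) auto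
  then show ?thesis using assms by (auto simp: set_pmf_eq pmf_exp_mechanism split: if_splits)
qed

text \<open>A change of the scores by \<open>\<Delta>\<close> moves each weight, and also the
  normalising sum, by a factor of at most \<open>exp (\<epsilon>/2)\<close>.\<close>

lemma exp_mechanism_ratio:
  assumes Q: "finite Q" "Q \<noteq> {}" and "0 < \<Delta>" "0 \<le> \<epsilon>" and s: "\<And>c. c \<in> Q \<Longrightarrow> \<bar>s c - s' c\<bar> \<le> \<Delta>"
  shows "pmf (exp_mechanism \<epsilon> \<Delta> Q s) c \<le> exp \<epsilon> * pmf (exp_mechanism \<epsilon> \<Delta> Q s') c"
proof (cases "c \<in> Q")
  case True
  let ?w = "\<lambda>s c. exp (\<epsilon> * s c / (2 * \<Delta>))"
  have w: "exp (\<epsilon> * a / (2 * \<Delta>)) \<le> exp (\<epsilon> / 2) * exp (\<epsilon> * b / (2 * \<Delta>))" if "\<bar>a - b\<bar> \<le> \<Delta>" for a b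
  proof -
    have "\<epsilon> * a \<le> \<epsilon> * (\<Delta> + b)" using that assms by (intro mult_left_mono) auto
    then have "\<epsilon> * a / (2 * \<Delta>) \<le> \<epsilon> / 2 + \<epsilon> * b / (2 * \<Delta>)"
      using assms by (simp add: divide_simps algebra_simps)
    then show ?thesis by (simp add: exp_add[symmetric])
  qed
  have pos: "0 < (\<Sum>c\<in>Q. ?w f c)" for f using Q by (intro sum_pos) auto
  have Z: "(\<Sum>c\<in>Q. ?w s' c) \<le> exp (\<epsilon> / 2) * (\<Sum>c\<in>Q. ?w s c)"
    unfolding sum_distrib_left using s by (intro sum_mono w) (auto simp: abs_minus_commute)
  have "?w s c / (\<Sum>c\<in>Q. ?w s c) \<le> (exp (\<epsilon> / 2) * ?w s' c) / ((\<Sum>c\<in>Q. ?w s' c) / exp (\<epsilon> / 2))"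
    using w[OF s[OF True]] Z pos by (intro frac_le) (auto simp: divide_le_eq mult.commute)
  also have "\<dots> = exp \<epsilon> * (?w s' c / (\<Sum>c\<in>Q. ?w s' c))"
    using exp_add[of "\<epsilon> / 2" "\<epsilon> / 2"] by simp
  finally show ?thesis using True Q by (simp add: pmf_exp_mechanism)
qed (use Q in \<open>simp add: pmf_exp_mechanism\<close>)

lemma renyi_dominated_exp_mechanism:
  assumes Q: "finite Q" "Q \<noteq> {}" and \<Delta>: "0 < \<Delta>" and \<epsilon>: "0 \<le> \<epsilon>" and l: "1 < l"
    and s: "\<And>c. c \<in> Q \<Longrightarrow> \<bar>s c - s' c\<bar> \<le> \<Delta>"
  shows "renyi_dominated l (l * \<epsilon>\<^sup>2 / 2) (exp_mechanism \<epsilon> \<Delta> Q s) (exp_mechanism \<epsilon> \<Delta> Q s')"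
proof -
  let ?p = "exp_mechanism \<epsilon> \<Delta> Q s" and ?q = "exp_mechanism \<epsilon> \<Delta> Q s'"
  define g where "g c = (if c \<in> Q then ln (pmf ?p c / pmf ?q c) else 0)" for c
  have pos: "0 < pmf ?p c" "0 < pmf ?q c" if "c \<in> Q" for c
    using that Q by (auto simp: pmf_positive set_pmf_exp_mechanism)
  have p0: "pmf ?p c = 0" if "c \<notin> Q" for c using that Q by (simp add: pmf_exp_mechanism)
  have gb: "\<bar>g c\<bar> \<le> \<epsilon>" for c
  proof (cases "c \<in> Q")
    case True
    note exp_mechanism_ratio[OF Q \<Delta> \<epsilon>, of s s' c]
      exp_mechanism_ratio[OF Q \<Delta> \<epsilon>, of s' s c]
    then have 1: "pmf ?p c \<le> exp \<epsilon> * pmf ?q c" "pmf ?q c \<le> exp \<epsilon> * pmf ?p c"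
      using s by (auto simp: abs_minus_commute)
    have "ln (pmf ?p c) \<le> \<epsilon> + ln (pmf ?q c)" "ln (pmf ?q c) \<le> \<epsilon> + ln (pmf ?p c)"
      using pos[OF True] 1 ln_le_cancel_iff[of "pmf ?p c" "exp \<epsilon> * pmf ?q c"]
        ln_le_cancel_iff[of "pmf ?q c" "exp \<epsilon> * pmf ?p c"]
      by (auto simp: ln_mult)
    then show ?thesis using True pos by (simp add: g_def ln_div abs_le_iff)
  qed (use \<epsilon> in \<open>simp add: g_def\<close>)
  have dens: "density (measure_pmf ?q) (\<lambda>c. ennreal (exp (g c))) = measure_pmf ?p"
    unfolding measure_pmf_eq_density[of ?q] measure_pmf_eq_density[of ?p]
  proof (subst density_density_eq)
    have "pmf ?q c * exp (g c) = pmf ?p c" for c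
    proof (cases "c \<in> Q")
      case True
      with pos have "exp (g c) = pmf ?p c / pmf ?q c" by (simp add: g_def)
      then show ?thesis using pos[OF True] by simp
    qed (use Q in \<open>simp add: pmf_exp_mechanism\<close>)
    then show "density (count_space UNIV) (\<lambda>x. ennreal (pmf ?q x) * ennreal (exp (g x)))
        = density (count_space UNIV) (\<lambda>x. ennreal (pmf ?p x))"
      by (simp add: ennreal_mult[symmetric])
  qed auto
  have "renyi_dominated l (l * \<epsilon>\<^sup>2 / 2) (density (measure_pmf ?q) (\<lambda>c. ennreal (exp (g c)))) ?q"
    by (rule renyi_dominated_pure_dp[OF _ _ _ gb l]) (auto simp: dens measure_pmf.prob_space_axioms)
  then show ?thesis by (simp add: dens)
qed

lemma Diff_nonempty_if_card_less: "finite S \<Longrightarrow> card S < card Q \<Longrightarrow> Q - S \<noteq> {}"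
  using card_mono[of S Q] by auto

lemma set_pmf_peel_select:
  assumes "finite Q" "m \<le> card Q"
  shows "set_pmf (peel_select \<epsilon> \<Delta> Q s m) \<subseteq> {S. S \<subseteq> Q \<and> card S = m}"
  using assms(2)
proof (induction m)
  case (Suc m)
  show ?case
  proof
    fix S' assume "S' \<in> set_pmf (peel_select \<epsilon> \<Delta> Q s (Suc m))"
    then obtain S c where S: "S \<in> set_pmf (peel_select \<epsilon> \<Delta> Q s m)"
      and c: "c \<in> set_pmf (exp_mechanism \<epsilon> \<Delta> (Q - S) s)" and S': "S' = insert c S"
      by (auto simp: set_bind_pmf)
    have "S \<in> {S. S \<subseteq> Q \<and> card S = m}" using S Suc.IH Suc.prems by (meson Suc_leD subsetD)
    then have SQ: "S \<subseteq> Q" "card S = m" by blast+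
    then have "Q - S \<noteq> {}" using Suc.prems Diff_nonempty_if_card_less[of S Q] finite_subset[OF _ assms(1)] by simp
    then have cQ: "c \<in> Q" "c \<notin> S" using c assms(1) by (auto simp: set_pmf_exp_mechanism)
    have "finite S" using SQ(1) assms(1) by (rule finite_subset)
    then have "card S' = Suc m" using cQ SQ by (simp add: S')
    moreover have "S' \<subseteq> Q" using cQ SQ by (simp add: S')
    ultimately show "S' \<in> {S. S \<subseteq> Q \<and> card S = Suc m}" by simp
  qed
qed simp

text \<open>The selection step as a total function of the set selected so far. On an exhausted
  candidate set it returns an arbitrary constant, which makes it private for every
  \<open>S\<close>, not only for those that occur.\<close>

definition peel_step :: "real \<Rightarrow> real \<Rightarrow> 'c set \<Rightarrow> ('c \<Rightarrow> real) \<Rightarrow> 'c set \<Rightarrow> 'c set pmf" where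
  "peel_step \<epsilon> \<Delta> Q s S = (if Q - S = {} then return_pmf {}
     else map_pmf (\<lambda>c. insert c S) (exp_mechanism \<epsilon> \<Delta> (Q - S) s))"

lemma peel_select_Suc:
  assumes "finite Q" "Suc m \<le> card Q"
  shows "peel_select \<epsilon> \<Delta> Q s (Suc m) = bind_pmf (peel_select \<epsilon> \<Delta> Q s m) (peel_step \<epsilon> \<Delta> Q s)"
  unfolding peel_select.simps
proof (rule bind_pmf_cong[OF refl])
  fix S assume "S \<in> set_pmf (peel_select \<epsilon> \<Delta> Q s m)"
  then have "S \<in> {S. S \<subseteq> Q \<and> card S = m}"
    using set_pmf_peel_select[OF assms(1)] assms(2) by (meson Suc_leD subsetD)
  then have "S \<subseteq> Q" "card S = m" by blast+
  then have "Q - S \<noteq> {}" using Diff_nonempty_if_card_less[of S Q] finite_subset[OF _ assms(1)] assms(2) by simp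
  then show "map_pmf (\<lambda>c. insert c S) (exp_mechanism \<epsilon> \<Delta> (Q - S) s) = peel_step \<epsilon> \<Delta> Q s S"
    by (simp add: peel_step_def)
qed

lemma renyi_dominated_peel_select:
  assumes Q: "finite Q" and \<Delta>: "0 < \<Delta>" and \<epsilon>: "0 \<le> \<epsilon>" and l: "1 < l"
    and s: "\<And>c. c \<in> Q \<Longrightarrow> \<bar>s c - s' c\<bar> \<le> \<Delta>" and m: "m \<le> card Q"
  shows "renyi_dominated l (real m * (l * \<epsilon>\<^sup>2 / 2)) (peel_select \<epsilon> \<Delta> Q s m) (peel_select \<epsilon> \<Delta> Q s' m)"
  using m
proof (induction m)
  case 0
  show ?case by (simp add: renyi_dominated_refl[OF measure_pmf.prob_space_axioms l])
next
  case (Suc m)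
  have step: "renyi_dominated l (l * \<epsilon>\<^sup>2 / 2) (peel_step \<epsilon> \<Delta> Q s S) (peel_step \<epsilon> \<Delta> Q s' S)" for S
  proof (cases "Q - S = {}")
    case True
    then show ?thesis
      using l \<epsilon> by (simp add: peel_step_def renyi_dominated_refl[OF _ l] measure_pmf.prob_space_axioms)
  next
    case False
    then show ?thesis
      using renyi_dominated_exp_mechanism[OF _ False \<Delta> \<epsilon> l, of s s'] Q s
      by (auto simp: peel_step_def map_pmf_rep_eq intro!: renyi_dominated_distr)
  qed
  have int: "(\<integral>y. f y \<partial>measure_pmf (bind_pmf p K)) = (\<integral>x. (\<integral>y. f y \<partial>measure_pmf (K x)) \<partial>measure_pmf p)"
    if "\<And>x. 0 \<le> f x" "\<And>x. f x \<le> (1::real)" for f and p and K :: "'a set \<Rightarrow> 'a set pmf"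
    unfolding measure_pmf_bind
    by (rule integral_bind[where K = "count_space UNIV" and B' = 1 and B = 1])
      (use that in \<open>auto intro: measure_pmf.emeasure_space_le_1 simp: measure_pmf_in_subprob_algebra\<close>)
  have "renyi_dominated l (real m * (l * \<epsilon>\<^sup>2 / 2) + l * \<epsilon>\<^sup>2 / 2)
      (peel_select \<epsilon> \<Delta> Q s (Suc m)) (peel_select \<epsilon> \<Delta> Q s' (Suc m))"
    by (rule renyi_dominated_mixture[OF Suc.IH l step])
      (use Suc.prems Q int in \<open>auto simp: peel_select_Suc measure_pmf.prob_space_axioms simp del: peel_select.simps\<close>)
  then show ?case by (simp add: algebra_simps add_divide_distrib del: peel_select.simps)
qed

lemma sclip_abs_le: "0 \<le> L \<Longrightarrow> \<bar>sclip L z\<bar> \<le> L"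
  by (cases "z = 0") (auto simp: sclip_def abs_mult min_def)

lemma abs_mean_diff_adjacent:
  assumes "adjacent n X X'" and c: "\<And>x. \<bar>f x\<bar> \<le> (c::real)"
  shows "\<bar>(\<Sum>i=1..n. f (X i)) / real n - (\<Sum>i=1..n. f (X' i)) / real n\<bar> \<le> 2 * c / real n"
proof -
  obtain i where i: "i \<in> {1..n}" "\<forall>j\<in>{1..n} - {i}. X j = X' j" using assms by (auto simp: adjacent_def)
  have "(\<Sum>j=1..n. f (X j)) - (\<Sum>j=1..n. f (X' j)) = (\<Sum>j=1..n. f (X j) - f (X' j))"
    by (simp add: sum_subtractf)
  also have "\<dots> = f (X i) - f (X' i)"
    using i by (subst sum.remove[of _ i]) auto
  finally have "\<bar>(\<Sum>j=1..n. f (X j)) - (\<Sum>j=1..n. f (X' j))\<bar> \<le> 2 * c"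
    using c[of "X i"] c[of "X' i"] by linarith
  then show ?thesis
    by (simp add: diff_divide_distrib[symmetric] divide_right_mono)
qed

lemma prob_space_PiM_std_normal: "prob_space (PiM I (\<lambda>_. std_normal_distribution))"
  by (intro prob_space_PiM prob_space_normal_density) simp

lemma arg_min_peel_objective:
  assumes "1 \<le> k"
  shows "1 \<le> arg_min (peel_objective n k a \<rho>B) (\<lambda>r. 1 \<le> r \<and> r \<le> k)"
    "arg_min (peel_objective n k a \<rho>B) (\<lambda>r. 1 \<le> r \<and> r \<le> k) \<le> k"
    "1 \<le> r \<Longrightarrow> r \<le> k \<Longrightarrow>
       peel_objective n k a \<rho>B (arg_min (peel_objective n k a \<rho>B) (\<lambda>r. 1 \<le> r \<and> r \<le> k)) \<le> peel_objective n k a \<rho>B r"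
proof -
  let ?f = "peel_objective n k a \<rho>B"
  have eq: "arg_min ?f (\<lambda>r. 1 \<le> r \<and> r \<le> k) = arg_min_on ?f {1..k}"
    by (simp add: arg_min_on_def)
  show "1 \<le> arg_min ?f (\<lambda>r. 1 \<le> r \<and> r \<le> k)" "arg_min ?f (\<lambda>r. 1 \<le> r \<and> r \<le> k) \<le> k"
    using arg_min_if_finite(1)[of "{1..k}" ?f] assms unfolding eq by auto
  show "?f (arg_min ?f (\<lambda>r. 1 \<le> r \<and> r \<le> k)) \<le> ?f r" if "1 \<le> r" "r \<le> k"
    using arg_min_least[of "{1..k}" r ?f] that unfolding eq by auto
qed

text \<open>With \<open>m = k r\<close> selections at \<open>\<epsilon>\<^sup>2 =
  \<rho>\<^sub>B/m\<close> the selection costs \<open>m \<epsilon>\<^sup>2/2 =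
  \<rho>\<^sub>B/2\<close>. Given the selected set, only \<open>m\<close> entries depend on the
  data, each with sensitivity \<open>\<Delta>\<close>, and \<open>\<sigma>\<^sup>2 = m
  \<Delta>\<^sup>2/\<rho>\<^sub>B\<close> makes the noise cost the other
  \<open>\<rho>\<^sub>B/2\<close>.\<close>

lemma renyi_dominated_peel_release:
  assumes IJ: "finite I" "finite J" "card I = k" "card J = k" "1 \<le> k"
    and L: "0 < L" and \<rho>: "0 < \<rho>B" and n: "1 \<le> n" and l: "1 < l" and adj: "adjacent n X X'"
  shows "renyi_dominated l (\<rho>B * l) (peel_release n L X I J a \<rho>B) (peel_release n L X' I J a \<rho>B)"
proof -
  define r where "r = arg_min (peel_objective n k a \<rho>B) (\<lambda>r. 1 \<le> r \<and> r \<le> k)"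
  define m where "m = k * r"
  have r: "1 \<le> r" "r \<le> k" using arg_min_peel_objective[OF IJ(5)] by (auto simp: r_def)
  have m: "1 \<le> m" "m \<le> card (I \<times> J)" using r IJ by (auto simp: m_def card_cartesian_product)
  define \<Delta> where "\<Delta> = 2 * L / real n"
  have \<Delta>: "0 < \<Delta>" using L n by (simp add: \<Delta>_def)
  define \<epsilon> where "\<epsilon> = sqrt (\<rho>B / real m)"
  have \<epsilon>: "0 \<le> \<epsilon>" "real m * \<epsilon>\<^sup>2 = \<rho>B" using \<rho> m by (auto simp: \<epsilon>_def)
  define \<sigma> where "\<sigma> = sqrt (4 * L\<^sup>2 * real m / (\<rho>B * (real n)\<^sup>2))"
  have \<sigma>: "0 < \<sigma>" "\<sigma>\<^sup>2 = real m * \<Delta>\<^sup>2 / \<rho>B"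
    using \<rho> m L n by (auto simp: \<sigma>_def \<Delta>_def power_divide power_mult_distrib ac_simps)
  define A where "A X = (\<lambda>(u, v). (\<Sum>i=1..n. sclip L (X i u * X i v)) / real n)" for X :: "nat \<Rightarrow> nat \<Rightarrow> real"
  have A: "\<bar>A X q - A X' q\<bar> \<le> \<Delta>" for q
    unfolding A_def \<Delta>_def case_prod_beta'
    using abs_mean_diff_adjacent[OF adj, of "\<lambda>x. sclip L (x (fst q) * x (snd q))" L] L
    by (simp add: sclip_abs_le less_imp_le)
  define B where "B = I \<times> J"
  have B: "finite B" "m \<le> card B" using IJ m by (auto simp: B_def)
  define G where "G = PiM B (\<lambda>_. std_normal_distribution)"
  define N where "N = PiM B (\<lambda>_. borel :: real measure)"
  interpret G: prob_space G unfolding G_def by (rule prob_space_PiM_std_normal)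
  define T where "T X S g = (\<lambda>q\<in>B. if q \<in> S then A X q + \<sigma> * g q else 0)" for X S and g :: "nat \<times> nat \<Rightarrow> real"
  define sel where "sel X = peel_select \<epsilon> \<Delta> B (\<lambda>q. \<bar>A X q\<bar>) m" for X
  have rel: "peel_release n L X I J a \<rho>B = distr (measure_pmf (sel X) \<Otimes>\<^sub>M G) N (\<lambda>(S, g). T X S g)" for X
    unfolding peel_release_def Let_def IJ(3) r_def[symmetric] m_def[symmetric] T_def sel_def A_def[symmetric]
      B_def[symmetric] G_def N_def \<epsilon>_def \<Delta>_def \<sigma>_def ..
  have [measurable]: "Measurable.pred (count_space UNIV \<Otimes>\<^sub>M PiM B (\<lambda>_. borel :: real measure)) (\<lambda>x. q \<in> fst x)" for q
    by (rule measurable_compose[OF measurable_fst]) simp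
  have Tm[measurable]: "(\<lambda>(S, g). T X S g) \<in> measurable (measure_pmf (sel X) \<Otimes>\<^sub>M G) N" for X
    unfolding T_def G_def N_def by measurable
  have TmS[measurable]: "T X S \<in> measurable G N" for X S
    unfolding T_def G_def N_def by measurable
  (* The kernel must be private for every set, so sets that are never selected are replaced by the
     empty set. *)
  define S' where "S' S = (if S \<subseteq> B \<and> card S = m then S else {})" for S
  define K where "K X S = distr G N (T X (S' S))" for X S
  have K: "renyi_dominated l (\<rho>B / 2 * l) (K X S) (K X' S)" for S
  proof -
    define S1 where "S1 = S' S"
    have S1: "S1 \<subseteq> B" "card S1 \<le> m" by (auto simp: S1_def S'_def)
    define \<mu> where "\<mu> X q = (if q \<in> S1 then A X q else 0)" for X q
    have sum: "(\<Sum>q\<in>B. (\<mu> X q - \<mu> X' q)\<^sup>2) \<le> 2 * \<sigma>\<^sup>2 * (\<rho>B / 2)"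
    proof -
      have "(\<Sum>q\<in>B. (\<mu> X q - \<mu> X' q)\<^sup>2) = (\<Sum>q\<in>S1. (A X q - A X' q)\<^sup>2)"
        using S1 B by (intro sum.mono_neutral_cong_right) (auto simp: \<mu>_def)
      also have "\<dots> \<le> (\<Sum>q\<in>S1. \<Delta>\<^sup>2)"
        using A \<Delta> by (intro sum_mono) (metis abs_ge_zero power2_abs power_mono)
      also have "\<dots> \<le> real m * \<Delta>\<^sup>2" using S1 by (simp add: mult_right_mono)
      finally show ?thesis using \<sigma> \<rho> by simp
    qed
    have "renyi_dominated l (\<rho>B / 2 * l)
        (distr (distr G N (\<lambda>g. \<lambda>q\<in>B. \<mu> X q + \<sigma> * g q)) N (\<lambda>y. \<lambda>q\<in>B. if q \<in> S1 then y q else 0))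
        (distr (distr G N (\<lambda>g. \<lambda>q\<in>B. \<mu> X' q + \<sigma> * g q)) N (\<lambda>y. \<lambda>q\<in>B. if q \<in> S1 then y q else 0))"
      unfolding G_def N_def
      by (intro renyi_dominated_distr renyi_dominated_gaussian_mechanism B \<sigma> l sum) measurable
    moreover have "distr (distr G N (\<lambda>g. \<lambda>q\<in>B. \<mu> X q + \<sigma> * g q)) N (\<lambda>y. \<lambda>q\<in>B. if q \<in> S1 then y q else 0) = K X S" for X
      unfolding K_def S1_def[symmetric] T_def G_def N_def
      by (subst distr_distr) (auto simp: comp_def \<mu>_def fun_eq_iff intro!: distr_cong)
    ultimately show ?thesis by (simp only:)
  qed
  have int: "(\<integral>y. f y \<partial>peel_release n L X I J a \<rho>B) = (\<integral>S. (\<integral>y. f y \<partial>K X S) \<partial>measure_pmf (sel X))"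
    if f: "f \<in> borel_measurable N" "\<And>x. 0 \<le> f x" "\<And>x. f x \<le> (1::real)" for f X
  proof -
    note [measurable] = f(1)
    interpret PP: pair_prob_space "measure_pmf (sel X)" G
      unfolding pair_prob_space_def pair_sigma_finite_def
      by (auto intro: prob_space_imp_sigma_finite measure_pmf.prob_space_axioms G.prob_space_axioms)
    have "(\<integral>y. f y \<partial>peel_release n L X I J a \<rho>B) = (\<integral>x. f (case x of (S, g) \<Rightarrow> T X S g) \<partial>(measure_pmf (sel X) \<Otimes>\<^sub>M G))"
      unfolding rel by (subst integral_distr) auto
    also have "\<dots> = (\<integral>S. (\<integral>g. f (T X S g) \<partial>G) \<partial>measure_pmf (sel X))"
      by (subst PP.integral_fst'[symmetric])
        (use f in \<open>auto intro!: integrable_unit_interval PP.prob_space_axioms\<close>)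
    also have "\<dots> = (\<integral>S. (\<integral>y. f y \<partial>K X S) \<partial>measure_pmf (sel X))"
    proof (rule integral_cong_AE)
      have "(\<integral>g. f (T X S g) \<partial>G) = (\<integral>y. f y \<partial>K X S)" if "S \<in> set_pmf (sel X)" for S
      proof -
        have "S \<in> {S. S \<subseteq> B \<and> card S = m}" using that set_pmf_peel_select[OF B] unfolding sel_def by (rule subsetD[rotated])
        then have "S' S = S" by (simp add: S'_def)
        then show ?thesis unfolding K_def by (subst integral_distr) auto
      qed
      then show "AE S in measure_pmf (sel X). (\<integral>g. f (T X S g) \<partial>G) = (\<integral>y. f y \<partial>K X S)"
        by (simp add: AE_measure_pmf_iff)
    qed auto
    finally show ?thesis .
  qed
  have prob: "prob_space (peel_release n L X I J a \<rho>B)" for X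
    unfolding rel
    by (intro prob_space.prob_space_distr Tm prob_space_pair G.prob_space_axioms measure_pmf.prob_space_axioms)
  have "renyi_dominated l (real m * (l * \<epsilon>\<^sup>2 / 2) + \<rho>B / 2 * l)
      (peel_release n L X I J a \<rho>B) (peel_release n L X' I J a \<rho>B)"
  proof (rule renyi_dominated_mixture[where p = "measure_pmf (sel X)" and q = "measure_pmf (sel X')"
        and K = "K X" and K' = "K X'"])
    show "renyi_dominated l (real m * (l * \<epsilon>\<^sup>2 / 2)) (sel X) (sel X')"
      unfolding sel_def using A
      by (intro renyi_dominated_peel_select B \<Delta> \<epsilon> l order_trans[OF abs_triangle_ineq3]) auto
    show "sets (K X' x) = sets (peel_release n L X' I J a \<rho>B)" for x by (simp add: K_def rel)
  qed (use l K prob int in \<open>auto simp: rel\<close>)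
  moreover have "real m * (l * \<epsilon>\<^sup>2 / 2) + \<rho>B / 2 * l = \<rho>B * l" using \<epsilon> by (simp add: algebra_simps)
  ultimately show ?thesis by simp
qed

lemma L2_set_vclip_le:
  assumes "0 \<le> R"
  shows "L2_set (vclip A R z) A \<le> R"
proof -
  let ?c = "min 1 (R / L2_set z A)"
  have c: "0 \<le> ?c" using assms by simp
  have "L2_set (vclip A R z) A = L2_set z A * ?c"
    unfolding vclip_def using L2_set_left_distrib[OF c, of z A] by simp
  also have "\<dots> \<le> R"
    using assms by (cases "L2_set z A = 0") (auto simp: min_def mult_le_cancel_left divide_le_eq mult.commute order_less_le)
  finally show ?thesis .
qed

lemma sum_outer_product_squares:
  assumes "finite I" "finite J"
  shows "(\<Sum>q\<in>I \<times> J. (x (fst q) * y (snd q))\<^sup>2) = (L2_set x I)\<^sup>2 * (L2_set y J)\<^sup>2"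
  by (simp add: L2_set_def sum_nonneg sum_product sum.cartesian_product power_mult_distrib case_prod_beta')

text \<open>For a block on or above the diagonal the noise entries are distinct coordinates of the
  upper triangle, so the release is a projection of a Gaussian mechanism on the whole triangle.
  One observation changes the clipped mean by at most \<open>2 R\<^sup>2/n\<close> in Frobenius
  norm, well below what the noise variance pays for.\<close>

lemma renyi_dominated_dp_cov_block:
  assumes IJ: "finite I" "finite J" "I \<subseteq> {1..p}" "J \<subseteq> {1..p}" and le: "\<And>u v. u \<in> I \<Longrightarrow> v \<in> J \<Longrightarrow> u \<le> v"
    and R: "0 < R" and \<rho>: "0 < \<rho>B" and n: "1 \<le> n" and l: "1 < l" and adj: "adjacent n X X'"
  shows "renyi_dominated l (\<rho>B * l) (dp_cov_block n p X I J \<rho>B R) (dp_cov_block n p X' I J \<rho>B R)"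
proof -
  define U where "U = {(u, v). 1 \<le> u \<and> u \<le> v \<and> v \<le> p}"
  have U: "finite U" by (rule finite_subset[of _ "{1..p} \<times> {1..p}"]) (auto simp: U_def)
  have IJU: "I \<times> J \<subseteq> U" using IJ le by (fastforce simp: U_def)
  define \<sigma> where "\<sigma> = sqrt (18 * R ^ 4 / (\<rho>B * (real n)\<^sup>2))"
  have \<sigma>: "0 < \<sigma>" "\<sigma>\<^sup>2 = 18 * R ^ 4 / (\<rho>B * (real n)\<^sup>2)" using R \<rho> n by (auto simp: \<sigma>_def)
  define w where "w x q = vclip I R x (fst q) * vclip J R x (snd q)" for x q
  define \<mu> where "\<mu> X q = (if q \<in> I \<times> J then (\<Sum>i=1..n. w (X i) q) / real n else 0)" for X q
  define G where "G = PiM U (\<lambda>_. std_normal_distribution)"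
  have eq: "dp_cov_block n p X I J \<rho>B R = distr (distr G (PiM U (\<lambda>_. borel)) (\<lambda>g. \<lambda>q\<in>U. \<mu> X q + \<sigma> * g q))
      (PiM (I \<times> J) (\<lambda>_. borel)) (\<lambda>y. restrict y (I \<times> J))" for X
    unfolding dp_cov_block_def U_def[symmetric] G_def \<sigma>_def[symmetric]
  proof (subst distr_distr)
    show "(\<lambda>y. restrict y (I \<times> J)) \<in> PiM U (\<lambda>_. borel) \<rightarrow>\<^sub>M PiM (I \<times> J) (\<lambda>_. borel :: real measure)"
      using IJU by (rule measurable_restrict_subset)
    show "distr (PiM U (\<lambda>_. std_normal_distribution)) (PiM (I \<times> J) (\<lambda>_. borel))
     (\<lambda>g. \<lambda>(u, v)\<in>I \<times> J. (\<Sum>i=1..n. vclip I R (X i) u * vclip J R (X i) v) / real n + \<sigma> * g (min u v, max u v)) =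
    distr (PiM U (\<lambda>_. std_normal_distribution)) (PiM (I \<times> J) (\<lambda>_. borel))
     ((\<lambda>y. restrict y (I \<times> J)) \<circ> (\<lambda>g. \<lambda>q\<in>U. \<mu> X q + \<sigma> * g q))"
    proof (intro distr_cong refl ext)
      fix g q
      show "(\<lambda>(u, v)\<in>I \<times> J. (\<Sum>i=1..n. vclip I R (X i) u * vclip J R (X i) v) / real n + \<sigma> * g (min u v, max u v)) q
        = ((\<lambda>y. restrict y (I \<times> J)) \<circ> (\<lambda>g. \<lambda>q\<in>U. \<mu> X q + \<sigma> * g q)) g q"
        using IJU le by (cases q) (auto simp: \<mu>_def w_def min_absorb1 max_absorb2)
    qed
  qed measurable
  have wn: "(\<Sum>q\<in>I \<times> J. (w x q)\<^sup>2) \<le> R ^ 4" for x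
  proof -
    have "(\<Sum>q\<in>I \<times> J. (w x q)\<^sup>2) = (L2_set (vclip I R x) I)\<^sup>2 * (L2_set (vclip J R x) J)\<^sup>2"
      unfolding w_def by (rule sum_outer_product_squares[OF IJ(1,2)])
    also have "\<dots> \<le> R\<^sup>2 * R\<^sup>2"
      using R by (intro mult_mono power_mono L2_set_vclip_le) auto
    finally show ?thesis by (simp add: power2_eq_square power4_eq_xxxx)
  qed
  have "(\<Sum>q\<in>U. (\<mu> X q - \<mu> X' q)\<^sup>2) \<le> 2 * \<sigma>\<^sup>2 * \<rho>B"
  proof -
    obtain i where i: "i \<in> {1..n}" "\<forall>j\<in>{1..n} - {i}. X j = X' j" using adj by (auto simp: adjacent_def)
    have d: "\<mu> X q - \<mu> X' q = (w (X i) q - w (X' i) q) / real n" if "q \<in> I \<times> J" for q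
    proof -
      have "(\<Sum>j=1..n. w (X j) q) - (\<Sum>j=1..n. w (X' j) q) = (\<Sum>j=1..n. w (X j) q - w (X' j) q)"
        by (simp add: sum_subtractf)
      also have "\<dots> = w (X i) q - w (X' i) q" using i by (subst sum.remove[of _ i]) auto
      finally show ?thesis using that by (simp add: \<mu>_def diff_divide_distrib[symmetric])
    qed
    have "(\<Sum>q\<in>U. (\<mu> X q - \<mu> X' q)\<^sup>2) = (\<Sum>q\<in>I \<times> J. (\<mu> X q - \<mu> X' q)\<^sup>2)"
      using U IJU by (intro sum.mono_neutral_right) (auto simp: \<mu>_def)
    also have "\<dots> \<le> (\<Sum>q\<in>I \<times> J. (2 * (w (X i) q)\<^sup>2 + 2 * (w (X' i) q)\<^sup>2) / (real n)\<^sup>2)"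
    proof (intro sum_mono)
      fix q assume "q \<in> I \<times> J"
      then show "(\<mu> X q - \<mu> X' q)\<^sup>2 \<le> (2 * (w (X i) q)\<^sup>2 + 2 * (w (X' i) q)\<^sup>2) / (real n)\<^sup>2"
        using zero_le_power2[of "w (X i) q + w (X' i) q"]
        by (simp add: d power_divide divide_right_mono power2_sum power2_diff)
    qed
    also have "\<dots> = (2 * (\<Sum>q\<in>I \<times> J. (w (X i) q)\<^sup>2) + 2 * (\<Sum>q\<in>I \<times> J. (w (X' i) q)\<^sup>2)) / (real n)\<^sup>2"
      by (simp add: sum_divide_distrib[symmetric] sum.distrib sum_distrib_left)
    also have "\<dots> \<le> (2 * R ^ 4 + 2 * R ^ 4) / (real n)\<^sup>2"
      by (intro divide_right_mono add_mono mult_left_mono wn) auto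
    also have "\<dots> \<le> 2 * \<sigma>\<^sup>2 * \<rho>B" using \<rho> R n by (simp add: \<sigma>(2) divide_right_mono)
    finally show ?thesis .
  qed
  then show ?thesis
    unfolding eq G_def
    by (intro renyi_dominated_distr renyi_dominated_gaussian_mechanism U \<sigma> l)
      (simp_all add: measurable_restrict_subset[OF IJU])
qed

section \<open>The spectral theorem for real symmetric matrices\<close>

text \<open>Families are indexed from one to \<open>m\<close>, as in the definition of the
  spectral clip.\<close>

definition orthonormal_upto :: "'i set \<Rightarrow> nat \<Rightarrow> (nat \<Rightarrow> 'i \<Rightarrow> real) \<Rightarrow> bool" where
  "orthonormal_upto I m w \<longleftrightarrow>
     (\<forall>l\<in>{1..m}. \<forall>l'\<in>{1..m}. (\<Sum>i\<in>I. w l i * w l' i) = (if l = l' then 1 else 0))"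

lemma orthonormal_uptoD:
  "orthonormal_upto I m w \<Longrightarrow> l \<in> {1..m} \<Longrightarrow> l' \<in> {1..m} \<Longrightarrow>
    (\<Sum>i\<in>I. w l i * w l' i) = (if l = l' then 1 else 0)"
  by (simp add: orthonormal_upto_def)

text \<open>Subtracting from a coordinate vector its projection onto the span leaves a vector
  orthogonal to the span, whose squared length is given by Pythagoras.\<close>

lemma residual_orthogonal:
  assumes "finite I" "orthonormal_upto I m w" "i \<in> I"
  defines "r \<equiv> (\<lambda>j. (if j = i then 1 else 0) - (\<Sum>l=1..m. w l i * w l j))"
  shows "l \<in> {1..m} \<Longrightarrow> (\<Sum>j\<in>I. r j * w l j) = 0"
    and "(\<Sum>j\<in>I. (r j)\<^sup>2) = 1 - (\<Sum>l=1..m. (w l i)\<^sup>2)"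
proof -
  show orth: "(\<Sum>j\<in>I. r j * w l j) = 0" if l: "l \<in> {1..m}" for l
  proof -
    have "(\<Sum>j\<in>I. r j * w l j) = (\<Sum>j\<in>I. (if j = i then w l j else 0)) - (\<Sum>j\<in>I. \<Sum>l'=1..m. w l' i * w l' j * w l j)"
      by (simp add: r_def left_diff_distrib sum_subtractf sum_distrib_right if_distrib[of "\<lambda>x. x * _"] cong: if_cong)
    also have "(\<Sum>j\<in>I. \<Sum>l'=1..m. w l' i * w l' j * w l j) = (\<Sum>l'=1..m. w l' i * (\<Sum>j\<in>I. w l' j * w l j))"
      by (subst sum.swap) (simp add: sum_distrib_left mult.assoc)
    also have "\<dots> = (\<Sum>l'=1..m. if l' = l then w l' i else 0)"
      using l by (intro sum.cong refl) (auto simp: orthonormal_uptoD[OF assms(2)])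
    also have "\<dots> = w l i" using l by simp
    also have "(\<Sum>j\<in>I. (if j = i then w l j else 0)) = w l i" using assms by simp
    finally show ?thesis by simp
  qed
  have "(\<Sum>j\<in>I. (r j)\<^sup>2) = (\<Sum>j\<in>I. r j * (if j = i then 1 else 0)) - (\<Sum>j\<in>I. \<Sum>l=1..m. w l i * (r j * w l j))"
    unfolding sum_subtractf[symmetric]
  proof (intro sum.cong refl)
    fix j
    have "r j * (\<Sum>l=1..m. w l i * w l j) = (\<Sum>l=1..m. w l i * (r j * w l j))"
      by (simp add: sum_distrib_left mult_ac)
    then show "(r j)\<^sup>2 = r j * (if j = i then 1 else 0) - (\<Sum>l=1..m. w l i * (r j * w l j))"
      by (simp only: r_def power2_eq_square right_diff_distrib)
  qed
  also have "(\<Sum>j\<in>I. \<Sum>l=1..m. w l i * (r j * w l j)) = (\<Sum>l=1..m. w l i * (\<Sum>j\<in>I. r j * w l j))"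
    by (subst sum.swap) (simp add: sum_distrib_left)
  also have "\<dots> = 0" using orth by simp
  also have "(\<Sum>j\<in>I. r j * (if j = i then 1 else 0)) = r i"
    using assms(1,3) by (simp add: if_distrib[of "\<lambda>x. _ * x"] cong: if_cong)
  finally show "(\<Sum>j\<in>I. (r j)\<^sup>2) = 1 - (\<Sum>l=1..m. (w l i)\<^sup>2)"
    by (simp add: r_def power2_eq_square)
qed

lemma sum_orthonormal_squares:
  assumes "finite I" "orthonormal_upto I m w"
  shows "(\<Sum>i\<in>I. \<Sum>l=1..m. (w l i)\<^sup>2) = real m"
  using orthonormal_uptoD[OF assms(2)]
  by (subst sum.swap) (simp add: power2_eq_square)

text \<open>Fewer than \<open>card I\<close> orthonormal vectors cannot span every coordinate
  vector, because their squared entries sum to \<open>m < card I\<close>; a coordinate vector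
  outside the span has a nonzero residual.\<close>

lemma orthonormal_extension:
  assumes "finite I" "orthonormal_upto I m w" "m < card I"
  obtains x where "(\<Sum>j\<in>I. (x j)\<^sup>2) = 1" "\<And>l. l \<in> {1..m} \<Longrightarrow> (\<Sum>j\<in>I. x j * w l j) = 0" "\<And>j. j \<notin> I \<Longrightarrow> x j = 0"
proof -
  have "\<exists>i\<in>I. (\<Sum>l=1..m. (w l i)\<^sup>2) < 1"
  proof (rule ccontr)
    assume "\<not> ?thesis"
    then have "(\<Sum>i\<in>I. 1) \<le> (\<Sum>i\<in>I. \<Sum>l=1..m. (w l i)\<^sup>2)" by (intro sum_mono) (auto simp: not_less)
    then show False using sum_orthonormal_squares[OF assms(1,2)] assms(3) by simp
  qed
  then obtain i where i: "i \<in> I" "(\<Sum>l=1..m. (w l i)\<^sup>2) < 1" by blast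
  define r where "r j = (if j = i then 1 else 0) - (\<Sum>l=1..m. w l i * w l j)" for j
  note res = residual_orthogonal[OF assms(1,2) i(1), folded r_def]
  define c where "c = sqrt (\<Sum>j\<in>I. (r j)\<^sup>2)"
  have c: "0 < c" "c\<^sup>2 = (\<Sum>j\<in>I. (r j)\<^sup>2)" using res(2) i by (auto simp: c_def)
  show ?thesis
  proof (rule that[of "\<lambda>j. if j \<in> I then r j / c else 0"])
    show "(\<Sum>j\<in>I. (if j \<in> I then r j / c else 0)\<^sup>2) = 1"
      using c(1) by (simp add: power_divide sum_divide_distrib[symmetric] c(2)[symmetric])
    show "(\<Sum>j\<in>I. (if j \<in> I then r j / c else 0) * w l j) = 0" if "l \<in> {1..m}" for l
      using res(1)[OF that] by (simp add: sum_divide_distrib[symmetric])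
  qed simp
qed

lemma compact_orthogonal_sphere:
  fixes I :: "'i set"
  assumes "finite I"
  shows "compact {x. (\<forall>j. j \<notin> I \<longrightarrow> x j = (0::real)) \<and> (\<Sum>j\<in>I. (x j)\<^sup>2) = 1 \<and> (\<forall>l\<in>{1..m}. (\<Sum>j\<in>I. x j * w l j) = 0)}"
    (is "compact ?C")
proof -
  have cont: "continuous_on UNIV (\<lambda>x :: 'i \<Rightarrow> real. x j)" for j by simp
  let ?B = "PiE UNIV (\<lambda>j. if j \<in> I then {-1..1} else {0::real})"
  have "compactin (product_topology (\<lambda>_. euclidean) UNIV) ?B"
    by (subst compactin_PiE) auto
  then have B: "compact ?B" by (simp add: euclidean_product_topology)
  have "closed ((\<Inter>j\<in>- I. {x. x j = (0::real)}) \<inter> {x. (\<Sum>j\<in>I. (x j)\<^sup>2) = 1}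
      \<inter> (\<Inter>l\<in>{1..m}. {x. (\<Sum>j\<in>I. x j * w l j) = 0}))"
    by (intro closed_Int closed_INT ballI closed_Collect_eq continuous_intros cont)
  also have "\<dots> = ?C" by auto
  finally have C: "closed ?C" .
  have "?C \<subseteq> ?B"
  proof
    fix x assume x: "x \<in> ?C"
    have "\<bar>x j\<bar> \<le> 1" if "j \<in> I" for j
    proof -
      have "(x j)\<^sup>2 \<le> (\<Sum>j\<in>I. (x j)\<^sup>2)" using assms that by (intro member_le_sum) auto
      then show ?thesis using x by (simp add: abs_square_le_1)
    qed
    then show "x \<in> ?B" using x by (auto simp: PiE_iff abs_le_iff minus_le_iff)
  qed
  then show ?thesis using compact_Int_closed[OF B C] by (simp add: Int_absorb1)
qed

text \<open>First-order optimality: a linear term that is dominated by a quadratic one near zero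
  vanishes.\<close>

lemma quadratic_perturbation_zero:
  assumes "\<And>t::real. 2 * t * b \<le> t\<^sup>2 * c" "0 \<le> c"
  shows "b = 0"
proof (rule ccontr)
  assume b: "b \<noteq> 0"
  have "2 * (b / (c + 1)) * b \<le> (b / (c + 1))\<^sup>2 * c" by (rule assms(1))
  then have "2 * b\<^sup>2 * (c + 1) \<le> b\<^sup>2 * c" using assms(2) by (simp add: divide_simps power2_eq_square)
  then have "b\<^sup>2 * (c + 2) \<le> 0" by (simp add: algebra_simps)
  then show False using b assms(2) by (simp add: mult_le_0_iff)
qed

text \<open>Maximise the quadratic form of \<open>A\<close> over unit vectors orthogonal to the
  eigenvectors found so far. Symmetry keeps the image of the maximiser \<open>x\<close> in that
  orthogonal complement, and optimality makes it orthogonal to everything there that is orthogonal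
  to \<open>x\<close>; so it is a multiple of \<open>x\<close>.\<close>

lemma symmetric_eigenvector:
  fixes A :: "'i \<times> 'i \<Rightarrow> real"
  assumes I: "finite I" and sym: "\<And>i j. i \<in> I \<Longrightarrow> j \<in> I \<Longrightarrow> A (i, j) = A (j, i)"
    and w: "orthonormal_upto I m w" "m < card I"
    and \<nu>: "\<And>l i. l \<in> {1..m} \<Longrightarrow> i \<in> I \<Longrightarrow> (\<Sum>j\<in>I. A (i, j) * w l j) = \<nu> l * w l i"
  obtains x eig where "(\<Sum>j\<in>I. (x j)\<^sup>2) = 1" "\<And>l. l \<in> {1..m} \<Longrightarrow> (\<Sum>j\<in>I. x j * w l j) = 0"
    "\<And>i. i \<in> I \<Longrightarrow> (\<Sum>j\<in>I. A (i, j) * x j) = eig * x i"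
proof -
  define C where "C = {x. (\<forall>j. j \<notin> I \<longrightarrow> x j = (0::real)) \<and> (\<Sum>j\<in>I. (x j)\<^sup>2) = 1 \<and> (\<forall>l\<in>{1..m}. (\<Sum>j\<in>I. x j * w l j) = 0)}"
  have C: "compact C" unfolding C_def by (rule compact_orthogonal_sphere[OF I])
  obtain x0 where "(\<Sum>j\<in>I. (x0 j)\<^sup>2) = 1" "\<And>l. l \<in> {1..m} \<Longrightarrow> (\<Sum>j\<in>I. x0 j * w l j) = 0"
    "\<And>j. j \<notin> I \<Longrightarrow> x0 j = 0" by (rule orthonormal_extension[OF I w]) blast
  then have "x0 \<in> C" by (simp add: C_def)
  then have ne: "C \<noteq> {}" by blast
  define ip where "ip x y = (\<Sum>i\<in>I. x i * y i)" for x y :: "'i \<Rightarrow> real"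
  define T where "T x i = (\<Sum>j\<in>I. A (i, j) * x j)" for x i
  have ip_sym: "ip x y = ip y x" for x y by (simp add: ip_def mult.commute)
  have T_sym: "ip (T x) y = ip x (T y)" for x y
  proof -
    have "ip (T x) y = (\<Sum>i\<in>I. \<Sum>j\<in>I. A (i, j) * x j * y i)" by (simp add: ip_def T_def sum_distrib_right)
    also have "\<dots> = (\<Sum>j\<in>I. \<Sum>i\<in>I. A (i, j) * x j * y i)" by (rule sum.swap)
    also have "\<dots> = (\<Sum>j\<in>I. \<Sum>i\<in>I. x j * (A (j, i) * y i))"
      using sym by (intro sum.cong refl) (simp add: mult_ac)
    finally show ?thesis by (simp add: ip_def T_def sum_distrib_left)
  qed
  have cont: "continuous_on UNIV (\<lambda>x :: 'i \<Rightarrow> real. x j)" for j by simp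
  have "continuous_on C (\<lambda>x. ip (T x) x)"
    unfolding ip_def T_def by (intro continuous_intros continuous_on_subset[OF cont]) auto
  from continuous_attains_sup[OF C ne this] obtain x where
    x: "x \<in> C" and max: "\<And>y. y \<in> C \<Longrightarrow> ip (T y) y \<le> ip (T x) x" by blast
  (* The maximal value of the quadratic form will be the eigenvalue of the maximiser. *)
  define eig where "eig = ip (T x) x"
  have x1: "ip x x = 1" "\<And>l. l \<in> {1..m} \<Longrightarrow> ip x (w l) = 0"
    using x by (auto simp: C_def ip_def power2_eq_square)
  have lin: "ip (\<lambda>j. a * u j + b * v j) z = a * ip u z + b * ip v z"
    "ip z (\<lambda>j. a * u j + b * v j) = a * ip z u + b * ip z v"
    "T (\<lambda>j. a * u j + b * v j) = (\<lambda>j. a * T u j + b * T v j)" for a b u v z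
    by (auto simp: ip_def T_def sum.distrib sum_distrib_left algebra_simps)
  have ip0: "0 \<le> ip z z" for z by (simp add: ip_def sum_nonneg)
  (* By homogeneity the maximum over the sphere bounds the form on the whole complement. *)
  have bound: "ip (T z) z \<le> eig * ip z z" if z: "\<And>l. l \<in> {1..m} \<Longrightarrow> ip z (w l) = 0" for z
  proof (cases "ip z z = 0")
    case True
    then have "z j = 0" if "j \<in> I" for j
      using that I by (simp add: ip_def sum_nonneg_eq_0_iff)
    then show ?thesis using True by (simp add: ip_def)
  next
    case False
    define c where "c = sqrt (ip z z)"
    have c: "0 < c" "c\<^sup>2 = ip z z" using False ip0[of z] by (auto simp: c_def)
    define y where "y j = (if j \<in> I then z j / c else 0)" for j
    have y: "ip y v = ip z v / c" "ip v y = ip v z / c" "T y = (\<lambda>j. T z j / c)" for v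
      by (auto simp: ip_def T_def y_def sum_divide_distrib)
    have ydiv: "ip (\<lambda>j. v j / c) u = ip v u / c" for u v by (simp add: ip_def sum_divide_distrib)
    have "y \<in> C" using z c y(1)[of "w _"] y(1)[of y] y(2)[of z]
      by (auto simp: C_def y_def power2_eq_square ip_def simp flip: c(2))
    from max[OF this] have "ip (T z) z / c / c \<le> eig" by (simp add: eig_def y ydiv)
    then show ?thesis using c by (simp add: c(2)[symmetric] power2_eq_square divide_le_eq mult.assoc)
  qed
  have orth: "ip (T x) y = 0" if y: "\<And>l. l \<in> {1..m} \<Longrightarrow> ip y (w l) = 0" "ip y x = 0" for y
  proof (rule quadratic_perturbation_zero)
    fix t :: real
    have "ip (T (\<lambda>j. 1 * x j + t * y j)) (\<lambda>j. 1 * x j + t * y j) \<le> eig * ip (\<lambda>j. 1 * x j + t * y j) (\<lambda>j. 1 * x j + t * y j)"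
    proof (rule bound)
      fix l assume l: "l \<in> {1..m}"
      show "ip (\<lambda>j. 1 * x j + t * y j) (w l) = 0"
        using lin(1)[of 1 x t y "w l"] x1(2)[OF l] y(1)[OF l] by simp
    qed
    then have "eig + t * ip (T x) y + t * (ip (T y) x + t * ip (T y) y) \<le> eig * (1 + t * t * ip y y)"
      unfolding lin using x1 y(2) ip_sym[of x y] by (simp add: eig_def algebra_simps)
    moreover have "ip (T y) x = ip (T x) y" using T_sym[of x y] ip_sym by simp
    ultimately show "2 * t * ip (T x) y \<le> t\<^sup>2 * (eig * ip y y - ip (T y) y)"
      by (simp add: power2_eq_square algebra_simps)
  next
    show "0 \<le> eig * ip y y - ip (T y) y" using bound[of y] y(1) by simp
  qed
  (* The residual y is orthogonal to x, so optimality makes it orthogonal to T x and thereby to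
     itself. *)
  define y where "y j = 1 * T x j + (- eig) * x j" for j
  have y1: "ip y (w l) = 0" if l: "l \<in> {1..m}" for l
  proof -
    have "ip (T x) (w l) = ip x (T (w l))" by (rule T_sym)
    also have "\<dots> = (\<Sum>i\<in>I. x i * (\<nu> l * w l i))"
      unfolding ip_def T_def using \<nu>[OF l] by (intro sum.cong refl) simp
    also have "\<dots> = \<nu> l * ip x (w l)" by (simp add: ip_def sum_distrib_left mult_ac)
    finally have "ip (T x) (w l) = 0" using x1(2)[OF l] by simp
    then show ?thesis unfolding y_def lin(1) using x1(2)[OF l] by simp
  qed
  have y2: "ip y x = 0" unfolding y_def lin(1) using x1(1) by (simp add: eig_def)
  have "ip y y = ip y (T x) - eig * ip y x"
    using arg_cong[of y "\<lambda>j. 1 * T x j + (- eig) * x j" "ip y"] lin(2)[of y 1 "T x" "- eig" x]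
    by (simp add: y_def[abs_def])
  also have "\<dots> = 0" using orth[OF y1 y2] y2 ip_sym by simp
  finally have "y j = 0" if "j \<in> I" for j
    using that I by (simp add: ip_def sum_nonneg_eq_0_iff)
  then show ?thesis
    using x1 by (intro that[of x eig]) (auto simp: ip_def power2_eq_square y_def T_def)
qed

lemma symmetric_eigensystem:
  fixes A :: "'i \<times> 'i \<Rightarrow> real"
  assumes I: "finite I" and sym: "\<And>i j. i \<in> I \<Longrightarrow> j \<in> I \<Longrightarrow> A (i, j) = A (j, i)" and m: "m \<le> card I"
  shows "\<exists>\<nu> w. orthonormal_upto I m w \<and>
     (\<forall>l\<in>{1..m}. \<forall>i\<in>I. (\<Sum>j\<in>I. A (i, j) * w l j) = \<nu> l * w l i)"
  using m
proof (induction m)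
  case 0
  then show ?case by (auto simp: orthonormal_upto_def)
next
  case (Suc m)
  then have "\<exists>\<nu> w. orthonormal_upto I m w \<and>
     (\<forall>l\<in>{1..m}. \<forall>i\<in>I. (\<Sum>j\<in>I. A (i, j) * w l j) = \<nu> l * w l i)" by simp
  then obtain \<nu> w where w: "orthonormal_upto I m w"
    and \<nu>: "\<And>l i. l \<in> {1..m} \<Longrightarrow> i \<in> I \<Longrightarrow> (\<Sum>j\<in>I. A (i, j) * w l j) = \<nu> l * w l i" by blast
  have "m < card I" using Suc by simp
  from symmetric_eigenvector[where A = A, OF I sym w this \<nu>] obtain x eig where
    x: "(\<Sum>j\<in>I. (x j)\<^sup>2) = 1" "\<And>l. l \<in> {1..m} \<Longrightarrow> (\<Sum>j\<in>I. x j * w l j) = 0"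
      "\<And>i. i \<in> I \<Longrightarrow> (\<Sum>j\<in>I. A (i, j) * x j) = eig * x i" by blast
  have x2: "(\<Sum>j\<in>I. w l j * x j) = 0" if "l \<in> {1..m}" for l
    using x(2)[OF that] by (simp add: mult.commute)
  have "orthonormal_upto I (Suc m) (w(Suc m := x))"
    unfolding orthonormal_upto_def using x x2 orthonormal_uptoD[OF w]
    by (auto simp: atLeastAtMostSuc_conv power2_eq_square)
  moreover have "\<forall>l\<in>{1..Suc m}. \<forall>i\<in>I. (\<Sum>j\<in>I. A (i, j) * (w(Suc m := x)) l j) = (\<nu>(Suc m := eig)) l * (w(Suc m := x)) l i"
    using \<nu> x(3) by (auto simp: atLeastAtMostSuc_conv)
  ultimately show ?case by blast
qed

text \<open>For a full family all residuals vanish, since their squared lengths are nonnegative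
  and add up to \<open>card I - card I\<close>.\<close>

lemma orthonormal_complete:
  assumes I: "finite I" and w: "orthonormal_upto I (card I) w" and ij: "i \<in> I" "j \<in> I"
  shows "(\<Sum>l=1..card I. w l i * w l j) = (if j = i then 1 else 0)"
proof -
  let ?r = "\<lambda>i j. (if j = i then 1 else 0) - (\<Sum>l=1..card I. w l i * w l j)"
  have r: "(\<Sum>j\<in>I. (?r i j)\<^sup>2) = 1 - (\<Sum>l=1..card I. (w l i)\<^sup>2)" if "i \<in> I" for i
    using residual_orthogonal(2)[OF I w that] .
  have "(\<Sum>i\<in>I. \<Sum>j\<in>I. (?r i j)\<^sup>2) = (\<Sum>i\<in>I. 1 - (\<Sum>l=1..card I. (w l i)\<^sup>2))"
    using r by (intro sum.cong refl)
  also have "\<dots> = 0" unfolding sum_subtractf sum_orthonormal_squares[OF I w] by simp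
  finally have "(\<Sum>j\<in>I. (?r i j)\<^sup>2) = 0" using I ij by (subst (asm) sum_nonneg_eq_0_iff) (auto intro: sum_nonneg)
  then have "(?r i j)\<^sup>2 = 0" using I ij by (subst (asm) sum_nonneg_eq_0_iff) auto
  then show ?thesis by simp
qed

lemma spectral_decomposition:
  fixes A :: "'i \<times> 'i \<Rightarrow> real"
  assumes I: "finite I" and sym: "\<And>i j. i \<in> I \<Longrightarrow> j \<in> I \<Longrightarrow> A (i, j) = A (j, i)"
  obtains \<nu> w where "orthonormal_upto I (card I) w"
    "\<And>i j. i \<in> I \<Longrightarrow> j \<in> I \<Longrightarrow> A (i, j) = (\<Sum>l=1..card I. \<nu> l * w l i * w l j)"
proof -
  obtain \<nu> w where w: "orthonormal_upto I (card I) w"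
    and \<nu>: "\<And>l i. l \<in> {1..card I} \<Longrightarrow> i \<in> I \<Longrightarrow> (\<Sum>j\<in>I. A (i, j) * w l j) = \<nu> l * w l i"
    using symmetric_eigensystem[where A = A and I = I and m = "card I", OF I sym order_refl] by blast
  show ?thesis
  proof (rule that[OF w])
    fix i j assume ij: "i \<in> I" "j \<in> I"
    have "A (i, j) = (\<Sum>k\<in>I. A (i, k) * (if k = j then 1 else 0))"
      using ij I by (simp add: if_distrib[of "\<lambda>x. _ * x"] cong: if_cong)
    also have "\<dots> = (\<Sum>k\<in>I. \<Sum>l=1..card I. A (i, k) * w l k * w l j)"
      using orthonormal_complete[OF I w ij(2)]
      by (intro sum.cong refl) (simp add: sum_distrib_left[symmetric] mult.assoc mult.commute[of "w _ _" "w _ j"])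
    also have "\<dots> = (\<Sum>l=1..card I. \<nu> l * w l i * w l j)"
      by (subst sum.swap) (simp add: sum_distrib_right[symmetric] \<nu> ij)
    finally show "A (i, j) = (\<Sum>l=1..card I. \<nu> l * w l i * w l j)" .
  qed
qed

section \<open>Spectral clipping as a Frobenius projection\<close>

definition quad_form :: "'i set \<Rightarrow> ('i \<times> 'i \<Rightarrow> real) \<Rightarrow> ('i \<Rightarrow> real) \<Rightarrow> real" where
  "quad_form I S v = (\<Sum>i\<in>I. \<Sum>j\<in>I. v i * S (i, j) * v j)"

definition spectrum_within :: "'i set \<Rightarrow> real \<Rightarrow> ('i \<times> 'i \<Rightarrow> real) \<Rightarrow> bool" where
  "spectrum_within I M0 S \<longleftrightarrow> (\<forall>v. 0 \<le> quad_form I S v \<and> quad_form I S v \<le> M0 * (\<Sum>i\<in>I. (v i)\<^sup>2))"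

definition eigen_expansion :: "nat \<Rightarrow> (nat \<Rightarrow> real) \<Rightarrow> (nat \<Rightarrow> 'i \<Rightarrow> real) \<Rightarrow> 'i \<times> 'i \<Rightarrow> real" where
  "eigen_expansion m \<nu> w = (\<lambda>(i, j). \<Sum>l=1..m. \<nu> l * w l i * w l j)"

lemma quad_form_eigen_expansion:
  "quad_form I (eigen_expansion m \<nu> w) v = (\<Sum>l=1..m. \<nu> l * (\<Sum>i\<in>I. v i * w l i)\<^sup>2)"
proof -
  have "quad_form I (eigen_expansion m \<nu> w) v = (\<Sum>i\<in>I. \<Sum>j\<in>I. \<Sum>l=1..m. \<nu> l * ((v i * w l i) * (v j * w l j)))"
    by (simp add: quad_form_def eigen_expansion_def sum_distrib_left sum_distrib_right mult_ac)
  also have "\<dots> = (\<Sum>i\<in>I. \<Sum>l=1..m. \<Sum>j\<in>I. \<nu> l * ((v i * w l i) * (v j * w l j)))"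
    by (intro sum.cong refl sum.swap)
  also have "\<dots> = (\<Sum>l=1..m. \<Sum>i\<in>I. \<Sum>j\<in>I. \<nu> l * ((v i * w l i) * (v j * w l j)))"
    by (rule sum.swap)
  also have "\<dots> = (\<Sum>l=1..m. \<nu> l * (\<Sum>i\<in>I. v i * w l i)\<^sup>2)"
  proof (intro sum.cong refl)
    fix l
    have "(\<Sum>i\<in>I. v i * w l i)\<^sup>2 = (\<Sum>i\<in>I. \<Sum>j\<in>I. (v i * w l i) * (v j * w l j))"
      unfolding power2_eq_square by (rule sum_product)
    then show "(\<Sum>i\<in>I. \<Sum>j\<in>I. \<nu> l * ((v i * w l i) * (v j * w l j))) = \<nu> l * (\<Sum>i\<in>I. v i * w l i)\<^sup>2"
      by (simp only: sum_distrib_left)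
  qed
  finally show ?thesis .
qed

lemma frobenius_eigen_expansion:
  "(\<Sum>q\<in>I \<times> I. eigen_expansion m \<nu> w q * C q) = (\<Sum>l=1..m. \<nu> l * quad_form I C (w l))"
proof -
  have "(\<Sum>q\<in>I \<times> I. eigen_expansion m \<nu> w q * C q)
      = (\<Sum>i\<in>I. \<Sum>j\<in>I. \<Sum>l=1..m. \<nu> l * (w l i * C (i, j) * w l j))"
    unfolding sum.cartesian_product' eigen_expansion_def split_conv sum_distrib_right by (simp add: mult_ac)
  also have "\<dots> = (\<Sum>i\<in>I. \<Sum>l=1..m. \<Sum>j\<in>I. \<nu> l * (w l i * C (i, j) * w l j))"
    by (intro sum.cong refl sum.swap)
  also have "\<dots> = (\<Sum>l=1..m. \<Sum>i\<in>I. \<Sum>j\<in>I. \<nu> l * (w l i * C (i, j) * w l j))"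
    by (rule sum.swap)
  finally show ?thesis by (simp add: quad_form_def sum_distrib_left)
qed

lemma quad_form_orthonormal:
  assumes "orthonormal_upto I m w" "l \<in> {1..m}"
  shows "quad_form I (eigen_expansion m \<nu> w) (w l) = \<nu> l"
proof -
  have "quad_form I (eigen_expansion m \<nu> w) (w l) = (\<Sum>l'=1..m. if l' = l then \<nu> l' else 0)"
    unfolding quad_form_eigen_expansion
    using orthonormal_uptoD[OF assms(1) assms(2)] by (intro sum.cong refl) (auto split: if_splits)
  then show ?thesis using assms(2) by simp
qed

lemma orthonormal_parseval:
  assumes I: "finite I" and w: "orthonormal_upto I (card I) w"
  shows "(\<Sum>l=1..card I. (\<Sum>i\<in>I. v i * w l i)\<^sup>2) = (\<Sum>i\<in>I. (v i)\<^sup>2)"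
proof -
  have "(\<Sum>l=1..card I. (\<Sum>i\<in>I. v i * w l i)\<^sup>2) = quad_form I (eigen_expansion (card I) (\<lambda>_. 1) w) v"
    by (simp add: quad_form_eigen_expansion)
  also have "\<dots> = (\<Sum>i\<in>I. \<Sum>j\<in>I. if j = i then v i * v j else 0)"
    unfolding quad_form_def eigen_expansion_def using orthonormal_complete[OF I w]
    by (intro sum.cong refl) simp
  also have "\<dots> = (\<Sum>i\<in>I. (v i)\<^sup>2)" using I by (simp add: power2_eq_square)
  finally show ?thesis .
qed

lemma quad_form_cong: "(\<And>q. q \<in> I \<times> I \<Longrightarrow> S q = S' q) \<Longrightarrow> quad_form I S v = quad_form I S' v"
  unfolding quad_form_def by (intro sum.cong refl) auto

definition clip_spectrum :: "real \<Rightarrow> (nat \<Rightarrow> real) \<Rightarrow> nat \<Rightarrow> real" where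
  "clip_spectrum M0 \<nu> l = max 0 (min M0 (\<nu> l))"

lemma spectrum_within_eigen_expansion:
  assumes "finite I" "orthonormal_upto I (card I) w" "0 \<le> M0"
  shows "spectrum_within I M0 (eigen_expansion (card I) (clip_spectrum M0 \<nu>) w)"
proof -
  have "quad_form I (eigen_expansion (card I) (clip_spectrum M0 \<nu>) w) v \<le> M0 * (\<Sum>i\<in>I. (v i)\<^sup>2)" for v
    unfolding quad_form_eigen_expansion orthonormal_parseval[OF assms(1,2), symmetric] sum_distrib_left
    using assms(3) by (intro sum_mono mult_right_mono) (auto simp: clip_spectrum_def)
  moreover have "0 \<le> quad_form I (eigen_expansion (card I) (clip_spectrum M0 \<nu>) w) v" for v
    unfolding quad_form_eigen_expansion by (auto simp: clip_spectrum_def intro!: sum_nonneg)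
  ultimately show ?thesis unfolding spectrum_within_def by blast
qed

text \<open>The variational characterisation of a projection: in the eigenbasis of
  \<open>A\<close> the inner product is a sum of products of the overshoot of an eigenvalue beyond
  \<open>[0, M\<^sub>0]\<close> with the difference between a point of that interval and the
  endpoint nearest to the eigenvalue.\<close>

lemma clip_obtuse:
  assumes "orthonormal_upto I m w" and C: "spectrum_within I M0 C" and M0: "0 \<le> M0"
    and A: "\<And>q. q \<in> I \<times> I \<Longrightarrow> A q = eigen_expansion m \<nu> w q"
    and B: "\<And>q. q \<in> I \<times> I \<Longrightarrow> B q = eigen_expansion m (clip_spectrum M0 \<nu>) w q"
  shows "(\<Sum>q\<in>I \<times> I. (A q - B q) * (C q - B q)) \<le> 0"
proof -
  let ?d = "\<lambda>l. \<nu> l - clip_spectrum M0 \<nu> l"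
  have "(\<Sum>q\<in>I \<times> I. (A q - B q) * (C q - B q))
      = (\<Sum>q\<in>I \<times> I. eigen_expansion m ?d w q * C q) - (\<Sum>q\<in>I \<times> I. eigen_expansion m ?d w q * B q)"
    unfolding sum_subtractf[symmetric]
    by (intro sum.cong refl) (auto simp: A B eigen_expansion_def left_diff_distrib sum_subtractf algebra_simps)
  also have "\<dots> = (\<Sum>l=1..m. ?d l * (quad_form I C (w l) - clip_spectrum M0 \<nu> l))"
  proof -
    have "quad_form I B (w l) = clip_spectrum M0 \<nu> l" if "l \<in> {1..m}" for l
      using quad_form_orthonormal[OF assms(1) that] quad_form_cong[of I B, OF B] by simp
    then show ?thesis
      unfolding frobenius_eigen_expansion by (simp add: sum_subtractf[symmetric] right_diff_distrib)
  qed
  also have "\<dots> \<le> 0"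
  proof (rule sum_nonpos)
    fix l assume l: "l \<in> {1..m}"
    have "(\<Sum>i\<in>I. (w l i)\<^sup>2) = 1"
      using orthonormal_uptoD[OF assms(1) l l] by (simp add: power2_eq_square)
    then have "0 \<le> quad_form I C (w l)" "quad_form I C (w l) \<le> M0"
      using C unfolding spectrum_within_def by (metis, metis mult.right_neutral)
    then show "?d l * (quad_form I C (w l) - clip_spectrum M0 \<nu> l) \<le> 0"
      using M0 unfolding clip_spectrum_def
      by (cases "\<nu> l < 0"; cases "\<nu> l > M0") (auto simp: mult_le_0_iff)
  qed
  finally show ?thesis .
qed

lemma frobenius_projection_unique:
  assumes F: "finite Q"
    and "(\<Sum>q\<in>Q. (A q - B q) * (B' q - B q)) \<le> (0::real)" "(\<Sum>q\<in>Q. (A q - B' q) * (B q - B' q)) \<le> 0"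
  shows "q \<in> Q \<Longrightarrow> B q = B' q"
proof -
  have "(\<Sum>q\<in>Q. (B q - B' q)\<^sup>2) = (\<Sum>q\<in>Q. (A q - B q) * (B' q - B q)) + (\<Sum>q\<in>Q. (A q - B' q) * (B q - B' q))"
    unfolding sum.distrib[symmetric] by (intro sum.cong refl) (simp add: power2_eq_square algebra_simps)
  then have "(\<Sum>q\<in>Q. (B q - B' q)\<^sup>2) = 0" using assms(2,3) sum_nonneg[of Q "\<lambda>q. (B q - B' q)\<^sup>2"] by simp
  then show "q \<in> Q \<Longrightarrow> B q = B' q" using F by (simp add: sum_nonneg_eq_0_iff)
qed

text \<open>The definite description is meaningful: any two clipped matrices obtained from
  eigendecompositions of \<open>A\<close> satisfy the variational inequality against each other,
  so they coincide.\<close>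

lemma spectral_clip_eq:
  assumes M0: "0 \<le> M0" and w: "orthonormal_upto {1..p} p w"
    and A: "\<And>i j. i \<in> {1..p} \<Longrightarrow> j \<in> {1..p} \<Longrightarrow> A (i, j) = eigen_expansion p \<nu> w (i, j)"
  shows "spectral_clip p M0 A = restrict (eigen_expansion p (clip_spectrum M0 \<nu>) w) ({1..p} \<times> {1..p})"
proof -
  define is_clip where "is_clip B \<longleftrightarrow> (\<exists>(\<nu> :: nat \<Rightarrow> real) (w :: nat \<Rightarrow> nat \<Rightarrow> real).
     (\<forall>l\<in>{1..p}. \<forall>l'\<in>{1..p}. (\<Sum>i=1..p. w l i * w l' i) = (if l = l' then 1 else 0)) \<and>
     (\<forall>i\<in>{1..p}. \<forall>j\<in>{1..p}. A (i, j) = (\<Sum>l=1..p. \<nu> l * w l i * w l j)) \<and>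
     B = (\<lambda>(i, j)\<in>{1..p} \<times> {1..p}. \<Sum>l=1..p. max 0 (min M0 (\<nu> l)) * w l i * w l j))" for B
  have is_clip: "is_clip B \<longleftrightarrow> (\<exists>\<nu> w. orthonormal_upto {1..p} p w \<and>
     (\<forall>i\<in>{1..p}. \<forall>j\<in>{1..p}. A (i, j) = eigen_expansion p \<nu> w (i, j)) \<and>
     B = restrict (eigen_expansion p (clip_spectrum M0 \<nu>) w) ({1..p} \<times> {1..p}))" for B
    unfolding is_clip_def orthonormal_upto_def eigen_expansion_def clip_spectrum_def
    by (simp add: split_beta')
  have "(THE B. is_clip B) = restrict (eigen_expansion p (clip_spectrum M0 \<nu>) w) ({1..p} \<times> {1..p})"
  proof (rule the_equality)
    show "is_clip (restrict (eigen_expansion p (clip_spectrum M0 \<nu>) w) ({1..p} \<times> {1..p}))"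
      unfolding is_clip using w A by auto
    fix B assume "is_clip B"
    then obtain \<nu>' w' where B: "orthonormal_upto {1..p} p w'"
      "\<And>i j. i \<in> {1..p} \<Longrightarrow> j \<in> {1..p} \<Longrightarrow> A (i, j) = eigen_expansion p \<nu>' w' (i, j)"
      "B = restrict (eigen_expansion p (clip_spectrum M0 \<nu>') w') ({1..p} \<times> {1..p})"
      unfolding is_clip by blast
    let ?B = "eigen_expansion p (clip_spectrum M0 \<nu>) w" and ?B' = "eigen_expansion p (clip_spectrum M0 \<nu>') w'"
    have "?B q = ?B' q" if "q \<in> {1..p} \<times> {1..p}" for q
    proof (rule frobenius_projection_unique[OF _ _ _ that])
      show "(\<Sum>q\<in>{1..p} \<times> {1..p}. (A q - ?B q) * (?B' q - ?B q)) \<le> 0"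
        using A B spectrum_within_eigen_expansion[of "{1..p}" w' M0 \<nu>'] M0
        by (intro clip_obtuse[OF w, where ?M0.0 = M0]) auto
      show "(\<Sum>q\<in>{1..p} \<times> {1..p}. (A q - ?B' q) * (?B q - ?B' q)) \<le> 0"
        using A B spectrum_within_eigen_expansion[of "{1..p}" w M0 \<nu>] M0 w
        by (intro clip_obtuse[OF B(1), where ?M0.0 = M0]) auto
    qed auto
    then show "B = restrict ?B ({1..p} \<times> {1..p})" unfolding B(3) by (intro restrict_ext) simp
  qed
  then show ?thesis unfolding is_clip_def spectral_clip_def .
qed

lemma spectral_clip_props:
  assumes M0: "0 \<le> M0" and sym: "\<And>i j. i \<in> {1..p} \<Longrightarrow> j \<in> {1..p} \<Longrightarrow> A (i, j) = A (j, i)"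
  shows "spectrum_within {1..p} M0 (spectral_clip p M0 A)"
    and "spectrum_within {1..p} M0 C \<Longrightarrow>
      (\<Sum>q\<in>{1..p} \<times> {1..p}. (A q - spectral_clip p M0 A q) * (C q - spectral_clip p M0 A q)) \<le> 0"
    and "(\<Sum>q\<in>{1..p} \<times> {1..p}. (spectral_clip p M0 A q)\<^sup>2) \<le> real p * M0\<^sup>2"
proof -
  obtain \<nu> w where w: "orthonormal_upto {1..p} (card {1..p}) w"
    and A: "\<And>i j. i \<in> {1..p} \<Longrightarrow> j \<in> {1..p} \<Longrightarrow> A (i, j) = (\<Sum>l=1..card {1..p}. \<nu> l * w l i * w l j)"
    by (rule spectral_decomposition[where A = A and I = "{1..p}", OF _ sym]) auto
  have w: "orthonormal_upto {1..p} p w" using w by simp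
  have A: "A (i, j) = eigen_expansion p \<nu> w (i, j)" if "i \<in> {1..p}" "j \<in> {1..p}" for i j
    using A[OF that] by (simp add: eigen_expansion_def)
  let ?B = "eigen_expansion p (clip_spectrum M0 \<nu>) w"
  have eq: "spectral_clip p M0 A q = ?B q" if "q \<in> {1..p} \<times> {1..p}" for q
  proof -
    have "spectral_clip p M0 A = restrict ?B ({1..p} \<times> {1..p})" by (rule spectral_clip_eq[OF M0 w A])
    then show ?thesis using that by (simp only: restrict_apply')
  qed
  have within: "spectrum_within {1..p} M0 ?B"
    using spectrum_within_eigen_expansion[of "{1..p}" w M0 \<nu>] w M0 by simp
  show "spectrum_within {1..p} M0 (spectral_clip p M0 A)"
    using within quad_form_cong[of "{1..p}" "spectral_clip p M0 A" ?B, OF eq] unfolding spectrum_within_def by simp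
  show "(\<Sum>q\<in>{1..p} \<times> {1..p}. (A q - spectral_clip p M0 A q) * (C q - spectral_clip p M0 A q)) \<le> 0"
    if "spectrum_within {1..p} M0 C"
    using A by (intro clip_obtuse[OF w that M0 _ eq]) auto
  have "(\<Sum>q\<in>{1..p} \<times> {1..p}. (spectral_clip p M0 A q)\<^sup>2) = (\<Sum>q\<in>{1..p} \<times> {1..p}. ?B q * ?B q)"
    using eq by (intro sum.cong refl) (simp add: power2_eq_square)
  also have "\<dots> = (\<Sum>l=1..p. clip_spectrum M0 \<nu> l * clip_spectrum M0 \<nu> l)"
    unfolding frobenius_eigen_expansion using quad_form_orthonormal[OF w] by (intro sum.cong refl) simp
  also have "\<dots> \<le> (\<Sum>l=1..p. M0 * M0)"
    using M0 by (intro sum_mono mult_mono) (auto simp: clip_spectrum_def)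
  finally show "(\<Sum>q\<in>{1..p} \<times> {1..p}. (spectral_clip p M0 A q)\<^sup>2) \<le> real p * M0\<^sup>2"
    by (simp add: power2_eq_square)
qed

lemma obtuse_distance_le:
  assumes "(\<Sum>q\<in>Q. (A q - B q) * (C q - B q)) \<le> (0::real)"
  shows "(\<Sum>q\<in>Q. (B q - C q)\<^sup>2) \<le> (\<Sum>q\<in>Q. (A q - C q)\<^sup>2)"
proof -
  have "(\<Sum>q\<in>Q. (A q - C q)\<^sup>2) = (\<Sum>q\<in>Q. (A q - B q)\<^sup>2) + (\<Sum>q\<in>Q. (B q - C q)\<^sup>2) - 2 * (\<Sum>q\<in>Q. (A q - B q) * (C q - B q))"
    unfolding sum.distrib[symmetric] sum_distrib_left sum_subtractf[symmetric]
    by (intro sum.cong refl) (simp add: power2_eq_square algebra_simps)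
  then show ?thesis using assms sum_nonneg[of Q "\<lambda>q. (A q - B q)\<^sup>2"] by simp
qed

text \<open>Projecting onto the matrices with spectrum in \<open>[0, M\<^sub>0]\<close> does not
  increase the distance to any of them; in particular not to the true covariance.\<close>

lemma spectral_clip_contracts:
  assumes "0 \<le> M0" "\<And>i j. i \<in> {1..p} \<Longrightarrow> j \<in> {1..p} \<Longrightarrow> A (i, j) = A (j, i)" "spectrum_within {1..p} M0 C"
  shows "(\<Sum>q\<in>{1..p} \<times> {1..p}. (spectral_clip p M0 A q - C q)\<^sup>2) \<le> (\<Sum>q\<in>{1..p} \<times> {1..p}. (A q - C q)\<^sup>2)"
  by (intro obtuse_distance_le spectral_clip_props(2) assms)

text \<open>A matrix with spectrum in \<open>[0, M\<^sub>0]\<close> equals its own clip, whose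
  squared norm is a sum of \<open>p\<close> squared eigenvalues.\<close>

lemma frobenius_spectrum_within:
  assumes "0 \<le> M0" "\<And>i j. i \<in> {1..p} \<Longrightarrow> j \<in> {1..p} \<Longrightarrow> C (i, j) = C (j, i)" "spectrum_within {1..p} M0 C"
  shows "(\<Sum>q\<in>{1..p} \<times> {1..p}. (C q)\<^sup>2) \<le> real p * M0\<^sup>2"
proof -
  have "(\<Sum>q\<in>{1..p} \<times> {1..p}. (spectral_clip p M0 C q - C q)\<^sup>2) \<le> 0"
    using spectral_clip_contracts[where A = C and C = C, OF assms(1,2,3)] by simp
  then have "(\<Sum>q\<in>{1..p} \<times> {1..p}. (spectral_clip p M0 C q - C q)\<^sup>2) = 0"
    by (intro antisym sum_nonneg) auto
  then have "spectral_clip p M0 C q = C q" if "q \<in> {1..p} \<times> {1..p}" for q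
    using that by (cases q) (simp add: sum_nonneg_eq_0_iff)
  then show ?thesis using spectral_clip_props(3)[of M0 p C] assms by (simp cong: sum.cong)
qed

lemma spectral_clip_nonexpansive:
  assumes "0 \<le> M0" "\<And>i j. i \<in> {1..p} \<Longrightarrow> j \<in> {1..p} \<Longrightarrow> A (i, j) = A (j, i)"
    "\<And>i j. i \<in> {1..p} \<Longrightarrow> j \<in> {1..p} \<Longrightarrow> A' (i, j) = A' (j, i)"
  shows "(\<Sum>q\<in>{1..p} \<times> {1..p}. (spectral_clip p M0 A q - spectral_clip p M0 A' q)\<^sup>2)
    \<le> (\<Sum>q\<in>{1..p} \<times> {1..p}. (A q - A' q)\<^sup>2)"
proof -
  let ?B = "spectral_clip p M0 A" and ?B' = "spectral_clip p M0 A'" and ?Q = "{1..p} \<times> {1..p}"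
  have 1: "(\<Sum>q\<in>?Q. (A q - ?B q) * (?B' q - ?B q)) \<le> 0"
    by (intro spectral_clip_props(2) spectral_clip_props(1) assms)
  have 2: "(\<Sum>q\<in>?Q. (A' q - ?B' q) * (?B q - ?B' q)) \<le> 0"
    by (intro spectral_clip_props(2) spectral_clip_props(1) assms)
  have "(\<Sum>q\<in>?Q. (A q - A' q)\<^sup>2) - (\<Sum>q\<in>?Q. (?B q - ?B' q)\<^sup>2)
      = (\<Sum>q\<in>?Q. (A q - A' q - (?B q - ?B' q))\<^sup>2) - 2 * (\<Sum>q\<in>?Q. (A q - ?B q) * (?B' q - ?B q))
        - 2 * (\<Sum>q\<in>?Q. (A' q - ?B' q) * (?B q - ?B' q))"
    unfolding sum_distrib_left sum_subtractf[symmetric]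
    by (intro sum.cong refl) (simp add: power2_eq_square algebra_simps)
  then show ?thesis using 1 2 sum_nonneg[of ?Q "\<lambda>q. (A q - A' q - (?B q - ?B' q))\<^sup>2"] by simp
qed

text \<open>The clip is nonexpansive, hence continuous on symmetric matrices. Precomposing with
  symmetrisation makes it continuous on all real functions of index pairs, where measurability can
  be checked coordinatewise.\<close>

lemma measurable_spectral_clip:
  assumes M0: "0 \<le> M0" and F: "\<And>q. q \<in> {1..p} \<times> {1..p} \<Longrightarrow> (\<lambda>x. F x q) \<in> borel_measurable M"
    and sym: "\<And>x i j. F x (i, j) = F x (j, i)" and q: "q \<in> {1..p} \<times> {1..p}"
  shows "(\<lambda>x. spectral_clip p M0 (F x) q) \<in> borel_measurable M"
proof -
  let ?Q = "{1..p} \<times> {1..p}"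
  (* Averaging with the transpose, which changes nothing on symmetric arguments. *)
  define sy where "sy a = (\<lambda>(i, j). (a (i, j) + a (j, i)) / 2)" for a :: "nat \<times> nat \<Rightarrow> real"
  have sy: "sy a (i, j) = sy a (j, i)" for a i j by (simp add: sy_def add.commute)
  have coord: "continuous_on UNIV (\<lambda>a :: nat \<times> nat \<Rightarrow> real. a q)" for q by simp
  have cont_sy: "continuous_on UNIV (\<lambda>a. sy a q)" for q
    unfolding sy_def split_beta' by (intro continuous_intros coord) auto
  let ?g = "\<lambda>a. spectral_clip p M0 (sy a) q"
  have "isCont ?g a" for a
    unfolding isCont_def
  proof (rule tendstoI)
    fix e :: real assume e: "0 < e"
    have "((\<lambda>x. \<Sum>q\<in>?Q. (sy x q - sy a q)\<^sup>2) \<longlongrightarrow> (\<Sum>q\<in>?Q. (sy a q - sy a q)\<^sup>2)) (at a)"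
      using cont_sy by (intro tendsto_intros) (simp add: continuous_on_def)
    then have "\<forall>\<^sub>F x in at a. (\<Sum>q\<in>?Q. (sy x q - sy a q)\<^sup>2) < e\<^sup>2"
      using e by (intro order_tendstoD(2)[where a = "e\<^sup>2"]) auto
    then show "\<forall>\<^sub>F x in at a. dist (?g x) (?g a) < e"
    proof eventually_elim
      case (elim x)
      have "(?g x - ?g a)\<^sup>2 \<le> (\<Sum>q\<in>?Q. (spectral_clip p M0 (sy x) q - spectral_clip p M0 (sy a) q)\<^sup>2)"
        by (rule member_le_sum[of q ?Q "\<lambda>q. (spectral_clip p M0 (sy x) q - spectral_clip p M0 (sy a) q)\<^sup>2"]) (use q in auto)
      also have "\<dots> \<le> (\<Sum>q\<in>?Q. (sy x q - sy a q)\<^sup>2)"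
        by (intro spectral_clip_nonexpansive M0 sy)
      also have "\<dots> < e\<^sup>2" by fact
      finally show ?case using e power2_less_imp_less[of "\<bar>?g x - ?g a\<bar>" e] by (simp add: dist_real_def)
    qed
  qed
  then have "?g \<in> borel_measurable borel"
    by (intro borel_measurable_continuous_onI) (auto simp: continuous_on_eq_continuous_at)
  moreover have "(\<lambda>x. \<lambda>q. if q \<in> ?Q then F x q else 0) \<in> measurable M borel"
  proof (rule measurable_coordinatewise_then_product)
    show "(\<lambda>x. if q \<in> ?Q then F x q else 0) \<in> borel_measurable M" for q
      by (cases "q \<in> ?Q") (use F in simp_all)
  qed
  ultimately have "(\<lambda>x. ?g (\<lambda>q. if q \<in> ?Q then F x q else 0)) \<in> borel_measurable M"
    by (rule measurable_compose[rotated])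
  also have "(\<lambda>x. ?g (\<lambda>q. if q \<in> ?Q then F x q else 0)) = (\<lambda>x. spectral_clip p M0 (F x) q)"
  proof
    fix x
    have "sy (\<lambda>q. if q \<in> ?Q then F x q else 0) (i, j) = F x (i, j)" if "i \<in> {1..p}" "j \<in> {1..p}" for i j
      using that sym[of x j i] by (simp add: sy_def)
    then show "?g (\<lambda>q. if q \<in> ?Q then F x q else 0) = spectral_clip p M0 (F x) q"
      unfolding spectral_clip_def by simp
  qed
  finally show ?thesis .
qed

section \<open>Measurability and privacy of the estimator\<close>

text \<open>Rectangles generate the product sigma-algebra, and on a rectangle a finite product of
  kernels is a finite product of measurable functions.\<close>

lemma measurable_PiM_kernel:
  assumes I: "finite I" and K: "\<And>i. i \<in> I \<Longrightarrow> K i \<in> M \<rightarrow>\<^sub>M prob_algebra (N i)"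
  shows "(\<lambda>x. PiM I (\<lambda>i. K i x)) \<in> M \<rightarrow>\<^sub>M prob_algebra (PiM I N)"
proof (rule measurable_prob_algebra_generated[OF sets_PiM Int_stable_prod_algebra prod_algebra_sets_into_space])
  have K1: "prob_space (K i x)" "sets (K i x) = sets (N i)" if "i \<in> I" "x \<in> space M" for i x
    using measurable_space[OF K[OF that(1)] that(2)] by (auto simp: space_prob_algebra)
  show "prob_space (PiM I (\<lambda>i. K i x))" "sets (PiM I (\<lambda>i. K i x)) = sets (PiM I N)" if "x \<in> space M" for x
    using K1[OF _ that] by (auto intro!: prob_space_PiM sets_PiM_cong)
  fix A assume "A \<in> prod_algebra I N"
  then obtain X where A: "A = PiE I X" and X: "\<And>i. i \<in> I \<Longrightarrow> X i \<in> sets (N i)"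
    unfolding prod_algebra_eq_finite[OF I] by blast
  have "emeasure (PiM I (\<lambda>i. K i x)) A = (\<Prod>i\<in>I. emeasure (K i x) (X i))" if x: "x \<in> space M" for x
  proof -
    define K' where "K' i = (if i \<in> I then K i x else return (count_space UNIV) undefined)" for i
    have "prob_space (K' i)" for i using K1[OF _ x] by (auto simp: K'_def intro: prob_space_return)
    then interpret product_prob_space K' I by (rule product_prob_spaceI)
    have "PiM I (\<lambda>i. K i x) = PiM I K'" by (intro PiM_cong) (auto simp: K'_def)
    then show ?thesis
      unfolding A using I X K1(2)[OF _ x] by (subst (1) \<open>PiM I (\<lambda>i. K i x) = PiM I K'\<close>, subst emeasure_PiM)
        (auto simp: K'_def intro!: prod.cong)
  qed
  moreover have "(\<lambda>x. \<Prod>i\<in>I. emeasure (K i x) (X i)) \<in> borel_measurable M"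
    using K X by (intro borel_measurable_prod_ennreal emeasure_measurable_subprob_algebra2[where N = "N _"])
      (auto intro: measurable_prob_algebraD)
  ultimately show "(\<lambda>x. emeasure (PiM I (\<lambda>i. K i x)) A) \<in> borel_measurable M"
    by (subst measurable_cong) auto
qed

lemma measure_pmf_finite_support:
  assumes "finite Q" "set_pmf q \<subseteq> Q"
  shows "measure (measure_pmf q) B = (\<Sum>c\<in>Q. pmf q c * indicator B c)"
proof -
  have "measure (measure_pmf q) B = (\<integral>c. indicator B c \<partial>measure_pmf q)" by simp
  also have "\<dots> = (\<Sum>c\<in>Q. pmf q c *\<^sub>R indicator B c)"
    using assms by (intro integral_measure_pmf) auto
  finally show ?thesis by simp
qed

lemma measurable_pmf_exp_mechanism:
  assumes "finite Q" "Q \<noteq> {}" and [measurable]: "\<And>c. c \<in> Q \<Longrightarrow> (\<lambda>x. s x c) \<in> borel_measurable M"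
  shows "(\<lambda>x. pmf (exp_mechanism \<epsilon> \<Delta> Q (s x)) c) \<in> borel_measurable M"
  unfolding pmf_exp_mechanism[OF assms(1,2)] by (cases "c \<in> Q") auto

text \<open>The probabilities are computed from the scores by finitely many sums, products and
  quotients.\<close>

lemma measurable_pmf_peel_select:
  assumes Q: "finite Q" and [measurable]: "\<And>c. c \<in> Q \<Longrightarrow> (\<lambda>x. s x c) \<in> borel_measurable M"
    and m: "m \<le> card Q"
  shows "(\<lambda>x. pmf (peel_select \<epsilon> \<Delta> Q (s x) m) S) \<in> borel_measurable M"
  using m
proof (induction m arbitrary: S)
  case (Suc m)
  define \<S> where "\<S> = {S. S \<subseteq> Q \<and> card S = m}"
  have fin: "finite \<S>" using Q by (auto simp: \<S>_def)
  have sub: "set_pmf (peel_select \<epsilon> \<Delta> Q (s x) m) \<subseteq> \<S>" for x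
    using set_pmf_peel_select[OF Q, of m] Suc.prems unfolding \<S>_def by simp
  have ne: "Q - T \<noteq> {}" if "T \<in> \<S>" for T
    using that Diff_nonempty_if_card_less[of T Q] finite_subset[OF _ Q] Suc.prems by (simp add: \<S>_def)
  have step: "pmf (map_pmf (\<lambda>c. insert c T) (exp_mechanism \<epsilon> \<Delta> (Q - T) (s x))) S
      = (\<Sum>c\<in>Q - T. pmf (exp_mechanism \<epsilon> \<Delta> (Q - T) (s x)) c * indicator {c. insert c T = S} c)"
    if "T \<in> \<S>" for T x
    unfolding pmf_map using Q ne[OF that]
    by (subst measure_pmf_finite_support[of "Q - T"]) (auto simp: set_pmf_exp_mechanism vimage_def)
  have "pmf (peel_select \<epsilon> \<Delta> Q (s x) (Suc m)) S = (\<Sum>T\<in>\<S>. pmf (peel_select \<epsilon> \<Delta> Q (s x) m) T *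
      (\<Sum>c\<in>Q - T. pmf (exp_mechanism \<epsilon> \<Delta> (Q - T) (s x)) c * indicator {c. insert c T = S} c))" for x
    unfolding peel_select.simps pmf_bind using sub fin step
    by (subst integral_measure_pmf[OF fin]) auto
  moreover have "(\<lambda>x. \<Sum>T\<in>\<S>. pmf (peel_select \<epsilon> \<Delta> Q (s x) m) T *
      (\<Sum>c\<in>Q - T. pmf (exp_mechanism \<epsilon> \<Delta> (Q - T) (s x)) c * indicator {c. insert c T = S} c)) \<in> borel_measurable M"
    using Suc ne Q by (intro borel_measurable_sum borel_measurable_times measurable_pmf_exp_mechanism) auto
  ultimately show ?case by (simp del: peel_select.simps)
qed simp

lemma measurable_peel_select:
  assumes Q: "finite Q" and s: "\<And>c. c \<in> Q \<Longrightarrow> (\<lambda>x. s x c) \<in> borel_measurable M" and m: "m \<le> card Q"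
  shows "(\<lambda>x. measure_pmf (peel_select \<epsilon> \<Delta> Q (s x) m)) \<in> M \<rightarrow>\<^sub>M prob_algebra (count_space UNIV)"
proof (rule measurable_prob_algebraI)
  show "(\<lambda>x. measure_pmf (peel_select \<epsilon> \<Delta> Q (s x) m)) \<in> M \<rightarrow>\<^sub>M subprob_algebra (count_space UNIV)"
  proof (rule measurable_subprob_algebra)
    fix A :: "'a set set"
    have "measure (measure_pmf (peel_select \<epsilon> \<Delta> Q (s x) m)) A
        = (\<Sum>S\<in>Pow Q. pmf (peel_select \<epsilon> \<Delta> Q (s x) m) S * indicator A S)" for x
      using set_pmf_peel_select[OF Q m, of \<epsilon> \<Delta> "s x"] Q
      by (intro measure_pmf_finite_support) auto
    moreover have "(\<lambda>x. \<Sum>S\<in>Pow Q. pmf (peel_select \<epsilon> \<Delta> Q (s x) m) S * indicator A S) \<in> borel_measurable M"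
      by (intro borel_measurable_sum borel_measurable_times measurable_pmf_peel_select Q s m) auto
    ultimately show "(\<lambda>x. emeasure (measure_pmf (peel_select \<epsilon> \<Delta> Q (s x) m)) A) \<in> borel_measurable M"
      by (simp add: measure_pmf.emeasure_eq_measure)
  qed (auto intro: prob_space_imp_subprob_space measure_pmf.prob_space_axioms)
qed (rule measure_pmf.prob_space_axioms)

lemma measurable_peel_release:
  assumes IJ: "finite I" "finite J" "card I = k" "card J = k" "1 \<le> k"
    and Y[measurable]: "\<And>i u. i \<in> {1..n} \<Longrightarrow> u \<in> I \<union> J \<Longrightarrow> (\<lambda>x. Y x i u) \<in> borel_measurable M"
  shows "(\<lambda>x. peel_release n L (Y x) I J a \<rho>B) \<in> M \<rightarrow>\<^sub>M prob_algebra (PiM (I \<times> J) (\<lambda>_. borel))"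
proof -
  define r where "r = arg_min (peel_objective n k a \<rho>B) (\<lambda>r. 1 \<le> r \<and> r \<le> k)"
  have r: "1 \<le> r" "r \<le> k" using arg_min_peel_objective[OF IJ(5)] by (auto simp: r_def)
  then have kr: "k * r \<le> card (I \<times> J)" using IJ by (simp add: card_cartesian_product)
  define A where "A x = (\<lambda>(u, v). (\<Sum>i=1..n. sclip L (Y x i u * Y x i v)) / real n)" for x
  have A[measurable]: "(\<lambda>x. A x q) \<in> borel_measurable M" if "q \<in> I \<times> J" for q
    using that unfolding A_def sclip_def by auto
  have sel: "(\<lambda>x. measure_pmf (peel_select \<epsilon> \<Delta> (I \<times> J) (\<lambda>q. \<bar>A x q\<bar>) (k * r))) \<in> M \<rightarrow>\<^sub>M prob_algebra (count_space UNIV)" for \<epsilon> \<Delta>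
    using IJ kr by (intro measurable_peel_select) auto
  have G: "(\<lambda>x. PiM (I \<times> J) (\<lambda>_. std_normal_distribution)) \<in> M \<rightarrow>\<^sub>M prob_algebra (PiM (I \<times> J) (\<lambda>_. std_normal_distribution))"
    by (intro measurable_const) (simp add: space_prob_algebra prob_space_PiM_std_normal)
  have [measurable]: "Measurable.pred (M \<Otimes>\<^sub>M (count_space UNIV \<Otimes>\<^sub>M PiM (I \<times> J) (\<lambda>_. borel :: real measure))) (\<lambda>x. q \<in> fst (snd x))" for q :: "nat \<times> nat"
    by (rule measurable_compose[OF measurable_compose[OF measurable_snd measurable_fst]]) simp
  show ?thesis
    unfolding peel_release_def Let_def IJ(3) r_def[symmetric] A_def[symmetric]
    by (intro measurable_distr_prob_space2[OF measurable_pair_prob[OF sel G]]) (unfold split_beta', measurable)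
qed

lemma measurable_vclip:
  assumes "finite I" and [measurable]: "\<And>u. u \<in> I \<Longrightarrow> (\<lambda>x. f x u) \<in> borel_measurable M" and u: "u \<in> I"
  shows "(\<lambda>x. vclip I R (f x) u) \<in> borel_measurable M"
  using u unfolding vclip_def L2_set_def by measurable

lemma measurable_dp_cov_block:
  assumes IJ: "finite I" "finite J" "I \<subseteq> {1..p}" "J \<subseteq> {1..p}"
    and Y: "\<And>i u. i \<in> {1..n} \<Longrightarrow> u \<in> I \<union> J \<Longrightarrow> (\<lambda>x. Y x i u) \<in> borel_measurable M"
  shows "(\<lambda>x. dp_cov_block n p (Y x) I J \<rho>B R) \<in> M \<rightarrow>\<^sub>M prob_algebra (PiM (I \<times> J) (\<lambda>_. borel))"
proof -
  define U where "U = {(u, v). 1 \<le> u \<and> u \<le> v \<and> v \<le> p}"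
  have U: "(min u v, max u v) \<in> U" if "u \<in> I" "v \<in> J" for u v
    using that IJ by (fastforce simp: U_def min_def max_def)
  have G: "(\<lambda>x. PiM U (\<lambda>_. std_normal_distribution)) \<in> M \<rightarrow>\<^sub>M prob_algebra (PiM U (\<lambda>_. std_normal_distribution))"
    by (intro measurable_const) (simp add: space_prob_algebra prob_space_PiM_std_normal)
  have vI[measurable]: "(\<lambda>x. vclip I R (Y x i) u) \<in> borel_measurable M" if "i \<in> {1..n}" "u \<in> I" for i u
    using that by (intro measurable_vclip IJ Y) auto
  have vJ[measurable]: "(\<lambda>x. vclip J R (Y x i) u) \<in> borel_measurable M" if "i \<in> {1..n}" "u \<in> J" for i u
    using that by (intro measurable_vclip IJ Y) auto
  show ?thesis
    unfolding dp_cov_block_def U_def[symmetric]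
  proof (intro measurable_distr_prob_space2[OF G])
    show "(\<lambda>(x, g). \<lambda>(u, v)\<in>I \<times> J. (\<Sum>i=1..n. vclip I R (Y x i) u * vclip J R (Y x i) v) / real n
          + sqrt (18 * R ^ 4 / (\<rho>B * (real n)\<^sup>2)) * g (min u v, max u v))
        \<in> M \<Otimes>\<^sub>M PiM U (\<lambda>_. std_normal_distribution) \<rightarrow>\<^sub>M PiM (I \<times> J) (\<lambda>_. borel)"
      unfolding split_beta'
    proof (intro measurable_restrict)
      fix q assume q: "q \<in> I \<times> J"
      then have [measurable]: "(\<lambda>g. g (min (fst q) (snd q), max (fst q) (snd q)))
          \<in> PiM U (\<lambda>_. std_normal_distribution) \<rightarrow>\<^sub>M borel"
        using measurable_component_singleton[OF U, of "fst q" "snd q" "\<lambda>_. std_normal_distribution"] by auto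
      have [measurable]: "fst q \<in> I" "snd q \<in> J" using q by auto
      show "(\<lambda>x. (\<Sum>i=1..n. vclip I R (Y (fst x) i) (fst q) * vclip J R (Y (fst x) i) (snd q)) / real n
          + sqrt (18 * R ^ 4 / (\<rho>B * (real n)\<^sup>2)) * snd x (min (fst q) (snd q), max (fst q) (snd q)))
          \<in> borel_measurable (M \<Otimes>\<^sub>M PiM U (\<lambda>_. std_normal_distribution))"
        by (intro borel_measurable_add borel_measurable_divide borel_measurable_sum borel_measurable_times borel_measurable_const
            measurable_compose[OF measurable_fst vI] measurable_compose[OF measurable_fst vJ])
          measurable
    qed
  qed
qed

context center_outer
begin

lemma p_bounds:
  assumes "1 \<le> d"
  shows "d \<le> p" "p \<le> 2 * d" "0 < p"
proof -
  have l0: "0 \<le> log 2 (real d)" using assms by simp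
  have c: "log 2 (real d) \<le> real (nat \<lceil>log 2 (real d)\<rceil>)" "real (nat \<lceil>log 2 (real d)\<rceil>) < log 2 (real d) + 1"
    using l0 by linarith+
  have pr: "real p = 2 powr real (nat \<lceil>log 2 (real d)\<rceil>)" by (simp add: p_def powr_realpow)
  have "real d = 2 powr log 2 (real d)" using assms by simp
  also have "\<dots> \<le> real p" unfolding pr using c by simp
  finally show "d \<le> p" by simp
  have "real p \<le> 2 powr (log 2 (real d) + 1)" unfolding pr using c by simp
  also have "\<dots> = 2 * real d" using assms by (simp add: powr_add)
  finally show "p \<le> 2 * d" by linarith
  show "0 < p" by (simp add: p_def)
qed

definition lg :: nat where "lg = nat \<lceil>log 2 (real d)\<rceil>"

lemma p_lg: "p = 2 ^ lg" by (simp add: p_def lg_def)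

text \<open>The scales run from \<open>1\<close> to \<open>p/4\<close>; there are \<open>lg - 1 =
  J_sq\<close> of them, which is the number by which the budget is divided.\<close>

lemma scales_eq: "scales = (\<lambda>s. 2 ^ s) ` {s. s + 2 \<le> lg}"
proof -
  have "4 * 2 ^ s \<le> p \<longleftrightarrow> s + 2 \<le> lg" for s
  proof -
    have "4 * 2 ^ s \<le> p \<longleftrightarrow> (2 :: nat) ^ (s + 2) \<le> 2 ^ lg" by (simp add: p_lg power_add)
    also have "\<dots> \<longleftrightarrow> s + 2 \<le> lg" by (rule power_increasing_iff) simp
    finally show ?thesis .
  qed
  then show ?thesis unfolding scales_def by auto
qed

lemma finite_scales: "finite scales"
  unfolding scales_eq by (intro finite_imageI finite_subset[of "{s. s + 2 \<le> lg}" "{..lg}"]) auto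

lemma card_scales: "card scales = lg - 1"
proof -
  have "card scales = card {s. s + 2 \<le> lg}" unfolding scales_eq
    by (intro card_image) (auto simp: inj_on_def)
  also have "{s. s + 2 \<le> lg} = {..<lg - 1}" by auto
  finally show ?thesis by simp
qed

lemma J_sq_eq: "J_sq = real lg - 1" by (simp add: J_sq_def p_lg log_nat_power)

lemma scalesE:
  assumes "k \<in> scales"
  obtains "1 \<le> k" "2 * k * N (2 * k) = p" "4 * k \<le> p"
proof -
  obtain s where s: "k = 2 ^ s" "s + 2 \<le> lg" using assms unfolding scales_eq by auto
  then have "p = 2 * k * 2 ^ (lg - s - 1)" unfolding p_lg by (simp add: power_Suc[symmetric] power_add[symmetric] del: power_Suc)
  then have "2 * k * N (2 * k) = p" by (simp add: N_def s)
  moreover have "4 * k \<le> p" using assms by (auto simp: scales_def)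
  ultimately show ?thesis using s that by simp
qed

lemma outer_labelsE:
  assumes "k \<in> scales" "(l, r) \<in> outer_labels k"
  obtains "1 \<le> l" "2 \<le> r" "(l + r) * k \<le> p"
proof -
  obtain m where m: "1 \<le> m" "m < N (2 * k)"
    "(l, r) = (2 * m - 1, 2) \<or> (l, r) = (2 * m - 1, 3) \<or> (l, r) = (2 * m, 2)"
    using assms(2) unfolding outer_labels_def by auto
  have "l + r \<le> 2 * N (2 * k)" using m by auto
  then have "(l + r) * k \<le> 2 * N (2 * k) * k" by simp
  also have "\<dots> = p" using scalesE[OF assms(1)] by (metis mult.assoc mult.commute)
  finally show ?thesis using m by (intro that) auto
qed

lemma finite_outer_labels: "finite (outer_labels k)" by (simp add: outer_labels_def)

lemma card_outer_labels: "card (outer_labels k) \<le> 3 * N (2 * k)"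
proof -
  have "card (outer_labels k) \<le> (\<Sum>l\<in>{1..<N (2 * k)}. card {(2 * l - 1, 2), (2 * l - 1, 3), (2 * l, 2 :: nat)})"
    unfolding outer_labels_def by (rule card_UN_le) simp
  also have "\<dots> \<le> (\<Sum>l\<in>{1..<N (2 * k)}. 3)" by (intro sum_mono) (simp add: card_insert_if)
  also have "\<dots> \<le> 3 * N (2 * k)" by simp
  finally show ?thesis .
qed

lemma finite_center_labels: "finite center_labels"
  by (rule finite_subset[of _ "{..p} \<times> {0, 1}"]) (auto simp: center_labels_def)

lemma card_center_labels: "card center_labels \<le> 2 * p"
proof -
  have "card center_labels \<le> card ({1..p} \<times> {0, 1 :: nat})"
    by (rule card_mono) (auto simp: center_labels_def)
  then show ?thesis by (simp add: card_cartesian_product)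
qed

lemma outer_index_eq: "outer_index = Sigma scales (\<lambda>k. outer_labels k \<times> {..J k})"
  by (auto simp: outer_index_def)

lemma finite_outer_index: "finite outer_index"
  unfolding outer_index_eq by (intro finite_SigmaI finite_scales finite_cartesian_product finite_outer_labels) auto

lemma card_Idx: "1 \<le> l \<Longrightarrow> card (Idx k l) = k"
  by (cases l) (auto simp: Idx_def algebra_simps)

lemma Idx_subset: "1 \<le> l \<Longrightarrow> l * k \<le> p \<Longrightarrow> Idx k l \<subseteq> {1..p}"
  by (auto simp: Idx_def)

lemma finite_Idx: "finite (Idx k l)" by (simp add: Idx_def)

text \<open>Blocks off the diagonal lie strictly above it, so their noise entries are
  independent.\<close>

lemma Idx_less:
  assumes "u \<in> Idx k l" "v \<in> Idx k (l + r)" "1 \<le> l" "1 \<le> r"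
  shows "u < v"
proof -
  have "l * k \<le> (l + r - 1) * k" using assms by (intro mult_right_mono) auto
  moreover have "u \<le> l * k" "(l + r - 1) * k < v" using assms(1,2) by (auto simp: Idx_def)
  ultimately show ?thesis by linarith
qed

lemma Idx_1: "1 \<le> l \<Longrightarrow> Idx 1 l = {l}" by (auto simp: Idx_def)

lemma center_law_dominated:
  assumes b: "b \<in> center_labels" and pos: "0 < \<rho>" "0 < R_center" "1 \<le> n" "1 < l" and adj: "adjacent n X X'"
  shows "renyi_dominated l ((\<rho> / 4) / (2 * real p) * l) (center_law X b) (center_law X' b)"
proof -
  obtain l' r where b': "b = (l', r)" "1 \<le> l'" "r \<in> {0, 1}" "l' + r \<le> p" using b by (auto simp: center_labels_def)
  have "adjacent n (pad X) (pad X')" using adj by (auto simp: adjacent_def pad_def fun_eq_iff)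
  then show ?thesis unfolding b' center_law.simps
    using b' pos by (intro renyi_dominated_dp_cov_block finite_Idx) (auto simp: Idx_def)
qed

lemma outer_law_dominated:
  assumes i: "(k, b, j) \<in> outer_index" and pos: "0 < budget k" "0 < L" "0 < R k" "1 \<le> n" "1 < l"
    and adj: "adjacent n X X'"
  shows "renyi_dominated l (budget k * l) (outer_law X (k, b, j)) (outer_law X' (k, b, j))"
proof -
  obtain l' r where b: "b = (l', r)" by (cases b)
  have k: "k \<in> scales" "(l', r) \<in> outer_labels k" using i by (auto simp: outer_index_def b)
  have lr: "1 \<le> l'" "2 \<le> r" "(l' + r) * k \<le> p" using outer_labelsE[OF k] by auto
  have k1: "1 \<le> k" using scalesE[OF k(1)] by auto
  have adj': "adjacent n (pad X) (pad X')" using adj by (auto simp: adjacent_def pad_def fun_eq_iff)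
  have "l' * k \<le> p" using lr(3) by (simp add: algebra_simps)
  then have sub: "Idx k l' \<subseteq> {1..p}" "Idx k (l' + r) \<subseteq> {1..p}" using lr by (intro Idx_subset; simp)+
  show ?thesis
  proof (cases "t k j")
    case Zero
    then show ?thesis unfolding b using pos
      by (auto intro!: renyi_dominated_refl prob_space_return simp: space_PiM)
  next
    case Structured
    then show ?thesis unfolding b using pos lr k1 adj'
      by (auto intro!: renyi_dominated_peel_release simp: finite_Idx card_Idx)
  next
    case Dense
    then show ?thesis unfolding b using pos lr sub adj' Idx_less[of _ k l' _ r]
      by (auto intro!: renyi_dominated_dp_cov_block simp: finite_Idx less_imp_le)
  qed
qed

abbreviation "center_space \<equiv> PiM center_labels (\<lambda>b. PiM (block 1 b) (\<lambda>_. borel :: real measure))"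
abbreviation "outer_space \<equiv> PiM outer_index (\<lambda>(k, b, j). PiM (block k b) (\<lambda>_. borel :: real measure))"

lemma sets_center_law: "sets (center_law X b) = sets (PiM (block 1 b) (\<lambda>_. borel))"
  by (cases b) (simp add: dp_cov_block_def)

lemma sets_outer_law: "sets (outer_law X (k, b, j)) = sets (PiM (block k b) (\<lambda>_. borel))"
  by (cases b) (simp add: dp_cov_block_def peel_release_def Let_def split: candidate.split)

lemma measurable_pad:
  "i \<in> {1..n} \<Longrightarrow> (\<lambda>X. pad X i u) \<in> borel_measurable (PiM {1..n} (\<lambda>_. vec_space d))"
  unfolding pad_def
proof (cases "u \<in> {1..d}")
  case True
  assume "i \<in> {1..n}"
  then have 1: "(\<lambda>X. X i) \<in> PiM {1..n} (\<lambda>_. vec_space d) \<rightarrow>\<^sub>M vec_space d"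
    by (rule measurable_component_singleton)
  have 2: "(\<lambda>x. x u) \<in> vec_space d \<rightarrow>\<^sub>M (borel :: real measure)"
    using True by (rule measurable_component_singleton)
  show "(\<lambda>X. if u \<in> {1..d} then X i u else 0) \<in> borel_measurable (PiM {1..n} (\<lambda>_. vec_space d))"
    using True measurable_compose[OF 1 2] by simp
qed auto

lemma measurable_center_law:
  assumes "b \<in> center_labels"
  shows "(\<lambda>X. center_law X b) \<in> PiM {1..n} (\<lambda>_. vec_space d) \<rightarrow>\<^sub>M prob_algebra (PiM (block 1 b) (\<lambda>_. borel))"
proof -
  obtain l' r where b': "b = (l', r)" "1 \<le> l'" "r \<in> {0, 1}" "l' + r \<le> p" using assms by (auto simp: center_labels_def)
  then show ?thesis unfolding b' center_law.simps block.simps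
    by (intro measurable_dp_cov_block measurable_pad finite_Idx Idx_subset) auto
qed

lemma measurable_outer_law:
  assumes i: "(k, b, j) \<in> outer_index"
  shows "(\<lambda>X. outer_law X (k, b, j)) \<in> PiM {1..n} (\<lambda>_. vec_space d) \<rightarrow>\<^sub>M prob_algebra (PiM (block k b) (\<lambda>_. borel))"
proof -
  obtain l' r where b: "b = (l', r)" by (cases b)
  have k: "k \<in> scales" "(l', r) \<in> outer_labels k" using i by (auto simp: outer_index_def b)
  have lr: "1 \<le> l'" "2 \<le> r" "(l' + r) * k \<le> p" using outer_labelsE[OF k] by auto
  have k1: "1 \<le> k" using scalesE[OF k(1)] by auto
  have "l' * k \<le> p" using lr(3) by (simp add: algebra_simps)
  then have sub: "Idx k l' \<subseteq> {1..p}" "Idx k (l' + r) \<subseteq> {1..p}" using lr by (intro Idx_subset; simp)+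
  show ?thesis
  proof (cases "t k j")
    case Zero
    then show ?thesis unfolding b
      by (auto intro!: measurable_const simp: space_prob_algebra prob_space_return space_PiM)
  next
    case Structured
    then show ?thesis unfolding b
      using lr k1 by (auto intro!: measurable_peel_release measurable_pad simp: finite_Idx card_Idx simp del: One_nat_def)
  next
    case Dense
    then show ?thesis unfolding b
      using sub by (auto intro!: measurable_dp_cov_block measurable_pad simp: finite_Idx simp del: One_nat_def)
  qed
qed

lemma finite_block: "finite (block k b)" by (cases b) (simp add: finite_Idx)

lemma measurable_Z:
  assumes i: "(k, b, j) \<in> outer_index" and q: "q \<in> block k b"
  shows "(\<lambda>z. Z z k b j q) \<in> borel_measurable outer_space"
  unfolding Z_def
proof (rule measurable_vclip[OF finite_block _ q])
  fix u assume "u \<in> block k b"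
  then have 2: "(\<lambda>y. y u) \<in> PiM (block k b) (\<lambda>_. borel) \<rightarrow>\<^sub>M (borel :: real measure)"
    by (rule measurable_component_singleton)
  have 1: "(\<lambda>z. z (k, b, j)) \<in> outer_space \<rightarrow>\<^sub>M PiM (block k b) (\<lambda>_. borel)"
    using measurable_component_singleton[OF i, of "\<lambda>(k, b, j). PiM (block k b) (\<lambda>_. borel :: real measure)"]
    by (simp only: prod.case)
  show "(\<lambda>z. z (k, b, j) u) \<in> borel_measurable outer_space" by (rule measurable_compose[OF 1 2])
qed

lemma j_hat_le: "j_hat z k \<le> J k"
proof -
  let ?S = "{j. j \<le> J k \<and> (\<forall>i<j. \<forall>b\<in>outer_labels k.
      L2_set (\<lambda>q. Z z k b j q - Z z k b i q) (block k b) \<le> D k j + D k i)}"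
  have "0 \<in> ?S" by simp
  then have "Max ?S \<in> ?S" by (intro Max_in) (auto intro: finite_subset[of _ "{..J k}"])
  then show ?thesis unfolding j_hat_def by simp
qed

lemma measurable_j_hat:
  assumes k: "k \<in> scales"
  shows "(\<lambda>z. j_hat z k) \<in> outer_space \<rightarrow>\<^sub>M count_space UNIV"
  unfolding j_hat_def
proof (rule measurable_Max_nat)
  fix j
  show "Measurable.pred outer_space (\<lambda>z. j \<le> J k \<and> (\<forall>i<j. \<forall>b\<in>outer_labels k.
      L2_set (\<lambda>q. Z z k b j q - Z z k b i q) (block k b) \<le> D k j + D k i))"
  proof (cases "j \<le> J k")
    case True
    have m: "(\<lambda>z. L2_set (\<lambda>q. Z z k b j q - Z z k b i q) (block k b)) \<in> borel_measurable outer_space"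
      if "i < j" "b \<in> outer_labels k" for i b
      unfolding L2_set_def using that True k
      by (intro measurable_compose[OF _ borel_measurable_sqrt] borel_measurable_sum borel_measurable_power borel_measurable_diff measurable_Z)
        (auto simp: outer_index_def)
    have "Measurable.pred outer_space (\<lambda>z. \<forall>i\<in>{..<j}. \<forall>b\<in>outer_labels k.
      L2_set (\<lambda>q. Z z k b j q - Z z k b i q) (block k b) \<le> D k j + D k i)"
    proof (intro pred_intros_finite finite_lessThan finite_outer_labels)
      fix i b assume "i \<in> {..<j}" "b \<in> outer_labels k"
      then have 1: "(\<lambda>z. L2_set (\<lambda>q. Z z k b j q - Z z k b i q) (block k b)) \<in> borel_measurable outer_space"
        using m by simp
      have 2: "Measurable.pred borel (\<lambda>x. x \<le> D k j + D k i)" by measurable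
      show "Measurable.pred outer_space (\<lambda>z. L2_set (\<lambda>q. Z z k b j q - Z z k b i q) (block k b) \<le> D k j + D k i)"
        by (rule measurable_compose[OF 1 2])
    qed
    then show ?thesis by (simp only: True simp_thms Ball_def lessThan_iff)
  qed simp
qed

lemma measurable_assemble: "(\<lambda>x. assemble (fst x) (snd x) q) \<in> borel_measurable (center_space \<Otimes>\<^sub>M outer_space)"
  unfolding assemble_def
proof (intro borel_measurable_add borel_measurable_sum)
  fix b assume b: "b \<in> center_labels"
  show "(\<lambda>x. if q \<in> block 1 b then fst x b q else 0) \<in> borel_measurable (center_space \<Otimes>\<^sub>M outer_space)"
  proof (cases "q \<in> block 1 b")
    case True
    have 1: "(\<lambda>c. c b) \<in> center_space \<rightarrow>\<^sub>M PiM (block 1 b) (\<lambda>_. borel)"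
      by (rule measurable_component_singleton[OF b])
    have 2: "(\<lambda>y. y q) \<in> PiM (block 1 b) (\<lambda>_. borel) \<rightarrow>\<^sub>M (borel :: real measure)"
      by (rule measurable_component_singleton[OF True])
    have "(\<lambda>c. c b q) \<in> borel_measurable center_space" by (rule measurable_compose[OF 1 2])
    then show ?thesis using True by (auto intro: measurable_compose[OF measurable_fst])
  qed simp
next
  fix k b assume k: "k \<in> scales" and b: "b \<in> outer_labels k"
  show "(\<lambda>x. if q \<in> block k b then Z (snd x) k b (j_hat (snd x) k) q else 0) \<in> borel_measurable (center_space \<Otimes>\<^sub>M outer_space)"
  proof (cases "q \<in> block k b")
    case True
    have "(\<lambda>z. if j \<le> J k then Z z k b j q else 0) \<in> borel_measurable outer_space" for j
    proof (cases "j \<le> J k")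
      case j: True
      then have "(k, b, j) \<in> outer_index" using k b by (simp add: outer_index_def)
      from measurable_Z[OF this True] show ?thesis using j by simp
    qed simp
    then have "(\<lambda>z. if j_hat z k \<le> J k then Z z k b (j_hat z k) q else 0) \<in> borel_measurable outer_space"
      using measurable_j_hat[OF k] by (rule measurable_compose_countable)
    then have "(\<lambda>z. Z z k b (j_hat z k) q) \<in> borel_measurable outer_space" by (simp add: j_hat_le)
    then show ?thesis using True by (auto intro: measurable_compose[OF measurable_snd])
  qed simp
qed

text \<open>The part of the estimator that does not look at the data: selection of the levels,
  assembly, symmetrisation and spectral clipping.\<close>

definition output_map :: "(nat \<times> nat \<Rightarrow> nat \<times> nat \<Rightarrow> real) \<times> (nat \<times> (nat \<times> nat) \<times> nat \<Rightarrow> nat \<times> nat \<Rightarrow> real) \<Rightarrow> nat \<times> nat \<Rightarrow> real" where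
  "output_map = (\<lambda>(c, z). \<lambda>q\<in>{1..d} \<times> {1..d}. spectral_clip p M\<^sub>0 (\<lambda>(u, v). assemble c z (min u v, max u v)) q)"

lemma estimator_eq:
  "estimator X = distr (PiM center_labels (center_law X) \<Otimes>\<^sub>M PiM outer_index (outer_law X)) (mat_space d) output_map"
  by (simp add: estimator_def output_map_def)

lemma measurable_output_map:
  assumes "1 \<le> d" "0 \<le> M\<^sub>0"
  shows "output_map \<in> center_space \<Otimes>\<^sub>M outer_space \<rightarrow>\<^sub>M mat_space d"
proof -
  have eq: "output_map = (\<lambda>x. \<lambda>q\<in>{1..d} \<times> {1..d}. spectral_clip p M\<^sub>0
      (\<lambda>y. assemble (fst x) (snd x) (min (fst y) (snd y), max (fst y) (snd y))) q)"
    by (simp add: output_map_def split_beta')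
  show ?thesis unfolding eq
  proof (rule measurable_restrict)
    fix q assume "q \<in> {1..d} \<times> {1..d}"
    then have q: "q \<in> {1..p} \<times> {1..p}" using p_bounds[OF assms(1)] by auto
    show "(\<lambda>x. spectral_clip p M\<^sub>0 (\<lambda>y. assemble (fst x) (snd x) (min (fst y) (snd y), max (fst y) (snd y))) q)
        \<in> borel_measurable (center_space \<Otimes>\<^sub>M outer_space)"
      using assms(2) by (intro measurable_spectral_clip q measurable_assemble) (auto simp: min.commute max.commute)
  qed
qed

lemma measurable_releases:
  "(\<lambda>X. PiM center_labels (center_law X) \<Otimes>\<^sub>M PiM outer_index (outer_law X))
     \<in> PiM {1..n} (\<lambda>_. vec_space d) \<rightarrow>\<^sub>M prob_algebra (center_space \<Otimes>\<^sub>M outer_space)"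
proof (rule measurable_pair_prob)
  show "(\<lambda>X. PiM center_labels (center_law X)) \<in> PiM {1..n} (\<lambda>_. vec_space d) \<rightarrow>\<^sub>M prob_algebra center_space"
    by (rule measurable_PiM_kernel[OF finite_center_labels measurable_center_law])
  have "(\<lambda>X. outer_law X i) \<in> PiM {1..n} (\<lambda>_. vec_space d) \<rightarrow>\<^sub>M
      prob_algebra ((\<lambda>(k, b, j). PiM (block k b) (\<lambda>_. borel)) i)" if "i \<in> outer_index" for i
    using that measurable_outer_law by (cases i) (simp only: prod.case)
  then show "(\<lambda>X. PiM outer_index (outer_law X)) \<in> PiM {1..n} (\<lambda>_. vec_space d) \<rightarrow>\<^sub>M prob_algebra outer_space"
    by (rule measurable_PiM_kernel[OF finite_outer_index])
qed

lemma measurable_estimator: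
  assumes "1 \<le> d" "0 \<le> M\<^sub>0"
  shows "estimator \<in> PiM {1..n} (\<lambda>_. vec_space d) \<rightarrow>\<^sub>M prob_algebra (mat_space d)"
  unfolding estimator_eq[abs_def]
  using measurable_compose[OF measurable_releases measurable_distr_prob_space[OF measurable_output_map[OF assms]]] by simp

lemma budget_pos:
  assumes "k \<in> scales" "0 < \<rho>"
  shows "0 < budget k"
proof -
  have "2 \<le> lg" using assms(1) unfolding scales_eq by auto
  then have "0 < J_sq" by (simp add: J_sq_eq)
  moreover have "0 < N (2 * k)" using scalesE[OF assms(1)] p_lg by (metis gr0I mult_0_right power_not_zero zero_neq_numeral)
  ultimately show ?thesis using assms(2) by (simp add: budget_def)
qed

text \<open>There are at most \<open>2p\<close> center blocks, and at most \<open>3 N (2k)\<close>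
  blocks per scale with \<open>J k + 1\<close> levels each. The budgets are the corresponding
  fractions of \<open>\<rho>/4\<close> and \<open>3\<rho>/4\<close>.\<close>

lemma total_budget:
  assumes "0 < \<rho>" "2 \<le> lg"
  shows "(\<Sum>b\<in>center_labels. (\<rho> / 4) / (2 * real p)) + (\<Sum>i\<in>outer_index. budget (fst i)) \<le> \<rho>"
proof -
  have p0: "0 < p" by (simp add: p_lg)
  have "(\<Sum>b\<in>center_labels. (\<rho> / 4) / (2 * real p)) = real (card center_labels) * ((\<rho> / 4) / (2 * real p))" by simp
  also have "\<dots> \<le> real (2 * p) * ((\<rho> / 4) / (2 * real p))"
    using assms card_center_labels by (intro mult_right_mono) auto
  also have "\<dots> = \<rho> / 4" using p0 by simp
  finally have c: "(\<Sum>b\<in>center_labels. (\<rho> / 4) / (2 * real p)) \<le> \<rho> / 4" .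
  have J: "0 < J_sq" using assms by (simp add: J_sq_eq)
  have "(\<Sum>i\<in>outer_index. budget (fst i)) = (\<Sum>k\<in>scales. \<Sum>y\<in>outer_labels k \<times> {..J k}. budget k)"
    unfolding outer_index_eq using finite_scales finite_outer_labels
    by (subst sum.Sigma) (auto simp: split_beta')
  also have "\<dots> \<le> (\<Sum>k\<in>scales. 3 * \<rho> / (4 * J_sq))"
  proof (rule sum_mono)
    fix k assume k: "k \<in> scales"
    have N0: "0 < N (2 * k)" using scalesE[OF k] p0 by (metis gr0I mult_0_right less_irrefl)
    have "(\<Sum>y\<in>outer_labels k \<times> {..J k}. budget k) = real (card (outer_labels k)) * (real (J k) + 1) * budget k"
      by (simp add: card_cartesian_product algebra_simps)
    also have "\<dots> \<le> real (3 * N (2 * k)) * (real (J k) + 1) * budget k"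
      using card_outer_labels[of k] budget_pos[OF k assms(1)] by (intro mult_right_mono) auto
    also have "\<dots> = 3 * \<rho> / (4 * J_sq)"
    proof -
      have "3 * x * y * (\<rho> / (4 * J_sq * x * y)) = 3 * \<rho> / (4 * J_sq)" if "x \<noteq> 0" "y \<noteq> 0" for x y
        using that J by (simp add: field_simps)
      from this[of "real (N (2 * k))" "real (J k) + 1"] N0 show ?thesis by (simp add: budget_def)
    qed
    finally show "(\<Sum>y\<in>outer_labels k \<times> {..J k}. budget k) \<le> 3 * \<rho> / (4 * J_sq)" .
  qed
  also have "\<dots> = real (lg - 1) * (3 * \<rho> / (4 * J_sq))" by (simp add: card_scales)
  also have "real (lg - 1) = J_sq" using assms by (simp add: J_sq_eq of_nat_diff)
  also have "J_sq * (3 * \<rho> / (4 * J_sq)) = 3 * \<rho> / 4" using J by simp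
  finally have "(\<Sum>i\<in>outer_index. budget (fst i)) \<le> 3 * \<rho> / 4" .
  from add_mono[OF c this] show ?thesis by (rule order_trans) simp
qed

lemma zCDP_estimator:
  assumes "0 < \<rho>" "4 \<le> d" "2 \<le> n" "0 \<le> M\<^sub>0" "0 < K" "0 < C_L" "0 < C_1" "0 < C_R"
  shows "zCDP n (vec_space d) (mat_space d) \<rho> estimator"
  unfolding zCDP_def
proof (intro conjI ballI impI allI)
  show "estimator \<in> PiM {1..n} (\<lambda>_. vec_space d) \<rightarrow>\<^sub>M prob_algebra (mat_space d)"
    using assms by (intro measurable_estimator) auto
  fix X X' :: "nat \<Rightarrow> nat \<Rightarrow> real" and l :: real
  assume adj: "adjacent n X X'" and l: "1 < l"
  have ln: "0 < ln (real n)" using assms by simp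
  have p4: "4 \<le> p" using p_bounds(1) assms by simp
  have lg: "2 \<le> lg"
  proof (rule ccontr)
    assume "\<not> 2 \<le> lg"
    then have "p \<le> 2 ^ 1" unfolding p_lg by (intro power_increasing) auto
    then show False using p4 by simp
  qed
  have RL: "0 < R_center" "0 < L" "0 < R k" for k
    using assms ln by (auto simp: R_center_def L_def R_def intro!: mult_pos_pos add_nonneg_pos)
  let ?b = "\<lambda>b :: nat \<times> nat. (\<rho> / 4) / (2 * real p) * l" and ?o = "\<lambda>i :: nat \<times> (nat \<times> nat) \<times> nat. budget (fst i) * l"
  have "renyi_dominated l ((\<Sum>b\<in>center_labels. ?b b) + (\<Sum>i\<in>outer_index. ?o i)) (estimator X) (estimator X')"
    unfolding estimator_eq
  proof (intro renyi_dominated_distr renyi_dominated_pair renyi_dominated_PiM finite_center_labels finite_outer_index l)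
    show "renyi_dominated l (?b b) (center_law X b) (center_law X' b)" if "b \<in> center_labels" for b
      using that assms RL adj l by (intro center_law_dominated) auto
    show "renyi_dominated l (?o i) (outer_law X i) (outer_law X' i)" if "i \<in> outer_index" for i
    proof -
      obtain k b j where i: "i = (k, b, j)" by (cases i)
      have "k \<in> scales" using that by (auto simp: i outer_index_def)
      then show ?thesis
        using that assms RL adj l budget_pos[of k] unfolding i fst_conv by (intro outer_law_dominated) auto
    qed
    have "sets (PiM center_labels (center_law X') \<Otimes>\<^sub>M PiM outer_index (outer_law X')) = sets (center_space \<Otimes>\<^sub>M outer_space)"
      by (intro sets_pair_measure_cong sets_PiM_cong refl) (auto simp: sets_center_law sets_outer_law simp del: outer_law.simps center_law.simps)
    then show "output_map \<in> PiM center_labels (center_law X') \<Otimes>\<^sub>M PiM outer_index (outer_law X') \<rightarrow>\<^sub>M mat_space d"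
      using measurable_output_map assms by (simp cong: measurable_cong_sets)
  qed
  moreover have "(\<Sum>b\<in>center_labels. ?b b) + (\<Sum>i\<in>outer_index. ?o i) \<le> \<rho> * l"
    using mult_right_mono[OF total_budget[OF assms(1) lg], of l] l by (simp add: sum_distrib_right distrib_right)
  ultimately have "renyi_dominated l (\<rho> * l) (estimator X) (estimator X')"
    using l by (rule renyi_dominated_mono)
  then show "renyi_divergence l (estimator X) (estimator X') \<le> ereal (\<rho> * l)"
    using assms l by (intro renyi_divergence_le_if_dominated) auto
qed

end

section \<open>Accuracy of the Gaussian noise and of the peeling selection\<close>

lemma emeasure_tail_exp:
  assumes [measurable]: "f \<in> borel_measurable M" and B: "(\<integral>\<^sup>+x. ennreal (exp (f x)) \<partial>M) \<le> ennreal B"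
  shows "emeasure M {x\<in>space M. s < f x} \<le> ennreal (exp (- s) * B)"
proof -
  have "emeasure M {x\<in>space M. s < f x} = (\<integral>\<^sup>+x. indicator {x\<in>space M. s < f x} x \<partial>M)" by simp
  also have "\<dots> \<le> (\<integral>\<^sup>+x. ennreal (exp (- s)) * ennreal (exp (f x)) \<partial>M)"
    by (intro nn_integral_mono) (auto simp: indicator_def ennreal_mult[symmetric] exp_add[symmetric])
  also have "\<dots> = ennreal (exp (- s)) * (\<integral>\<^sup>+x. ennreal (exp (f x)) \<partial>M)" by (rule nn_integral_cmult) measurable
  also have "\<dots> \<le> ennreal (exp (- s)) * ennreal B" by (intro mult_left_mono B) auto
  finally show ?thesis by (simp add: ennreal_mult')
qed

lemma std_normal_exp_linear: "(\<integral>\<^sup>+x. ennreal (exp (c * x)) \<partial>std_normal_distribution) = ennreal (exp (c\<^sup>2 / 2))"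
proof -
  have e: "std_normal_density x * exp (c * x) = exp (c\<^sup>2 / 2) * normal_density c 1 x" for x
    by (simp add: normal_density_def exp_add[symmetric]) (simp add: power2_eq_square field_simps)
  have "(\<integral>\<^sup>+x. ennreal (exp (c * x)) \<partial>std_normal_distribution)
      = (\<integral>\<^sup>+x. ennreal (exp (c\<^sup>2 / 2)) * ennreal (normal_density c 1 x) \<partial>lborel)"
    by (subst nn_integral_density) (auto simp: ennreal_mult[symmetric] e)
  also have "\<dots> = ennreal (exp (c\<^sup>2 / 2)) * (\<integral>\<^sup>+x. ennreal (normal_density c 1 x) \<partial>lborel)"
    by (rule nn_integral_cmult) measurable
  also have "(\<integral>\<^sup>+x. ennreal (normal_density c 1 x) \<partial>lborel) = 1"
    by (subst nn_integral_eq_integral) auto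
  finally show ?thesis by simp
qed

lemma std_normal_exp_square: "(\<integral>\<^sup>+x. ennreal (exp (x\<^sup>2 / 4)) \<partial>std_normal_distribution) = ennreal (sqrt 2)"
proof -
  have e: "std_normal_density x * exp (x\<^sup>2 / 4) = sqrt 2 * normal_density 0 (sqrt 2) x" for x
    by (simp add: normal_density_def exp_add[symmetric] real_sqrt_mult field_simps)
  have "(\<integral>\<^sup>+x. ennreal (exp (x\<^sup>2 / 4)) \<partial>std_normal_distribution)
      = (\<integral>\<^sup>+x. ennreal (sqrt 2) * ennreal (normal_density 0 (sqrt 2) x) \<partial>lborel)"
    by (subst nn_integral_density) (auto simp: ennreal_mult[symmetric] e)
  also have "\<dots> = ennreal (sqrt 2) * (\<integral>\<^sup>+x. ennreal (normal_density 0 (sqrt 2) x) \<partial>lborel)"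
    by (rule nn_integral_cmult) measurable
  also have "(\<integral>\<^sup>+x. ennreal (normal_density 0 (sqrt 2) x) \<partial>lborel) = 1"
    by (subst nn_integral_eq_integral) auto
  finally show ?thesis by simp
qed

lemma std_normal_tail:
  assumes "0 \<le> s"
  shows "emeasure std_normal_distribution {x. s < \<bar>x\<bar>} \<le> ennreal (2 * exp (- s\<^sup>2 / 4))"
proof -
  have "emeasure std_normal_distribution {x\<in>space std_normal_distribution. s\<^sup>2 / 4 < x\<^sup>2 / 4}
      \<le> ennreal (exp (- (s\<^sup>2 / 4)) * sqrt 2)"
    by (rule emeasure_tail_exp) (auto simp: std_normal_exp_square)
  moreover have "{x\<in>space std_normal_distribution. s\<^sup>2 / 4 < x\<^sup>2 / 4} = {x. s < \<bar>x\<bar>}"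
    using assms abs_le_square_iff[of _ s] by (auto simp: not_le[symmetric])
  moreover have "exp (- (s\<^sup>2 / 4)) * sqrt 2 \<le> 2 * exp (- s\<^sup>2 / 4)"
    using real_sqrt_le_mono[of 2 4] by simp
  ultimately show ?thesis by (auto intro: order_trans ennreal_leI)
qed

text \<open>Union bound over the coordinates in \<open>Q\<close>; the family may have more
  coordinates than \<open>Q\<close>.\<close>

lemma std_normal_family_tail:
  assumes "finite Q" "Q \<subseteq> U" "0 \<le> s"
  shows "emeasure (PiM U (\<lambda>_. std_normal_distribution)) {g\<in>space (PiM U (\<lambda>_. std_normal_distribution)). \<exists>q\<in>Q. s < \<bar>g q\<bar>}
    \<le> ennreal (real (card Q) * (2 * exp (- s\<^sup>2 / 4)))"
proof -
  let ?G = "PiM U (\<lambda>_. std_normal_distribution)"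
  interpret product_prob_space "\<lambda>_. std_normal_distribution" U
    by (intro product_prob_spaceI prob_space_normal_density) simp
  have [measurable]: "{x. s < \<bar>x\<bar>} \<in> sets std_normal_distribution" by simp
  have eq: "{g\<in>space ?G. \<exists>q\<in>Q. s < \<bar>g q\<bar>} = (\<Union>q\<in>Q. {g\<in>space ?G. g q \<in> {x. s < \<bar>x\<bar>}})" by auto
  have "emeasure ?G {g\<in>space ?G. \<exists>q\<in>Q. s < \<bar>g q\<bar>} \<le> (\<Sum>q\<in>Q. emeasure ?G {g\<in>space ?G. g q \<in> {x. s < \<bar>x\<bar>}})"
    unfolding eq using assms by (intro emeasure_subadditive_finite) auto
  also have "\<dots> = (\<Sum>q\<in>Q. emeasure std_normal_distribution {x. s < \<bar>x\<bar>})"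
    using assms by (intro sum.cong refl emeasure_PiM_Collect_single) auto
  also have "\<dots> \<le> (\<Sum>q\<in>Q. ennreal (2 * exp (- s\<^sup>2 / 4)))"
    by (intro sum_mono std_normal_tail assms)
  also have "\<dots> = ennreal (real (card Q) * (2 * exp (- s\<^sup>2 / 4)))"
    by (simp add: ennreal_of_nat_eq_real_of_nat ennreal_mult)
  finally show ?thesis .
qed

text \<open>Turns a deterministic implication into a probability bound: whatever follows from all
  noise entries being at most \<open>s\<close> standard deviations fails only with Gaussian tail
  probability.\<close>

lemma dp_cov_block_prob:
  assumes IJ: "finite I" "finite J" "I \<subseteq> {1..p}" "J \<subseteq> {1..p}" and le: "\<And>u v. u \<in> I \<Longrightarrow> v \<in> J \<Longrightarrow> u \<le> v"
    and s: "0 \<le> s" and \<Phi>: "Measurable.pred (PiM (I \<times> J) (\<lambda>_. borel)) \<Phi>"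
    and good: "\<And>y. (\<And>u v. u \<in> I \<Longrightarrow> v \<in> J \<Longrightarrow> \<bar>y (u, v) - (\<Sum>i=1..n. vclip I R (X i) u * vclip J R (X i) v) / real n\<bar>
        \<le> sqrt (18 * R ^ 4 / (\<rho>B * (real n)\<^sup>2)) * s) \<Longrightarrow> \<Phi> y"
    and \<rho>B: "0 \<le> \<rho>B"
  shows "emeasure (dp_cov_block n p X I J \<rho>B R) {y\<in>space (dp_cov_block n p X I J \<rho>B R). \<not> \<Phi> y}
    \<le> ennreal (real (card (I \<times> J)) * (2 * exp (- s\<^sup>2 / 4)))"
proof -
  define U where "U = {(u, v). 1 \<le> u \<and> u \<le> v \<and> v \<le> p}"
  let ?G = "PiM U (\<lambda>_. std_normal_distribution)"
  have IJU: "I \<times> J \<subseteq> U" using IJ le by (fastforce simp: U_def)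
  define \<sigma> where "\<sigma> = sqrt (18 * R ^ 4 / (\<rho>B * (real n)\<^sup>2))"
  have \<sigma>: "0 \<le> \<sigma>" using \<rho>B by (simp add: \<sigma>_def)
  define \<mu> where "\<mu> q = (\<Sum>i=1..n. vclip I R (X i) (fst q) * vclip J R (X i) (snd q)) / real n" for q
  define F where "F g = (\<lambda>q\<in>I \<times> J. \<mu> q + \<sigma> * g q)" for g
  have eq: "dp_cov_block n p X I J \<rho>B R = distr ?G (PiM (I \<times> J) (\<lambda>_. borel)) F"
    unfolding dp_cov_block_def U_def[symmetric] \<sigma>_def[symmetric]
  proof (intro distr_cong refl ext)
    fix g q
    show "(\<lambda>(u, v)\<in>I \<times> J. (\<Sum>i=1..n. vclip I R (X i) u * vclip J R (X i) v) / real n + \<sigma> * g (min u v, max u v)) q = F g q"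
      using le by (cases q) (auto simp: F_def \<mu>_def min_absorb1 max_absorb2)
  qed
  have [measurable]: "F \<in> ?G \<rightarrow>\<^sub>M PiM (I \<times> J) (\<lambda>_. borel)"
    unfolding F_def
  proof (intro measurable_restrict)
    fix q assume "q \<in> I \<times> J"
    then have "q \<in> U" using IJU by auto
    then show "(\<lambda>g. \<mu> q + \<sigma> * g q) \<in> borel_measurable ?G" by measurable
  qed
  note [measurable] = \<Phi>
  have "emeasure (dp_cov_block n p X I J \<rho>B R) {y\<in>space (dp_cov_block n p X I J \<rho>B R). \<not> \<Phi> y}
      = emeasure ?G {g\<in>space ?G. \<not> \<Phi> (F g)}"
    unfolding eq space_distr by (subst emeasure_distr)
      (auto intro!: arg_cong2[where f = emeasure] dest: measurable_space[OF \<open>F \<in> _\<close>])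
  also have "\<dots> \<le> emeasure ?G {g\<in>space ?G. \<exists>q\<in>I \<times> J. s < \<bar>g q\<bar>}"
  proof (rule emeasure_mono)
    show "{g\<in>space ?G. \<not> \<Phi> (F g)} \<subseteq> {g\<in>space ?G. \<exists>q\<in>I \<times> J. s < \<bar>g q\<bar>}"
    proof (intro subsetI CollectI conjI)
      fix g assume g: "g \<in> {g\<in>space ?G. \<not> \<Phi> (F g)}"
      show "\<exists>q\<in>I \<times> J. s < \<bar>g q\<bar>"
      proof (rule ccontr)
        assume "\<not> ?thesis"
        then have "\<bar>g q\<bar> \<le> s" if "q \<in> I \<times> J" for q using that by (auto simp: not_less)
        then have "\<Phi> (F g)"
          using \<sigma> by (intro good) (auto simp: F_def \<mu>_def \<sigma>_def[symmetric] abs_mult intro!: mult_left_mono)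
        then show False using g by simp
      qed
    qed simp
    have "{g\<in>space ?G. \<exists>q\<in>I \<times> J. s < \<bar>g q\<bar>} = (\<Union>q\<in>I \<times> J. {g\<in>space ?G. s < \<bar>g q\<bar>})" by auto
    moreover have "{g\<in>space ?G. s < \<bar>g q\<bar>} \<in> sets ?G" if "q \<in> I \<times> J" for q
    proof -
      have "q \<in> U" using that IJU by auto
      then show ?thesis by measurable
    qed
    ultimately show "{g\<in>space ?G. \<exists>q\<in>I \<times> J. s < \<bar>g q\<bar>} \<in> sets ?G"
      using IJ by (auto intro!: sets.finite_UN)
  qed
  also have "\<dots> \<le> ennreal (real (card (I \<times> J)) * (2 * exp (- s\<^sup>2 / 4)))"
    using IJ IJU s by (intro std_normal_family_tail) auto
  finally show ?thesis .
qed

text \<open>An approximate version of being a set of largest scores.\<close>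

definition near_top :: "'c set \<Rightarrow> ('c \<Rightarrow> real) \<Rightarrow> real \<Rightarrow> 'c set \<Rightarrow> bool" where
  "near_top Q s \<eta> S \<longleftrightarrow> (\<forall>c\<in>S. \<forall>c'\<in>Q - S. s c' \<le> s c + \<eta>)"

text \<open>A candidate more than \<open>\<eta>\<close> below the best one has weight at most
  \<open>exp (- \<epsilon> \<eta> / (2 \<Delta>))\<close> relative to it, and there are at most
  \<open>card Q\<close> of those.\<close>

lemma exp_mechanism_utility:
  assumes Q: "finite Q" "Q \<noteq> {}" and \<Delta>: "0 < \<Delta>" and \<epsilon>: "0 \<le> \<epsilon>"
  shows "measure (measure_pmf (exp_mechanism \<epsilon> \<Delta> Q s)) {c. \<exists>c'\<in>Q. s c + \<eta> < s c'} \<le> real (card Q) * exp (- (\<epsilon> * \<eta> / (2 * \<Delta>)))"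
proof -
  let ?w = "\<lambda>c. exp (\<epsilon> * s c / (2 * \<Delta>))" and ?B = "{c. \<exists>c'\<in>Q. s c + \<eta> < s c'}"
  have "pmf (exp_mechanism \<epsilon> \<Delta> Q s) c * indicator ?B c \<le> exp (- (\<epsilon> * \<eta> / (2 * \<Delta>)))" if c: "c \<in> Q" for c
  proof (cases "c \<in> ?B")
    case True
    then obtain c' where c': "c' \<in> Q" "s c + \<eta> < s c'" by auto
    have Z: "?w c' \<le> (\<Sum>c\<in>Q. ?w c)" using Q c' by (intro member_le_sum) auto
    have "\<epsilon> * (s c + \<eta>) \<le> \<epsilon> * s c'" using c' \<epsilon> by (intro mult_left_mono) auto
    then have "(\<epsilon> * s c - \<epsilon> * s c') / (2 * \<Delta>) \<le> - (\<epsilon> * \<eta>) / (2 * \<Delta>)"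
      using \<Delta> by (intro divide_right_mono) (auto simp: algebra_simps)
    then have "\<epsilon> * s c / (2 * \<Delta>) - \<epsilon> * s c' / (2 * \<Delta>) \<le> - (\<epsilon> * \<eta> / (2 * \<Delta>))"
      by (simp add: diff_divide_distrib)
    then have "?w c / ?w c' \<le> exp (- (\<epsilon> * \<eta> / (2 * \<Delta>)))" by (simp add: exp_diff[symmetric])
    moreover have "?w c / (\<Sum>c\<in>Q. ?w c) \<le> ?w c / ?w c'" using Z by (intro divide_left_mono mult_pos_pos) (auto intro: less_le_trans[OF _ Z])
    ultimately show ?thesis using c True Q by (simp add: pmf_exp_mechanism)
  qed simp
  then have "(\<Sum>c\<in>Q. pmf (exp_mechanism \<epsilon> \<Delta> Q s) c * indicator ?B c) \<le> (\<Sum>c\<in>Q. exp (- (\<epsilon> * \<eta> / (2 * \<Delta>))))"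
    by (rule sum_mono)
  then show ?thesis
    using Q by (subst measure_pmf_finite_support[of Q]) (auto simp: set_pmf_exp_mechanism)
qed

text \<open>Adding a candidate that is nearly best among the remaining ones preserves
  \<open>near_top\<close>, and removing candidates from the competition does not hurt the earlier
  selections; so it suffices that no single step fails.\<close>

lemma peel_select_utility:
  assumes Q: "finite Q" and \<Delta>: "0 < \<Delta>" and \<epsilon>: "0 \<le> \<epsilon>" and m: "m \<le> card Q"
  shows "emeasure (measure_pmf (peel_select \<epsilon> \<Delta> Q s m)) {S. \<not> near_top Q s \<eta> S}
    \<le> ennreal (real m * (real (card Q) * exp (- (\<epsilon> * \<eta> / (2 * \<Delta>)))))"
  using m
proof (induction m)
  case 0
  then show ?case by (simp add: near_top_def)
next
  case (Suc m)
  define \<delta> where "\<delta> = real (card Q) * exp (- (\<epsilon> * \<eta> / (2 * \<Delta>)))"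
  have \<delta>: "0 \<le> \<delta>" by (simp add: \<delta>_def)
  let ?p = "peel_select \<epsilon> \<Delta> Q s m"
  have step: "emeasure (measure_pmf (peel_step \<epsilon> \<Delta> Q s S)) {S. \<not> near_top Q s \<eta> S}
      \<le> indicator {S. \<not> near_top Q s \<eta> S} S + ennreal \<delta>" if S: "S \<in> set_pmf ?p" for S
  proof (cases "near_top Q s \<eta> S")
    case False
    then show ?thesis using measure_pmf.emeasure_le_1[of "peel_step \<epsilon> \<Delta> Q s S"] by (simp add: add_increasing2)
  next
    case True
    have "S \<in> {S. S \<subseteq> Q \<and> card S = m}" using S set_pmf_peel_select[OF Q] Suc.prems by (meson Suc_leD subsetD)
    then have ne: "Q - S \<noteq> {}" using Suc.prems Diff_nonempty_if_card_less[of S Q] finite_subset[OF _ Q] by simp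
    let ?e = "exp_mechanism \<epsilon> \<Delta> (Q - S) s"
    have "emeasure (measure_pmf (peel_step \<epsilon> \<Delta> Q s S)) {S. \<not> near_top Q s \<eta> S}
        = measure (measure_pmf ?e) {c. \<not> near_top Q s \<eta> (insert c S)}"
      using ne by (simp add: peel_step_def measure_pmf.emeasure_eq_measure vimage_def)
    also have "\<dots> \<le> measure (measure_pmf ?e) {c. \<exists>c'\<in>Q - S. s c + \<eta> < s c'}"
      using True by (intro ennreal_leI measure_pmf.finite_measure_mono) (auto simp: near_top_def not_le)
    also have "\<dots> \<le> ennreal (real (card (Q - S)) * exp (- (\<epsilon> * \<eta> / (2 * \<Delta>))))"
      using Q ne \<Delta> \<epsilon> by (intro ennreal_leI exp_mechanism_utility) auto
    also have "\<dots> \<le> ennreal \<delta>" unfolding \<delta>_def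
      using Q by (intro ennreal_leI mult_right_mono) (auto intro: card_mono)
    finally show ?thesis using True by simp
  qed
  have "emeasure (measure_pmf (peel_select \<epsilon> \<Delta> Q s (Suc m))) {S. \<not> near_top Q s \<eta> S}
      = (\<integral>\<^sup>+S. emeasure (measure_pmf (peel_step \<epsilon> \<Delta> Q s S)) {S. \<not> near_top Q s \<eta> S} \<partial>measure_pmf ?p)"
    using Q Suc.prems by (simp only: peel_select_Suc emeasure_bind_pmf)
  also have "\<dots> \<le> (\<integral>\<^sup>+S. indicator {S. \<not> near_top Q s \<eta> S} S + ennreal \<delta> \<partial>measure_pmf ?p)"
    using step by (intro nn_integral_mono_AE) (auto simp: AE_measure_pmf_iff)
  also have "\<dots> = emeasure (measure_pmf ?p) {S. \<not> near_top Q s \<eta> S} + ennreal \<delta>"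
    by (subst nn_integral_add) (auto simp: measure_pmf.emeasure_space_1)
  also have "\<dots> \<le> ennreal (real m * \<delta>) + ennreal \<delta>"
    using Suc by (intro add_right_mono) (simp add: \<delta>_def)
  also have "\<dots> = ennreal (real (Suc m) * \<delta>)" using \<delta> by (simp add: ennreal_plus[symmetric] algebra_simps del: ennreal_plus)
  finally show ?case by (simp add: \<delta>_def del: peel_select.simps)
qed

text \<open>The counterpart of \<open>dp_cov_block_prob\<close> for peeling. The selection slack
  is chosen so that \<open>\<epsilon> \<eta> / (2 \<Delta>) = s\<close>, which gives each of the
  at most \<open>k\<^sup>2\<close> steps failure probability at most \<open>k\<^sup>2 exp
  (-s)\<close>.\<close>

lemma peel_release_prob:
  fixes X :: "nat \<Rightarrow> nat \<Rightarrow> real" and a :: real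
  assumes IJ: "finite I" "finite J" "card I = k" "card J = k" "1 \<le> k"
    and L: "0 < L" and \<rho>: "0 < \<rho>B" and n: "1 \<le> n" and s: "0 \<le> s"
    and \<Phi>: "Measurable.pred (PiM (I \<times> J) (\<lambda>_. borel)) \<Phi>"
  defines "r \<equiv> arg_min (peel_objective n k a \<rho>B) (\<lambda>r. 1 \<le> r \<and> r \<le> k)"
  defines "A \<equiv> (\<lambda>(u, v). (\<Sum>i=1..n. sclip L (X i u * X i v)) / real n)"
  assumes good: "\<And>S y. S \<subseteq> I \<times> J \<Longrightarrow> card S = k * r \<Longrightarrow>
      near_top (I \<times> J) (\<lambda>q. \<bar>A q\<bar>) (4 * L / real n * sqrt (real (k * r) / \<rho>B) * s) S \<Longrightarrow>
      (\<And>q. q \<in> S \<Longrightarrow> \<bar>y q - A q\<bar> \<le> sqrt (4 * L\<^sup>2 * real (k * r) / (\<rho>B * (real n)\<^sup>2)) * s) \<Longrightarrow>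
      (\<And>q. q \<in> I \<times> J - S \<Longrightarrow> y q = 0) \<Longrightarrow> \<Phi> y"
  shows "emeasure (peel_release n L X I J a \<rho>B) {y\<in>space (peel_release n L X I J a \<rho>B). \<not> \<Phi> y}
    \<le> ennreal (real k ^ 4 * exp (- s) + real k ^ 2 * (2 * exp (- s\<^sup>2 / 4)))"
proof -
  define m where "m = k * r"
  have r: "1 \<le> r" "r \<le> k" using arg_min_peel_objective[OF IJ(5)] by (auto simp: r_def)
  have m: "1 \<le> m" "m \<le> card (I \<times> J)" using r IJ by (auto simp: m_def card_cartesian_product)
  define \<Delta> where "\<Delta> = 2 * L / real n"
  have \<Delta>: "0 < \<Delta>" using L n by (simp add: \<Delta>_def)
  define \<epsilon> where "\<epsilon> = sqrt (\<rho>B / real m)"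
  have \<epsilon>: "0 < \<epsilon>" using \<rho> m by (auto simp: \<epsilon>_def)
  define \<eta> where "\<eta> = 4 * L / real n * sqrt (real m / \<rho>B) * s"
  (* The slack is calibrated so that a selection step fails with probability of order exp (-s). *)
  have \<epsilon>\<eta>: "\<epsilon> * \<eta> / (2 * \<Delta>) = s"
  proof -
    have "\<epsilon> * sqrt (real m / \<rho>B) = 1"
      unfolding \<epsilon>_def real_sqrt_mult[symmetric] using \<rho> m by simp
    moreover have "\<epsilon> * \<eta> / (2 * \<Delta>) = (\<epsilon> * sqrt (real m / \<rho>B)) * s * (4 * L / real n / (2 * \<Delta>))"
      by (simp add: \<eta>_def)
    moreover have "4 * L / real n / (2 * \<Delta>) = 1" using L n by (simp add: \<Delta>_def)
    ultimately show ?thesis using L by simp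
  qed
  define \<sigma> where "\<sigma> = sqrt (4 * L\<^sup>2 * real m / (\<rho>B * (real n)\<^sup>2))"
  have \<sigma>: "0 \<le> \<sigma>" using \<rho> by (simp add: \<sigma>_def)
  define B where "B = I \<times> J"
  have B: "finite B" "m \<le> card B" "card B = k\<^sup>2" using IJ m by (auto simp: B_def card_cartesian_product power2_eq_square)
  let ?G = "PiM B (\<lambda>_. std_normal_distribution)" and ?N = "PiM B (\<lambda>_. borel :: real measure)"
  interpret G: prob_space ?G by (rule prob_space_PiM_std_normal)
  define T where "T x = (\<lambda>q\<in>B. if q \<in> fst x then A q + \<sigma> * snd x q else 0)" for x :: "(nat \<times> nat) set \<times> (nat \<times> nat \<Rightarrow> real)"
  define sel where "sel = peel_select \<epsilon> \<Delta> B (\<lambda>q. \<bar>A q\<bar>) m"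
  let ?M = "measure_pmf sel \<Otimes>\<^sub>M ?G"
  have rel: "peel_release n L X I J a \<rho>B = distr ?M ?N T"
    unfolding peel_release_def Let_def IJ(3) r_def[symmetric] m_def[symmetric] T_def[abs_def] sel_def A_def[symmetric]
      B_def[symmetric] \<epsilon>_def \<Delta>_def \<sigma>_def split_beta' ..
  have [measurable]: "Measurable.pred (count_space UNIV \<Otimes>\<^sub>M PiM B (\<lambda>_. borel :: real measure)) (\<lambda>x. q \<in> fst x)" for q
    by (rule measurable_compose[OF measurable_fst]) simp
  have Tm[measurable]: "T \<in> measurable ?M ?N" unfolding T_def[abs_def] by measurable
  note [measurable] = \<Phi>[folded B_def]
  let ?bad1 = "{S. \<not> near_top B (\<lambda>q. \<bar>A q\<bar>) \<eta> S}" and ?bad2 = "{g\<in>space ?G. \<exists>q\<in>B. s < \<bar>g q\<bar>}"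
  have b2: "?bad2 \<in> sets ?G" 
  proof -
    have "?bad2 = (\<Union>q\<in>B. {g\<in>space ?G. s < \<bar>g q\<bar>})" by auto
    moreover have "{g\<in>space ?G. s < \<bar>g q\<bar>} \<in> sets ?G" if "q \<in> B" for q using that by measurable
    ultimately show ?thesis using B by (auto intro!: sets.finite_UN)
  qed
  have sub: "AE S in measure_pmf sel. S \<subseteq> B \<and> card S = m"
    unfolding sel_def using set_pmf_peel_select[OF B(1,2)] by (auto simp: AE_measure_pmf_iff subset_eq)
  have "emeasure (peel_release n L X I J a \<rho>B) {y\<in>space (peel_release n L X I J a \<rho>B). \<not> \<Phi> y}
      = emeasure ?M {x\<in>space ?M. \<not> \<Phi> (T x)}"
    unfolding rel space_distr by (subst emeasure_distr)
      (auto intro!: arg_cong2[where f = emeasure] dest: measurable_space[OF Tm])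
  also have "\<dots> \<le> emeasure ?M (?bad1 \<times> space ?G \<union> space (measure_pmf sel) \<times> ?bad2)"
  proof (rule emeasure_mono_AE)
    interpret PP: pair_prob_space "measure_pmf sel" ?G
      unfolding pair_prob_space_def pair_sigma_finite_def
      by (auto intro: prob_space_imp_sigma_finite measure_pmf.prob_space_axioms G.prob_space_axioms)
    have "AE x in ?M. fst x \<subseteq> B \<and> card (fst x) = m"
      using sub by (intro PP.AE_pair_measure) (auto simp: measurable_compose[OF measurable_fst])
    then show "AE x in ?M. x \<in> {x\<in>space ?M. \<not> \<Phi> (T x)} \<longrightarrow> x \<in> ?bad1 \<times> space ?G \<union> space (measure_pmf sel) \<times> ?bad2"
    proof eventually_elim
      case (elim x)
      note S = elim
      show ?case
      proof (intro impI, rule ccontr)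
      assume x: "x \<in> {x\<in>space ?M. \<not> \<Phi> (T x)}"
        and n: "x \<notin> ?bad1 \<times> space ?G \<union> space (measure_pmf sel) \<times> ?bad2"
      have sp: "snd x \<in> space ?G" using x by (auto simp: space_pair_measure)
      have g: "\<bar>snd x q\<bar> \<le> s" if "q \<in> B" for q using n sp that by (cases x) (auto simp: not_less)
      have nt: "near_top B (\<lambda>q. \<bar>A q\<bar>) \<eta> (fst x)" using n sp by (cases x) auto
      have "\<Phi> (T x)"
      proof (rule good[of "fst x"])
        show "near_top (I \<times> J) (\<lambda>q. \<bar>A q\<bar>) (4 * L / real n * sqrt (real (k * r) / \<rho>B) * s) (fst x)"
          using nt unfolding \<eta>_def m_def B_def .
        show "\<bar>T x q - A q\<bar> \<le> sqrt (4 * L\<^sup>2 * real (k * r) / (\<rho>B * (real n)\<^sup>2)) * s" if "q \<in> fst x" for q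
          unfolding m_def[symmetric] \<sigma>_def[symmetric]
          using that S g[of q] \<sigma> by (auto simp: T_def abs_mult intro!: mult_left_mono)
      qed (use S in \<open>auto simp: B_def m_def T_def\<close>)
      then show False using x by simp
      qed
    qed
  qed (use b2 in auto)
  also have "\<dots> \<le> emeasure ?M (?bad1 \<times> space ?G) + emeasure ?M (space (measure_pmf sel) \<times> ?bad2)"
    using b2 by (intro emeasure_subadditive) auto
  also have "\<dots> = emeasure (measure_pmf sel) ?bad1 + emeasure ?G ?bad2"
    using b2 by (simp add: G.emeasure_pair_measure_Times G.emeasure_space_1 measure_pmf.emeasure_space_1)
  also have "\<dots> \<le> ennreal (real m * (real (card B) * exp (- (\<epsilon> * \<eta> / (2 * \<Delta>))))) + ennreal (real (card B) * (2 * exp (- s\<^sup>2 / 4)))"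
    unfolding sel_def using B \<Delta> \<epsilon> s by (intro add_mono peel_select_utility std_normal_family_tail) auto
  also have "\<dots> = ennreal (real m * (real (card B) * exp (- s)) + real (card B) * (2 * exp (- s\<^sup>2 / 4)))"
    unfolding \<epsilon>\<eta> by (subst ennreal_plus) auto
  also have "\<dots> \<le> ennreal (real k ^ 4 * exp (- s) + real k ^ 2 * (2 * exp (- s\<^sup>2 / 4)))"
  proof (intro ennreal_leI add_mono)
    have "real m * real (card B) \<le> real (k\<^sup>2) * real (k\<^sup>2)" using B by (intro mult_mono) auto
    also have "\<dots> = real k ^ 4" by (simp add: power2_eq_square power4_eq_xxxx)
    finally show "real m * (real (card B) * exp (- s)) \<le> real k ^ 4 * exp (- s)"
      by (simp add: mult.assoc[symmetric] mult_right_mono)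
  qed (simp add: B)
  finally show ?thesis .
qed

section \<open>Concentration for sub-Gaussian vectors\<close>

lemma emeasure_Bex_le:
  assumes "finite I" "\<And>i. i \<in> I \<Longrightarrow> {x\<in>space M. Q i x} \<in> sets M"
    and "\<And>i. i \<in> I \<Longrightarrow> emeasure M {x\<in>space M. Q i x} \<le> ennreal c"
  shows "emeasure M {x\<in>space M. \<exists>i\<in>I. Q i x} \<le> ennreal (real (card I) * c)"
proof -
  have eq: "{x\<in>space M. \<exists>i\<in>I. Q i x} = (\<Union>i\<in>I. {x\<in>space M. Q i x})" by auto
  have "emeasure M {x\<in>space M. \<exists>i\<in>I. Q i x} \<le> (\<Sum>i\<in>I. emeasure M {x\<in>space M. Q i x})"
    unfolding eq using assms by (intro emeasure_subadditive_finite) auto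
  also have "\<dots> \<le> (\<Sum>i\<in>I. ennreal c)" by (intro sum_mono assms)
  also have "\<dots> = ennreal (real (card I) * c)"
    by (simp add: ennreal_of_nat_eq_real_of_nat ennreal_mult')
  finally show ?thesis .
qed

lemma sets_Collect_Bex:
  assumes "finite I" "\<And>i. i \<in> I \<Longrightarrow> {x\<in>space M. Q i x} \<in> sets M"
  shows "{x\<in>space M. \<exists>i\<in>I. Q i x} \<in> sets M"
proof -
  have "{x\<in>space M. \<exists>i\<in>I. Q i x} = (\<Union>i\<in>I. {x\<in>space M. Q i x})" by auto
  then show ?thesis using assms by auto
qed

text \<open>The infimum in the definition of the norm need not be attained, so the exponential
  moment is taken at \<open>2K\<close>, which is strictly above it.\<close>

lemma psi2_exp_moment:
  assumes "psi2_norm d P \<le> ennreal K" "0 < K" "L2_set v {1..d} = 1"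
  shows "(\<integral>\<^sup>+x. ennreal (exp ((\<Sum>i=1..d. x i * v i)\<^sup>2 / (4 * K\<^sup>2))) \<partial>P) \<le> 2"
proof -
  let ?S = "{t::real. 0 < t \<and> (\<integral>\<^sup>+x. ennreal (exp ((\<Sum>i=1..d. x i * v i)\<^sup>2 / t\<^sup>2)) \<partial>P) \<le> 2}"
  have "(INF t\<in>?S. ennreal t) \<le> psi2_norm d P"
    unfolding psi2_norm_def using assms(3) by (intro SUP_upper2[of v]) auto
  also have "\<dots> < ennreal (2 * K)" using assms by (auto intro: le_less_trans simp: ennreal_less_iff)
  finally obtain t where t: "t \<in> ?S" "ennreal t < ennreal (2 * K)" by (auto simp: INF_less_iff)
  then have t': "0 < t" "t \<le> 2 * K" by (auto simp: ennreal_less_iff)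
  have "t\<^sup>2 \<le> 4 * K\<^sup>2" using power_mono[OF t'(2), of 2] t'(1) by simp
  then have "(\<integral>\<^sup>+x. ennreal (exp ((\<Sum>i=1..d. x i * v i)\<^sup>2 / (4 * K\<^sup>2))) \<partial>P)
      \<le> (\<integral>\<^sup>+x. ennreal (exp ((\<Sum>i=1..d. x i * v i)\<^sup>2 / t\<^sup>2)) \<partial>P)"
    using t' by (intro nn_integral_mono ennreal_leI) (simp add: divide_left_mono)
  also have "\<dots> \<le> 2" using t by simp
  finally show ?thesis .
qed

lemma measurable_exp_square: "(\<lambda>t :: real. ennreal (exp (t\<^sup>2 / 4))) \<in> borel_measurable std_normal_distribution"
  by measurable

text \<open>The scale \<open>\<kappa>\<close> is in squared units: a multiple of the squared
  sub-Gaussian norm.\<close>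

locale subgaussian_vector = prob_space P for P :: "(nat \<Rightarrow> real) measure" +
  fixes d :: nat and \<kappa> :: real
  assumes sets_P: "sets P = sets (vec_space d)" and \<kappa>: "0 < \<kappa>"
    and exp_moment: "\<And>v. L2_set v {1..d} = 1 \<Longrightarrow> (\<integral>\<^sup>+x. ennreal (exp ((\<Sum>i=1..d. x i * v i)\<^sup>2 / \<kappa>)) \<partial>P) \<le> 2"
begin

lemma measurable_coord[measurable]: "u \<in> {1..d} \<Longrightarrow> (\<lambda>x. x u) \<in> borel_measurable P"
  by (subst measurable_cong_sets[OF sets_P refl]) (rule measurable_component_singleton)

lemma exp_coord:
  assumes "u \<in> {1..d}"
  shows "(\<integral>\<^sup>+x. ennreal (exp ((x u)\<^sup>2 / \<kappa>)) \<partial>P) \<le> 2"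
proof -
  have "L2_set (\<lambda>i. if i = u then 1 else 0) {1..d} = 1"
    using assms by (simp add: L2_set_def if_distrib[of "\<lambda>x. x\<^sup>2"] cong: if_cong)
  from exp_moment[OF this] show ?thesis
    using assms by (simp add: if_distrib[of "\<lambda>x. _ * x"] cong: if_cong)
qed

lemma coord_tail:
  assumes "u \<in> {1..d}"
  shows "emeasure P {x\<in>space P. s < (x u)\<^sup>2} \<le> ennreal (2 * exp (- (s / \<kappa>)))"
proof -
  have "emeasure P {x\<in>space P. s / \<kappa> < (x u)\<^sup>2 / \<kappa>} \<le> ennreal (exp (- (s / \<kappa>)) * 2)"
    using exp_coord[OF assms] assms by (intro emeasure_tail_exp) auto
  then show ?thesis using \<kappa> by (simp add: divide_less_cancel mult.commute)
qed

text \<open>Completing the square bounds the exponent by \<open>\<kappa>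
  \<bar>w\<bar>\<^sup>2/4\<close> plus the square of the normalised linear form over
  \<open>\<kappa>\<close>, whose exponential moment is at most two.\<close>

lemma exp_linear:
  "(\<integral>\<^sup>+x. ennreal (exp (\<Sum>i=1..d. x i * w i)) \<partial>P) \<le> ennreal (2 * exp (\<kappa> * (\<Sum>i=1..d. (w i)\<^sup>2) / 4))"
proof (cases "L2_set w {1..d} = 0")
  case True
  then have "w i = 0" if "i \<in> {1..d}" for i using that by (simp add: L2_set_eq_0_iff)
  then have "(\<integral>\<^sup>+x. ennreal (exp (\<Sum>i=1..d. x i * w i)) \<partial>P) = 1" by (simp add: emeasure_space_1)
  moreover have "1 \<le> exp (\<kappa> * (\<Sum>i=1..d. (w i)\<^sup>2) / 4)"
    using \<kappa> by (simp add: sum_nonneg less_imp_le)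
  then have "1 \<le> 2 * exp (\<kappa> * (\<Sum>i=1..d. (w i)\<^sup>2) / 4)" by linarith
  ultimately show ?thesis by (simp add: ennreal_1[symmetric] del: ennreal_1)
next
  case False
  define W where "W = L2_set w {1..d}"
  have "0 < W" using False L2_set_nonneg[of w "{1..d}"] unfolding W_def by linarith
  moreover have "W\<^sup>2 = (\<Sum>i=1..d. (w i)\<^sup>2)" by (simp add: W_def L2_set_def sum_nonneg)
  ultimately have W: "0 < W" "W\<^sup>2 = (\<Sum>i=1..d. (w i)\<^sup>2)" .
  define v where "v i = w i / W" for i
  have v1: "L2_set v {1..d} = 1"
  proof -
    have "(\<Sum>i=1..d. (v i)\<^sup>2) = (\<Sum>i=1..d. (w i)\<^sup>2) / W\<^sup>2"
      by (simp add: v_def power_divide sum_divide_distrib)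
    also have "\<dots> = 1" unfolding W(2)[symmetric] using W(1) by simp
    finally show ?thesis by (simp add: L2_set_def)
  qed
  let ?Y = "\<lambda>x. \<Sum>i=1..d. x i * v i"
  have "(\<Sum>i=1..d. x i * w i) \<le> \<kappa> * W\<^sup>2 / 4 + (?Y x)\<^sup>2 / \<kappa>" for x
  proof -
    have "(\<Sum>i=1..d. x i * w i) = W * ?Y x" using W by (simp add: v_def sum_distrib_left)
    moreover have "0 \<le> (?Y x - \<kappa> * W / 2)\<^sup>2 / \<kappa>" using \<kappa> by simp
    moreover have "(?Y x - \<kappa> * W / 2)\<^sup>2 / \<kappa> = \<kappa> * W\<^sup>2 / 4 + (?Y x)\<^sup>2 / \<kappa> - W * ?Y x"
      using \<kappa> by (simp add: power2_eq_square field_simps)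
    ultimately show ?thesis by linarith
  qed
  then have "(\<integral>\<^sup>+x. ennreal (exp (\<Sum>i=1..d. x i * w i)) \<partial>P) \<le> (\<integral>\<^sup>+x. ennreal (exp (\<kappa> * W\<^sup>2 / 4)) * ennreal (exp ((?Y x)\<^sup>2 / \<kappa>)) \<partial>P)"
    by (intro nn_integral_mono) (simp add: ennreal_mult[symmetric] exp_add[symmetric])
  also have "\<dots> = ennreal (exp (\<kappa> * W\<^sup>2 / 4)) * (\<integral>\<^sup>+x. ennreal (exp ((?Y x)\<^sup>2 / \<kappa>)) \<partial>P)"
    by (rule nn_integral_cmult) measurable
  also have "\<dots> \<le> ennreal (exp (\<kappa> * W\<^sup>2 / 4)) * 2" by (intro mult_left_mono exp_moment v1) auto
  also have "\<dots> = ennreal (2 * exp (\<kappa> * W\<^sup>2 / 4))" by (simp add: ennreal_mult' mult.commute)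
  finally show ?thesis by (simp add: W(2))
qed

text \<open>Gaussian decoupling: \<open>exp (\<bar>x\<bar>\<^sup>2/(2\<kappa>))\<close> is the
  average of \<open>exp (\<langle>x, g\<rangle>/\<surd>\<kappa>)\<close> over a standard Gaussian
  \<open>g\<close>. Exchanging the two integrals leaves a linear exponential moment of
  \<open>x\<close>, and then a product of one-dimensional Gaussian integrals.\<close>

lemma exp_norm:
  assumes I: "I \<subseteq> {1..d}"
  shows "(\<integral>\<^sup>+x. ennreal (exp ((\<Sum>i\<in>I. (x i)\<^sup>2) / (2 * \<kappa>))) \<partial>P) \<le> ennreal (2 * sqrt 2 ^ card I)"
proof -
  have fin: "finite I" using I finite_subset by blast
  define c where "c = 1 / sqrt \<kappa>"
  have c: "c\<^sup>2 = 1 / \<kappa>" using \<kappa> by (simp add: c_def power_divide)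
  let ?G = "PiM I (\<lambda>_. std_normal_distribution)"
  interpret G: product_prob_space "\<lambda>_. std_normal_distribution" I
    by (intro product_prob_spaceI prob_space_normal_density) simp
  interpret PG: pair_sigma_finite P ?G
    by (simp add: pair_sigma_finite_def prob_space_imp_sigma_finite prob_space_PiM_std_normal prob_space_axioms)
  have inner: "(\<integral>\<^sup>+g. ennreal (exp (\<Sum>i\<in>I. c * x i * g i)) \<partial>?G) = ennreal (exp ((\<Sum>i\<in>I. (x i)\<^sup>2) / (2 * \<kappa>)))" for x
  proof -
    have "(\<integral>\<^sup>+g. ennreal (exp (\<Sum>i\<in>I. c * x i * g i)) \<partial>?G) = (\<integral>\<^sup>+g. (\<Prod>i\<in>I. ennreal (exp (c * x i * g i))) \<partial>?G)"
      using fin by (simp add: exp_sum prod_ennreal)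
    also have "\<dots> = (\<Prod>i\<in>I. \<integral>\<^sup>+g. ennreal (exp (c * x i * g)) \<partial>std_normal_distribution)"
      using fin by (intro G.product_nn_integral_prod) auto
    also have "\<dots> = (\<Prod>i\<in>I. ennreal (exp ((x i)\<^sup>2 / (2 * \<kappa>))))"
      by (simp add: std_normal_exp_linear power_mult_distrib c) (simp add: mult.commute)
    also have "\<dots> = ennreal (exp ((\<Sum>i\<in>I. (x i)\<^sup>2) / (2 * \<kappa>)))"
      using fin by (simp add: prod_ennreal exp_sum[symmetric] sum_divide_distrib)
    finally show ?thesis .
  qed
  have mx: "i \<in> I \<Longrightarrow> (\<lambda>x. x i) \<in> borel_measurable P" for i using I by auto
  have m[measurable]: "(\<lambda>(x, g). ennreal (exp (\<Sum>i\<in>I. c * x i * g i))) \<in> borel_measurable (P \<Otimes>\<^sub>M ?G)"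
  proof -
    have "(\<lambda>z. fst z i) \<in> borel_measurable (P \<Otimes>\<^sub>M ?G)" if "i \<in> I" for i
      using mx[OF that] by measurable
    moreover have "(\<lambda>z. snd z i) \<in> borel_measurable (P \<Otimes>\<^sub>M ?G)" if "i \<in> I" for i
      using that by measurable
    ultimately show ?thesis unfolding split_beta'
      by (intro measurable_compose[OF _ measurable_ennreal] measurable_compose[OF _ borel_measurable_exp]
          borel_measurable_sum borel_measurable_times borel_measurable_const) auto
  qed
  have "(\<integral>\<^sup>+x. ennreal (exp ((\<Sum>i\<in>I. (x i)\<^sup>2) / (2 * \<kappa>))) \<partial>P)
      = (\<integral>\<^sup>+x. (\<integral>\<^sup>+g. ennreal (exp (\<Sum>i\<in>I. c * x i * g i)) \<partial>?G) \<partial>P)" by (simp add: inner)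
  also have "\<dots> = (\<integral>\<^sup>+g. (\<integral>\<^sup>+x. ennreal (exp (\<Sum>i\<in>I. c * x i * g i)) \<partial>P) \<partial>?G)"
    using PG.Fubini'[OF m] by simp
  also have "\<dots> \<le> (\<integral>\<^sup>+g. 2 * (\<Prod>i\<in>I. ennreal (exp ((g i)\<^sup>2 / 4))) \<partial>?G)"
  proof (intro nn_integral_mono)
    fix g :: "nat \<Rightarrow> real"
    let ?w = "\<lambda>i. if i \<in> I then c * g i else 0"
    have "(\<Sum>i\<in>I. c * x i * g i) = (\<Sum>i=1..d. x i * ?w i)" for x
      using I by (intro sum.mono_neutral_cong_left) auto
    moreover have "(\<Sum>i=1..d. (?w i)\<^sup>2) = (\<Sum>i\<in>I. (g i)\<^sup>2) / \<kappa>"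
    proof -
      have "(\<Sum>i=1..d. (?w i)\<^sup>2) = (\<Sum>i\<in>I. (c * g i)\<^sup>2)"
        using I by (intro sum.mono_neutral_cong_right) auto
      then show ?thesis by (simp add: power_mult_distrib c sum_divide_distrib)
    qed
    ultimately have "(\<integral>\<^sup>+x. ennreal (exp (\<Sum>i\<in>I. c * x i * g i)) \<partial>P) \<le> ennreal (2 * exp ((\<Sum>i\<in>I. (g i)\<^sup>2) / 4))"
      using exp_linear[of ?w] \<kappa> by simp
    also have "\<dots> = 2 * (\<Prod>i\<in>I. ennreal (exp ((g i)\<^sup>2 / 4)))"
      using fin by (simp add: prod_ennreal exp_sum[symmetric] sum_divide_distrib ennreal_mult')
    finally show "(\<integral>\<^sup>+x. ennreal (exp (\<Sum>i\<in>I. c * x i * g i)) \<partial>P) \<le> 2 * (\<Prod>i\<in>I. ennreal (exp ((g i)\<^sup>2 / 4)))" .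
  qed
  also have "\<dots> = 2 * (\<integral>\<^sup>+g. (\<Prod>i\<in>I. ennreal (exp ((g i)\<^sup>2 / 4))) \<partial>?G)"
  proof (intro nn_integral_cmult borel_measurable_prod_ennreal)
    fix i assume "i \<in> I"
    then have 1: "(\<lambda>g. g i) \<in> ?G \<rightarrow>\<^sub>M std_normal_distribution" by (rule measurable_component_singleton)
    note 2 = measurable_exp_square
    show "(\<lambda>g. ennreal (exp ((g i)\<^sup>2 / 4))) \<in> borel_measurable ?G" by (rule measurable_compose[OF 1 2])
  qed
  also have "(\<integral>\<^sup>+g. (\<Prod>i\<in>I. ennreal (exp ((g i)\<^sup>2 / 4))) \<partial>?G) = (\<Prod>i\<in>I. \<integral>\<^sup>+g. ennreal (exp (g\<^sup>2 / 4)) \<partial>std_normal_distribution)"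
    using fin by (intro G.product_nn_integral_prod[of I "\<lambda>_ g. ennreal (exp (g\<^sup>2 / 4))"]) auto
  also have "2 * \<dots> = ennreal (2 * sqrt 2 ^ card I)"
    by (simp add: std_normal_exp_square ennreal_power ennreal_mult')
  finally show ?thesis .
qed

lemma norm_tail:
  assumes I: "I \<subseteq> {1..d}"
  shows "emeasure P {x\<in>space P. s < (\<Sum>i\<in>I. (x i)\<^sup>2)} \<le> ennreal (exp (- (s / (2 * \<kappa>))) * (2 * sqrt 2 ^ card I))"
proof -
  have [measurable]: "i \<in> I \<Longrightarrow> (\<lambda>x. x i) \<in> borel_measurable P" for i using I by auto
  have "emeasure P {x\<in>space P. s / (2 * \<kappa>) < (\<Sum>i\<in>I. (x i)\<^sup>2) / (2 * \<kappa>)}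
      \<le> ennreal (exp (- (s / (2 * \<kappa>))) * (2 * sqrt 2 ^ card I))"
    by (intro emeasure_tail_exp exp_norm I) measurable
  then show ?thesis using \<kappa> by (simp add: divide_less_cancel)
qed

lemma exp_product:
  assumes "u \<in> {1..d}" "v \<in> {1..d}"
  shows "integrable P (\<lambda>x. exp (\<bar>x u * x v\<bar> / \<kappa>))" "(\<integral>x. exp (\<bar>x u * x v\<bar> / \<kappa>) \<partial>P) \<le> 4"
proof -
  note [measurable] = measurable_coord[OF assms(1)] measurable_coord[OF assms(2)]
  have "exp (\<bar>x u * x v\<bar> / \<kappa>) \<le> exp ((x u)\<^sup>2 / \<kappa>) + exp ((x v)\<^sup>2 / \<kappa>)" for x
  proof -
    have "\<bar>x u * x v\<bar> \<le> max ((x u)\<^sup>2) ((x v)\<^sup>2)"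
    proof (cases "\<bar>x u\<bar> \<le> \<bar>x v\<bar>")
      case True
      then have "\<bar>x u * x v\<bar> \<le> \<bar>x v\<bar> * \<bar>x v\<bar>" by (simp only: abs_mult mult_right_mono abs_ge_zero)
      then show ?thesis by (simp add: power2_eq_square le_max_iff_disj)
    next
      case False
      then have "\<bar>x u\<bar> * \<bar>x v\<bar> \<le> \<bar>x u\<bar> * \<bar>x u\<bar>" by (intro mult_left_mono) auto
      then show ?thesis by (simp add: abs_mult power2_eq_square le_max_iff_disj)
    qed
    then have "\<bar>x u * x v\<bar> / \<kappa> \<le> max ((x u)\<^sup>2) ((x v)\<^sup>2) / \<kappa>" using \<kappa> by (simp add: divide_right_mono)
    then have "exp (\<bar>x u * x v\<bar> / \<kappa>) \<le> exp (max ((x u)\<^sup>2) ((x v)\<^sup>2) / \<kappa>)" by simp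
    also have "\<dots> \<le> exp ((x u)\<^sup>2 / \<kappa>) + exp ((x v)\<^sup>2 / \<kappa>)" by (auto simp: max_def)
    finally show ?thesis .
  qed
  then have "(\<integral>\<^sup>+x. ennreal (exp (\<bar>x u * x v\<bar> / \<kappa>)) \<partial>P)
      \<le> (\<integral>\<^sup>+x. ennreal (exp ((x u)\<^sup>2 / \<kappa>)) + ennreal (exp ((x v)\<^sup>2 / \<kappa>)) \<partial>P)"
    by (intro nn_integral_mono) (simp add: ennreal_plus[symmetric] del: ennreal_plus)
  also have "\<dots> = (\<integral>\<^sup>+x. ennreal (exp ((x u)\<^sup>2 / \<kappa>)) \<partial>P) + (\<integral>\<^sup>+x. ennreal (exp ((x v)\<^sup>2 / \<kappa>)) \<partial>P)"
    by (rule nn_integral_add) measurable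
  also have "\<dots> \<le> 2 + 2" by (intro add_mono exp_coord assms)
  finally have le: "(\<integral>\<^sup>+x. ennreal (exp (\<bar>x u * x v\<bar> / \<kappa>)) \<partial>P) \<le> ennreal 4" by simp
  show int: "integrable P (\<lambda>x. exp (\<bar>x u * x v\<bar> / \<kappa>))"
    by (intro integrableI_nonneg) (use le in \<open>auto intro: le_less_trans\<close>)
  show "(\<integral>x. exp (\<bar>x u * x v\<bar> / \<kappa>) \<partial>P) \<le> 4"
  proof -
    have "ennreal (\<integral>x. exp (\<bar>x u * x v\<bar> / \<kappa>) \<partial>P) = (\<integral>\<^sup>+x. ennreal (exp (\<bar>x u * x v\<bar> / \<kappa>)) \<partial>P)"
      using int by (intro nn_integral_eq_integral[symmetric]) auto
    also note le
    finally show ?thesis by (subst (asm) ennreal_le_iff) auto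
  qed
qed

text \<open>Only products beyond \<open>L\<close> are affected, and there
  \<open>\<bar>y\<bar>\<close> is at most a multiple of \<open>exp (-L/(2\<kappa>)) exp
  (\<bar>y\<bar>/\<kappa>)\<close>, which is integrable.\<close>

lemma truncation_bias:
  assumes "u \<in> {1..d}" "v \<in> {1..d}" "0 < L"
  shows "\<bar>(\<integral>x. sclip L (x u * x v) \<partial>P) - (\<integral>x. x u * x v \<partial>P)\<bar> \<le> 8 * \<kappa> * exp (- (L / (2 * \<kappa>)))"
proof -
  note [measurable] = measurable_coord[OF assms(1)] measurable_coord[OF assms(2)]
  note exp = exp_product[OF assms(1,2)]
  have y_le: "y \<le> 2 * \<kappa> * exp (y / (2 * \<kappa>))" for y
  proof -
    have "y / (2 * \<kappa>) \<le> exp (y / (2 * \<kappa>))" using exp_ge_add_one_self[of "y / (2 * \<kappa>)"] by linarith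
    then show ?thesis using \<kappa> by (simp add: divide_le_eq mult_ac)
  qed
  have pt: "\<bar>sclip L y - y\<bar> \<le> 2 * \<kappa> * exp (- (L / (2 * \<kappa>))) * exp (\<bar>y\<bar> / \<kappa>)" for y
  proof (cases "\<bar>y\<bar> \<le> L")
    case True
    then have "sclip L y = y" using assms(3) by (cases "y = 0") (auto simp: sclip_def min_def le_divide_eq)
    then show ?thesis using \<kappa> by simp
  next
    case False
    define c where "c = 1 - min 1 (L / \<bar>y\<bar>)"
    have c: "0 \<le> c" "c \<le> 1" using assms(3) by (auto simp: c_def)
    have "sclip L y - y = - (y * c)" by (simp add: sclip_def c_def right_diff_distrib)
    then have "\<bar>sclip L y - y\<bar> = \<bar>y\<bar> * c" using c by (simp add: abs_mult)
    also have "\<dots> \<le> \<bar>y\<bar>" using c mult_left_mono[of c 1 "\<bar>y\<bar>"] by simp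
    finally have "\<bar>sclip L y - y\<bar> \<le> \<bar>y\<bar>" .
    also have "\<dots> \<le> 2 * \<kappa> * exp (\<bar>y\<bar> / (2 * \<kappa>))" by (rule y_le)
    also have "\<dots> \<le> 2 * \<kappa> * (exp (- (L / (2 * \<kappa>))) * exp (\<bar>y\<bar> / \<kappa>))"
    proof -
      have "L / (2 * \<kappa>) \<le> \<bar>y\<bar> / (2 * \<kappa>)" using False \<kappa> by (intro divide_right_mono) auto
      moreover have "\<bar>y\<bar> / \<kappa> = \<bar>y\<bar> / (2 * \<kappa>) + \<bar>y\<bar> / (2 * \<kappa>)" by simp
      ultimately have "\<bar>y\<bar> / (2 * \<kappa>) \<le> - (L / (2 * \<kappa>)) + \<bar>y\<bar> / \<kappa>" by linarith
      then show ?thesis using \<kappa> by (simp add: exp_add[symmetric])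
    qed
    finally show ?thesis by simp
  qed
  have iY: "integrable P (\<lambda>x. x u * x v)"
  proof (rule Bochner_Integration.integrable_bound[OF integrable_mult_right[OF exp(1), of "2 * \<kappa>"]])
    have "\<bar>y\<bar> \<le> 2 * \<kappa> * exp (\<bar>y\<bar> / \<kappa>)" for y
    proof -
      have "\<bar>y\<bar> \<le> 2 * \<kappa> * exp (\<bar>y\<bar> / (2 * \<kappa>))" by (rule y_le)
      also have "\<dots> \<le> 2 * \<kappa> * exp (\<bar>y\<bar> / \<kappa>)" using \<kappa> by (intro mult_left_mono) (auto intro!: divide_left_mono)
      finally show ?thesis .
    qed
    then show "AE x in P. norm (x u * x v) \<le> norm (2 * \<kappa> * exp (\<bar>x u * x v\<bar> / \<kappa>))" using \<kappa> by simp
  qed measurable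
  have iS: "integrable P (\<lambda>x. sclip L (x u * x v))"
  proof (rule integrable_const_bound[where B = L])
    show "AE x in P. norm (sclip L (x u * x v)) \<le> L" using assms(3) by (simp add: sclip_abs_le)
    show "(\<lambda>x. sclip L (x u * x v)) \<in> borel_measurable P" unfolding sclip_def by measurable
  qed
  have "\<bar>(\<integral>x. sclip L (x u * x v) \<partial>P) - (\<integral>x. x u * x v \<partial>P)\<bar> = \<bar>\<integral>x. sclip L (x u * x v) - x u * x v \<partial>P\<bar>"
    using iY iS by simp
  also have "\<dots> \<le> (\<integral>x. \<bar>sclip L (x u * x v) - x u * x v\<bar> \<partial>P)" by (rule integral_abs_bound)
  also have "\<dots> \<le> (\<integral>x. 2 * \<kappa> * exp (- (L / (2 * \<kappa>))) * exp (\<bar>x u * x v\<bar> / \<kappa>) \<partial>P)"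
    using iY iS exp(1) pt by (intro integral_mono) auto
  also have "\<dots> = 2 * \<kappa> * exp (- (L / (2 * \<kappa>))) * (\<integral>x. exp (\<bar>x u * x v\<bar> / \<kappa>) \<partial>P)" by simp
  also have "\<dots> \<le> 2 * \<kappa> * exp (- (L / (2 * \<kappa>))) * 4" using exp(2) \<kappa> by (intro mult_left_mono) auto
  finally show ?thesis by simp
qed

end

text \<open>Hoeffding's inequality for the coordinates of a product measure.\<close>

lemma PiM_mean_deviation:
  assumes P: "prob_space P" and f[measurable]: "f \<in> borel_measurable P" and L: "\<And>x. \<bar>f x\<bar> \<le> L" "0 < L"
    and n: "1 \<le> n" and \<epsilon>: "0 \<le> \<epsilon>"
  shows "emeasure (PiM {1..n} (\<lambda>_. P)) {X\<in>space (PiM {1..n} (\<lambda>_. P)). \<epsilon> < \<bar>(\<Sum>i=1..n. f (X i)) / real n - (\<integral>x. f x \<partial>P)\<bar>}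
    \<le> ennreal (2 * exp (- (real n * \<epsilon>\<^sup>2 / (2 * L\<^sup>2))))"
proof -
  let ?M = "PiM {1..n} (\<lambda>_. P)"
  interpret P: prob_space P by fact
  interpret M: prob_space ?M by (intro prob_space_PiM P)
  have comp: "distr ?M borel (\<lambda>X. f (X i)) = distr P borel f" if "i \<in> {1..n}" for i
  proof -
    have "distr P borel f = distr (distr ?M P (\<lambda>X. X i)) borel f"
      using distr_PiM_component[of "{1..n}" "\<lambda>_. P" i] P that by simp
    then show ?thesis using that by (simp add: distr_distr comp_def)
  qed
  have ind: "M.indep_vars (\<lambda>_. borel) (\<lambda>i X. f (X i)) {1..n}"
  proof (subst M.indep_vars_iff_distr_eq_PiM')
    have "distr ?M (PiM {1..n} (\<lambda>_. borel)) (\<lambda>X. \<lambda>i\<in>{1..n}. f (X i)) = PiM {1..n} (\<lambda>i. distr P borel f)"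
      by (intro distr_PiM_coordinatewise) (auto intro: P)
    also have "\<dots> = PiM {1..n} (\<lambda>i. distr ?M borel (\<lambda>X. f (X i)))"
      using comp by (intro PiM_cong) auto
    finally show "distr ?M (PiM {1..n} (\<lambda>_. borel)) (\<lambda>X. \<lambda>i\<in>{1..n}. f (X i)) = PiM {1..n} (\<lambda>i. distr ?M borel (\<lambda>X. f (X i)))" .
  qed (use n in auto)
  interpret H: Hoeffding_ineq ?M "{1..n}" "\<lambda>i X. f (X i)" "\<lambda>_. - L" "\<lambda>_. L" "\<Sum>i=1..n. M.expectation (\<lambda>X. f (X i))"
    by unfold_locales (use ind L(1) in \<open>auto simp: abs_le_iff minus_le_iff\<close>)
  have e: "M.expectation (\<lambda>X. f (X i)) = (\<integral>x. f x \<partial>P)" if "i \<in> {1..n}" for i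
  proof -
    have "M.expectation (\<lambda>X. f (X i)) = (\<integral>x. x \<partial>distr ?M borel (\<lambda>X. f (X i)))" using that by (subst integral_distr) auto
    also have "\<dots> = (\<integral>x. f x \<partial>P)" unfolding comp[OF that] by (subst integral_distr) auto
    finally show ?thesis .
  qed
  have "M.prob {X\<in>space ?M. real n * \<epsilon> \<le> \<bar>(\<Sum>i=1..n. f (X i)) - (\<Sum>i=1..n. M.expectation (\<lambda>X. f (X i)))\<bar>}
      \<le> 2 * exp (- 2 * (real n * \<epsilon>)\<^sup>2 / (\<Sum>i=1..n. (L - - L)\<^sup>2))"
    using \<epsilon> L n by (intro H.Hoeffding_ineq_abs_ge) auto
  also have "(\<Sum>i=1..n. M.expectation (\<lambda>X. f (X i))) = real n * (\<integral>x. f x \<partial>P)" using e by simp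
  also have "- 2 * (real n * \<epsilon>)\<^sup>2 / (\<Sum>i=1..n. (L - - L)\<^sup>2) = - (real n * \<epsilon>\<^sup>2 / (2 * L\<^sup>2))"
    using n L by (simp add: power2_eq_square field_simps)
  finally have "M.prob {X\<in>space ?M. real n * \<epsilon> \<le> \<bar>(\<Sum>i=1..n. f (X i)) - real n * (\<integral>x. f x \<partial>P)\<bar>}
      \<le> 2 * exp (- (real n * \<epsilon>\<^sup>2 / (2 * L\<^sup>2)))" .
  moreover have "\<epsilon> < \<bar>S / real n - \<mu>\<bar> \<Longrightarrow> real n * \<epsilon> \<le> \<bar>S - real n * \<mu>\<bar>" for S \<mu>
  proof -
    assume a: "\<epsilon> < \<bar>S / real n - \<mu>\<bar>"
    have "S - real n * \<mu> = real n * (S / real n - \<mu>)" using n by (simp add: right_diff_distrib)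
    then have "\<bar>S - real n * \<mu>\<bar> = real n * \<bar>S / real n - \<mu>\<bar>" by (simp only: abs_mult abs_of_nat)
    then show ?thesis using a by (simp add: mult_left_mono)
  qed
  then have "M.prob {X\<in>space ?M. \<epsilon> < \<bar>(\<Sum>i=1..n. f (X i)) / real n - (\<integral>x. f x \<partial>P)\<bar>}
     \<le> M.prob {X\<in>space ?M. real n * \<epsilon> \<le> \<bar>(\<Sum>i=1..n. f (X i)) - real n * (\<integral>x. f x \<partial>P)\<bar>}"
    by (intro M.finite_measure_mono) auto
  ultimately show ?thesis unfolding M.emeasure_eq_measure by (intro ennreal_leI) linarith
qed

section \<open>Typical data sets and the error of peeling\<close>

lemma P_class_subgaussian:
  assumes "P \<in> P_class d \<alpha> K M0 M" "0 < K"
  shows "subgaussian_vector P d (4 * K\<^sup>2)"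
proof -
  have P: "prob_space P" "sets P = sets (vec_space d)" "psi2_norm d P \<le> ennreal K" using assms by (auto simp: P_class_def)
  interpret prob_space P by fact
  show ?thesis
    by unfold_locales (use P assms psi2_exp_moment in auto)
qed

lemma P_class_covariance:
  assumes "P \<in> P_class d \<alpha> K M0 M" "u \<in> {1..d}" "v \<in> {1..d}"
  shows "covariance P (u, v) = (\<integral>x. x u * x v \<partial>P)"
  using assms by (simp add: P_class_def covariance_def)

lemma exp_neg_nat_ln: "1 \<le> n \<Longrightarrow> exp (- (real m * ln (real n))) = 1 / real n ^ m"
  by (simp add: exp_minus exp_of_nat_mult divide_inverse)

lemma sclip_id: "\<bar>z\<bar> \<le> L \<Longrightarrow> sclip L z = z"
  by (cases "z = 0") (auto simp: sclip_def min_def le_divide_eq)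

lemma vclip_id:
  assumes "finite A" "L2_set z A \<le> R" "i \<in> A"
  shows "vclip A R z i = z i"
proof (cases "L2_set z A = 0")
  case True
  then have "z i = 0" using assms by (simp add: L2_set_eq_0_iff)
  then show ?thesis by (simp add: vclip_def)
next
  case False
  then have "0 < L2_set z A" using L2_set_nonneg[of z A] by linarith
  then have "1 \<le> R / L2_set z A" using assms(2) by simp
  then show ?thesis by (simp add: vclip_def)
qed

text \<open>The error on the selected set is noise plus sampling error. Off the selected set it is
  the entry itself: by \<open>near_top\<close> it exceeds no selected entry by more than
  \<open>\<delta> = \<eta> + 2e\<close>, so it is at most the average of the selected entries plus
  \<open>\<delta>\<close>, that is \<open>a/r + \<delta>\<close>. Multiplying the largest entry by
  the absolute sum \<open>k a\<close> bounds the sum of squares.\<close>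

lemma peel_error:
  fixes a \<eta> e \<tau> :: real
  assumes B: "finite B" "S \<subseteq> B" "card S = k * r" "1 \<le> k" "1 \<le> r" and a: "0 \<le> a"
    and l1: "(\<Sum>q\<in>B. \<bar>Sg q\<bar>) \<le> real k * a" and dev: "\<And>q. q \<in> B \<Longrightarrow> \<bar>A q - Sg q\<bar> \<le> e"
    and top: "near_top B (\<lambda>q. \<bar>A q\<bar>) \<eta> S" and \<eta>: "0 \<le> \<eta>" and e: "0 \<le> e"
    and noise: "\<And>q. q \<in> S \<Longrightarrow> \<bar>y q - A q\<bar> \<le> \<tau>" and y0: "\<And>q. q \<in> B - S \<Longrightarrow> y q = 0"
  shows "(\<Sum>q\<in>B. (y q - Sg q)\<^sup>2) \<le> 2 * real k * a\<^sup>2 / real r + real (k * r) * (\<eta>\<^sup>2 + 6 * e\<^sup>2 + 2 * \<tau>\<^sup>2)"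
proof -
  define \<delta> where "\<delta> = \<eta> + 2 * e"
  have \<delta>: "0 \<le> \<delta>" "\<delta>\<^sup>2 \<le> 2 * \<eta>\<^sup>2 + 8 * e\<^sup>2"
    using \<eta> e zero_le_power2[of "\<eta> - 2 * e"] by (auto simp: \<delta>_def power2_sum power2_diff power_mult_distrib)
  have sq: "(x + z)\<^sup>2 \<le> 2 * x\<^sup>2 + 2 * z\<^sup>2" for x z :: real
    using zero_le_power2[of "x - z"] by (simp add: power2_sum power2_diff)
  have kr: "0 < real (k * r)" using B by simp
  have onS: "(y q - Sg q)\<^sup>2 \<le> 2 * \<tau>\<^sup>2 + 2 * e\<^sup>2" if "q \<in> S" for q
  proof -
    have "(y q - Sg q)\<^sup>2 \<le> 2 * (y q - A q)\<^sup>2 + 2 * (A q - Sg q)\<^sup>2" using sq[of "y q - A q" "A q - Sg q"] by simp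
    moreover have "(y q - A q)\<^sup>2 \<le> \<tau>\<^sup>2" using noise[OF that] by (metis abs_ge_zero power2_abs power_mono)
    moreover have "(A q - Sg q)\<^sup>2 \<le> e\<^sup>2" using dev[of q] that B(2) by (metis abs_ge_zero power2_abs power_mono subsetD)
    ultimately show ?thesis by linarith
  qed
  have off: "\<bar>Sg q\<bar> \<le> a / real r + \<delta>" if q: "q \<in> B - S" for q
  proof -
    have "\<bar>Sg q\<bar> \<le> \<bar>Sg s\<bar> + \<delta>" if s: "s \<in> S" for s
    proof -
      have "\<bar>A q\<bar> \<le> \<bar>A s\<bar> + \<eta>" using top q s by (auto simp: near_top_def)
      moreover have "\<bar>A q - Sg q\<bar> \<le> e" "\<bar>A s - Sg s\<bar> \<le> e" using dev q s B(2) by auto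
      ultimately show ?thesis unfolding \<delta>_def by linarith
    qed
    then have "(\<Sum>s\<in>S. \<bar>Sg q\<bar>) \<le> (\<Sum>s\<in>S. \<bar>Sg s\<bar> + \<delta>)" by (rule sum_mono)
    then have "real (k * r) * \<bar>Sg q\<bar> \<le> (\<Sum>s\<in>S. \<bar>Sg s\<bar>) + real (k * r) * \<delta>" using B(3) by (simp add: sum.distrib)
    also have "(\<Sum>s\<in>S. \<bar>Sg s\<bar>) \<le> (\<Sum>s\<in>B. \<bar>Sg s\<bar>)" using B by (intro sum_mono2) auto
    also note l1
    finally have "real (k * r) * \<bar>Sg q\<bar> \<le> real (k * r) * (a / real r + \<delta>)" using B by (simp add: distrib_left)
    then show ?thesis using kr by (simp only: mult_le_cancel_left_pos)
  qed
  have "(\<Sum>q\<in>B - S. (y q - Sg q)\<^sup>2) \<le> (\<Sum>q\<in>B - S. (a / real r + \<delta>) * \<bar>Sg q\<bar>)"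
  proof (rule sum_mono)
    fix q assume q: "q \<in> B - S"
    have "(y q - Sg q)\<^sup>2 = \<bar>Sg q\<bar> * \<bar>Sg q\<bar>" using y0[OF q] by (simp add: power2_eq_square)
    also have "\<dots> \<le> (a / real r + \<delta>) * \<bar>Sg q\<bar>" using off[OF q] by (intro mult_right_mono) auto
    finally show "(y q - Sg q)\<^sup>2 \<le> (a / real r + \<delta>) * \<bar>Sg q\<bar>" .
  qed
  also have "\<dots> = (a / real r + \<delta>) * (\<Sum>q\<in>B - S. \<bar>Sg q\<bar>)" by (simp add: sum_distrib_left)
  also have "\<dots> \<le> (a / real r + \<delta>) * (real k * a)"
  proof (rule mult_left_mono)
    have "(\<Sum>q\<in>B - S. \<bar>Sg q\<bar>) \<le> (\<Sum>q\<in>B. \<bar>Sg q\<bar>)" using B by (intro sum_mono2) auto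
    then show "(\<Sum>q\<in>B - S. \<bar>Sg q\<bar>) \<le> real k * a" using l1 by linarith
    show "0 \<le> a / real r + \<delta>" using a \<delta> by simp
  qed
  also have "\<dots> \<le> 2 * real k * a\<^sup>2 / real r + real (k * r) * (\<eta>\<^sup>2 + 4 * e\<^sup>2)"
  proof -
    (* Splits the mixed term so that it is absorbed by the tail and the selection error. *)
    have "2 * a * \<delta> \<le> a\<^sup>2 / real r + real r * \<delta>\<^sup>2"
    proof -
      have "0 \<le> (a - real r * \<delta>)\<^sup>2 / real r" by simp
      also have "\<dots> = a\<^sup>2 / real r + real r * \<delta>\<^sup>2 - 2 * a * \<delta>"
        using B(5) by (simp add: power2_eq_square field_simps)
      finally show ?thesis by simp
    qed
    also have "\<dots> \<le> a\<^sup>2 / real r + real r * (2 * \<eta>\<^sup>2 + 8 * e\<^sup>2)" using \<delta>(2) by (intro add_left_mono mult_left_mono) auto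
    also have "real r * (2 * \<eta>\<^sup>2 + 8 * e\<^sup>2) = 2 * (real r * (\<eta>\<^sup>2 + 4 * e\<^sup>2))" by (simp add: algebra_simps)
    finally have "2 * (a * \<delta>) \<le> a\<^sup>2 / real r + 2 * (real r * (\<eta>\<^sup>2 + 4 * e\<^sup>2))" by (simp only: mult.assoc)
    moreover have "0 \<le> a\<^sup>2 / real r" by simp
    ultimately have "a * \<delta> \<le> a\<^sup>2 / real r + real r * (\<eta>\<^sup>2 + 4 * e\<^sup>2)" by linarith
    then have "real k * (a * \<delta>) \<le> real k * (a\<^sup>2 / real r + real r * (\<eta>\<^sup>2 + 4 * e\<^sup>2))" by (intro mult_left_mono) auto
    moreover define w where "w = real k * (a\<^sup>2 / real r)"
    have e1: "(a / real r + \<delta>) * (real k * a) = w + real k * (a * \<delta>)"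
      by (simp add: w_def power2_eq_square algebra_simps)
    have e2: "2 * real k * a\<^sup>2 / real r = 2 * w" by (simp add: w_def)
    have e3: "real k * (a\<^sup>2 / real r + real r * (\<eta>\<^sup>2 + 4 * e\<^sup>2)) = w + real (k * r) * (\<eta>\<^sup>2 + 4 * e\<^sup>2)"
      by (simp only: w_def distrib_left of_nat_mult mult.assoc)
    ultimately show ?thesis unfolding e1 e2 e3 by simp
  qed
  finally have "(\<Sum>q\<in>B - S. (y q - Sg q)\<^sup>2) \<le> 2 * real k * a\<^sup>2 / real r + real (k * r) * (\<eta>\<^sup>2 + 4 * e\<^sup>2)" .
  moreover have "(\<Sum>q\<in>S. (y q - Sg q)\<^sup>2) \<le> real (k * r) * (2 * \<tau>\<^sup>2 + 2 * e\<^sup>2)"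
    using sum_mono[of S, OF onS] B(3) by simp
  moreover have "(\<Sum>q\<in>B. (y q - Sg q)\<^sup>2) = (\<Sum>q\<in>B - S. (y q - Sg q)\<^sup>2) + (\<Sum>q\<in>S. (y q - Sg q)\<^sup>2)"
    using B by (intro sum.subset_diff) auto
  ultimately show ?thesis by (simp add: algebra_simps)
qed

context center_outer
begin

definition ell :: real where "ell = ln (real n)"

text \<open>The covariance matrix of the padded observations.\<close>

definition pcov :: "(nat \<Rightarrow> real) measure \<Rightarrow> nat \<times> nat \<Rightarrow> real" where
  "pcov P q = (if q \<in> {1..d} \<times> {1..d} then covariance P q else 0)"

text \<open>No coordinate product, and no block of any observation, is reached by clipping, and
  the truncated second moments concentrate. Each clause is the negation of a finite disjunction of
  exceptional events, ready for a union bound.\<close>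

definition data_good :: "(nat \<Rightarrow> real) measure \<Rightarrow> (nat \<Rightarrow> nat \<Rightarrow> real) \<Rightarrow> bool" where
  "data_good P X \<longleftrightarrow>
     \<not> (\<exists>i\<in>{1..n} \<times> {1..d}. 24 * K\<^sup>2 * ell < (X (fst i) (snd i))\<^sup>2) \<and>
     \<not> (\<exists>i\<in>{1..n} \<times> (scales \<times> {1..p}).
          (R (fst (snd i)))\<^sup>2 < (\<Sum>u\<in>Idx (fst (snd i)) (snd (snd i)) \<inter> {1..d}. (X (fst i) u)\<^sup>2)) \<and>
     \<not> (\<exists>q\<in>{1..d} \<times> {1..d}. L * ell / sqrt (real n) <
          \<bar>(\<Sum>i=1..n. sclip L (X i (fst q) * X i (snd q))) / real n - (\<integral>x. sclip L (x (fst q) * x (snd q)) \<partial>P)\<bar>)"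

text \<open>The thresholds make the exceptional probabilities small powers of \<open>1/n\<close>;
  the relation between \<open>d\<close> and \<open>n\<close> turns counts of coordinates and
  blocks into powers of \<open>n\<close>.\<close>

definition tuned :: bool where
  "tuned \<longleftrightarrow> 0 < K \<and> 0 \<le> M\<^sub>0 \<and> 0 < \<rho> \<and> 32 \<le> C_L \<and> 24 \<le> C_1 \<and> 64 \<le> C_R \<and> 100 \<le> ell \<and> 4 \<le> d \<and> d \<le> n\<^sup>2"

lemma tunedD:
  assumes tuned
  shows "0 < K" "0 \<le> M\<^sub>0" "0 < \<rho>" "32 \<le> C_L" "24 \<le> C_1" "64 \<le> C_R" "100 \<le> ell" "4 \<le> d" "d \<le> n\<^sup>2" "100 \<le> n" "0 < L" "4 \<le> p" "p \<le> 2 * n\<^sup>2"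
proof -
  show a: "0 < K" "0 \<le> M\<^sub>0" "0 < \<rho>" "32 \<le> C_L" "24 \<le> C_1" "64 \<le> C_R" "100 \<le> ell" "4 \<le> d" "d \<le> n\<^sup>2"
    using assms by (auto simp: tuned_def)
  have "0 < real n" using a(8,9) by (cases "n = 0") auto
  then have "ell \<le> real n - 1" using ln_le_minus_one by (simp add: ell_def)
  then show "100 \<le> n" using a(7) by linarith
  show "0 < L" unfolding L_def ell_def[symmetric] using a by (intro mult_pos_pos) auto
  show "4 \<le> p" "p \<le> 2 * n\<^sup>2" using p_bounds a(8,9) by linarith+
qed

lemma measurable_coord_sample:
  assumes "sets P = sets (vec_space d)" "i \<in> {1..n}" "u \<in> {1..d}"
  shows "(\<lambda>X. X i u) \<in> borel_measurable (PiM {1..n} (\<lambda>_. P))"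
proof -
  have 1: "(\<lambda>X. X i) \<in> PiM {1..n} (\<lambda>_. P) \<rightarrow>\<^sub>M P" using assms(2) by (rule measurable_component_singleton)
  have 2: "(\<lambda>x. x u) \<in> P \<rightarrow>\<^sub>M (borel :: real measure)"
    using assms(3) by (subst measurable_cong_sets[OF assms(1) refl]) (rule measurable_component_singleton)
  show ?thesis by (rule measurable_compose[OF 1 2])
qed

text \<open>A single event has probability at most \<open>2/n^6\<close> for the first kind and
  \<open>2/n^8\<close> for the other two, and there are at most \<open>n^3\<close>, \<open>4
  n^5\<close> and \<open>n^4\<close> events of the three kinds.\<close>

lemma data_bad_prob:
  assumes P: "P \<in> P_class d \<alpha> K M\<^sub>0 M" and tuned
  shows "{X\<in>space (PiM {1..n} (\<lambda>_. P)). \<not> data_good P X} \<in> sets (PiM {1..n} (\<lambda>_. P))"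
    "emeasure (PiM {1..n} (\<lambda>_. P)) {X\<in>space (PiM {1..n} (\<lambda>_. P)). \<not> data_good P X} \<le> ennreal (1 / real n)"
proof -
  note T = tunedD[OF \<open>tuned\<close>]
  let ?M = "PiM {1..n} (\<lambda>_. P)"
  interpret subgaussian_vector P d "4 * K\<^sup>2" by (rule P_class_subgaussian[OF P T(1)])
  interpret PP: product_prob_space "\<lambda>_. P" "{1..n}" by (intro product_prob_spaceI prob_space_axioms)
  have n0: "0 < real n" "1 \<le> n" using T(10) by auto
  have coord[measurable]: "i \<in> {1..n} \<Longrightarrow> u \<in> {1..d} \<Longrightarrow> (\<lambda>X. X i u) \<in> borel_measurable ?M" for i u
    by (rule measurable_coord_sample[OF sets_P])
  have single: "emeasure ?M {X\<in>space ?M. Q (X i)} \<le> c" if "i \<in> {1..n}" "{x\<in>space P. Q x} \<in> sets P" "emeasure P {x\<in>space P. Q x} \<le> c" for i Q c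
  proof -
    have "{X\<in>space ?M. Q (X i)} = {X\<in>space ?M. X i \<in> {x\<in>space P. Q x}}"
      using that(1) by (auto simp: space_PiM)
    then show ?thesis using PP.emeasure_PiM_Collect_single[OF that(1,2)] that(3) by simp
  qed
  define Q1 where "Q1 i X \<longleftrightarrow> 24 * K\<^sup>2 * ell < (X (fst i) (snd i))\<^sup>2" for i :: "nat \<times> nat" and X :: "nat \<Rightarrow> nat \<Rightarrow> real"
  define Q2 where "Q2 i X \<longleftrightarrow> (R (fst (snd i)))\<^sup>2 < (\<Sum>u\<in>Idx (fst (snd i)) (snd (snd i)) \<inter> {1..d}. (X (fst i) u)\<^sup>2)"
    for i :: "nat \<times> nat \<times> nat" and X :: "nat \<Rightarrow> nat \<Rightarrow> real"
  define Q3 where "Q3 q X \<longleftrightarrow> L * ell / sqrt (real n) <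
      \<bar>(\<Sum>i=1..n. sclip L (X i (fst q) * X i (snd q))) / real n - (\<integral>x. sclip L (x (fst q) * x (snd q)) \<partial>P)\<bar>" for q X
  let ?I1 = "{1..n} \<times> {1..d}" and ?I2 = "{1..n} \<times> (scales \<times> {1..p})" and ?I3 = "{1..d} \<times> {1..d}"
  have s1: "{X\<in>space ?M. Q1 i X} \<in> sets ?M" if "i \<in> ?I1" for i
  proof -
    have "(\<lambda>X. X (fst i) (snd i)) \<in> borel_measurable ?M" using that by (intro coord) auto
    then show ?thesis unfolding Q1_def by measurable
  qed
  have s2: "{X\<in>space ?M. Q2 i X} \<in> sets ?M" if "i \<in> ?I2" for i
  proof -
    have "(\<lambda>X. \<Sum>u\<in>Idx (fst (snd i)) (snd (snd i)) \<inter> {1..d}. (X (fst i) u)\<^sup>2) \<in> borel_measurable ?M"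
      using that by (intro borel_measurable_sum borel_measurable_power coord) auto
    then show ?thesis unfolding Q2_def by measurable
  qed
  have ms: "(\<lambda>z. sclip L z) \<in> borel_measurable borel" unfolding sclip_def by measurable
  have s3: "{X\<in>space ?M. Q3 q X} \<in> sets ?M" if "q \<in> ?I3" for q
  proof -
    have "(\<lambda>X. \<Sum>i=1..n. sclip L (X i (fst q) * X i (snd q))) \<in> borel_measurable ?M"
      using that by (intro borel_measurable_sum measurable_compose[OF _ ms] borel_measurable_times coord) auto
    then show ?thesis unfolding Q3_def by measurable
  qed
  have f1: "finite ?I1" and f2: "finite ?I2" and f3: "finite ?I3" using finite_scales by auto
  have b1: "emeasure ?M {X\<in>space ?M. \<exists>i\<in>?I1. Q1 i X} \<le> ennreal (real (card ?I1) * (2 * (1 / real n ^ 6)))"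
  proof (rule emeasure_Bex_le[OF f1 s1])
    fix i assume i: "i \<in> ?I1"
    have "24 * K\<^sup>2 * ell / (4 * K\<^sup>2) = real 6 * ln (real n)" using T(1) by (simp add: ell_def)
    then have "emeasure P {x\<in>space P. 24 * K\<^sup>2 * ell < (x (snd i))\<^sup>2} \<le> ennreal (2 * (1 / real n ^ 6))"
      using coord_tail[of "snd i" "24 * K\<^sup>2 * ell"] i exp_neg_nat_ln[OF n0(2), of 6] by auto
    moreover have "{x\<in>space P. 24 * K\<^sup>2 * ell < (x (snd i))\<^sup>2} \<in> sets P"
    proof -
      have "(\<lambda>x. x (snd i)) \<in> borel_measurable P" using i by (intro measurable_coord) auto
      then show ?thesis by measurable
    qed
    moreover have "fst i \<in> {1..n}" using i by auto
    ultimately show "emeasure ?M {X\<in>space ?M. Q1 i X} \<le> ennreal (2 * (1 / real n ^ 6))"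
      unfolding Q1_def by (intro single)
  qed
  have b2: "emeasure ?M {X\<in>space ?M. \<exists>i\<in>?I2. Q2 i X} \<le> ennreal (real (card ?I2) * (2 * (1 / real n ^ 8)))"
  proof (rule emeasure_Bex_le[OF f2 s2])
    fix i assume i: "i \<in> ?I2"
    define k where "k = fst (snd i)"
    define I where "I = Idx k (snd (snd i)) \<inter> {1..d}"
    have cI: "card I \<le> k"
    proof -
      have "card I \<le> card (Idx k (snd (snd i)))" unfolding I_def by (intro card_mono finite_Idx) auto
      also have "\<dots> = k" using i by (intro card_Idx) auto
      finally show ?thesis .
    qed
    have "sqrt 2 ^ card I \<le> exp (real k)"
    proof -
      have "sqrt 2 \<le> exp (1::real)" using exp_ge_add_one_self[of 1] real_sqrt_le_mono[of 2 4] by simp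
      then have "sqrt 2 ^ card I \<le> exp 1 ^ card I" by (intro power_mono) auto
      also have "\<dots> \<le> exp 1 ^ k" using cI by (intro power_increasing) auto
      also have "\<dots> = exp (real k)" by (simp add: exp_of_nat_mult[symmetric])
      finally show ?thesis .
    qed
    moreover have "8 * (real k + ell) \<le> (R k)\<^sup>2 / (2 * (4 * K\<^sup>2))"
    proof -
      have "64 * (real k + ell) \<le> C_R * (real k + ell)" using T(6,7) by (intro mult_right_mono) auto
      moreover have "(R k)\<^sup>2 / (2 * (4 * K\<^sup>2)) = C_R * (real k + ell) / 8"
        using T by (simp add: R_def ell_def[symmetric])
      ultimately show ?thesis by simp
    qed
    ultimately have "exp (- ((R k)\<^sup>2 / (2 * (4 * K\<^sup>2)))) * (2 * sqrt 2 ^ card I) \<le> exp (- (8 * (real k + ell))) * (2 * exp (real k))"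
      by (intro mult_mono) auto
    also have "\<dots> = 2 * exp (- 8 * ell - 7 * real k)" by (simp add: exp_add[symmetric])
    also have "\<dots> \<le> 2 * exp (- (real 8 * ln (real n)))" by (simp add: ell_def)
    also have "\<dots> = 2 * (1 / real n ^ 8)" by (simp only: exp_neg_nat_ln[OF n0(2)])
    finally have le: "exp (- ((R k)\<^sup>2 / (2 * (4 * K\<^sup>2)))) * (2 * sqrt 2 ^ card I) \<le> 2 * (1 / real n ^ 8)" .
    have "I \<subseteq> {1..d}" by (auto simp: I_def)
    from order_trans[OF norm_tail[OF this] ennreal_leI[OF le]]
    have "emeasure P {x\<in>space P. (R k)\<^sup>2 < (\<Sum>u\<in>I. (x u)\<^sup>2)} \<le> ennreal (2 * (1 / real n ^ 8))" .
    moreover have "(\<lambda>x. \<Sum>u\<in>I. (x u)\<^sup>2) \<in> borel_measurable P"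
      by (intro borel_measurable_sum borel_measurable_power measurable_coord) (auto simp: I_def)
    ultimately show "emeasure ?M {X\<in>space ?M. Q2 i X} \<le> ennreal (2 * (1 / real n ^ 8))"
      unfolding Q2_def k_def[symmetric] I_def[symmetric] using i by (intro single) auto
  qed
  have b3: "emeasure ?M {X\<in>space ?M. \<exists>q\<in>?I3. Q3 q X} \<le> ennreal (real (card ?I3) * (2 * (1 / real n ^ 8)))"
  proof (rule emeasure_Bex_le[OF f3 s3])
    fix q assume q: "q \<in> ?I3"
    have "(\<lambda>x. sclip L (x (fst q) * x (snd q))) \<in> borel_measurable P"
      using q by (intro measurable_compose[OF _ ms] borel_measurable_times measurable_coord) auto
    then have "emeasure ?M {X\<in>space ?M. Q3 q X} \<le> ennreal (2 * exp (- (real n * (L * ell / sqrt (real n))\<^sup>2 / (2 * L\<^sup>2))))"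
      unfolding Q3_def using T by (intro PiM_mean_deviation prob_space_axioms) (auto simp: sclip_abs_le)
    also have "real n * (L * ell / sqrt (real n))\<^sup>2 / (2 * L\<^sup>2) = ell * ell / 2"
      using T(11) n0 by (simp add: power_divide power_mult_distrib power2_eq_square)
    also have "ennreal (2 * exp (- (ell * ell / 2))) \<le> ennreal (2 * exp (- (real 8 * ln (real n))))"
    proof -
      have "16 * ell \<le> ell * ell" using T(7) by (intro mult_right_mono) auto
      then show ?thesis by (intro ennreal_leI) (simp add: ell_def)
    qed
    also have "\<dots> = ennreal (2 * (1 / real n ^ 8))" by (simp only: exp_neg_nat_ln[OF n0(2)])
    finally show "emeasure ?M {X\<in>space ?M. Q3 q X} \<le> ennreal (2 * (1 / real n ^ 8))" .
  qed
  have eq: "{X\<in>space ?M. \<not> data_good P X} = {X\<in>space ?M. \<exists>i\<in>?I1. Q1 i X} \<union> ({X\<in>space ?M. \<exists>i\<in>?I2. Q2 i X} \<union> {X\<in>space ?M. \<exists>q\<in>?I3. Q3 q X})"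
    unfolding data_good_def Q1_def Q2_def Q3_def by blast
  have S: "{X\<in>space ?M. \<exists>i\<in>?I1. Q1 i X} \<in> sets ?M" "{X\<in>space ?M. \<exists>i\<in>?I2. Q2 i X} \<in> sets ?M"
    "{X\<in>space ?M. \<exists>q\<in>?I3. Q3 q X} \<in> sets ?M"
    by (intro sets_Collect_Bex f1 f2 f3 s1 s2 s3; assumption)+
  show "{X\<in>space ?M. \<not> data_good P X} \<in> sets ?M" unfolding eq using S by simp
  have "emeasure ?M {X\<in>space ?M. \<not> data_good P X} \<le> emeasure ?M {X\<in>space ?M. \<exists>i\<in>?I1. Q1 i X}
      + (emeasure ?M {X\<in>space ?M. \<exists>i\<in>?I2. Q2 i X} + emeasure ?M {X\<in>space ?M. \<exists>q\<in>?I3. Q3 q X})"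
    unfolding eq using S by (intro order_trans[OF emeasure_subadditive] add_left_mono emeasure_subadditive) auto
  also have "\<dots> \<le> ennreal (real (card ?I1) * (2 * (1 / real n ^ 6))) +
      (ennreal (real (card ?I2) * (2 * (1 / real n ^ 8))) + ennreal (real (card ?I3) * (2 * (1 / real n ^ 8))))"
    by (intro add_mono b1 b2 b3)
  also have "\<dots> = ennreal (real (card ?I1) * (2 * (1 / real n ^ 6)) +
      (real (card ?I2) * (2 * (1 / real n ^ 8)) + real (card ?I3) * (2 * (1 / real n ^ 8))))"
    by (subst ennreal_plus, simp, simp, subst ennreal_plus, simp, simp, rule refl)
  also have "\<dots> \<le> ennreal (1 / real n)"
  proof (rule ennreal_leI)
    have d: "real d \<le> real n ^ 2" "real p \<le> 2 * real n ^ 2"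
      using T(9,13) by (auto simp flip: of_nat_power simp: of_nat_le_iff) 
    have c1: "real (card ?I1) \<le> real n ^ 3"
      using mult_left_mono[OF d(1), of "real n"] by (simp add: card_cartesian_product power_numeral_reduce)
    have c3: "real (card ?I3) \<le> real n ^ 4"
      using mult_mono[OF d(1) d(1)] by (simp add: card_cartesian_product power_numeral_reduce)
    have c2: "real (card ?I2) \<le> 4 * real n ^ 5"
    proof -
      have "card scales \<le> p"
        unfolding card_scales p_lg by (meson diff_le_self less_imp_le less_exp order_trans)
      then have "real (card scales) * real p \<le> (2 * real n ^ 2) * (2 * real n ^ 2)"
        using d(2) by (intro mult_mono) auto
      then have "real n * (real (card scales) * real p) \<le> real n * ((2 * real n ^ 2) * (2 * real n ^ 2))"
        by (intro mult_left_mono) auto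
      then show ?thesis by (simp add: card_cartesian_product power_numeral_reduce)
    qed
    have "real (card ?I1) * (2 * (1 / real n ^ 6)) + (real (card ?I2) * (2 * (1 / real n ^ 8)) + real (card ?I3) * (2 * (1 / real n ^ 8)))
      \<le> real n ^ 3 * (2 * (1 / real n ^ 6)) + (4 * real n ^ 5 * (2 * (1 / real n ^ 8)) + real n ^ 4 * (2 * (1 / real n ^ 8)))"
      by (intro add_mono mult_right_mono c1 c2 c3) auto
    also have "\<dots> = 10 / real n ^ 3 + 2 / real n ^ 4"
      using n0 by (simp add: divide_simps power_numeral_reduce)
    also have "\<dots> \<le> 1 / real n"
    proof -
      have n100: "100 \<le> real n" using T(10) by simp
      have "10 * real n + 2 \<le> real n * real n * real n"
      proof -
        have "100 * real n \<le> real n * real n" using n100 by (intro mult_right_mono) auto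
        moreover have "real n * real n * 1 \<le> real n * real n * real n" using n100 by (intro mult_left_mono) auto
        ultimately show ?thesis using n100 by linarith
      qed
      then show ?thesis using n0 by (simp add: divide_simps power_numeral_reduce)
    qed
    finally show "real (card ?I1) * (2 * (1 / real n ^ 6)) + (real (card ?I2) * (2 * (1 / real n ^ 8)) + real (card ?I3) * (2 * (1 / real n ^ 8))) \<le> 1 / real n" .
  qed
  finally show "emeasure ?M {X\<in>space ?M. \<not> data_good P X} \<le> ennreal (1 / real n)" .
qed

end

section \<open>Error of a single release on typical data\<close>

text \<open>Reduces the bound of \<open>peel_error\<close>, with the noise levels inserted, to a
  multiple of the objective that the rank \<open>r\<close> minimises.\<close>

lemma structured_budget_bound:
  fixes k r n \<rho> a L l F :: real
  assumes pos: "0 < k" "0 < r" "0 < n" "0 < \<rho>" "1 \<le> l" and F: "2 \<le> F" "24 * L\<^sup>2 * l ^ 4 \<le> F"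
  shows "2 * k * a\<^sup>2 / r + (k * r) * (16 * L\<^sup>2 / n\<^sup>2 * (k * r / \<rho>) * l ^ 4 + 6 * (4 * L\<^sup>2 * l\<^sup>2 / n)
      + 2 * (4 * L\<^sup>2 * (k * r) / (\<rho> * n\<^sup>2) * l ^ 4)) \<le> F * (k * (a\<^sup>2 / r + r / n + k * r\<^sup>2 / (\<rho> * n\<^sup>2)))"
proof -
  define x y z where "x = a\<^sup>2 / r" and "y = r / n" and "z = k * r\<^sup>2 / (\<rho> * n\<^sup>2)"
  have xyz: "0 \<le> x" "0 \<le> y" "0 \<le> z" using pos by (auto simp: x_def y_def z_def)
  have eq: "2 * k * a\<^sup>2 / r + (k * r) * (16 * L\<^sup>2 / n\<^sup>2 * (k * r / \<rho>) * l ^ 4 + 6 * (4 * L\<^sup>2 * l\<^sup>2 / n)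
      + 2 * (4 * L\<^sup>2 * (k * r) / (\<rho> * n\<^sup>2) * l ^ 4)) = k * (2 * x + 24 * L\<^sup>2 * l\<^sup>2 * y + 24 * L\<^sup>2 * l ^ 4 * z)"
    using pos unfolding x_def y_def z_def by (simp add: power2_eq_square field_simps)
  have "l\<^sup>2 \<le> l ^ 4" using pos by (intro power_increasing) auto
  then have "24 * L\<^sup>2 * l\<^sup>2 \<le> 24 * L\<^sup>2 * l ^ 4" by (intro mult_left_mono) auto
  then have F2: "24 * L\<^sup>2 * l\<^sup>2 \<le> F" using F(2) by linarith
  have "k * (2 * x + 24 * L\<^sup>2 * l\<^sup>2 * y + 24 * L\<^sup>2 * l ^ 4 * z) \<le> k * (F * x + F * y + F * z)"
    using pos xyz F F2 by (intro mult_left_mono add_mono mult_right_mono) auto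
  also have "\<dots> = F * (k * (x + y + z))" by (simp add: algebra_simps)
  finally show ?thesis unfolding eq x_def y_def z_def .
qed

lemma abs_mult_le_of_squares:
  fixes x y s :: real
  assumes "x\<^sup>2 \<le> s" "y\<^sup>2 \<le> s"
  shows "\<bar>x * y\<bar> \<le> s"
proof -
  have "0 \<le> (\<bar>x\<bar> - \<bar>y\<bar>)\<^sup>2" by simp
  then have "2 * \<bar>x * y\<bar> \<le> x\<^sup>2 + y\<^sup>2" by (simp add: power2_diff abs_mult)
  then show ?thesis using assms by linarith
qed

lemma square_le_of_abs_le: "\<bar>x\<bar> \<le> c \<Longrightarrow> x\<^sup>2 \<le> (c::real)\<^sup>2"
  using power_mono[of "\<bar>x\<bar>" c 2] by simp

lemma square_triangle: "(x - z)\<^sup>2 \<le> 2 * (x - m)\<^sup>2 + 2 * (m - z :: real)\<^sup>2"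
  using zero_le_power2[of "(x - m) - (m - z)"] by (simp add: power2_eq_square algebra_simps)

context center_outer
begin

lemma scales_ge_1: "k \<in> scales \<Longrightarrow> 1 \<le> k" by (erule scalesE)

lemma scales_le: "k \<in> scales \<Longrightarrow> 4 * k \<le> p" by (erule scalesE)

text \<open>Half of it accounts for the sampling error of the truncated products and half for
  their bias.\<close>

definition entry_deviation :: real where "entry_deviation = 2 * L * ell / sqrt (real n)"

text \<open>The common loss of all kinds of release relative to their proxies. The constant
  \<open>C_L\<close> enters through peeling and the entrywise sampling error, \<open>C_R\<close>
  and \<open>C_1\<close> through the noise of the dense outer and center blocks; the powers of
  \<open>ell\<close> come from the clipping radii and from the noise level
  \<open>ell\<^sup>2\<close> at which the tails are cut.\<close>

definition err_factor :: real where
  "err_factor = (2 + 24 * C_L\<^sup>2 * K ^ 4 + 144 * C_R\<^sup>2 * K ^ 4 + 1152 * C_1\<^sup>2 * K ^ 4) * ell ^ 6"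

text \<open>Cutting the noise at \<open>ell\<^sup>2\<close> standard deviations makes a failure
  less likely than any power of \<open>1/n\<close>, so even all releases together fail with
  negligible probability.\<close>

definition fail_prob :: real where "fail_prob = 3 * real p ^ 4 * exp (- ell\<^sup>2)"

lemma entry_deviation_square: "entry_deviation\<^sup>2 = 4 * L\<^sup>2 * ell\<^sup>2 / real n"
  by (simp add: entry_deviation_def power_divide power_mult_distrib)

lemma L_square: "L\<^sup>2 = C_L\<^sup>2 * K ^ 4 * ell\<^sup>2"
  by (simp add: L_def ell_def[symmetric] power_mult_distrib)

lemma err_factor_ge:
  assumes tuned
  shows "2 \<le> err_factor" "24 * L\<^sup>2 * ell ^ 4 \<le> err_factor" "144 * C_R\<^sup>2 * K ^ 4 * ell ^ 6 \<le> err_factor"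
    "1152 * C_1\<^sup>2 * K ^ 4 * ell ^ 6 \<le> err_factor" "8 * L\<^sup>2 * ell\<^sup>2 \<le> err_factor"
proof -
  note T = tunedD[OF assms]
  have e6: "1 \<le> ell ^ 6" using T(7) by (intro one_le_power) auto
  have nn: "0 \<le> C_L\<^sup>2 * K ^ 4" "0 \<le> C_R\<^sup>2 * K ^ 4" "0 \<le> C_1\<^sup>2 * K ^ 4" by auto
  have "2 * 1 \<le> (2 + 24 * C_L\<^sup>2 * K ^ 4 + 144 * C_R\<^sup>2 * K ^ 4 + 1152 * C_1\<^sup>2 * K ^ 4) * ell ^ 6"
    using e6 nn by (intro mult_mono) auto
  then show "2 \<le> err_factor" by (simp add: err_factor_def)
  have "24 * L\<^sup>2 * ell ^ 4 = 24 * C_L\<^sup>2 * K ^ 4 * ell ^ 6" by (simp add: L_square power_add[symmetric])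
  also have "\<dots> \<le> err_factor" unfolding err_factor_def using nn e6 by (intro mult_right_mono) auto
  finally show a: "24 * L\<^sup>2 * ell ^ 4 \<le> err_factor" .
  show "144 * C_R\<^sup>2 * K ^ 4 * ell ^ 6 \<le> err_factor" "1152 * C_1\<^sup>2 * K ^ 4 * ell ^ 6 \<le> err_factor"
    unfolding err_factor_def using nn e6 by (intro mult_right_mono; simp)+
  have "ell\<^sup>2 \<le> ell ^ 4" using T(7) by (intro power_increasing) auto
  then have "8 * L\<^sup>2 * ell\<^sup>2 \<le> 24 * L\<^sup>2 * ell ^ 4" by (intro mult_mono) auto
  then show "8 * L\<^sup>2 * ell\<^sup>2 \<le> err_factor" using a by linarith
qed

lemma noise_fail_le:
  assumes tuned "1 \<le> k" "k \<le> p"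
  shows "real k ^ 4 * exp (- (ell\<^sup>2)) + real k ^ 2 * (2 * exp (- (ell\<^sup>2)\<^sup>2 / 4)) \<le> fail_prob"
proof -
  note T = tunedD[OF assms(1)]
  have "100 * 100 \<le> ell * ell" using T(7) by (intro mult_mono) auto
  then have e4: "4 \<le> ell\<^sup>2" by (simp add: power2_eq_square)
  then have "4 * ell\<^sup>2 \<le> ell\<^sup>2 * ell\<^sup>2" by (intro mult_right_mono) auto
  then have ex: "exp (- (ell\<^sup>2)\<^sup>2 / 4) \<le> exp (- (ell\<^sup>2))" by (simp add: power2_eq_square)
  have k24: "real k ^ 2 \<le> real k ^ 4" using assms by (intro power_increasing) auto
  have "real k ^ 2 * (2 * exp (- (ell\<^sup>2)\<^sup>2 / 4)) \<le> real k ^ 4 * (2 * exp (- (ell\<^sup>2)))"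
    using k24 ex by (intro mult_mono) auto
  then have "real k ^ 4 * exp (- (ell\<^sup>2)) + real k ^ 2 * (2 * exp (- (ell\<^sup>2)\<^sup>2 / 4)) \<le> 3 * real k ^ 4 * exp (- ell\<^sup>2)" by simp
  also have "\<dots> \<le> fail_prob" unfolding fail_prob_def using assms by (intro mult_mono power_mono) auto
  finally show ?thesis .
qed

context
  fixes P :: "(nat \<Rightarrow> real) measure" and \<alpha> M :: real and X :: "nat \<Rightarrow> nat \<Rightarrow> real"
  assumes P: "P \<in> P_class d \<alpha> K M\<^sub>0 M" and tuned: tuned and good: "data_good P X"
begin

lemma pad_square_le: "i \<in> {1..n} \<Longrightarrow> (pad X i u)\<^sup>2 \<le> 24 * K\<^sup>2 * ell"
proof -
  assume i: "i \<in> {1..n}"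
  show ?thesis
  proof (cases "u \<in> {1..d}")
    case True
    then have "(i, u) \<in> {1..n} \<times> {1..d}" using i by simp
    then have "\<not> 24 * K\<^sup>2 * ell < (X i u)\<^sup>2" using good unfolding data_good_def by fastforce
    then show ?thesis using True by (simp add: pad_def)
  next
    case False
    then have "pad X i u = 0" by (auto simp: pad_def)
    then show ?thesis using tunedD(7)[OF tuned] by simp
  qed
qed

lemma pad_product_le: "i \<in> {1..n} \<Longrightarrow> \<bar>pad X i u * pad X i v\<bar> \<le> L"
proof -
  assume i: "i \<in> {1..n}"
  note T = tunedD[OF tuned]
  have "\<bar>pad X i u * pad X i v\<bar> \<le> 24 * K\<^sup>2 * ell" by (intro abs_mult_le_of_squares pad_square_le i)
  also have "\<dots> \<le> C_L * K\<^sup>2 * ell" using T by (intro mult_right_mono) auto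
  finally show ?thesis by (simp add: L_def ell_def)
qed

lemma pad_block_norm:
  assumes "i \<in> {1..n}" "k \<in> scales" "1 \<le> l" "l * k \<le> p"
  shows "L2_set (pad X i) (Idx k l) \<le> R k"
proof -
  note T = tunedD[OF tuned]
  have R0: "0 \<le> R k" unfolding R_def ell_def[symmetric] using T by (auto intro!: mult_nonneg_nonneg add_nonneg_nonneg)
  have "1 \<le> k" by (rule scales_ge_1[OF assms(2)])
  then have "l * 1 \<le> l * k" by (intro mult_left_mono) auto
  then have "l \<le> p" using assms(4) by linarith
  then have "(i, k, l) \<in> {1..n} \<times> (scales \<times> {1..p})" using assms by simp
  then have "\<not> (R k)\<^sup>2 < (\<Sum>u\<in>Idx k l \<inter> {1..d}. (X i u)\<^sup>2)" using good unfolding data_good_def by fastforce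
  moreover have "(\<Sum>u\<in>Idx k l. (pad X i u)\<^sup>2) = (\<Sum>u\<in>Idx k l \<inter> {1..d}. (X i u)\<^sup>2)"
    by (rule sum.mono_neutral_cong_right) (auto simp: finite_Idx pad_def)
  ultimately have "(\<Sum>u\<in>Idx k l. (pad X i u)\<^sup>2) \<le> (R k)\<^sup>2" by simp
  then show ?thesis unfolding L2_set_def using R0 by (simp add: real_le_lsqrt sum_nonneg)
qed

lemma pad_center_norm:
  assumes "i \<in> {1..n}" "1 \<le> l"
  shows "L2_set (pad X i) (Idx 1 l) \<le> R_center"
proof -
  note T = tunedD[OF tuned]
  have "L2_set (pad X i) (Idx 1 l) = sqrt ((pad X i l)\<^sup>2)" using assms(2) by (simp add: Idx_1[unfolded One_nat_def] L2_set_def)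
  also have "\<dots> \<le> sqrt (24 * K\<^sup>2 * ell)" by (rule real_sqrt_le_mono[OF pad_square_le[OF assms(1)]])
  also have "\<dots> \<le> sqrt (K\<^sup>2 * (C_1 * (1 + ell)))"
  proof -
    have "24 * ell \<le> C_1 * (1 + ell)" using T by (intro mult_mono) auto
    then have "K\<^sup>2 * (24 * ell) \<le> K\<^sup>2 * (C_1 * (1 + ell))" by (intro mult_left_mono) auto
    then show ?thesis by (simp add: mult_ac)
  qed
  also have "\<dots> = R_center" using T by (simp add: R_center_def ell_def real_sqrt_mult)
  finally show ?thesis .
qed

text \<open>On typical data no product is truncated, so both kinds of release estimate the same
  matrix of empirical second moments.\<close>

lemma mean_deviation:
  shows "\<bar>(\<Sum>i=1..n. sclip L (pad X i u * pad X i v)) / real n - pcov P (u, v)\<bar> \<le> entry_deviation"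
    and "\<bar>(\<Sum>i=1..n. pad X i u * pad X i v) / real n - pcov P (u, v)\<bar> \<le> entry_deviation"
proof -
  note T = tunedD[OF tuned]
  interpret subgaussian_vector P d "4 * K\<^sup>2" by (rule P_class_subgaussian[OF P T(1)])
  have n0: "1 \<le> real n" "1 \<le> n" using T(10) by auto
  have sc: "sclip L (pad X i u * pad X i v) = pad X i u * pad X i v" if "i \<in> {1..n}" for i
    using pad_product_le[OF that] by (rule sclip_id)
  show 1: "\<bar>(\<Sum>i=1..n. sclip L (pad X i u * pad X i v)) / real n - pcov P (u, v)\<bar> \<le> entry_deviation"
  proof (cases "u \<in> {1..d} \<and> v \<in> {1..d}")
    case True
    let ?E = "\<integral>x. sclip L (x u * x v) \<partial>P"
    have "(u, v) \<in> {1..d} \<times> {1..d}" using True by simp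
    then have "\<not> L * ell / sqrt (real n) < \<bar>(\<Sum>i=1..n. sclip L (X i u * X i v)) / real n - ?E\<bar>"
      using good unfolding data_good_def by fastforce
    then have a: "\<bar>(\<Sum>i=1..n. sclip L (pad X i u * pad X i v)) / real n - ?E\<bar> \<le> L * ell / sqrt (real n)"
      using True by (simp add: pad_def)
    have "\<bar>?E - (\<integral>x. x u * x v \<partial>P)\<bar> \<le> 8 * (4 * K\<^sup>2) * exp (- (L / (2 * (4 * K\<^sup>2))))"
      using True T by (intro truncation_bias) auto
    also have "\<dots> \<le> L * ell * (1 / sqrt (real n))"
    proof (rule mult_mono)
      have "32 * 1 \<le> C_L * (ell * ell)" using T mult_mono[of 1 ell 1 ell] by (intro mult_mono) auto
      then have "K\<^sup>2 * 32 \<le> K\<^sup>2 * (C_L * (ell * ell))" by (intro mult_left_mono) auto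
      then show "8 * (4 * K\<^sup>2) \<le> L * ell" by (simp add: L_def ell_def mult_ac)
      have "ell * 32 \<le> ell * C_L" using T by (intro mult_left_mono) auto
      then have "real 1 * ln (real n) \<le> L / (2 * (4 * K\<^sup>2))"
        using T by (simp add: L_def ell_def)
      then have "exp (- (L / (2 * (4 * K\<^sup>2)))) \<le> exp (- (real 1 * ln (real n)))" by simp
      also have "\<dots> = 1 / real n" using exp_neg_nat_ln[OF n0(2), of 1] by simp
      also have "\<dots> \<le> 1 / sqrt (real n)"
      proof -
        have "sqrt (real n) \<le> sqrt (real n) * sqrt (real n)" using n0 by (intro mult_le_cancel_left1[THEN iffD2]) auto
        then show ?thesis using n0 by (intro divide_left_mono) auto
      qed
      finally show "exp (- (L / (2 * (4 * K\<^sup>2)))) \<le> 1 / sqrt (real n)" .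
    qed (use T in auto)
    finally have b: "\<bar>?E - (\<integral>x. x u * x v \<partial>P)\<bar> \<le> L * ell / sqrt (real n)" by simp
    have c: "pcov P (u, v) = (\<integral>x. x u * x v \<partial>P)" using True P_class_covariance[OF P] by (simp add: pcov_def)
    have "entry_deviation = L * ell / sqrt (real n) + L * ell / sqrt (real n)" by (simp add: entry_deviation_def)
    then show ?thesis using a b unfolding c by linarith
  next
    case False
    then have z: "pad X i u * pad X i v = 0" for i by (auto simp: pad_def)
    have "pcov P (u, v) = 0" using False by (auto simp: pcov_def)
    moreover have "0 \<le> entry_deviation" using T by (simp add: entry_deviation_def)
    ultimately show ?thesis unfolding z by (simp add: sclip_def)
  qed
  show "\<bar>(\<Sum>i=1..n. pad X i u * pad X i v) / real n - pcov P (u, v)\<bar> \<le> entry_deviation"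
    using 1 sc by simp
qed

text \<open>The index intervals of an outer block are separated by a full interval of length
  \<open>k\<close>, so its rows are part of the tails that the class controls.\<close>

lemma covariance_row_sum:
  assumes k: "k \<in> scales" and lr: "1 \<le> l" "2 \<le> r" and u: "u \<in> Idx k l"
  shows "(\<Sum>v\<in>Idx k (l + r). \<bar>pcov P (u, v)\<bar>) \<le> M * real k powr (- \<alpha>)"
proof (cases "u \<in> {1..d}")
  case True
  have G: "covariance P \<in> G_class d \<alpha> M\<^sub>0 M" using P by (simp add: P_class_def)
  have k1: "1 \<le> k" by (rule scales_ge_1[OF k])
  have far: "\<bar>int v - int u\<bar> > int k" if v: "v \<in> Idx k (l + r)" for v
  proof -
    have "u \<le> l * k" using u by (simp add: Idx_def)
    moreover have "(l + 1) * k \<le> (l + r - 1) * k" using lr by (intro mult_right_mono) auto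
    moreover have "(l + r - 1) * k < v" using v by (auto simp: Idx_def)
    ultimately have "u + k < v" by (simp add: algebra_simps)
    then show ?thesis by linarith
  qed
  have "(\<Sum>v\<in>Idx k (l + r). \<bar>pcov P (u, v)\<bar>) = (\<Sum>v\<in>Idx k (l + r) \<inter> {1..d}. \<bar>covariance P (v, u)\<bar>)"
    using True G by (intro sum.mono_neutral_cong_right) (auto simp: finite_Idx pcov_def G_class_def)
  also have "\<dots> \<le> (\<Sum>v | v \<in> {1..d} \<and> \<bar>int v - int u\<bar> > int k. \<bar>covariance P (v, u)\<bar>)"
    using far by (intro sum_mono2) auto
  also have "\<dots> \<le> M * real k powr (- \<alpha>)" using G True k1 by (simp add: G_class_def)
  finally show ?thesis .
next
  case False
  have "covariance P \<in> G_class d \<alpha> M\<^sub>0 M" using P by (simp add: P_class_def)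
  then have "\<forall>j\<in>{1..d}. (\<Sum>i | i \<in> {1..d} \<and> \<bar>int i - int j\<bar> > int k. \<bar>covariance P (i, j)\<bar>) \<le> M * real k powr (- \<alpha>)"
    using scales_ge_1[OF k] unfolding G_class_def mem_Collect_eq by blast
  moreover have "1 \<in> {1..d}" using tunedD(8)[OF tuned] by simp
  ultimately have "(\<Sum>i | i \<in> {1..d} \<and> \<bar>int i - int 1\<bar> > int k. \<bar>covariance P (i, 1)\<bar>) \<le> M * real k powr (- \<alpha>)" by blast
  moreover have "0 \<le> (\<Sum>i | i \<in> {1..d} \<and> \<bar>int i - int 1\<bar> > int k. \<bar>covariance P (i, 1)\<bar>)" by (intro sum_nonneg) auto
  ultimately have "0 \<le> M * real k powr (- \<alpha>)" by (rule order_trans[rotated])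
  moreover have "pcov P (u, v) = 0" for v using False by (auto simp: pcov_def)
  ultimately show ?thesis by simp
qed

text \<open>The squared norm is at most the largest entry times the absolute sum, and the largest
  entry is at most a row sum.\<close>

lemma outer_block_bounds:
  assumes k: "k \<in> scales" and lr: "1 \<le> l" "2 \<le> r" and a: "M * real k powr (- \<alpha>) \<le> a0"
  shows "(\<Sum>q\<in>block k (l, r). \<bar>pcov P q\<bar>) \<le> real k * a0" "(\<Sum>q\<in>block k (l, r). (pcov P q)\<^sup>2) \<le> real k * a0\<^sup>2" "0 \<le> a0"
proof -
  have row: "(\<Sum>v\<in>Idx k (l + r). \<bar>pcov P (u, v)\<bar>) \<le> a0" if "u \<in> Idx k l" for u
    using covariance_row_sum[OF k lr that] a by linarith
  have k1: "1 \<le> k" by (rule scales_ge_1[OF k])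
  have "l * k \<in> Idx k l" using lr(1) k1 by (cases l) (auto simp: Idx_def)
  from row[OF this] show a0: "0 \<le> a0" by (meson abs_ge_zero order_trans sum_nonneg)
  have "(\<Sum>q\<in>block k (l, r). \<bar>pcov P q\<bar>) = (\<Sum>u\<in>Idx k l. \<Sum>v\<in>Idx k (l + r). \<bar>pcov P (u, v)\<bar>)"
    by (simp add: sum.cartesian_product')
  also have "\<dots> \<le> (\<Sum>u\<in>Idx k l. a0)" by (intro sum_mono row)
  finally show s: "(\<Sum>q\<in>block k (l, r). \<bar>pcov P q\<bar>) \<le> real k * a0" using lr by (simp add: card_Idx)
  have "\<bar>pcov P q\<bar> \<le> a0" if q: "q \<in> block k (l, r)" for q
  proof -
    obtain u v where uv: "q = (u, v)" "u \<in> Idx k l" "v \<in> Idx k (l + r)" using q by auto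
    have "\<bar>pcov P (u, v)\<bar> \<le> (\<Sum>v\<in>Idx k (l + r). \<bar>pcov P (u, v)\<bar>)" using uv by (intro member_le_sum) (auto simp: finite_Idx)
    then show ?thesis using row[OF uv(2)] uv(1) by simp
  qed
  then have "(\<Sum>q\<in>block k (l, r). (pcov P q)\<^sup>2) \<le> (\<Sum>q\<in>block k (l, r). a0 * \<bar>pcov P q\<bar>)"
    unfolding power2_eq_square by (intro sum_mono) (metis abs_mult_self_eq abs_ge_zero mult_right_mono)
  also have "\<dots> \<le> a0 * (real k * a0)" unfolding sum_distrib_left[symmetric] using s a0 by (intro mult_left_mono)
  finally show "(\<Sum>q\<in>block k (l, r). (pcov P q)\<^sup>2) \<le> real k * a0\<^sup>2" by (simp add: power2_eq_square mult_ac)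
qed

lemma measurable_block_error:
  "Measurable.pred (PiM (block k b) (\<lambda>_. borel)) (\<lambda>y. (\<Sum>q\<in>block k b. (y q - S q)\<^sup>2) \<le> (c::real))"
  by measurable

text \<open>The zero candidate errs by the block itself, the dense one by \<open>k\<^sup>2\<close>
  entrywise errors, and peeling is covered by \<open>peel_error\<close>. The radius only has to
  dominate the class bound, so the lemma applies to every level up to the resolved one.\<close>

lemma outer_release_good:
  assumes i: "(k, b, j) \<in> outer_index" and aj: "M * real k powr (- \<alpha>) \<le> a k j"
  shows "emeasure (outer_law X (k, b, j)) {y\<in>space (outer_law X (k, b, j)).
      \<not> (\<Sum>q\<in>block k b. (y q - pcov P q)\<^sup>2) \<le> err_factor * W k j (t k j)} \<le> ennreal fail_prob"
proof -
  note T = tunedD[OF tuned] and F = err_factor_ge[OF tuned]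
  obtain l r where b: "b = (l, r)" by (cases b)
  have k: "k \<in> scales" "(l, r) \<in> outer_labels k" using i by (auto simp: outer_index_def b)
  have lr: "1 \<le> l" "2 \<le> r" "(l + r) * k \<le> p" using outer_labelsE[OF k] by auto
  have k1: "1 \<le> k" "k \<le> p" using scales_ge_1[OF k(1)] scales_le[OF k(1)] by linarith+
  have lk: "l * k \<le> p" using lr(3) by (simp add: algebra_simps)
  note bb = outer_block_bounds[OF k(1) lr(1,2) aj]
  define \<Phi> where "\<Phi> y \<longleftrightarrow> (\<Sum>q\<in>block k b. (y q - pcov P q)\<^sup>2) \<le> err_factor * W k j (t k j)" for y
  have bud: "0 < budget k" by (rule budget_pos[OF k(1) T(3)])
  have n0: "0 < real n" "1 \<le> n" using T(10) by auto
  have ell2: "0 \<le> ell\<^sup>2" by simp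
  have entry_deviation_nonneg: "0 \<le> entry_deviation" using T by (simp add: entry_deviation_def)
  have meas: "Measurable.pred (PiM (Idx k l \<times> Idx k (l + r)) (\<lambda>_. borel)) \<Phi>"
    unfolding \<Phi>_def using measurable_block_error[where k = k and b = b and S = "pcov P" and c = "err_factor * W k j (t k j)"] by (simp add: b)
  show ?thesis
  proof (cases "t k j")
    case Zero
    have "\<Phi> (\<lambda>_\<in>block k b. 0)"
    proof -
      have "(\<Sum>q\<in>block k b. ((\<lambda>_\<in>block k b. 0) q - pcov P q)\<^sup>2) = (\<Sum>q\<in>block k b. (pcov P q)\<^sup>2)" by simp
      also have "\<dots> \<le> 1 * W k j (t k j)" using bb(2) by (simp add: Zero b)
      also have "\<dots> \<le> err_factor * W k j (t k j)" using F(1) by (intro mult_right_mono) (auto simp: Zero)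
      finally show ?thesis by (simp add: \<Phi>_def)
    qed
    then have "emeasure (outer_law X (k, b, j)) {y\<in>space (outer_law X (k, b, j)). \<not> \<Phi> y} = 0"
      using meas unfolding b by (simp add: Zero emeasure_return)
    then show ?thesis unfolding \<Phi>_def by simp
  next
    case Structured
    define r0 where "r0 = arg_min (peel_objective n k (a k j) (budget k)) (\<lambda>r. 1 \<le> r \<and> r \<le> k)"
    note am = arg_min_peel_objective[OF k1(1), where n = n and a = "a k j" and \<rho>B = "budget k", folded r0_def]
    have Wge: "real k * peel_objective n k (a k j) (budget k) r0 \<le> W k j (t k j)"
    proof -
      have "peel_objective n k (a k j) (budget k) r0 \<le> (MIN r\<in>{1..k}. peel_objective n k (a k j) (budget k) r)"
        using k1 am by (intro Min.boundedI) auto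
      then show ?thesis unfolding Structured W.simps by (intro mult_left_mono) auto
    qed
    have "emeasure (peel_release n L (pad X) (Idx k l) (Idx k (l + r)) (a k j) (budget k))
        {y\<in>space (peel_release n L (pad X) (Idx k l) (Idx k (l + r)) (a k j) (budget k)). \<not> \<Phi> y}
      \<le> ennreal (real k ^ 4 * exp (- (ell\<^sup>2)) + real k ^ 2 * (2 * exp (- (ell\<^sup>2)\<^sup>2 / 4)))"
    proof (rule peel_release_prob[where a = "a k j" and X = "pad X" and n = n, OF finite_Idx finite_Idx card_Idx card_Idx k1(1) T(11) bud n0(2) ell2 meas, folded r0_def])
      show "1 \<le> l" "1 \<le> l + r" using lr by auto
    next
      fix S y
      let ?A = "\<lambda>(u, v). (\<Sum>i=1..n. sclip L (pad X i u * pad X i v)) / real n"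
      let ?\<eta> = "4 * L / real n * sqrt (real (k * r0) / budget k) * ell\<^sup>2"
      let ?\<tau> = "sqrt (4 * L\<^sup>2 * real (k * r0) / (budget k * (real n)\<^sup>2)) * ell\<^sup>2"
      assume S: "S \<subseteq> Idx k l \<times> Idx k (l + r)" "card S = k * r0"
        and top: "near_top (Idx k l \<times> Idx k (l + r)) (\<lambda>q. \<bar>?A q\<bar>) ?\<eta> S"
        and noise: "\<And>q. q \<in> S \<Longrightarrow> \<bar>y q - ?A q\<bar> \<le> ?\<tau>" and y0: "\<And>q. q \<in> Idx k l \<times> Idx k (l + r) - S \<Longrightarrow> y q = 0"
      have "(\<Sum>q\<in>Idx k l \<times> Idx k (l + r). (y q - pcov P q)\<^sup>2)
          \<le> 2 * real k * (a k j)\<^sup>2 / real r0 + real (k * r0) * (?\<eta>\<^sup>2 + 6 * entry_deviation\<^sup>2 + 2 * ?\<tau>\<^sup>2)"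
      proof (rule peel_error[OF _ S k1(1) am(1) bb(3) _ _ top _ entry_deviation_nonneg noise y0])
        show "(\<Sum>q\<in>Idx k l \<times> Idx k (l + r). \<bar>pcov P q\<bar>) \<le> real k * a k j" using bb(1) by simp
        show "\<bar>?A q - pcov P q\<bar> \<le> entry_deviation" if "q \<in> Idx k l \<times> Idx k (l + r)" for q
          using mean_deviation(1) by (cases q) simp
        show "0 \<le> ?\<eta>" using T bud by (intro mult_nonneg_nonneg divide_nonneg_nonneg) auto
      qed (auto simp: finite_Idx)
      also have "?\<eta>\<^sup>2 = 16 * L\<^sup>2 / (real n)\<^sup>2 * (real k * real r0 / budget k) * ell ^ 4"
        using bud by (simp add: power_mult_distrib power_divide)
      also have "?\<tau>\<^sup>2 = 4 * L\<^sup>2 * (real k * real r0) / (budget k * (real n)\<^sup>2) * ell ^ 4"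
        using bud by (simp add: power_mult_distrib)
      also have "entry_deviation\<^sup>2 = 4 * L\<^sup>2 * ell\<^sup>2 / real n" by (rule entry_deviation_square)
      also have "2 * real k * (a k j)\<^sup>2 / real r0 + real (k * r0) * (16 * L\<^sup>2 / (real n)\<^sup>2 * (real k * real r0 / budget k) * ell ^ 4
          + 6 * (4 * L\<^sup>2 * ell\<^sup>2 / real n) + 2 * (4 * L\<^sup>2 * (real k * real r0) / (budget k * (real n)\<^sup>2) * ell ^ 4))
        \<le> err_factor * (real k * peel_objective n k (a k j) (budget k) r0)"
        unfolding peel_objective_def of_nat_mult using k1 am bud n0 T F by (intro structured_budget_bound) auto
      also have "\<dots> \<le> err_factor * W k j (t k j)" using Wge F by (intro mult_left_mono) auto
      finally show "\<Phi> y" by (simp add: \<Phi>_def b)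
    qed
    also have "\<dots> \<le> ennreal fail_prob" using noise_fail_le[OF tuned k1] by (rule ennreal_leI)
    finally show ?thesis unfolding \<Phi>_def b by (simp add: Structured)
  next
    case Dense
    have sub: "Idx k l \<subseteq> {1..p}" "Idx k (l + r) \<subseteq> {1..p}" using lr lk by (intro Idx_subset; simp)+
    let ?\<tau> = "sqrt (18 * (R k) ^ 4 / (budget k * (real n)\<^sup>2)) * ell\<^sup>2"
    have R4: "(R k) ^ 4 \<le> 4 * C_R\<^sup>2 * K ^ 4 * (real k)\<^sup>2 * ell\<^sup>2"
    proof -
      have Rsq: "(R k)\<^sup>2 = C_R * K\<^sup>2 * (real k + ell)" unfolding R_def ell_def[symmetric] using T by simp
      have "(R k) ^ 4 = ((R k)\<^sup>2)\<^sup>2" by simp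
      also have "\<dots> = C_R\<^sup>2 * K ^ 4 * (real k + ell)\<^sup>2" unfolding Rsq by (simp add: power_mult_distrib)
      also have "\<dots> \<le> C_R\<^sup>2 * K ^ 4 * (2 * real k * ell)\<^sup>2"
      proof (intro mult_left_mono power_mono)
        have "real k * 1 \<le> real k * ell" "1 * ell \<le> real k * ell" using k1 T by (intro mult_left_mono mult_right_mono; simp)+
        then show "real k + ell \<le> 2 * real k * ell" by simp
      qed (use T in auto)
      finally show ?thesis by (simp add: power_mult_distrib mult_ac)
    qed
    have "emeasure (dp_cov_block n p (pad X) (Idx k l) (Idx k (l + r)) (budget k) (R k))
        {y\<in>space (dp_cov_block n p (pad X) (Idx k l) (Idx k (l + r)) (budget k) (R k)). \<not> \<Phi> y}
      \<le> ennreal (real (card (Idx k l \<times> Idx k (l + r))) * (2 * exp (- (ell\<^sup>2)\<^sup>2 / 4)))"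
    proof (rule dp_cov_block_prob[OF finite_Idx finite_Idx sub _ ell2 meas])
      show "u \<le> v" if "u \<in> Idx k l" "v \<in> Idx k (l + r)" for u v using Idx_less[OF that] lr by simp
      show "0 \<le> budget k" using bud by simp
      fix y assume y: "\<And>u v. u \<in> Idx k l \<Longrightarrow> v \<in> Idx k (l + r) \<Longrightarrow>
          \<bar>y (u, v) - (\<Sum>i=1..n. vclip (Idx k l) (R k) (pad X i) u * vclip (Idx k (l + r)) (R k) (pad X i) v) / real n\<bar> \<le> ?\<tau>"
      have each: "(y q - pcov P q)\<^sup>2 \<le> 2 * ?\<tau>\<^sup>2 + 2 * entry_deviation\<^sup>2" if q: "q \<in> block k b" for q
      proof -
        obtain u v where uv: "q = (u, v)" "u \<in> Idx k l" "v \<in> Idx k (l + r)" using q unfolding b by auto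
        let ?m = "(\<Sum>i=1..n. pad X i u * pad X i v) / real n"
        have "vclip (Idx k l) (R k) (pad X i) u = pad X i u" "vclip (Idx k (l + r)) (R k) (pad X i) v = pad X i v" if "i \<in> {1..n}" for i
          using that uv lr lk k(1) by (auto intro!: vclip_id pad_block_norm simp: finite_Idx)
        then have "\<bar>y (u, v) - ?m\<bar> \<le> ?\<tau>" using y[OF uv(2,3)] by simp
        then have 1: "(y (u, v) - ?m)\<^sup>2 \<le> ?\<tau>\<^sup>2" by (rule square_le_of_abs_le)
        have 2: "(?m - pcov P (u, v))\<^sup>2 \<le> entry_deviation\<^sup>2" using mean_deviation(2)[of u v] by (rule square_le_of_abs_le)
        have "(y (u, v) - pcov P (u, v))\<^sup>2 \<le> 2 * (y (u, v) - ?m)\<^sup>2 + 2 * (?m - pcov P (u, v))\<^sup>2"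
          by (rule square_triangle)
        then show ?thesis using 1 2 uv(1) by simp
      qed
      have "(\<Sum>q\<in>block k b. (y q - pcov P q)\<^sup>2) \<le> (\<Sum>q\<in>block k b. 2 * ?\<tau>\<^sup>2 + 2 * entry_deviation\<^sup>2)" by (rule sum_mono[OF each])
      also have "\<dots> = (real k)\<^sup>2 * (2 * ?\<tau>\<^sup>2 + 2 * entry_deviation\<^sup>2)"
        using lr by (simp add: b card_cartesian_product card_Idx power2_eq_square)
      also have "\<dots> \<le> (real k)\<^sup>2 * (err_factor * ((real k)\<^sup>2 / (budget k * (real n)\<^sup>2)) + err_factor * (1 / real n))"
      proof (intro mult_left_mono add_mono)
        have "2 * ?\<tau>\<^sup>2 = 36 * (R k) ^ 4 * ell ^ 4 / (budget k * (real n)\<^sup>2)" using bud by (simp add: power_mult_distrib)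
        also have "\<dots> \<le> 36 * (4 * C_R\<^sup>2 * K ^ 4 * (real k)\<^sup>2 * ell\<^sup>2) * ell ^ 4 / (budget k * (real n)\<^sup>2)"
          using bud R4 by (intro divide_right_mono mult_right_mono mult_left_mono) auto
        also have "\<dots> = 144 * C_R\<^sup>2 * K ^ 4 * ell ^ 6 * ((real k)\<^sup>2 / (budget k * (real n)\<^sup>2))"
          by (simp add: power_add[symmetric])
        also have "\<dots> \<le> err_factor * ((real k)\<^sup>2 / (budget k * (real n)\<^sup>2))" using F(3) bud by (intro mult_right_mono) auto
        finally show "2 * ?\<tau>\<^sup>2 \<le> err_factor * ((real k)\<^sup>2 / (budget k * (real n)\<^sup>2))" .
        have "2 * entry_deviation\<^sup>2 = 8 * L\<^sup>2 * ell\<^sup>2 * (1 / real n)" by (simp add: entry_deviation_square)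
        also have "\<dots> \<le> err_factor * (1 / real n)" using F(5) by (intro mult_right_mono) auto
        finally show "2 * entry_deviation\<^sup>2 \<le> err_factor * (1 / real n)" .
      qed auto
      also have "\<dots> = err_factor * W k j (t k j)" unfolding Dense W.simps by (simp add: algebra_simps power2_eq_square power4_eq_xxxx)
      finally show "\<Phi> y" by (simp add: \<Phi>_def)
    qed
    also have "\<dots> \<le> ennreal fail_prob"
    proof (rule ennreal_leI)
      have "real (card (Idx k l \<times> Idx k (l + r))) * (2 * exp (- (ell\<^sup>2)\<^sup>2 / 4)) = real k ^ 2 * (2 * exp (- (ell\<^sup>2)\<^sup>2 / 4))"
        using lr by (simp add: card_cartesian_product card_Idx power2_eq_square)
      also have "\<dots> \<le> fail_prob" using noise_fail_le[OF tuned k1] by (smt (verit) exp_ge_zero mult_nonneg_nonneg zero_le_power of_nat_0_le_iff)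
      finally show "real (card (Idx k l \<times> Idx k (l + r))) * (2 * exp (- (ell\<^sup>2)\<^sup>2 / 4)) \<le> fail_prob" .
    qed
    finally show ?thesis unfolding \<Phi>_def b by (simp add: Dense)
  qed
qed

lemma center_release_good:
  assumes bc: "b \<in> center_labels"
  shows "emeasure (center_law X b) {y\<in>space (center_law X b).
      \<not> (\<Sum>q\<in>block 1 b. (y q - pcov P q)\<^sup>2) \<le> err_factor * (1 / real n + real p / (\<rho> * (real n)\<^sup>2))} \<le> ennreal fail_prob"
proof -
  note T = tunedD[OF tuned] and F = err_factor_ge[OF tuned]
  obtain l r where b: "b = (l, r)" "1 \<le> l" "r \<in> {0, 1}" "l + r \<le> p" using bc by (auto simp: center_labels_def)
  let ?c = "err_factor * (1 / real n + real p / (\<rho> * (real n)\<^sup>2))"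
  define \<Phi> where "\<Phi> y \<longleftrightarrow> (\<Sum>q\<in>block 1 b. (y q - pcov P q)\<^sup>2) \<le> ?c" for y
  have n0: "0 < real n" "1 \<le> n" using T(10) by auto
  have ell2: "0 \<le> ell\<^sup>2" by simp
  define \<rho>B where "\<rho>B = (\<rho> / 4) / (2 * real p)"
  have bud: "0 < \<rho>B" using T by (simp add: \<rho>B_def)
  have meas: "Measurable.pred (PiM (Idx 1 l \<times> Idx 1 (l + r)) (\<lambda>_. borel)) \<Phi>"
    unfolding \<Phi>_def using measurable_block_error[where k = 1 and b = b and S = "pcov P" and c = ?c] by (simp add: b)
  have sub: "Idx 1 l \<subseteq> {1..p}" "Idx 1 (l + r) \<subseteq> {1..p}" using b by (intro Idx_subset; simp)+
  have I: "Idx 1 l = {l}" "Idx 1 (l + r) = {l + r}" using b(2) by (auto simp: Idx_1 simp del: One_nat_def)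
  let ?\<tau> = "sqrt (18 * R_center ^ 4 / (\<rho>B * (real n)\<^sup>2)) * ell\<^sup>2"
  have R4: "R_center ^ 4 \<le> 4 * C_1\<^sup>2 * K ^ 4 * ell\<^sup>2"
  proof -
    have Rsq: "R_center\<^sup>2 = C_1 * K\<^sup>2 * (1 + ell)" unfolding R_center_def ell_def[symmetric] using T by (simp add: power_mult_distrib)
    have "R_center ^ 4 = (R_center\<^sup>2)\<^sup>2" by simp
    also have "\<dots> = C_1\<^sup>2 * K ^ 4 * (1 + ell)\<^sup>2" unfolding Rsq by (simp add: power_mult_distrib)
    also have "\<dots> \<le> C_1\<^sup>2 * K ^ 4 * (2 * ell)\<^sup>2" using T by (intro mult_left_mono power_mono) auto
    finally show ?thesis by (simp add: power_mult_distrib mult_ac)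
  qed
  have "emeasure (dp_cov_block n p (pad X) (Idx 1 l) (Idx 1 (l + r)) \<rho>B R_center)
      {y\<in>space (dp_cov_block n p (pad X) (Idx 1 l) (Idx 1 (l + r)) \<rho>B R_center). \<not> \<Phi> y}
    \<le> ennreal (real (card (Idx 1 l \<times> Idx 1 (l + r))) * (2 * exp (- (ell\<^sup>2)\<^sup>2 / 4)))"
  proof (rule dp_cov_block_prob[OF finite_Idx finite_Idx sub _ ell2 meas])
    show "u \<le> v" if "u \<in> Idx 1 l" "v \<in> Idx 1 (l + r)" for u v using that unfolding I by simp
    show "0 \<le> \<rho>B" using bud by simp
    fix y assume y: "\<And>u v. u \<in> Idx 1 l \<Longrightarrow> v \<in> Idx 1 (l + r) \<Longrightarrow>
        \<bar>y (u, v) - (\<Sum>i=1..n. vclip (Idx 1 l) R_center (pad X i) u * vclip (Idx 1 (l + r)) R_center (pad X i) v) / real n\<bar> \<le> ?\<tau>"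
    define u v where "u = l" and "v = l + r"
    have uv: "u \<in> Idx 1 l" "v \<in> Idx 1 (l + r)" unfolding I by (auto simp: u_def v_def)
    let ?m = "(\<Sum>i=1..n. pad X i u * pad X i v) / real n"
    have "vclip (Idx 1 l) R_center (pad X i) u = pad X i u" "vclip (Idx 1 (l + r)) R_center (pad X i) v = pad X i v" if "i \<in> {1..n}" for i
      using that uv b(2) by (auto intro!: vclip_id pad_center_norm simp: finite_Idx simp del: One_nat_def)
    then have "\<bar>y (u, v) - ?m\<bar> \<le> ?\<tau>" using y[OF uv] by simp
    then have 1: "(y (u, v) - ?m)\<^sup>2 \<le> ?\<tau>\<^sup>2" by (rule square_le_of_abs_le)
    have 2: "(?m - pcov P (u, v))\<^sup>2 \<le> entry_deviation\<^sup>2" using mean_deviation(2)[of u v] by (rule square_le_of_abs_le)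
    have "(\<Sum>q\<in>block 1 b. (y q - pcov P q)\<^sup>2) = (y (u, v) - pcov P (u, v))\<^sup>2"
      unfolding b block.simps I by (simp add: u_def v_def)
    also have "\<dots> \<le> 2 * (y (u, v) - ?m)\<^sup>2 + 2 * (?m - pcov P (u, v))\<^sup>2"
      by (rule square_triangle)
    also have "\<dots> \<le> 2 * ?\<tau>\<^sup>2 + 2 * entry_deviation\<^sup>2" using 1 2 by simp
    also have "\<dots> \<le> err_factor * (real p / (\<rho> * (real n)\<^sup>2)) + err_factor * (1 / real n)"
    proof (rule add_mono)
      have "2 * ?\<tau>\<^sup>2 = 36 * R_center ^ 4 * ell ^ 4 / (\<rho>B * (real n)\<^sup>2)" using bud by (simp add: power_mult_distrib)
      also have "\<dots> \<le> 36 * (4 * C_1\<^sup>2 * K ^ 4 * ell\<^sup>2) * ell ^ 4 / (\<rho>B * (real n)\<^sup>2)"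
        using bud R4 by (intro divide_right_mono mult_right_mono mult_left_mono) auto
      also have "\<dots> = 1152 * C_1\<^sup>2 * K ^ 4 * ell ^ 6 * (real p / (\<rho> * (real n)\<^sup>2))"
        using T n0 by (simp add: power_add[symmetric] \<rho>B_def field_simps)
      also have "\<dots> \<le> err_factor * (real p / (\<rho> * (real n)\<^sup>2))" using F(4) T by (intro mult_right_mono) auto
      finally show "2 * ?\<tau>\<^sup>2 \<le> err_factor * (real p / (\<rho> * (real n)\<^sup>2))" .
      have "2 * entry_deviation\<^sup>2 = 8 * L\<^sup>2 * ell\<^sup>2 * (1 / real n)" by (simp add: entry_deviation_square)
      also have "\<dots> \<le> err_factor * (1 / real n)" using F(5) by (intro mult_right_mono) auto
      finally show "2 * entry_deviation\<^sup>2 \<le> err_factor * (1 / real n)" .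
    qed
    finally show "\<Phi> y" by (simp add: \<Phi>_def algebra_simps)
  qed
  also have "\<dots> \<le> ennreal fail_prob"
  proof (rule ennreal_leI)
    have "real (card (Idx 1 l \<times> Idx 1 (l + r))) * (2 * exp (- (ell\<^sup>2)\<^sup>2 / 4)) = 2 * exp (- (ell\<^sup>2)\<^sup>2 / 4)" unfolding I by simp
    also have "\<dots> \<le> fail_prob" using noise_fail_le[OF tuned, of 1] T(12) by (simp add: add_increasing[OF less_imp_le[OF exp_gt_zero]])
        (smt (verit) exp_ge_zero)
    finally show "real (card (Idx 1 l \<times> Idx 1 (l + r))) * (2 * exp (- (ell\<^sup>2)\<^sup>2 / 4)) \<le> fail_prob" .
  qed
  finally show ?thesis unfolding \<Phi>_def b center_law.simps \<rho>B_def .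
qed

end

end

section \<open>Geometry of the blocks and selection of the level\<close>

text \<open>Every pair on or above the diagonal represents at most two pairs.\<close>

lemma symmetric_sum_le:
  fixes f :: "nat \<times> nat \<Rightarrow> real"
  assumes "\<And>q. 0 \<le> f q"
  shows "(\<Sum>q\<in>{1..m} \<times> {1..m}. f (min (fst q) (snd q), max (fst q) (snd q))) \<le> 2 * (\<Sum>q | q \<in> {1..m} \<times> {1..m} \<and> fst q \<le> snd q. f q)"
proof -
  let ?g = "\<lambda>q. f (min (fst q) (snd q), max (fst q) (snd q))"
  let ?U = "{q. q \<in> {1..m} \<times> {1..m} \<and> fst q \<le> snd q}" and ?V = "{q. q \<in> {1..m} \<times> {1..m} \<and> snd q < fst q}"
  have fin: "finite ?U" "finite ?V" by (rule finite_subset[of _ "{1..m} \<times> {1..m}"]; auto)+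
  have "{1..m} \<times> {1..m} = ?U \<union> ?V" by auto
  then have "(\<Sum>q\<in>{1..m} \<times> {1..m}. ?g q) = (\<Sum>q\<in>?U \<union> ?V. ?g q)" by (rule arg_cong)
  also have "\<dots> = (\<Sum>q\<in>?U. ?g q) + (\<Sum>q\<in>?V. ?g q)"
    using fin by (intro sum.union_disjoint) auto
  also have "(\<Sum>q\<in>?U. ?g q) = (\<Sum>q\<in>?U. f q)"
    by (intro sum.cong refl) (auto simp: min_absorb1 max_absorb2)
  also have "(\<Sum>q\<in>?V. ?g q) = (\<Sum>q\<in>prod.swap ` ?V. f q)"
    by (subst sum.reindex) (auto simp: min_absorb2 max_absorb1 intro!: sum.cong)
  also have "\<dots> \<le> (\<Sum>q\<in>?U. f q)"
    using fin assms by (intro sum_mono2) auto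
  finally show ?thesis by simp
qed

text \<open>Radial clipping is the projection onto a ball; by the Cauchy-Schwarz inequality it
  satisfies the same obtuse-angle condition as the spectral clip.\<close>

lemma vclip_contracts:
  assumes A: "finite A" and S: "L2_set S A \<le> R"
  shows "L2_set (\<lambda>q. vclip A R z q - S q) A \<le> L2_set (\<lambda>q. z q - S q) A"
proof (cases "L2_set z A \<le> R")
  case True
  have "vclip A R z q = z q" if "q \<in> A" for q by (rule vclip_id[OF A True that])
  then show ?thesis by (simp add: L2_set_def)
next
  case False
  have R0: "0 \<le> R" using S L2_set_nonneg[of S A] by linarith
  define Z where "Z = L2_set z A"
  have Z: "R < Z" "0 < Z" using False R0 by (auto simp: Z_def)
  define c where "c = R / Z"
  have c: "0 \<le> c" "c \<le> 1" "c * Z = R" using Z R0 by (auto simp: c_def)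
  have v: "vclip A R z q = c * z q" for q using c Z by (simp add: vclip_def Z_def[symmetric] c_def[symmetric])
  have "(\<Sum>q\<in>A. (z q - vclip A R z q) * (S q - vclip A R z q)) = (1 - c) * ((\<Sum>q\<in>A. z q * S q) - c * Z\<^sup>2)"
  proof -
    have "Z\<^sup>2 = (\<Sum>q\<in>A. z q * z q)" by (simp add: Z_def L2_set_def sum_nonneg power2_eq_square)
    then show ?thesis
      unfolding v by (simp add: sum_distrib_left sum_subtractf[symmetric] algebra_simps)
  qed
  also have "\<dots> \<le> 0"
  proof (rule mult_nonneg_nonpos)
    have "(\<Sum>q\<in>A. z q * S q) \<le> (\<Sum>q\<in>A. \<bar>z q\<bar> * \<bar>S q\<bar>)"
      by (intro sum_mono) (metis abs_ge_self abs_mult)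
    also have "\<dots> \<le> Z * L2_set S A" unfolding Z_def by (rule L2_set_mult_ineq)
    also have "\<dots> \<le> Z * R" using S Z by (intro mult_left_mono) auto
    also have "\<dots> = c * Z\<^sup>2" using c by (simp add: power2_eq_square mult_ac)
    finally show "(\<Sum>q\<in>A. z q * S q) - c * Z\<^sup>2 \<le> 0" by simp
  qed (use c in simp)
  finally have "(\<Sum>q\<in>A. (vclip A R z q - S q)\<^sup>2) \<le> (\<Sum>q\<in>A. (z q - S q)\<^sup>2)" by (rule obtuse_distance_le)
  then show ?thesis by (simp add: L2_set_def)
qed

context center_outer
begin

text \<open>The position, counted from zero, of the dyadic interval of length \<open>k\<close>
  that contains \<open>u\<close>.\<close>

definition cell :: "nat \<Rightarrow> nat \<Rightarrow> nat" where "cell k u = (u - 1) div k"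

text \<open>For pairs on or above the diagonal: the intervals of length \<open>k\<close> that
  contain the two indices are equal or adjacent. The pairs near at scale \<open>1\<close> form the
  center, and the outer blocks of side \<open>k\<close> tile the pairs that are near at scale
  \<open>2k\<close> but not at scale \<open>k\<close>.\<close>

definition near :: "nat \<Rightarrow> nat \<times> nat \<Rightarrow> bool" where
  "near k q \<longleftrightarrow> cell k (snd q) \<le> cell k (fst q) + 1"

lemma mem_Idx_iff:
  assumes "1 \<le> u" "1 \<le> k" "1 \<le> l"
  shows "u \<in> Idx k l \<longleftrightarrow> l = cell k u + 1"
proof
  assume "u \<in> Idx k l"
  then have u: "(l - 1) * k \<le> u - 1" "u - 1 < l * k" by (auto simp: Idx_def)
  have "l * k = (l - 1) * k + k" using assms(3) by (cases l) auto
  with u have "(u - 1) div k = l - 1" using assms(2) by (intro div_nat_eqI) (auto simp: mult.commute)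
  then show "l = cell k u + 1" using assms(3) by (simp add: cell_def)
next
  assume l: "l = cell k u + 1"
  have "cell k u * k \<le> u - 1" by (simp add: cell_def)
  moreover have "u - 1 < (cell k u + 1) * k" unfolding cell_def using assms(2) dividend_less_div_times[of k "u - 1"] by (simp add: algebra_simps)
  ultimately show "u \<in> Idx k l" using assms(1) unfolding l Idx_def by auto
qed

lemma cell_double: "cell (2 * k) u = cell k u div 2"
  unfolding cell_def by (metis div_mult2_eq mult.commute)

lemma cell_mono: "u \<le> v \<Longrightarrow> cell k u \<le> cell k v"
  unfolding cell_def by (intro div_le_mono) auto

lemma near_double: "near k q \<Longrightarrow> near (2 * k) q"
  unfolding near_def cell_double by linarith

lemma near_scale_mono: "s \<le> s' \<Longrightarrow> near (2 ^ s) q \<Longrightarrow> near (2 ^ s') q"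
  by (induction s' rule: dec_induct) (auto dest: near_double)

lemma center_block_iff:
  assumes q: "q = (u, v)" "1 \<le> u" "u \<le> v" "v \<le> p" and b: "b \<in> center_labels"
  shows "q \<in> block 1 b \<longleftrightarrow> b = (u, v - u)"
proof -
  obtain l r where b': "b = (l, r)" "1 \<le> l" using b by (auto simp: center_labels_def)
  then have I: "Idx 1 l = {l}" "Idx 1 (l + r) = {l + r}" using Idx_1[of l] Idx_1[of "l + r"] by auto
  show ?thesis unfolding q(1) b' block.simps I using q(3) by auto
qed

lemma center_label_iff_near:
  assumes "1 \<le> u" "u \<le> v" "v \<le> p"
  shows "(u, v - u) \<in> center_labels \<longleftrightarrow> near 1 (u, v)"
  using assms by (auto simp: center_labels_def near_def cell_def)

text \<open>The three patterns of outer labels enumerate the parities of the two interval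
  positions: their parents are adjacent while they themselves are at least two apart.\<close>

lemma outer_label_iff:
  assumes k: "k \<in> scales" and xy: "x \<le> y" "y < N k"
  shows "(x + 1, y - x) \<in> outer_labels k \<longleftrightarrow> y div 2 \<le> x div 2 + 1 \<and> \<not> y \<le> x + 1"
proof
  assume "(x + 1, y - x) \<in> outer_labels k"
  then obtain m where m: "m \<in> {1..<N (2 * k)}" "(x + 1, y - x) \<in> {(2 * m - 1, 2), (2 * m - 1, 3), (2 * m, 2)}"
    unfolding outer_labels_def by blast
  have "1 \<le> m" using m(1) by simp
  moreover have "(x + 1 = 2 * m - 1 \<and> y - x = 2) \<or> (x + 1 = 2 * m - 1 \<and> y - x = 3) \<or> (x + 1 = 2 * m \<and> y - x = 2)"
    using m(2) by blast
  ultimately show "y div 2 \<le> x div 2 + 1 \<and> \<not> y \<le> x + 1" using xy by presburger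
next
  assume a: "y div 2 \<le> x div 2 + 1 \<and> \<not> y \<le> x + 1"
  define m where "m = y div 2"
  have "(x + 1 = 2 * m - 1 \<and> y - x = 2) \<or> (x + 1 = 2 * m - 1 \<and> y - x = 3) \<or> (x + 1 = 2 * m \<and> y - x = 2)" "1 \<le> m"
  proof -
    define i where "i = x div 2"
    have x: "x = 2 * i \<or> x = 2 * i + 1" and y: "y = 2 * m \<or> y = 2 * m + 1" unfolding i_def m_def by presburger+
    have le: "m \<le> i + 1" "x + 2 \<le> y" using a unfolding i_def m_def by auto
    then have m: "m = i + 1" using x y by linarith
    show "(x + 1 = 2 * m - 1 \<and> y - x = 2) \<or> (x + 1 = 2 * m - 1 \<and> y - x = 3) \<or> (x + 1 = 2 * m \<and> y - x = 2)"
      using x y le(2) unfolding m by auto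
    show "1 \<le> m" unfolding m by simp
  qed
  moreover have "m < N (2 * k)"
  proof -
    have "N (2 * k) = N k div 2" unfolding N_def by (metis div_mult2_eq mult.commute)
    moreover obtain s where "2 * k * s = p" using scalesE[OF k] by metis
    then have "N k = 2 * s" using scales_ge_1[OF k] unfolding N_def by (metis mult.assoc mult.commute nonzero_mult_div_cancel_left not_one_le_zero)
    ultimately show ?thesis using xy(2) unfolding m_def by presburger
  qed
  ultimately show "(x + 1, y - x) \<in> outer_labels k" unfolding outer_labels_def by auto
qed

lemma cell_less: "1 \<le> v \<Longrightarrow> v \<le> p \<Longrightarrow> k \<in> scales \<Longrightarrow> cell k v < N k"
proof -
  assume v: "1 \<le> v" "v \<le> p" and k: "k \<in> scales"
  obtain s where s: "k = 2 ^ s" "s + 2 \<le> lg" using k unfolding scales_eq by auto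
  then have "p = k * 2 ^ (lg - s)" unfolding p_lg by (simp add: power_add[symmetric])
  then have "p = k * N k" using scales_ge_1[OF k] by (simp add: N_def)
  then show "cell k v < N k" unfolding cell_def using v scales_ge_1[OF k]
    by (intro less_mult_imp_div_less) (auto simp: mult.commute)
qed

lemma outer_block_iff:
  assumes q: "q = (u, v)" "1 \<le> u" "u \<le> v" "v \<le> p" and k: "k \<in> scales" and b: "b \<in> outer_labels k"
  shows "q \<in> block k b \<longleftrightarrow> b = (cell k u + 1, cell k v - cell k u)"
proof -
  obtain l r where b': "b = (l, r)" by (cases b)
  have lr: "1 \<le> l" "2 \<le> r" using outer_labelsE[OF k b[unfolded b']] by auto
  have "q \<in> block k b \<longleftrightarrow> l = cell k u + 1 \<and> l + r = cell k v + 1"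
    unfolding q(1) b' block.simps using mem_Idx_iff[of u k l] mem_Idx_iff[of v k "l + r"] q lr scales_ge_1[OF k] by auto
  then show ?thesis unfolding b' using cell_mono[OF q(3), of k] by auto
qed

lemma outer_label_iff_near:
  assumes q: "1 \<le> u" "u \<le> v" "v \<le> p" and k: "k \<in> scales"
  shows "(cell k u + 1, cell k v - cell k u) \<in> outer_labels k \<longleftrightarrow> near (2 * k) (u, v) \<and> \<not> near k (u, v)"
proof -
  have "cell k u \<le> cell k v" by (rule cell_mono[OF q(2)])
  moreover have "cell k v < N k" using q k by (intro cell_less) auto
  ultimately show ?thesis using outer_label_iff[OF k, of "cell k u" "cell k v"] by (simp add: near_def cell_double)
qed

text \<open>A pair on or above the diagonal lies in exactly one block, determined by the least
  scale at which it is near. So the two sums consist of a single term, and any nonnegative error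
  functional passes through them.\<close>

lemma assemble_error_le:
  fixes e :: "real \<Rightarrow> real"
  assumes q: "q = (u, v)" "1 \<le> u" "u \<le> v" "v \<le> p" and lg: "1 \<le> lg" and e: "\<And>x. 0 \<le> e x"
  shows "e (assemble c z q) \<le> (\<Sum>b\<in>center_labels. if q \<in> block 1 b then e (c b q) else 0)
     + (\<Sum>k\<in>scales. \<Sum>b\<in>outer_labels k. if q \<in> block k b then e (Z z k b (j_hat z k) q) else 0)"
proof -
  let ?cb = "(u, v - u)" and ?ob = "\<lambda>k. (cell k u + 1, cell k v - cell k u)"
  have cen: "(\<Sum>b\<in>center_labels. if q \<in> block 1 b then f b else 0) = (if near 1 (u, v) then f ?cb else 0)" for f :: "nat \<times> nat \<Rightarrow> real"
  proof -
    have "(\<Sum>b\<in>center_labels. if q \<in> block 1 b then f b else 0) = (\<Sum>b\<in>center_labels. if b = ?cb then f b else 0)"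
      using center_block_iff[OF q] by (intro sum.cong refl) simp
    then show ?thesis using center_label_iff_near[OF q(2-4)] finite_center_labels by simp
  qed
  have out: "(\<Sum>b\<in>outer_labels k. if q \<in> block k b then f b else 0) = (if near (2 * k) (u, v) \<and> \<not> near k (u, v) then f (?ob k) else 0)"
    if k: "k \<in> scales" for k and f :: "nat \<times> nat \<Rightarrow> real"
  proof -
    have "(\<Sum>b\<in>outer_labels k. if q \<in> block k b then f b else 0) = (\<Sum>b\<in>outer_labels k. if b = ?ob k then f b else 0)"
      using outer_block_iff[OF q k] by (intro sum.cong refl) simp
    then show ?thesis using outer_label_iff_near[OF q(2-4) k] finite_outer_labels by simp
  qed
  have outs: "(\<Sum>k\<in>scales. \<Sum>b\<in>outer_labels k. if q \<in> block k b then f k b else 0)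
      = (\<Sum>k\<in>scales. if near (2 * k) (u, v) \<and> \<not> near k (u, v) then f k (?ob k) else 0)" for f :: "nat \<Rightarrow> nat \<times> nat \<Rightarrow> real"
    by (intro sum.cong refl out)
  show ?thesis
  proof (cases "near 1 (u, v)")
    case True
    have "near k (u, v)" if "k \<in> scales" for k
      using that near_scale_mono[of 0 _ "(u, v)"] True unfolding scales_eq by auto
    then have eq: "(\<Sum>k\<in>scales. if near (2 * k) (u, v) \<and> \<not> near k (u, v) then f k (?ob k) else 0) = 0" for f :: "nat \<Rightarrow> nat \<times> nat \<Rightarrow> real"
      by (intro sum.neutral) auto
    show ?thesis unfolding assemble_def cen outs
        eq[of "\<lambda>k b. Z z k b (j_hat z k) q"] eq[of "\<lambda>k b. e (Z z k b (j_hat z k) q)"] using True by simp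
  next
    case False
    (* Nearness is monotone in the scale and holds at p/2, where there are only two intervals; so
       it changes exactly once, between k0 and 2 k0. *)
    define s where "s = (LEAST s. near (2 ^ s) (u, v))"
    have top: "near (2 ^ (lg - 1)) (u, v)"
    proof -
      have "v - 1 < 2 ^ (lg - 1) * 2" using q(2-4) lg unfolding p_lg by (simp add: power_Suc2[symmetric])
      then have "cell (2 ^ (lg - 1)) v < 2" unfolding cell_def by (intro less_mult_imp_div_less) (simp add: mult.commute)
      then show ?thesis by (simp add: near_def)
    qed
    have ns: "near (2 ^ s) (u, v)" unfolding s_def by (rule LeastI[where P = "\<lambda>s. near (2 ^ s) (u, v)", OF top])
    have s1: "s \<le> lg - 1" unfolding s_def by (rule Least_le[where P = "\<lambda>s. near (2 ^ s) (u, v)", OF top])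
    have "s \<noteq> 0" using ns False by (cases s) auto
    then obtain s' where s': "s = Suc s'" by (cases s) auto
    have n': "\<not> near (2 ^ s') (u, v)" using not_less_Least[of s' "\<lambda>s. near (2 ^ s) (u, v)"] s' unfolding s_def by auto
    define k0 where "k0 = (2 :: nat) ^ s'"
    have "s' + 2 \<le> lg" using s1 s' lg by linarith
    then have k0: "k0 \<in> scales" unfolding scales_eq k0_def by blast
    have iff: "near (2 * k) (u, v) \<and> \<not> near k (u, v) \<longleftrightarrow> k = k0" if k: "k \<in> scales" for k
    proof
      assume "k = k0"
      then show "near (2 * k) (u, v) \<and> \<not> near k (u, v)" using ns n' s' by (simp add: k0_def)
    next
      obtain r where r: "k = 2 ^ r" using k unfolding scales_eq by auto
      assume a: "near (2 * k) (u, v) \<and> \<not> near k (u, v)"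
      have "\<not> r < s'"
      proof
        assume "r < s'"
        then have "Suc r \<le> s'" by simp
        from near_scale_mono[OF this] a r n' show False by auto
      qed
      moreover have "\<not> s' < r"
      proof
        assume "s' < r"
        then have "s \<le> r" using s' by simp
        from near_scale_mono[OF this ns] a r show False by auto
      qed
      ultimately show "k = k0" using r by (simp add: k0_def)
    qed
    have eq: "(\<Sum>k\<in>scales. if near (2 * k) (u, v) \<and> \<not> near k (u, v) then f k (?ob k) else 0) = f k0 (?ob k0)" for f :: "nat \<Rightarrow> nat \<times> nat \<Rightarrow> real"
    proof -
      have "(\<Sum>k\<in>scales. if near (2 * k) (u, v) \<and> \<not> near k (u, v) then f k (?ob k) else 0) = (\<Sum>k\<in>scales. if k = k0 then f k (?ob k) else 0)"
        using iff by (intro sum.cong refl) simp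
      then show ?thesis using k0 finite_scales by simp
    qed
    show ?thesis unfolding assemble_def cen outs
        eq[of "\<lambda>k b. Z z k b (j_hat z k) q"] eq[of "\<lambda>k b. e (Z z k b (j_hat z k) q)"] using False by simp
  qed
qed

lemma assembled_loss_le:
  assumes lg: "1 \<le> lg" and S: "\<And>i j. S (i, j) = S (j, i)"
  shows "(\<Sum>q\<in>{1..p} \<times> {1..p}. (assemble c z (min (fst q) (snd q), max (fst q) (snd q)) - S q)\<^sup>2)
    \<le> 2 * ((\<Sum>b\<in>center_labels. \<Sum>q\<in>block 1 b. (c b q - S q)\<^sup>2)
        + (\<Sum>k\<in>scales. \<Sum>b\<in>outer_labels k. \<Sum>q\<in>block k b. (Z z k b (j_hat z k) q - S q)\<^sup>2))"
proof -
  let ?U = "{q. q \<in> {1..p} \<times> {1..p} \<and> fst q \<le> snd q}"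
  have fin: "finite ?U" by (rule finite_subset[of _ "{1..p} \<times> {1..p}"]) auto
  have Sm: "S q = S (min (fst q) (snd q), max (fst q) (snd q))" for q
    using S by (cases q) (auto simp: min_def max_def)
  have each: "(assemble c z q - S q)\<^sup>2 \<le> (\<Sum>b\<in>center_labels. if q \<in> block 1 b then (c b q - S q)\<^sup>2 else 0)
     + (\<Sum>k\<in>scales. \<Sum>b\<in>outer_labels k. if q \<in> block k b then (Z z k b (j_hat z k) q - S q)\<^sup>2 else 0)" if "q \<in> ?U" for q
    using that by (intro assemble_error_le[where e = "\<lambda>x. (x - S q)\<^sup>2" and u = "fst q" and v = "snd q"] lg) auto
  have inner: "(\<Sum>q\<in>?U. if q \<in> block k b then f q else 0) \<le> (\<Sum>q\<in>block k b. f q)" if "\<And>q. 0 \<le> f q" for k b and f :: "nat \<times> nat \<Rightarrow> real"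
  proof -
    have "(\<Sum>q\<in>?U. if q \<in> block k b then f q else 0) = (\<Sum>q\<in>?U \<inter> block k b. f q)"
      using fin by (simp add: sum.inter_restrict)
    also have "\<dots> \<le> (\<Sum>q\<in>block k b. f q)" using that by (intro sum_mono2 finite_block) auto
    finally show ?thesis .
  qed
  have "(\<Sum>q\<in>{1..p} \<times> {1..p}. (assemble c z (min (fst q) (snd q), max (fst q) (snd q)) - S q)\<^sup>2)
      = (\<Sum>q\<in>{1..p} \<times> {1..p}. (\<lambda>q. (assemble c z q - S q)\<^sup>2) (min (fst q) (snd q), max (fst q) (snd q)))"
    by (intro sum.cong refl) (subst Sm, rule refl)
  also have "\<dots> \<le> 2 * (\<Sum>q\<in>?U. (assemble c z q - S q)\<^sup>2)" by (rule symmetric_sum_le) simp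
  also have "\<dots> \<le> 2 * (\<Sum>q\<in>?U. (\<Sum>b\<in>center_labels. if q \<in> block 1 b then (c b q - S q)\<^sup>2 else 0)
     + (\<Sum>k\<in>scales. \<Sum>b\<in>outer_labels k. if q \<in> block k b then (Z z k b (j_hat z k) q - S q)\<^sup>2 else 0))"
    by (intro mult_left_mono sum_mono each) auto
  also have "\<dots> = 2 * ((\<Sum>b\<in>center_labels. \<Sum>q\<in>?U. if q \<in> block 1 b then (c b q - S q)\<^sup>2 else 0)
     + (\<Sum>k\<in>scales. \<Sum>b\<in>outer_labels k. \<Sum>q\<in>?U. if q \<in> block k b then (Z z k b (j_hat z k) q - S q)\<^sup>2 else 0))"
  proof -
    have 1: "(\<Sum>q\<in>?U. \<Sum>b\<in>center_labels. if q \<in> block 1 b then (c b q - S q)\<^sup>2 else 0)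
        = (\<Sum>b\<in>center_labels. \<Sum>q\<in>?U. if q \<in> block 1 b then (c b q - S q)\<^sup>2 else 0)" by (rule sum.swap)
    have "(\<Sum>q\<in>?U. \<Sum>k\<in>scales. \<Sum>b\<in>outer_labels k. if q \<in> block k b then (Z z k b (j_hat z k) q - S q)\<^sup>2 else 0)
        = (\<Sum>k\<in>scales. \<Sum>q\<in>?U. \<Sum>b\<in>outer_labels k. if q \<in> block k b then (Z z k b (j_hat z k) q - S q)\<^sup>2 else 0)" by (rule sum.swap)
    also have "\<dots> = (\<Sum>k\<in>scales. \<Sum>b\<in>outer_labels k. \<Sum>q\<in>?U. if q \<in> block k b then (Z z k b (j_hat z k) q - S q)\<^sup>2 else 0)"
      by (intro sum.cong refl sum.swap)
    finally show ?thesis by (simp only: sum.distrib 1)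
  qed
  also have "\<dots> \<le> 2 * ((\<Sum>b\<in>center_labels. \<Sum>q\<in>block 1 b. (c b q - S q)\<^sup>2)
        + (\<Sum>k\<in>scales. \<Sum>b\<in>outer_labels k. \<Sum>q\<in>block k b. (Z z k b (j_hat z k) q - S q)\<^sup>2))"
    by (intro mult_left_mono add_mono sum_mono inner) auto
  finally show ?thesis .
qed

definition best_W :: "nat \<Rightarrow> nat \<Rightarrow> real" where "best_W k j = W k j (t k j)"

lemma best_W_le: "best_W k j \<le> W k j c"
proof -
  have U: "(UNIV :: candidate set) = {Zero, Structured, Dense}" using candidate.exhaust by blast
  then have fin: "finite (UNIV :: candidate set)" by (metis finite.emptyI finite_insert)
  have "t k j = arg_min_on (W k j) UNIV" by (simp add: t_def arg_min_on_def)
  then show ?thesis unfolding best_W_def using arg_min_least[OF fin, of c "W k j"] by auto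
qed

lemma a_antimono:
  assumes "0 \<le> C_G" "i \<le> j"
  shows "0 \<le> a k j" "a k j \<le> a k i"
proof -
  show "0 \<le> a k j" unfolding a_def using assms by simp
  have "(2::real) ^ i \<le> 2 ^ j" using assms by (intro power_increasing) auto
  then show "a k j \<le> a k i" unfolding a_def using assms by (intro divide_left_mono) auto
qed

lemma peel_objective_mono:
  assumes "0 \<le> x" "x \<le> y"
  shows "peel_objective n k x \<rho>B r \<le> peel_objective n k y \<rho>B r"
  unfolding peel_objective_def using assms by (intro add_right_mono divide_right_mono power_mono) auto

text \<open>Smaller radii make no candidate type more expensive, since all levels have the same
  budget.\<close>

lemma best_W_antimono:
  assumes CG: "0 \<le> C_G" and ij: "i \<le> j" and k: "1 \<le> k"
  shows "best_W k j \<le> best_W k i"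
proof -
  note aa = a_antimono[OF CG ij, of k]
  have "W k j c \<le> W k i c" for c
  proof (cases c)
    case Zero
    then show ?thesis using aa by (auto intro!: mult_left_mono power_mono)
  next
    case Structured
    have "(MIN r\<in>{1..k}. peel_objective n k (a k j) (budget k) r) \<le> (MIN r\<in>{1..k}. peel_objective n k (a k i) (budget k) r)"
    proof (rule Min.boundedI)
      fix x assume "x \<in> (\<lambda>r. peel_objective n k (a k i) (budget k) r) ` {1..k}"
      then obtain r where r: "r \<in> {1..k}" "x = peel_objective n k (a k i) (budget k) r" by auto
      have "(MIN r\<in>{1..k}. peel_objective n k (a k j) (budget k) r) \<le> peel_objective n k (a k j) (budget k) r" using r by (intro Min_le) auto
      also have "\<dots> \<le> x" unfolding r(2) by (intro peel_objective_mono aa)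
      finally show "(MIN r\<in>{1..k}. peel_objective n k (a k j) (budget k) r) \<le> x" .
    qed (use k in auto)
    then show ?thesis unfolding Structured W.simps by (intro mult_left_mono) auto
  qed simp
  then have "W k j (t k i) \<le> best_W k i" unfolding best_W_def .
  with best_W_le[of k j "t k i"] show ?thesis by linarith
qed

lemma best_W_nonneg:
  assumes "k \<in> scales" "0 < \<rho>"
  shows "0 \<le> best_W k j"
proof -
  have b: "0 < budget k" by (rule budget_pos[OF assms])
  have k: "1 \<le> k" by (rule scales_ge_1[OF assms(1)])
  have "0 \<le> W k j c" for c
  proof (cases c)
    case Structured
    have "0 \<le> (MIN r\<in>{1..k}. peel_objective n k (a k j) (budget k) r)"
      using k b by (intro Min.boundedI) (auto simp: peel_objective_def)
    then show ?thesis using Structured by simp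
  qed (use b in auto)
  then show ?thesis unfolding best_W_def .
qed

text \<open>Lepski's argument. All levels up to \<open>j0\<close> are within their tolerances, so
  \<open>j0\<close> passes the pairwise comparisons and the selected level is at least
  \<open>j0\<close>. It was itself compared with \<open>j0\<close>, and its tolerance is no larger
  than that of \<open>j0\<close>; the triangle inequality gives a factor of three.\<close>

lemma selected_block_error:
  assumes k: "k \<in> scales" and \<rho>: "0 < \<rho>" and CD: "0 \<le> C_D" and CG: "0 \<le> C_G" and jJ: "j0 \<le> J k"
    and S: "\<And>b. b \<in> outer_labels k \<Longrightarrow> L2_set S (block k b) \<le> sqrt (real k) * a k 0"
    and err: "\<And>b j. b \<in> outer_labels k \<Longrightarrow> j \<le> j0 \<Longrightarrow> (\<Sum>q\<in>block k b. (z (k, b, j) q - S q)\<^sup>2) \<le> C_D * ell powr E_D * best_W k j"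
    and b: "b \<in> outer_labels k"
  shows "(\<Sum>q\<in>block k b. (Z z k b (j_hat z k) q - S q)\<^sup>2) \<le> 9 * (C_D * ell powr E_D * best_W k j0)"
proof -
  have k1: "1 \<le> k" by (rule scales_ge_1[OF k])
  have Wn: "0 \<le> C_D * ell powr E_D * best_W k j" for j
    using best_W_nonneg[OF k \<rho>] CD by simp
  have D: "D k j = sqrt (C_D * ell powr E_D * best_W k j)" for j by (simp add: D_def ell_def best_W_def)
  have Zerr: "L2_set (\<lambda>q. Z z k b j q - S q) (block k b) \<le> D k j" if "b \<in> outer_labels k" "j \<le> j0" for b j
  proof -
    have "L2_set (\<lambda>q. Z z k b j q - S q) (block k b) \<le> L2_set (\<lambda>q. z (k, b, j) q - S q) (block k b)"
      unfolding Z_def by (intro vclip_contracts finite_block S that)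
    also have "\<dots> \<le> D k j" unfolding D L2_set_def using err[OF that] by simp
    finally show ?thesis .
  qed
  have tri: "L2_set (\<lambda>q. f q - h q) A \<le> L2_set (\<lambda>q. f q - g q) A + L2_set (\<lambda>q. g q - h q) A" for f g h :: "nat \<times> nat \<Rightarrow> real" and A
    using L2_set_triangle_ineq[of "\<lambda>q. f q - g q" "\<lambda>q. g q - h q" A] by simp
  have swap: "L2_set (\<lambda>q. f q - g q) A = L2_set (\<lambda>q. g q - f q) A" for f g :: "nat \<times> nat \<Rightarrow> real" and A
    unfolding L2_set_def by (simp add: power2_commute)
  let ?ok = "\<lambda>j. j \<le> J k \<and> (\<forall>i<j. \<forall>b\<in>outer_labels k. L2_set (\<lambda>q. Z z k b j q - Z z k b i q) (block k b) \<le> D k j + D k i)"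
  have fin: "finite {j. ?ok j}" by (rule finite_subset[of _ "{..J k}"]) auto
  have ok0: "?ok j0"
  proof (intro conjI jJ allI impI ballI)
    fix i b assume i: "i < j0" and b: "b \<in> outer_labels k"
    have "L2_set (\<lambda>q. Z z k b j0 q - Z z k b i q) (block k b)
        \<le> L2_set (\<lambda>q. Z z k b j0 q - S q) (block k b) + L2_set (\<lambda>q. S q - Z z k b i q) (block k b)" by (rule tri)
    also have "\<dots> \<le> D k j0 + D k i" using Zerr[OF b, of j0] Zerr[OF b, of i] i swap[of S "Z z k b i"] by simp
    finally show "L2_set (\<lambda>q. Z z k b j0 q - Z z k b i q) (block k b) \<le> D k j0 + D k i" .
  qed
  have ge: "j0 \<le> j_hat z k" unfolding j_hat_def using fin ok0 by (intro Max_ge) auto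
  have okh: "?ok (j_hat z k)"
  proof -
    have "Max {j. ?ok j} \<in> {j. ?ok j}" using fin ok0 by (intro Max_in) auto
    then show ?thesis unfolding j_hat_def by simp
  qed
  have D0: "0 \<le> D k j0" unfolding D using Wn[of j0] by simp
  have "D k (j_hat z k) \<le> D k j0"
    unfolding D using best_W_antimono[OF CG ge k1] CD by (intro real_sqrt_le_mono mult_left_mono) auto
  have "L2_set (\<lambda>q. Z z k b (j_hat z k) q - S q) (block k b) \<le> 3 * D k j0"
  proof (cases "j_hat z k = j0")
    case True
    then show ?thesis using Zerr[OF b, of j0] D0 by simp
  next
    case False
    then have "j0 < j_hat z k" using ge by simp
    then have "L2_set (\<lambda>q. Z z k b (j_hat z k) q - Z z k b j0 q) (block k b) \<le> D k (j_hat z k) + D k j0"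
      using okh b by blast
    moreover have "L2_set (\<lambda>q. Z z k b (j_hat z k) q - S q) (block k b)
        \<le> L2_set (\<lambda>q. Z z k b (j_hat z k) q - Z z k b j0 q) (block k b) + L2_set (\<lambda>q. Z z k b j0 q - S q) (block k b)" by (rule tri)
    ultimately show ?thesis using Zerr[OF b, of j0] \<open>D k (j_hat z k) \<le> D k j0\<close> by linarith
  qed
  then have "(L2_set (\<lambda>q. Z z k b (j_hat z k) q - S q) (block k b))\<^sup>2 \<le> (3 * D k j0)\<^sup>2"
    by (intro power_mono L2_set_nonneg)
  also have "\<dots> = 9 * (C_D * ell powr E_D * best_W k j0)" unfolding D using Wn[of j0] by (simp add: power_mult_distrib)
  finally show ?thesis by (simp add: L2_set_def sum_nonneg)
qed

end

section \<open>Balancing truncation, sampling and privacy errors across scales\<close>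

text \<open>At the width \<open>k1\<close> the squared tail \<open>k powr - (2\<alpha> +
  1)\<close> equals \<open>k/n\<close>, and at \<open>k2\<close> it equals \<open>k\<^sup>2
  \<delta>\<close>; the common values are the two nonparametric rates. The ambient dimension
  \<open>x\<close> enters as a cap on the width.\<close>

lemma optimal_width_rate:
  fixes \<alpha> n \<delta> x :: real
  assumes \<alpha>: "0 < \<alpha>" and n: "1 \<le> n" and \<delta>: "0 < \<delta>" "\<delta> \<le> 1"
  defines "T1 \<equiv> min (n powr (- ((2 * \<alpha> + 1) / (2 * \<alpha> + 2)))) (x / n)"
    and "T2 \<equiv> min (\<delta> powr ((2 * \<alpha> + 1) / (2 * \<alpha> + 3))) (x\<^sup>2 * \<delta>)"
    and "k1 \<equiv> n powr (1 / (2 * \<alpha> + 2))" and "k2 \<equiv> \<delta> powr (- (1 / (2 * \<alpha> + 3)))"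
  shows "1 \<le> k1" "1 \<le> k2" "\<And>w. w \<le> k1 \<Longrightarrow> w \<le> x \<Longrightarrow> w / n \<le> T1"
    "\<And>w. 0 \<le> w \<Longrightarrow> w \<le> k2 \<Longrightarrow> w \<le> x \<Longrightarrow> w\<^sup>2 * \<delta> \<le> T2"
    "k1 \<le> x \<Longrightarrow> k1 powr (- (2 * \<alpha> + 1)) \<le> T1" "k2 \<le> x \<Longrightarrow> k2 powr (- (2 * \<alpha> + 1)) \<le> T2"
proof -
  have n0: "0 < n" using n by simp
  show k1: "1 \<le> k1" unfolding k1_def using n \<alpha> by (intro ge_one_powr_ge_zero) auto
  have "k2 = (1 / \<delta>) powr (1 / (2 * \<alpha> + 3))" unfolding k2_def using \<delta> by (simp add: powr_minus_divide powr_divide)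
  then show k2: "1 \<le> k2" using \<delta> \<alpha> by (simp add: ge_one_powr_ge_zero)
  have f1: "k1 / n = n powr (- ((2 * \<alpha> + 1) / (2 * \<alpha> + 2)))"
  proof -
    have "k1 / n = n powr (1 / (2 * \<alpha> + 2) - 1)" unfolding k1_def using n0 by (simp add: powr_diff)
    also have "1 / (2 * \<alpha> + 2) - 1 = - ((2 * \<alpha> + 1) / (2 * \<alpha> + 2))" using \<alpha> by (simp add: field_simps)
    finally show ?thesis .
  qed
  have f1': "k1 powr (- (2 * \<alpha> + 1)) = n powr (- ((2 * \<alpha> + 1) / (2 * \<alpha> + 2)))"
    unfolding k1_def powr_powr mult_minus_right times_divide_eq_left mult_1 ..
  have f2: "k2\<^sup>2 * \<delta> = \<delta> powr ((2 * \<alpha> + 1) / (2 * \<alpha> + 3))"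
  proof -
    have "k2\<^sup>2 = k2 powr 2" using k2 by (simp add: powr_numeral)
    also have "\<dots> = \<delta> powr (- (2 / (2 * \<alpha> + 3)))" unfolding k2_def powr_powr by simp
    finally have "k2\<^sup>2 * \<delta> = \<delta> powr (- (2 / (2 * \<alpha> + 3)) + 1)"
      using \<delta> powr_add[of \<delta> "- (2 / (2 * \<alpha> + 3))" 1] by simp
    also have "- (2 / (2 * \<alpha> + 3)) + 1 = (2 * \<alpha> + 1) / (2 * \<alpha> + 3)" using \<alpha> by (simp add: field_simps)
    finally show ?thesis .
  qed
  have f2': "k2 powr (- (2 * \<alpha> + 1)) = \<delta> powr ((2 * \<alpha> + 1) / (2 * \<alpha> + 3))"
    unfolding k2_def powr_powr minus_mult_minus times_divide_eq_left mult_1 ..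
  show "w / n \<le> T1" if "w \<le> k1" "w \<le> x" for w
    unfolding T1_def f1[symmetric] using that n0 by (simp add: divide_right_mono)
  show "w\<^sup>2 * \<delta> \<le> T2" if "0 \<le> w" "w \<le> k2" "w \<le> x" for w
    unfolding T2_def f2[symmetric] using that \<delta> by (auto intro!: mult_right_mono power_mono)
  show "k1 powr (- (2 * \<alpha> + 1)) \<le> T1" if "k1 \<le> x"
    unfolding f1' T1_def using that n0 f1 by (auto simp: divide_right_mono simp flip: f1)
  show "k2 powr (- (2 * \<alpha> + 1)) \<le> T2" if "k2 \<le> x"
    unfolding f2' T2_def using that \<delta> k2 by (auto simp flip: f2 intro!: mult_right_mono power_mono)
qed

text \<open>The first alternative is the dense release below the optimal width \<open>min k1
  k2\<close>, the second is peeling with \<open>r\<close> equal to the integer part of that width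
  above it: rank plays the part of width, since \<open>k powr - 2\<alpha> / r\<close> is at most
  the squared tail at the optimal width up to a factor of two.\<close>

lemma scale_rate:
  fixes \<alpha> n \<delta> :: real and k m :: nat
  assumes \<alpha>: "0 < \<alpha>" and n: "1 \<le> n" and \<delta>: "0 < \<delta>" "\<delta> \<le> 1" and k: "1 \<le> k" "k \<le> m"
  defines "T \<equiv> min (n powr (- ((2 * \<alpha> + 1) / (2 * \<alpha> + 2)))) (real m / n)
      + min (\<delta> powr ((2 * \<alpha> + 1) / (2 * \<alpha> + 3))) ((real m)\<^sup>2 * \<delta>)"
  shows "real k / n + (real k)\<^sup>2 * \<delta> \<le> T \<or>
    (\<exists>r\<in>{1..k}. real k powr (- 2 * \<alpha>) / real r \<le> 2 * T \<and> real r / n + (real r)\<^sup>2 * \<delta> \<le> T)"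
    and "1 / n + \<delta> \<le> T"
proof -
  define k1 k2 where "k1 = n powr (1 / (2 * \<alpha> + 2))" and "k2 = \<delta> powr (- (1 / (2 * \<alpha> + 3)))"
  define T1 T2 where "T1 = min (n powr (- ((2 * \<alpha> + 1) / (2 * \<alpha> + 2)))) (real m / n)"
    and "T2 = min (\<delta> powr ((2 * \<alpha> + 1) / (2 * \<alpha> + 3))) ((real m)\<^sup>2 * \<delta>)"
  note o = optimal_width_rate(1,2)[OF \<alpha> n \<delta>, folded k1_def k2_def]
    optimal_width_rate(3-6)[where x = "real m", OF \<alpha> n \<delta>, folded k1_def k2_def T1_def T2_def]
  have T: "T = T1 + T2" by (simp add: T_def T1_def T2_def)
  have T0: "0 \<le> T1" "0 \<le> T2" using n \<delta> by (auto simp: T1_def T2_def)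
  have m1: "1 \<le> real m" using k by simp
  show "1 / n + \<delta> \<le> T" unfolding T using o(3)[of 1] o(4)[of 1] o(1,2) m1 by simp
  show "real k / n + (real k)\<^sup>2 * \<delta> \<le> T \<or>
    (\<exists>r\<in>{1..k}. real k powr (- 2 * \<alpha>) / real r \<le> 2 * T \<and> real r / n + (real r)\<^sup>2 * \<delta> \<le> T)"
  proof (cases "real k \<le> min k1 k2")
    case True
    then show ?thesis unfolding T using o(3)[of "real k"] o(4)[of "real k"] k by auto
  next
    case False
    define m0 where "m0 = min k1 k2"
    (* Rounding down costs a factor of two, because the optimal width is at least one. *)
    define r where "r = nat \<lfloor>m0\<rfloor>"
    have m0: "1 \<le> m0" "m0 < real k" using False o(1,2) by (auto simp: m0_def)
    have r: "1 \<le> r" "real r \<le> m0" "m0 \<le> 2 * real r"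
    proof -
      have f: "1 \<le> \<lfloor>m0\<rfloor>" "real_of_int \<lfloor>m0\<rfloor> \<le> m0" "m0 < real_of_int \<lfloor>m0\<rfloor> + 1" using m0(1) by linarith+
      have e: "real r = real_of_int \<lfloor>m0\<rfloor>" using f(1) by (simp add: r_def)
      have r1: "1 \<le> real r" using f(1) unfolding e by simp
      then show "1 \<le> r" by simp
      show "real r \<le> m0" "m0 \<le> 2 * real r" using f(2,3) r1 unfolding e by linarith+
    qed
    have rk: "r \<in> {1..k}" using r m0 by simp
    have rm: "real r \<le> real m" using rk k by simp
    have "real r \<le> k1" "real r \<le> k2" using r by (auto simp: m0_def)
    then have b: "real r / n + (real r)\<^sup>2 * \<delta> \<le> T" unfolding T using o(3)[of "real r"] o(4)[of "real r"] rm by simp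
    have "real k powr (- 2 * \<alpha>) \<le> m0 powr (- 2 * \<alpha>)"
      using m0 \<alpha> by (intro powr_mono2') auto
    then have "real k powr (- 2 * \<alpha>) / real r \<le> m0 powr (- 2 * \<alpha>) / (m0 / 2)"
      using r m0 by (intro frac_le) auto
    also have "\<dots> = 2 * m0 powr (- (2 * \<alpha> + 1))"
    proof -
      have "- (2 * \<alpha> + 1) = - 2 * \<alpha> - 1" by simp
      then show ?thesis using m0 by (simp only: powr_diff) simp
    qed
    also have "m0 powr (- (2 * \<alpha> + 1)) \<le> T"
    proof (cases "k1 \<le> k2")
      case True
      then have "m0 = k1" by (simp add: m0_def)
      then show ?thesis unfolding T using o(5) m0 k T0 by simp
    next
      case False
      then have "m0 = k2" by (simp add: m0_def)
      then show ?thesis unfolding T using o(6) m0 k T0 by simp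
    qed
    finally have "real k powr (- 2 * \<alpha>) / real r \<le> 2 * T" by simp
    then show ?thesis using b rk by blast
  qed
qed

lemma emeasure_PiM_component:
  assumes "\<And>i. i \<in> I \<Longrightarrow> prob_space (M i)" "i \<in> I" "{y\<in>space (M i). Q y} \<in> sets (M i)"
  shows "{x\<in>space (PiM I M). Q (x i)} \<in> sets (PiM I M)"
    "emeasure (PiM I M) {x\<in>space (PiM I M). Q (x i)} = emeasure (M i) {y\<in>space (M i). Q y}"
proof -
  have m: "(\<lambda>x. x i) \<in> PiM I M \<rightarrow>\<^sub>M M i" by (rule measurable_component_singleton[OF assms(2)])
  have eq: "{x\<in>space (PiM I M). Q (x i)} = (\<lambda>x. x i) -` {y\<in>space (M i). Q y} \<inter> space (PiM I M)"
    using measurable_space[OF m] by auto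
  show "{x\<in>space (PiM I M). Q (x i)} \<in> sets (PiM I M)" unfolding eq by (rule measurable_sets[OF m assms(3)])
  have "emeasure (M i) {y\<in>space (M i). Q y} = emeasure (distr (PiM I M) (M i) (\<lambda>x. x i)) {y\<in>space (M i). Q y}"
    using distr_PiM_component[of I M i] assms by simp
  then show "emeasure (PiM I M) {x\<in>space (PiM I M). Q (x i)} = emeasure (M i) {y\<in>space (M i). Q y}"
    unfolding eq by (simp add: emeasure_distr[OF m assms(3)])
qed

context center_outer
begin

text \<open>The last level whose radius still dominates \<open>C_G k powr - \<alpha>\<close>, the
  bound of the class with index \<open>\<alpha>\<close>.\<close>

definition jstar :: "real \<Rightarrow> nat \<Rightarrow> nat" where
  "jstar \<alpha> k = nat \<lfloor>(\<alpha> - \<alpha>_lo) * log 2 (real k)\<rfloor>"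

lemma jstar_props:
  assumes \<alpha>: "\<alpha>_lo \<le> \<alpha>" "\<alpha> \<le> \<alpha>_hi" and k: "1 \<le> k" and CG: "0 \<le> C_G"
  shows "jstar \<alpha> k \<le> J k" "j \<le> jstar \<alpha> k \<Longrightarrow> C_G * real k powr (- \<alpha>) \<le> a k j"
    "a k (jstar \<alpha> k) \<le> 2 * C_G * real k powr (- \<alpha>)"
proof -
  let ?x = "(\<alpha> - \<alpha>_lo) * log 2 (real k)"
  have l0: "0 \<le> log 2 (real k)" using k by simp
  have x0: "0 \<le> ?x" using \<alpha> l0 by simp
  have "?x \<le> (\<alpha>_hi - \<alpha>_lo) * log 2 (real k)" using \<alpha> l0 by (intro mult_right_mono) auto
  then show "jstar \<alpha> k \<le> J k" unfolding jstar_def J_def by (intro nat_mono) linarith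
  have j: "real (jstar \<alpha> k) \<le> ?x" "?x < real (jstar \<alpha> k) + 1" using x0 unfolding jstar_def by linarith+
  (* The radii shrink by powers of two from exponent alpha_lo, and x is the real number of
     halvings that leads to alpha. *)
  have kp: "2 powr ?x = real k powr (\<alpha> - \<alpha>_lo)"
  proof -
    have "2 powr ?x = (2 powr log 2 (real k)) powr (\<alpha> - \<alpha>_lo)" by (simp add: powr_powr mult.commute)
    then show ?thesis using k by simp
  qed
  have split: "real k powr (- \<alpha>_lo) = real k powr (- \<alpha>) * real k powr (\<alpha> - \<alpha>_lo)" by (simp add: powr_add[symmetric])
  have "(2::real) ^ jstar \<alpha> k = 2 powr real (jstar \<alpha> k)" by (simp add: powr_realpow)
  also have "\<dots> \<le> 2 powr ?x" using j by simp
  finally have up: "2 ^ jstar \<alpha> k \<le> real k powr (\<alpha> - \<alpha>_lo)" unfolding kp .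
  have "2 powr ?x \<le> 2 powr (real (jstar \<alpha> k) + 1)" using j by simp
  also have "\<dots> = 2 * 2 ^ jstar \<alpha> k" by (simp add: powr_add powr_realpow)
  finally have lo: "real k powr (\<alpha> - \<alpha>_lo) \<le> 2 * 2 ^ jstar \<alpha> k" unfolding kp .
  show "C_G * real k powr (- \<alpha>) \<le> a k j" if "j \<le> jstar \<alpha> k"
  proof -
    have "C_G * real k powr (- \<alpha>) * 2 ^ jstar \<alpha> k \<le> C_G * real k powr (- \<alpha>) * real k powr (\<alpha> - \<alpha>_lo)"
      using up CG by (intro mult_left_mono) auto
    then have "C_G * real k powr (- \<alpha>) \<le> a k (jstar \<alpha> k)" unfolding a_def split by (simp add: le_divide_eq)
    also have "\<dots> \<le> a k j" by (rule a_antimono(2)[OF CG that])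
    finally show ?thesis .
  qed
  have "C_G * real k powr (- \<alpha>) * real k powr (\<alpha> - \<alpha>_lo) \<le> C_G * real k powr (- \<alpha>) * (2 * 2 ^ jstar \<alpha> k)"
    using lo CG by (intro mult_left_mono) auto
  then show "a k (jstar \<alpha> k) \<le> 2 * C_G * real k powr (- \<alpha>)" unfolding a_def split by (simp add: divide_le_eq mult_ac)
qed

text \<open>A release for an outer block of side \<open>k\<close> has budget at least
  \<open>\<rho> k/d\<close> divided by this factor.\<close>

definition budget_factor :: real where
  "budget_factor = 16 * (4 * (\<alpha>_hi - \<alpha>_lo) + 1) * ell\<^sup>2"

lemma lg_le:
  assumes tuned
  shows "real lg \<le> 4 * ell" "2 \<le> lg"
proof -
  note T = tunedD[OF assms]
  have "real p \<le> 2 * real n ^ 2" using T(13) by (metis (mono_tags) of_nat_le_iff of_nat_mult of_nat_numeral of_nat_power)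
  then have "ln (real p) \<le> ln (2 * real n ^ 2)" using T(12) by (intro ln_mono) auto
  also have "\<dots> = ln 2 + 2 * ell" using T(10) by (simp add: ln_mult ln_realpow ell_def)
  finally have "real lg * ln 2 \<le> ln 2 + 2 * ell" by (simp add: p_lg ln_realpow)
  moreover have "real lg * (2 / 3) \<le> real lg * ln 2" using ln2_ge_two_thirds by (intro mult_left_mono) auto
  moreover have "ln 2 \<le> (1::real)" using ln_le_minus_one[of 2] by simp
  ultimately show "real lg \<le> 4 * ell" using T(7) by linarith
  show "2 \<le> lg"
  proof (rule ccontr)
    assume "\<not> 2 \<le> lg"
    then have "p \<le> 2 ^ 1" unfolding p_lg by (intro power_increasing) auto
    then show False using T(12) by simp
  qed
qed

lemma N_double_le:
  assumes "k \<in> scales" tuned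
  shows "real (N (2 * k)) \<le> real d / real k"
proof -
  have k: "0 < real k" using scales_ge_1[OF assms(1)] by simp
  have "2 * k * N (2 * k) = p" using assms(1) by (rule scalesE)
  then have "2 * k * N (2 * k) \<le> 2 * d" using p_bounds(2) tunedD(8)[OF assms(2)] by simp
  then have "real (N (2 * k)) * real k \<le> real d" by (metis mult.assoc mult.commute mult_le_cancel1 of_nat_le_iff of_nat_mult zero_less_numeral)
  then show ?thesis using k by (simp add: le_divide_eq)
qed

lemma inverse_budget_le:
  assumes k: "k \<in> scales" and tuned and hl: "\<alpha>_lo \<le> \<alpha>_hi"
  shows "1 / budget k \<le> budget_factor * real d / (real k * \<rho>)" "real (J k) + 1 \<le> (4 * (\<alpha>_hi - \<alpha>_lo) + 1) * ell"
proof -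
  note T = tunedD[OF \<open>tuned\<close>] and lg = lg_le[OF \<open>tuned\<close>]
  have k1: "1 \<le> k" by (rule scales_ge_1[OF k])
  have "k \<le> p" using scales_le[OF k] by simp
  then have "log 2 (real k) \<le> log 2 (real p)" using k1 by simp
  also have "\<dots> = real lg" by (simp add: p_lg log_nat_power)
  finally have logk: "log 2 (real k) \<le> 4 * ell" "0 \<le> log 2 (real k)" using lg k1 by auto
  have "(\<alpha>_hi - \<alpha>_lo) * log 2 (real k) \<le> (\<alpha>_hi - \<alpha>_lo) * (4 * ell)" using logk hl by (intro mult_left_mono) auto
  moreover have "real (J k) \<le> (\<alpha>_hi - \<alpha>_lo) * log 2 (real k) + 1"
  proof -
    have "0 \<le> (\<alpha>_hi - \<alpha>_lo) * log 2 (real k)" using hl logk by simp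
    then show ?thesis unfolding J_def by linarith
  qed
  ultimately show Jk: "real (J k) + 1 \<le> (4 * (\<alpha>_hi - \<alpha>_lo) + 1) * ell" using T(7) by (simp add: algebra_simps)
  have J0: "0 \<le> J_sq" "J_sq \<le> 4 * ell" using lg by (auto simp: J_sq_eq)
  have "1 / budget k = 4 * J_sq * real (N (2 * k)) * (real (J k) + 1) / \<rho>" by (simp add: budget_def)
  also have "\<dots> \<le> 4 * (4 * ell) * (real d / real k) * ((4 * (\<alpha>_hi - \<alpha>_lo) + 1) * ell) / \<rho>"
    using T J0 Jk N_double_le[OF k \<open>tuned\<close>] hl by (intro divide_right_mono mult_mono) auto
  also have "\<dots> = budget_factor * real d / (real k * \<rho>)"
    unfolding budget_factor_def by (simp add: power2_eq_square)
  finally show "1 / budget k \<le> budget_factor * real d / (real k * \<rho>)" .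
qed

text \<open>The privacy term of rank \<open>r\<close> is \<open>k r\<^sup>2/(budget k
  n\<^sup>2)\<close>, which is \<open>r\<^sup>2 \<delta>\<close> up to
  \<open>budget_factor\<close>; so \<open>scale_rate\<close> applies with the dimension as the
  cap.\<close>

lemma best_W_rate:
  assumes k: "k \<in> scales" and tuned and hl: "0 < \<alpha>_lo" "\<alpha>_lo \<le> \<alpha>" "\<alpha> \<le> \<alpha>_hi" and CG: "0 \<le> C_G"
    and \<delta>1: "real d / (\<rho> * (real n)\<^sup>2) \<le> 1"
  shows "best_W k (jstar \<alpha> k) / real k \<le> (8 * C_G\<^sup>2 + budget_factor + 1) * rate \<alpha> n d \<rho>"
proof -
  note T = tunedD[OF \<open>tuned\<close>]
  define \<delta> where "\<delta> = real d / (\<rho> * (real n)\<^sup>2)"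
  have \<delta>: "0 < \<delta>" "\<delta> \<le> 1" using T \<delta>1 by (auto simp: \<delta>_def)
  have k1: "1 \<le> k" by (rule scales_ge_1[OF k])
  have kd: "k \<le> d" using scales_le[OF k] p_bounds(2) T(8) by linarith
  have n1: "1 \<le> real n" using T(10) by simp
  have r_eq: "rate \<alpha> n d \<rho> = min (real n powr (- ((2 * \<alpha> + 1) / (2 * \<alpha> + 2)))) (real d / real n)
      + min (\<delta> powr ((2 * \<alpha> + 1) / (2 * \<alpha> + 3))) ((real d)\<^sup>2 * \<delta>)"
    by (simp add: rate_def \<delta>_def power2_eq_square power3_eq_cube)
  note sr = scale_rate[where n = "real n" and k = k and m = d and \<alpha> = \<alpha>, OF _ n1 \<delta> k1 kd, folded r_eq]
  have \<alpha>0: "0 < \<alpha>" using hl by simp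
  have bf: "0 \<le> budget_factor" using hl by (simp add: budget_factor_def)
  have b0: "0 < budget k" by (rule budget_pos[OF k T(3)])
  have inv: "1 / budget k \<le> budget_factor * real d / (real k * \<rho>)" using inverse_budget_le[OF k \<open>tuned\<close>] hl by simp
  have R0: "0 \<le> rate \<alpha> n d \<rho>" using sr(2)[OF \<alpha>0] \<delta> n1 by (smt (verit) divide_nonneg_nonneg)
  have priv: "real k * w\<^sup>2 / (budget k * (real n)\<^sup>2) \<le> budget_factor * (w\<^sup>2 * \<delta>)" for w
  proof -
    have "real k * w\<^sup>2 / (budget k * (real n)\<^sup>2) = real k * w\<^sup>2 / (real n)\<^sup>2 * (1 / budget k)" by simp
    also have "\<dots> \<le> real k * w\<^sup>2 / (real n)\<^sup>2 * (budget_factor * real d / (real k * \<rho>))" using inv by (intro mult_left_mono) auto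
    also have "\<dots> = budget_factor * (w\<^sup>2 * \<delta>)" using k1 by (simp add: \<delta>_def mult_ac)
    finally show ?thesis .
  qed
  from sr(1)[OF \<alpha>0] show ?thesis
  proof
    assume a: "real k / real n + (real k)\<^sup>2 * \<delta> \<le> rate \<alpha> n d \<rho>"
    have p1: "real k / real n \<le> rate \<alpha> n d \<rho>" "(real k)\<^sup>2 * \<delta> \<le> rate \<alpha> n d \<rho>"
      using a \<delta> by (auto intro: order_trans[rotated])
    have "best_W k (jstar \<alpha> k) / real k \<le> W k (jstar \<alpha> k) Dense / real k" by (intro divide_right_mono best_W_le) auto
    also have "\<dots> = real k / real n + real k * (real k)\<^sup>2 / (budget k * (real n)\<^sup>2)"
      using k1 by (simp add: add_divide_distrib power2_eq_square power4_eq_xxxx)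
    also have "\<dots> \<le> rate \<alpha> n d \<rho> + budget_factor * rate \<alpha> n d \<rho>"
      using p1 priv[of "real k"] mult_left_mono[OF p1(2) bf] by linarith
    also have "\<dots> \<le> (8 * C_G\<^sup>2 + budget_factor + 1) * rate \<alpha> n d \<rho>" using R0 by (simp add: algebra_simps)
    finally show ?thesis .
  next
    assume "\<exists>r\<in>{1..k}. real k powr (- 2 * \<alpha>) / real r \<le> 2 * rate \<alpha> n d \<rho> \<and> real r / real n + (real r)\<^sup>2 * \<delta> \<le> rate \<alpha> n d \<rho>"
    then obtain r where r: "r \<in> {1..k}" and b: "real k powr (- 2 * \<alpha>) / real r \<le> 2 * rate \<alpha> n d \<rho>"
      and v: "real r / real n + (real r)\<^sup>2 * \<delta> \<le> rate \<alpha> n d \<rho>" by blast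
    have v1: "(real r)\<^sup>2 * \<delta> \<le> rate \<alpha> n d \<rho>" "real r / real n \<le> rate \<alpha> n d \<rho>" using v \<delta> by (auto intro: order_trans[rotated])
    let ?a = "a k (jstar \<alpha> k)"
    note js = jstar_props[OF hl(2,3) k1 CG]
    have a0: "0 \<le> ?a" by (rule a_antimono(1)[OF CG order_refl])
    have "best_W k (jstar \<alpha> k) / real k \<le> W k (jstar \<alpha> k) Structured / real k" by (intro divide_right_mono best_W_le) auto
    also have "\<dots> = (MIN r\<in>{1..k}. peel_objective n k ?a (budget k) r)" using k1 by simp
    also have "\<dots> \<le> peel_objective n k ?a (budget k) r" using r by (intro Min_le) auto
    also have "\<dots> = ?a\<^sup>2 / real r + real r / real n + real k * (real r)\<^sup>2 / (budget k * (real n)\<^sup>2)" by (simp add: peel_objective_def)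
    also have "\<dots> \<le> 8 * C_G\<^sup>2 * rate \<alpha> n d \<rho> + rate \<alpha> n d \<rho> + budget_factor * rate \<alpha> n d \<rho>"
    proof (intro add_mono v1(2))
      have "?a\<^sup>2 \<le> (2 * C_G * real k powr (- \<alpha>))\<^sup>2" using js(3) a0 by (intro power_mono) auto
      also have "\<dots> = 4 * C_G\<^sup>2 * real k powr (- 2 * \<alpha>)"
        by (simp add: power_mult_distrib power2_eq_square powr_add[symmetric])
      finally have "?a\<^sup>2 / real r \<le> 4 * C_G\<^sup>2 * real k powr (- 2 * \<alpha>) / real r" by (intro divide_right_mono) auto
      also have "\<dots> = 4 * C_G\<^sup>2 * (real k powr (- 2 * \<alpha>) / real r)" by simp
      also have "\<dots> \<le> 4 * C_G\<^sup>2 * (2 * rate \<alpha> n d \<rho>)" using b by (intro mult_left_mono) auto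
      finally show "?a\<^sup>2 / real r \<le> 8 * C_G\<^sup>2 * rate \<alpha> n d \<rho>" by simp
      have "real k * (real r)\<^sup>2 / (budget k * (real n)\<^sup>2) \<le> budget_factor * ((real r)\<^sup>2 * \<delta>)" by (rule priv)
      also have "\<dots> \<le> budget_factor * rate \<alpha> n d \<rho>" using v1(1) bf by (rule mult_left_mono)
      finally show "real k * (real r)\<^sup>2 / (budget k * (real n)\<^sup>2) \<le> budget_factor * rate \<alpha> n d \<rho>" .
    qed
    also have "\<dots> = (8 * C_G\<^sup>2 + budget_factor + 1) * rate \<alpha> n d \<rho>" by (simp add: algebra_simps)
    finally show ?thesis .
  qed
qed

text \<open>The parametric error is below the rate. It absorbs the center blocks and, through
  \<open>1/n\<close>, the exceptional events.\<close>

lemma rate_ge: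
  assumes tuned and "0 < \<alpha>" and \<delta>1: "real d / (\<rho> * (real n)\<^sup>2) \<le> 1"
  shows "1 / real n + real d / (\<rho> * (real n)\<^sup>2) \<le> rate \<alpha> n d \<rho>"
proof -
  note T = tunedD[OF \<open>tuned\<close>]
  have "1 / real n + real d / (\<rho> * (real n)\<^sup>2) \<le> min (real n powr (- ((2 * \<alpha> + 1) / (2 * \<alpha> + 2)))) (real d / real n)
      + min ((real d / (\<rho> * (real n)\<^sup>2)) powr ((2 * \<alpha> + 1) / (2 * \<alpha> + 3))) ((real d)\<^sup>2 * (real d / (\<rho> * (real n)\<^sup>2)))"
    using T assms by (intro scale_rate(2)[where k = 1]) auto
  then show ?thesis by (simp add: rate_def power2_eq_square power3_eq_cube)
qed

end

section \<open>The risk for a fixed sample size\<close>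

lemma square_double: "(x - y)\<^sup>2 \<le> 2 * x\<^sup>2 + 2 * y\<^sup>2" for x y :: real
  using zero_le_power2[of "x + y"] by (simp add: power2_eq_square algebra_simps)

context center_outer
begin

definition loss :: "(nat \<Rightarrow> real) measure \<Rightarrow> (nat \<times> nat \<Rightarrow> real) \<Rightarrow> real" where
  "loss P Y = (\<Sum>q\<in>{1..d} \<times> {1..d}. (Y q - covariance P q)\<^sup>2)"

lemma pcov_spectrum:
  assumes P: "P \<in> P_class d \<alpha> K M\<^sub>0 M" and "1 \<le> d"
  shows "pcov P (i, j) = pcov P (j, i)" "0 \<le> M\<^sub>0 \<Longrightarrow> spectrum_within {1..p} M\<^sub>0 (pcov P)"
proof -
  have G: "covariance P \<in> G_class d \<alpha> M\<^sub>0 M" using P by (simp add: P_class_def)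
  show "pcov P (i, j) = pcov P (j, i)"
  proof (cases "i \<in> {1..d} \<and> j \<in> {1..d}")
    case True
    then have "covariance P (i, j) = covariance P (j, i)" using G unfolding G_class_def mem_Collect_eq by blast
    then show ?thesis using True by (simp add: pcov_def)
  qed (auto simp: pcov_def)
  assume M0: "0 \<le> M\<^sub>0"
  show "spectrum_within {1..p} M\<^sub>0 (pcov P)"
    unfolding spectrum_within_def
  proof
    fix v :: "nat \<Rightarrow> real"
    have sub: "{1..d} \<subseteq> {1..p}" using p_bounds(1)[OF assms(2)] by auto
    have q: "quad_form {1..p} (pcov P) v = (\<Sum>i=1..d. \<Sum>j=1..d. v i * covariance P (i, j) * v j)"
    proof -
      have "quad_form {1..p} (pcov P) v = (\<Sum>i=1..d. \<Sum>j=1..p. v i * pcov P (i, j) * v j)"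
        unfolding quad_form_def using sub by (intro sum.mono_neutral_right) (auto simp: pcov_def)
      also have "\<dots> = (\<Sum>i=1..d. \<Sum>j=1..d. v i * pcov P (i, j) * v j)"
        using sub by (intro sum.cong refl sum.mono_neutral_right) (auto simp: pcov_def)
      also have "\<dots> = (\<Sum>i=1..d. \<Sum>j=1..d. v i * covariance P (i, j) * v j)"
        by (intro sum.cong refl) (simp add: pcov_def)
      finally show ?thesis .
    qed
    have "\<forall>v :: nat \<Rightarrow> real. 0 \<le> (\<Sum>i=1..d. \<Sum>j=1..d. v i * covariance P (i, j) * v j)
        \<and> (\<Sum>i=1..d. \<Sum>j=1..d. v i * covariance P (i, j) * v j) \<le> M\<^sub>0 * (\<Sum>i=1..d. (v i)\<^sup>2)"
      using G unfolding G_class_def mem_Collect_eq by blast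
    then have "0 \<le> quad_form {1..p} (pcov P) v" "quad_form {1..p} (pcov P) v \<le> M\<^sub>0 * (\<Sum>i=1..d. (v i)\<^sup>2)"
      unfolding q by blast+
    moreover have "M\<^sub>0 * (\<Sum>i=1..d. (v i)\<^sup>2) \<le> M\<^sub>0 * (\<Sum>i=1..p. (v i)\<^sup>2)"
      using sub M0 by (intro mult_left_mono sum_mono2) auto
    ultimately show "0 \<le> quad_form {1..p} (pcov P) v \<and> quad_form {1..p} (pcov P) v \<le> M\<^sub>0 * (\<Sum>i\<in>{1..p}. (v i)\<^sup>2)" by linarith
  qed
qed

text \<open>The first bound compares with the assembled matrix; the second holds for every
  outcome, because the clipped matrix and the padded covariance both have spectrum in \<open>[0,
  M\<^sub>0]\<close>.\<close>

lemma loss_output_map: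
  assumes P: "P \<in> P_class d \<alpha> K M\<^sub>0 M" and tuned
  shows "loss P (output_map (c, z)) \<le> (\<Sum>q\<in>{1..p} \<times> {1..p}. (assemble c z (min (fst q) (snd q), max (fst q) (snd q)) - pcov P q)\<^sup>2)"
    "loss P (output_map (c, z)) \<le> 8 * real d * M\<^sub>0\<^sup>2"
proof -
  note T = tunedD[OF \<open>tuned\<close>]
  have d1: "1 \<le> d" using T(8) by simp
  let ?A = "\<lambda>(u, v). assemble c z (min u v, max u v)" and ?Q = "{1..p} \<times> {1..p}"
  have sym: "?A (i, j) = ?A (j, i)" for i j by (simp add: min.commute max.commute)
  have psym: "\<And>i j. pcov P (i, j) = pcov P (j, i)" by (rule pcov_spectrum(1)[OF P d1])
  have spec: "spectrum_within {1..p} M\<^sub>0 (pcov P)" using pcov_spectrum(2)[OF P d1] T(2) by simp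
  have sub: "{1..d} \<times> {1..d} \<subseteq> ?Q" using p_bounds(1)[OF d1] by auto
  have "loss P (output_map (c, z)) = (\<Sum>q\<in>{1..d} \<times> {1..d}. (spectral_clip p M\<^sub>0 ?A q - pcov P q)\<^sup>2)"
    unfolding loss_def output_map_def by (intro sum.cong refl) (auto simp: pcov_def)
  also have "\<dots> \<le> (\<Sum>q\<in>?Q. (spectral_clip p M\<^sub>0 ?A q - pcov P q)\<^sup>2)" using sub by (intro sum_mono2) auto
  finally have le: "loss P (output_map (c, z)) \<le> (\<Sum>q\<in>?Q. (spectral_clip p M\<^sub>0 ?A q - pcov P q)\<^sup>2)" .
  also have "\<dots> \<le> (\<Sum>q\<in>?Q. (?A q - pcov P q)\<^sup>2)"
    using sym by (intro spectral_clip_contracts T spec) auto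
  finally show "loss P (output_map (c, z)) \<le> (\<Sum>q\<in>?Q. (assemble c z (min (fst q) (snd q), max (fst q) (snd q)) - pcov P q)\<^sup>2)"
    by (simp only: split_beta')
  have "(\<Sum>q\<in>?Q. (spectral_clip p M\<^sub>0 ?A q - pcov P q)\<^sup>2) \<le> (\<Sum>q\<in>?Q. 2 * (spectral_clip p M\<^sub>0 ?A q)\<^sup>2 + 2 * (pcov P q)\<^sup>2)"
    by (rule sum_mono) (rule square_double)
  also have "\<dots> = 2 * (\<Sum>q\<in>?Q. (spectral_clip p M\<^sub>0 ?A q)\<^sup>2) + 2 * (\<Sum>q\<in>?Q. (pcov P q)\<^sup>2)"
    by (simp only: sum.distrib sum_distrib_left)
  also have "\<dots> \<le> 2 * (real p * M\<^sub>0\<^sup>2) + 2 * (real p * M\<^sub>0\<^sup>2)"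
    by (intro add_mono mult_left_mono spectral_clip_props(3) frobenius_spectrum_within T spec sym psym) auto
  also have "\<dots> = 4 * real p * M\<^sub>0\<^sup>2" by simp
  also have "\<dots> \<le> 4 * (2 * real d) * M\<^sub>0\<^sup>2"
    using p_bounds(2)[OF d1] by (intro mult_right_mono mult_left_mono) simp_all
  finally show "loss P (output_map (c, z)) \<le> 8 * real d * M\<^sub>0\<^sup>2" using le by simp
qed

definition good_center :: "(nat \<Rightarrow> real) measure \<Rightarrow> (nat \<times> nat \<Rightarrow> nat \<times> nat \<Rightarrow> real) \<Rightarrow> bool" where
  "good_center P c \<longleftrightarrow> \<not> (\<exists>b\<in>center_labels. \<not> (\<Sum>q\<in>block 1 b. (c b q - pcov P q)\<^sup>2)
      \<le> err_factor * (1 / real n + real p / (\<rho> * (real n)\<^sup>2)))"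

text \<open>The releases whose radius dominates the class bound, which is what their error bounds
  assume.\<close>

definition resolved_index :: "real \<Rightarrow> (nat \<times> (nat \<times> nat) \<times> nat) set" where
  "resolved_index \<alpha> = {(k, b, j). (k, b, j) \<in> outer_index \<and> j \<le> jstar \<alpha> k}"

definition good_outer :: "(nat \<Rightarrow> real) measure \<Rightarrow> real \<Rightarrow> (nat \<times> (nat \<times> nat) \<times> nat \<Rightarrow> nat \<times> nat \<Rightarrow> real) \<Rightarrow> bool" where
  "good_outer P \<alpha> z \<longleftrightarrow> \<not> (\<exists>i\<in>resolved_index \<alpha>. \<not> (\<Sum>q\<in>block (fst i) (fst (snd i)). (z i q - pcov P q)\<^sup>2)
      \<le> err_factor * best_W (fst i) (snd (snd i)))"

text \<open>The first summand comes from the center blocks and the second from the outer blocks,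
  for which \<open>ell\<close> counts the scales and \<open>C_D * ell powr E_D\<close> is the
  squared tolerance per unit of proxy.\<close>

definition loss_factor :: real where
  "loss_factor = 16 * err_factor + 216 * ell * (C_D * ell powr E_D) * (8 * C_G\<^sup>2 + budget_factor + 1)"

text \<open>In addition to \<open>tuned\<close>: the radii dominate the class bound, the
  tolerances of the level selection dominate the errors of the releases, the parametric privacy
  error is at most one, and the number of levels is at most a square of the logarithm.\<close>

definition admissible :: "real \<Rightarrow> bool" where
  "admissible M \<longleftrightarrow> tuned \<and> 0 < \<alpha>_lo \<and> \<alpha>_lo \<le> \<alpha>_hi \<and> 0 \<le> M \<and> M \<le> C_G \<and> 0 \<le> C_D \<and> err_factor \<le> C_D * ell powr E_D
     \<and> real d / (\<rho> * (real n)\<^sup>2) \<le> 1 \<and> 4 * (\<alpha>_hi - \<alpha>_lo) + 1 \<le> ell"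

text \<open>On typical data and noise each scale contributes at most \<open>d\<close> times the
  rate, up to the factors collected in \<open>loss_factor\<close>.\<close>

lemma good_loss:
  assumes adm: "admissible M" and P: "P \<in> P_class d \<alpha> K M\<^sub>0 M" and \<alpha>: "\<alpha>_lo \<le> \<alpha>" "\<alpha> \<le> \<alpha>_hi"
    and X: "data_good P X" and c: "good_center P c" and z: "good_outer P \<alpha> z"
  shows "loss P (output_map (c, z)) \<le> loss_factor * real d * rate \<alpha> n d \<rho>"
proof -
  have A: tuned "0 < \<alpha>_lo" "\<alpha>_lo \<le> \<alpha>_hi" "0 \<le> M" "M \<le> C_G" "0 \<le> C_D" "err_factor \<le> C_D * ell powr E_D"
    "real d / (\<rho> * (real n)\<^sup>2) \<le> 1" using adm by (auto simp: admissible_def)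
  note T = tunedD[OF A(1)]
  have CG: "0 \<le> C_G" using A by simp
  have d1: "1 \<le> d" using T(8) by simp
  have ef: "0 \<le> err_factor" using err_factor_ge(1)[OF A(1)] by simp
  have bf: "0 \<le> budget_factor" using A by (simp add: budget_factor_def)
  have lg: "1 \<le> lg" using lg_le(2)[OF A(1)] by simp
  have \<alpha>0: "0 < \<alpha>" using A \<alpha> by simp
  let ?rt = "rate \<alpha> n d \<rho>" and ?CE = "C_D * ell powr E_D" and ?F = "8 * C_G\<^sup>2 + budget_factor + 1"
  have rt: "1 / real n + real d / (\<rho> * (real n)\<^sup>2) \<le> ?rt" by (rule rate_ge[OF A(1) \<alpha>0 A(8)])
  have rt0: "0 \<le> ?rt"
  proof -
    have "0 \<le> 1 / real n + real d / (\<rho> * (real n)\<^sup>2)" using T(3) by simp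
    then show ?thesis using rt by linarith
  qed
  have CE: "0 \<le> ?CE" using A by simp
  have cen: "(\<Sum>b\<in>center_labels. \<Sum>q\<in>block 1 b. (c b q - pcov P q)\<^sup>2) \<le> 8 * err_factor * real d * ?rt"
  proof -
    have "(\<Sum>b\<in>center_labels. \<Sum>q\<in>block 1 b. (c b q - pcov P q)\<^sup>2)
        \<le> (\<Sum>b\<in>center_labels. err_factor * (1 / real n + real p / (\<rho> * (real n)\<^sup>2)))"
      using c unfolding good_center_def by (intro sum_mono) blast
    also have "\<dots> = real (card center_labels) * (err_factor * (1 / real n + real p / (\<rho> * (real n)\<^sup>2)))" by simp
    also have "\<dots> \<le> (4 * real d) * (err_factor * (2 * ?rt))"
    proof (intro mult_mono)
      show "real (card center_labels) \<le> 4 * real d" using card_center_labels p_bounds(2)[OF d1] by linarith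
      have scale: "1 / real n + x / q \<le> 2 * (1 / real n + y / q)" if "x \<le> 2 * y" "0 < q" for x y q :: real
      proof -
        have "x / q \<le> (2 * y) / q" using that by (intro divide_right_mono) auto
        moreover have "1 / real n \<le> 2 / real n" by (intro divide_right_mono) auto
        ultimately show ?thesis by simp
      qed
      have "1 / real n + real p / (\<rho> * (real n)\<^sup>2) \<le> 2 * (1 / real n + real d / (\<rho> * (real n)\<^sup>2))"
        using p_bounds(2)[OF d1] T by (intro scale) auto
      also have "\<dots> \<le> 2 * ?rt" using rt by (rule mult_left_mono) simp
      finally show "1 / real n + real p / (\<rho> * (real n)\<^sup>2) \<le> 2 * ?rt" .
    qed (use ef T(3) in auto)
    finally show ?thesis by (simp add: mult_ac)
  qed
  have out: "(\<Sum>k\<in>scales. \<Sum>b\<in>outer_labels k. \<Sum>q\<in>block k b. (Z z k b (j_hat z k) q - pcov P q)\<^sup>2)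
      \<le> 108 * ell * ?CE * ?F * real d * ?rt"
  proof -
    have each: "(\<Sum>b\<in>outer_labels k. \<Sum>q\<in>block k b. (Z z k b (j_hat z k) q - pcov P q)\<^sup>2) \<le> 27 * ?CE * ?F * real d * ?rt"
      if k: "k \<in> scales" for k
    proof -
      have k1: "1 \<le> k" by (rule scales_ge_1[OF k])
      note js = jstar_props[OF \<alpha> k1 CG]
      let ?w = "best_W k (jstar \<alpha> k)"
      have w0: "0 \<le> best_W k j" for j by (rule best_W_nonneg[OF k T(3)])
      have lev: "M * real k powr (- \<alpha>) \<le> a k j" if "j \<le> jstar \<alpha> k" for j
      proof -
        have "M * real k powr (- \<alpha>) \<le> C_G * real k powr (- \<alpha>)" using A by (intro mult_right_mono) auto
        also have "\<dots> \<le> a k j" by (rule js(2)[OF that])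
        finally show ?thesis .
      qed
      have "(\<Sum>q\<in>block k b. (Z z k b (j_hat z k) q - pcov P q)\<^sup>2) \<le> 9 * (?CE * ?w)" if b: "b \<in> outer_labels k" for b
      proof (rule selected_block_error[OF k T(3) A(6) CG js(1) _ _ b])
        fix b assume b: "b \<in> outer_labels k"
        obtain l r where lr: "b = (l, r)" by (cases b)
        have lr1: "1 \<le> l" "2 \<le> r" using outer_labelsE[OF k b[unfolded lr]] by auto
        have a0: "0 \<le> a k 0" by (rule a_antimono(1)[OF CG order_refl])
        have "(\<Sum>q\<in>block k b. (pcov P q)\<^sup>2) \<le> real k * (a k 0)\<^sup>2"
          unfolding lr by (rule outer_block_bounds(2)[OF P A(1) X k lr1 lev]) simp
        then have "L2_set (pcov P) (block k b) \<le> sqrt (real k * (a k 0)\<^sup>2)" unfolding L2_set_def by simp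
        then show "L2_set (pcov P) (block k b) \<le> sqrt (real k) * a k 0" using a0 by (simp add: real_sqrt_mult)
      next
        fix b j assume b: "b \<in> outer_labels k" and j: "j \<le> jstar \<alpha> k"
        have "(k, b, j) \<in> resolved_index \<alpha>" using k b j js(1) by (auto simp: resolved_index_def outer_index_def)
        then have "(\<Sum>q\<in>block k b. (z (k, b, j) q - pcov P q)\<^sup>2) \<le> err_factor * best_W k j"
          using z unfolding good_outer_def by fastforce
        also have "\<dots> \<le> ?CE * best_W k j" using A(7) w0 by (intro mult_right_mono) auto
        finally show "(\<Sum>q\<in>block k b. (z (k, b, j) q - pcov P q)\<^sup>2) \<le> ?CE * best_W k j" .
      qed
      then have "(\<Sum>b\<in>outer_labels k. \<Sum>q\<in>block k b. (Z z k b (j_hat z k) q - pcov P q)\<^sup>2) \<le> (\<Sum>b\<in>outer_labels k. 9 * (?CE * ?w))"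
        by (rule sum_mono)
      also have "\<dots> = real (card (outer_labels k)) * (9 * (?CE * ?w))" by simp
      also have "\<dots> \<le> (3 * (real d / real k)) * (9 * (?CE * ?w))"
      proof (intro mult_right_mono)
        have "real (card (outer_labels k)) \<le> 3 * real (N (2 * k))" using card_outer_labels[of k] by linarith
        then show "real (card (outer_labels k)) \<le> 3 * (real d / real k)" using N_double_le[OF k A(1)] by linarith
      qed (use CE w0 in auto)
      also have "\<dots> = 27 * real d * ?CE * (?w / real k)" by simp
      also have "\<dots> \<le> 27 * real d * ?CE * (?F * ?rt)"
        using best_W_rate[OF k A(1,2) \<alpha> CG A(8)] CE by (intro mult_left_mono) auto
      finally show ?thesis by (simp add: mult_ac)
    qed
    have "(\<Sum>k\<in>scales. \<Sum>b\<in>outer_labels k. \<Sum>q\<in>block k b. (Z z k b (j_hat z k) q - pcov P q)\<^sup>2)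
        \<le> (\<Sum>k\<in>scales. 27 * ?CE * ?F * real d * ?rt)" by (rule sum_mono[OF each])
    also have "\<dots> = real (card scales) * (27 * ?CE * ?F * real d * ?rt)" by simp
    also have "\<dots> \<le> (4 * ell) * (27 * ?CE * ?F * real d * ?rt)"
    proof (rule mult_right_mono)
      show "real (card scales) \<le> 4 * ell" using lg_le(1)[OF A(1)] by (simp add: card_scales)
    qed (use CE bf rt0 in auto)
    finally show ?thesis by (simp add: mult_ac)
  qed
  have "loss P (output_map (c, z)) \<le> (\<Sum>q\<in>{1..p} \<times> {1..p}. (assemble c z (min (fst q) (snd q), max (fst q) (snd q)) - pcov P q)\<^sup>2)"
    by (rule loss_output_map(1)[OF P A(1)])
  also have "\<dots> \<le> 2 * ((\<Sum>b\<in>center_labels. \<Sum>q\<in>block 1 b. (c b q - pcov P q)\<^sup>2)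
        + (\<Sum>k\<in>scales. \<Sum>b\<in>outer_labels k. \<Sum>q\<in>block k b. (Z z k b (j_hat z k) q - pcov P q)\<^sup>2))"
    by (rule assembled_loss_le[where S = "pcov P", OF lg pcov_spectrum(1)[OF P d1]])
  also have "\<dots> \<le> 2 * (8 * err_factor * real d * ?rt + 108 * ell * ?CE * ?F * real d * ?rt)"
    by (intro mult_left_mono add_mono cen out) auto
  also have "\<dots> = loss_factor * real d * ?rt" unfolding loss_factor_def by (simp add: algebra_simps)
  finally show ?thesis .
qed

text \<open>There are polynomially many releases, while \<open>fail_prob\<close> is at most of the
  order of \<open>n^8 / n^100\<close>.\<close>

lemma release_fail_total:
  assumes adm: "admissible M"
  shows "(real (card center_labels) + real (card outer_index)) * fail_prob \<le> 1 / real n"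
proof -
  have A: tuned "\<alpha>_lo \<le> \<alpha>_hi" "4 * (\<alpha>_hi - \<alpha>_lo) + 1 \<le> ell" using adm by (auto simp: admissible_def)
  note T = tunedD[OF A(1)]
  have n0: "100 \<le> real n" "1 \<le> n" using T(10) by auto
  have n1: "1 \<le> real n" using n0 by simp
  have pn: "real p \<le> 2 * real n ^ 2" using T(13) by (metis (mono_tags) of_nat_le_iff of_nat_mult of_nat_numeral of_nat_power)
  have elln: "ell \<le> real n" unfolding ell_def using ln_le_minus_one[of "real n"] n1 by linarith
  have J: "real (J k) + 1 \<le> real n ^ 2" if "k \<in> scales" for k
  proof -
    have "real (J k) + 1 \<le> (4 * (\<alpha>_hi - \<alpha>_lo) + 1) * ell" by (rule inverse_budget_le(2)[OF that A(1,2)])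
    also have "\<dots> \<le> real n * real n" using A(2,3) elln T(7) by (intro mult_mono) auto
    finally show ?thesis by (simp add: power2_eq_square)
  qed
  have co: "real (card outer_index) \<le> 12 * real n ^ 6"
  proof -
    have "card outer_index = (\<Sum>k\<in>scales. card (outer_labels k) * (J k + 1))"
      unfolding outer_index_eq using finite_scales finite_outer_labels by (subst card_SigmaI) (auto simp: card_cartesian_product)
    then have "real (card outer_index) = (\<Sum>k\<in>scales. real (card (outer_labels k)) * (real (J k) + 1))" by (simp add: algebra_simps)
    also have "\<dots> \<le> (\<Sum>k\<in>scales. (3 * real p) * real n ^ 2)"
    proof (intro sum_mono mult_mono J)
      fix k assume "k \<in> scales"
      have "N (2 * k) \<le> p" unfolding N_def by simp
      then show "real (card (outer_labels k)) \<le> 3 * real p" using card_outer_labels[of k] by linarith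
    qed auto
    also have "\<dots> = real (card scales) * ((3 * real p) * real n ^ 2)" by simp
    also have "\<dots> \<le> real p * ((3 * real p) * real n ^ 2)"
    proof (rule mult_right_mono)
      have "card scales \<le> p" unfolding card_scales p_lg by (meson diff_le_self less_imp_le less_exp order_trans)
      then show "real (card scales) \<le> real p" by simp
    qed simp
    also have "\<dots> \<le> (2 * real n ^ 2) * ((3 * (2 * real n ^ 2)) * real n ^ 2)"
      using pn by (intro mult_mono) auto
    also have "\<dots> = 12 * real n ^ 6" by (simp add: power_numeral_reduce)
    finally show ?thesis .
  qed
  have cc: "real (card center_labels) \<le> 4 * real n ^ 6"
  proof -
    have "real (card center_labels) \<le> 2 * real p" using card_center_labels by linarith
    also have "\<dots> \<le> 4 * real n ^ 2" using pn by simp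
    also have "\<dots> \<le> 4 * real n ^ 6" using n1 by (intro mult_left_mono power_increasing) auto
    finally show ?thesis .
  qed
  have fp: "fail_prob \<le> 48 * real n ^ 8 * (1 / real n ^ 100)"
  proof -
    have "real p ^ 4 \<le> (2 * real n ^ 2) ^ 4" using pn by (intro power_mono) auto
    then have p4: "real p ^ 4 \<le> 16 * real n ^ 8" by (simp add: power_mult_distrib power_mult[symmetric])
    have "100 * ell \<le> ell * ell" using T(7) by (intro mult_right_mono) auto
    then have "exp (- ell\<^sup>2) \<le> exp (- (real 100 * ln (real n)))" by (simp add: ell_def power2_eq_square)
    also have "\<dots> = 1 / real n ^ 100" by (rule exp_neg_nat_ln[OF n0(2)])
    finally have "exp (- ell\<^sup>2) \<le> 1 / real n ^ 100" .
    then have "real p ^ 4 * exp (- ell\<^sup>2) \<le> 16 * real n ^ 8 * (1 / real n ^ 100)" using p4 by (intro mult_mono) auto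
    then show ?thesis by (simp add: fail_prob_def)
  qed
  have f0: "0 \<le> fail_prob" by (simp add: fail_prob_def)
  have "(real (card center_labels) + real (card outer_index)) * fail_prob \<le> (16 * real n ^ 6) * (48 * real n ^ 8 * (1 / real n ^ 100))"
    using co cc fp f0 by (intro mult_mono) auto
  also have "\<dots> = 768 * real n ^ 14 / real n ^ 100" by (simp add: power_add[symmetric])
  also have "\<dots> \<le> real n ^ 2 * real n ^ 14 / real n ^ 100"
  proof (intro divide_right_mono mult_right_mono)
    have "100 * 100 \<le> real n * real n" using n0 by (intro mult_mono) auto
    then show "768 \<le> real n ^ 2" by (simp add: power2_eq_square)
  qed auto
  also have "\<dots> = real n ^ 16 / real n ^ 100" by (simp add: power_add[symmetric])
  also have "\<dots> \<le> real n ^ 99 / real n ^ 100" using n1 by (intro divide_right_mono power_increasing) auto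
  also have "\<dots> = 1 / real n" using n1 by (simp add: power_numeral_reduce)
  finally show ?thesis .
qed

lemma expected_loss_good_data:
  assumes adm: "admissible M" and P: "P \<in> P_class d \<alpha> K M\<^sub>0 M" and \<alpha>: "\<alpha>_lo \<le> \<alpha>" "\<alpha> \<le> \<alpha>_hi"
    and X: "data_good P X" "X \<in> space (PiM {1..n} (\<lambda>_. vec_space d))"
  shows "(\<integral>\<^sup>+Y. ennreal (loss P Y) \<partial>estimator X) \<le> ennreal (loss_factor * real d * rate \<alpha> n d \<rho> + 8 * real d * M\<^sub>0\<^sup>2 * (1 / real n))"
proof -
  have A: tuned "0 \<le> M" "M \<le> C_G" using adm by (auto simp: admissible_def)
  note T = tunedD[OF A(1)]
  have CG: "0 \<le> C_G" using A by simp
  have d1: "1 \<le> d" using T(8) by simp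
  let ?M1 = "PiM center_labels (center_law X)" and ?M2 = "PiM outer_index (outer_law X)"
  let ?M = "?M1 \<Otimes>\<^sub>M ?M2"
  have pr1: "prob_space (center_law X b)" if "b \<in> center_labels" for b
    using measurable_space[OF measurable_center_law[OF that] X(2)] by (simp add: space_prob_algebra)
  have pr2: "prob_space (outer_law X i)" if "i \<in> outer_index" for i
    using measurable_space[OF measurable_outer_law X(2)] that by (cases i) (simp add: space_prob_algebra del: outer_law.simps)
  interpret M1: prob_space ?M1 by (intro prob_space_PiM pr1)
  interpret M2: prob_space ?M2 by (intro prob_space_PiM pr2)
  have sets_M: "sets ?M = sets (center_space \<Otimes>\<^sub>M outer_space)"
    by (intro sets_pair_measure_cong sets_PiM_cong refl) (auto simp: sets_center_law sets_outer_law simp del: outer_law.simps center_law.simps)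
  have om: "output_map \<in> ?M \<rightarrow>\<^sub>M mat_space d"
    using measurable_output_map[OF d1 T(2)] by (simp only: measurable_cong_sets[OF sets_M refl])
  have lm: "(\<lambda>Y. ennreal (loss P Y)) \<in> borel_measurable (mat_space d)"
    unfolding loss_def by measurable
  let ?G = "loss_factor * real d * rate \<alpha> n d \<rho>" and ?T = "8 * real d * M\<^sub>0\<^sup>2"
  let ?B1 = "{c\<in>space ?M1. \<not> good_center P c}" and ?B2 = "{z\<in>space ?M2. \<not> good_outer P \<alpha> z}"
  (* Both kinds of failure concern one release at a time, so marginals of the product suffice. *)
  define Q1 where "Q1 b y \<longleftrightarrow> \<not> (\<Sum>q\<in>block 1 b. (y q - pcov P q)\<^sup>2) \<le> err_factor * (1 / real n + real p / (\<rho> * (real n)\<^sup>2))" for b :: "nat \<times> nat" and y :: "nat \<times> nat \<Rightarrow> real"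
  define Q2 where "Q2 i y \<longleftrightarrow> \<not> (\<Sum>q\<in>block (fst i) (fst (snd i)). (y q - pcov P q)\<^sup>2) \<le> err_factor * best_W (fst i) (snd (snd i))"
    for i :: "nat \<times> (nat \<times> nat) \<times> nat" and y :: "nat \<times> nat \<Rightarrow> real"
  have B1: "?B1 = {c\<in>space ?M1. \<exists>b\<in>center_labels. Q1 b (c b)}" by (auto simp: good_center_def Q1_def)
  have B2: "?B2 = {z\<in>space ?M2. \<exists>i\<in>resolved_index \<alpha>. Q2 i (z i)}" by (auto simp: good_outer_def Q2_def)
  have res: "resolved_index \<alpha> \<subseteq> outer_index" "finite (resolved_index \<alpha>)"
    using finite_outer_index by (auto simp: resolved_index_def intro: finite_subset[OF _ finite_outer_index])
  have c1: "{c\<in>space ?M1. Q1 b (c b)} \<in> sets ?M1 \<and> emeasure ?M1 {c\<in>space ?M1. Q1 b (c b)} \<le> ennreal fail_prob" if b: "b \<in> center_labels" for b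
  proof -
    have "Measurable.pred (center_law X b) (Q1 b)"
      unfolding Q1_def measurable_cong_sets[OF sets_center_law refl] by measurable
    then have s: "{y\<in>space (center_law X b). Q1 b y} \<in> sets (center_law X b)" by measurable
    have "emeasure (center_law X b) {y\<in>space (center_law X b). Q1 b y} \<le> ennreal fail_prob"
      unfolding Q1_def by (rule center_release_good[OF P A(1) X(1) b])
    then show ?thesis using emeasure_PiM_component[of center_labels "center_law X" b "Q1 b"] pr1 b s by simp
  qed
  have c2: "{z\<in>space ?M2. Q2 i (z i)} \<in> sets ?M2 \<and> emeasure ?M2 {z\<in>space ?M2. Q2 i (z i)} \<le> ennreal fail_prob" if i: "i \<in> resolved_index \<alpha>" for i
  proof -
    obtain k b j where ie: "i = (k, b, j)" by (cases i)
    have io: "(k, b, j) \<in> outer_index" "j \<le> jstar \<alpha> k" using i by (auto simp: ie resolved_index_def)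
    have k: "k \<in> scales" using io by (auto simp: outer_index_def)
    have "Measurable.pred (outer_law X i) (Q2 i)"
      unfolding Q2_def ie fst_conv snd_conv measurable_cong_sets[OF sets_outer_law refl] by measurable
    then have s: "{y\<in>space (outer_law X i). Q2 i y} \<in> sets (outer_law X i)" by measurable
    have "M * real k powr (- \<alpha>) \<le> C_G * real k powr (- \<alpha>)" using A by (intro mult_right_mono) auto
    also have "\<dots> \<le> a k j" by (rule jstar_props(2)[OF \<alpha> scales_ge_1[OF k] CG io(2)])
    finally have "emeasure (outer_law X i) {y\<in>space (outer_law X i). Q2 i y} \<le> ennreal fail_prob"
      unfolding Q2_def ie fst_conv snd_conv best_W_def by (rule outer_release_good[OF P A(1) X(1) io(1)])
    then show ?thesis using emeasure_PiM_component[of outer_index "outer_law X" i "Q2 i"] pr2 io(1) s by (simp add: ie del: outer_law.simps)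
  qed
  have b1: "?B1 \<in> sets ?M1" "emeasure ?M1 ?B1 \<le> ennreal (real (card center_labels) * fail_prob)"
    unfolding B1 using c1 finite_center_labels by (auto intro!: sets_Collect_Bex emeasure_Bex_le)
  have f0: "0 \<le> fail_prob" by (simp add: fail_prob_def)
  have b2: "?B2 \<in> sets ?M2" "emeasure ?M2 ?B2 \<le> ennreal (real (card outer_index) * fail_prob)"
  proof -
    show "?B2 \<in> sets ?M2" unfolding B2 using c2 res by (auto intro!: sets_Collect_Bex)
    have "emeasure ?M2 ?B2 \<le> ennreal (real (card (resolved_index \<alpha>)) * fail_prob)"
      unfolding B2 using c2 res by (auto intro!: emeasure_Bex_le)
    also have "\<dots> \<le> ennreal (real (card outer_index) * fail_prob)"
      using f0 card_mono[OF finite_outer_index res(1)] by (intro ennreal_leI mult_right_mono) auto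
    finally show "emeasure ?M2 ?B2 \<le> ennreal (real (card outer_index) * fail_prob)" .
  qed
  let ?Bad = "?B1 \<times> space ?M2 \<union> space ?M1 \<times> ?B2"
  have Bad: "?Bad \<in> sets ?M" using b1 b2 by auto
  have "emeasure ?M ?Bad \<le> emeasure ?M (?B1 \<times> space ?M2) + emeasure ?M (space ?M1 \<times> ?B2)"
    using b1 b2 by (intro emeasure_subadditive) auto
  also have "\<dots> = emeasure ?M1 ?B1 + emeasure ?M2 ?B2"
    using b1 b2 by (simp add: M2.emeasure_pair_measure_Times M2.emeasure_space_1 M1.emeasure_space_1)
  also have "\<dots> \<le> ennreal (real (card center_labels) * fail_prob) + ennreal (real (card outer_index) * fail_prob)"
    by (intro add_mono b1 b2)
  also have "\<dots> = ennreal ((real (card center_labels) + real (card outer_index)) * fail_prob)"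
    using f0 by (simp add: distrib_right ennreal_plus)
  also have "\<dots> \<le> ennreal (1 / real n)" by (intro ennreal_leI release_fail_total[OF adm])
  finally have bad: "emeasure ?M ?Bad \<le> ennreal (1 / real n)" .
  have lf: "loss P (output_map x) \<le> ?G" if "x \<in> space ?M" "x \<notin> ?Bad" for x
  proof -
    obtain c z where x: "x = (c, z)" by (cases x)
    have "good_center P c" "good_outer P \<alpha> z" using that by (auto simp: x space_pair_measure)
    then show ?thesis unfolding x by (rule good_loss[OF adm P \<alpha> X(1)])
  qed
  have lT: "loss P (output_map x) \<le> ?T" for x
    using loss_output_map(2)[OF P A(1), of "fst x" "snd x"] by simp
  have G0: "0 \<le> loss P Y" for Y by (simp add: loss_def sum_nonneg)
  have "(\<integral>\<^sup>+Y. ennreal (loss P Y) \<partial>estimator X) = (\<integral>\<^sup>+x. ennreal (loss P (output_map x)) \<partial>?M)"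
    unfolding estimator_eq by (intro nn_integral_distr om) (simp add: lm del: One_nat_def)
  also have "\<dots> \<le> (\<integral>\<^sup>+x. ennreal ?G + ennreal ?T * indicator ?Bad x \<partial>?M)"
  proof (rule nn_integral_mono)
    fix x assume x: "x \<in> space ?M"
    show "ennreal (loss P (output_map x)) \<le> ennreal ?G + ennreal ?T * indicator ?Bad x"
    proof (cases "x \<in> ?Bad")
      case True
      then show ?thesis using ennreal_leI[OF lT[of x]] by (simp add: add_increasing)
    next
      case False
      then show ?thesis using ennreal_leI[OF lf[OF x False]] by (simp add: indicator_def)
    qed
  qed
  also have "\<dots> = ennreal ?G + ennreal ?T * emeasure ?M ?Bad"
  proof -
    interpret MM: pair_prob_space ?M1 ?M2 unfolding pair_prob_space_def pair_sigma_finite_def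
      by (auto intro: prob_space_imp_sigma_finite M1.prob_space_axioms M2.prob_space_axioms)
    have "(\<integral>\<^sup>+x. ennreal ?G + ennreal ?T * indicator ?Bad x \<partial>?M) = (\<integral>\<^sup>+x. ennreal ?G \<partial>?M) + (\<integral>\<^sup>+x. ennreal ?T * indicator ?Bad x \<partial>?M)"
      using Bad by (intro nn_integral_add borel_measurable_const borel_measurable_times_ennreal borel_measurable_indicator)
    then show ?thesis using Bad by (simp add: MM.emeasure_space_1 nn_integral_cmult_indicator)
  qed
  also have "\<dots> \<le> ennreal ?G + ennreal ?T * ennreal (1 / real n)" by (intro add_left_mono mult_left_mono bad) auto
  also have "\<dots> = ennreal (?G + ?T * (1 / real n))"
  proof -
    have "0 \<le> ?G"
    proof -
      have "0 < \<alpha>" using adm \<alpha> by (simp add: admissible_def)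
      then have "1 / real n + real d / (\<rho> * (real n)\<^sup>2) \<le> rate \<alpha> n d \<rho>"
        using adm by (intro rate_ge) (auto simp: admissible_def)
      moreover have "0 \<le> 1 / real n + real d / (\<rho> * (real n)\<^sup>2)" using T(3) by simp
      ultimately have "0 \<le> rate \<alpha> n d \<rho>" by linarith
      moreover have "0 \<le> loss_factor"
      proof -
        have "0 \<le> err_factor" using err_factor_ge(1)[OF A(1)] by simp
        moreover have "0 \<le> budget_factor" using adm by (simp add: admissible_def budget_factor_def)
        ultimately show ?thesis unfolding loss_factor_def using T(7) adm by (auto simp: admissible_def)
      qed
      ultimately show ?thesis by simp
    qed
    then show ?thesis by (simp add: ennreal_mult[symmetric] ennreal_plus[symmetric] del: ennreal_plus)
  qed
  finally show ?thesis .
qed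

lemma risk_le:
  assumes adm: "admissible M" and P: "P \<in> P_class d \<alpha> K M\<^sub>0 M" and \<alpha>: "\<alpha>_lo \<le> \<alpha>" "\<alpha> \<le> \<alpha>_hi"
  shows "risk n d estimator P \<le> ennreal ((loss_factor + 16 * M\<^sub>0\<^sup>2) * rate \<alpha> n d \<rho>)"
proof -
  have A: tuned using adm by (auto simp: admissible_def)
  note T = tunedD[OF A]
  have d1: "1 \<le> d" using T(8) by simp
  have P': "prob_space P" "sets P = sets (vec_space d)" using P by (auto simp: P_class_def)
  let ?M = "PiM {1..n} (\<lambda>_. P)"
  interpret M: prob_space ?M by (intro prob_space_PiM P')
  let ?Bad = "{X\<in>space ?M. \<not> data_good P X}"
  let ?rt = "rate \<alpha> n d \<rho>"
  let ?G = "loss_factor * real d * ?rt + 8 * real d * M\<^sub>0\<^sup>2 * (1 / real n)" and ?T = "8 * real d * M\<^sub>0\<^sup>2"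
  note bad = data_bad_prob[OF P A]
  have \<alpha>0: "0 < \<alpha>" using adm \<alpha> by (simp add: admissible_def)
  have rt: "1 / real n + real d / (\<rho> * (real n)\<^sup>2) \<le> ?rt"
    using adm \<alpha>0 by (intro rate_ge) (auto simp: admissible_def)
  have rn: "1 / real n \<le> ?rt"
  proof -
    have "0 \<le> real d / (\<rho> * (real n)\<^sup>2)" using T(3) by simp
    then show ?thesis using rt by linarith
  qed
  have rt0: "0 \<le> ?rt" using rn by (smt (verit) divide_nonneg_nonneg of_nat_0_le_iff)
  have lf0: "0 \<le> loss_factor"
  proof -
    have "0 \<le> err_factor" using err_factor_ge(1)[OF A] by simp
    moreover have "0 \<le> budget_factor" using adm by (simp add: admissible_def budget_factor_def)
    ultimately show ?thesis unfolding loss_factor_def using T(7) adm by (auto simp: admissible_def)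
  qed
  have G0: "0 \<le> ?G" using lf0 rt0 by simp
  have sp: "space ?M = space (PiM {1..n} (\<lambda>_. vec_space d))"
    using sets_eq_imp_space_eq[OF P'(2)] by (simp add: space_PiM)
  have inner: "(\<integral>\<^sup>+Y. ennreal ((L2_set (\<lambda>q. Y q - covariance P q) ({1..d} \<times> {1..d}))\<^sup>2) \<partial>estimator X) = (\<integral>\<^sup>+Y. ennreal (loss P Y) \<partial>estimator X)" for X
    by (simp add: L2_set_def loss_def sum_nonneg)
  have T': "(\<integral>\<^sup>+Y. ennreal (loss P Y) \<partial>estimator X) \<le> ennreal ?T" if "X \<in> space ?M" for X
  proof -
    have X: "X \<in> space (PiM {1..n} (\<lambda>_. vec_space d))" using that sp by simp
    have mR: "prob_space (PiM center_labels (center_law X) \<Otimes>\<^sub>M PiM outer_index (outer_law X))"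
      and sM: "sets (PiM center_labels (center_law X) \<Otimes>\<^sub>M PiM outer_index (outer_law X)) = sets (center_space \<Otimes>\<^sub>M outer_space)"
      using measurable_space[OF measurable_releases X] by (auto simp: space_prob_algebra)
    have om: "output_map \<in> PiM center_labels (center_law X) \<Otimes>\<^sub>M PiM outer_index (outer_law X) \<rightarrow>\<^sub>M mat_space d"
      using measurable_output_map[OF d1 T(2)] by (simp only: measurable_cong_sets[OF sM refl])
    have lm: "(\<lambda>Y. ennreal (loss P Y)) \<in> borel_measurable (mat_space d)" unfolding loss_def by measurable
    have "(\<integral>\<^sup>+Y. ennreal (loss P Y) \<partial>estimator X)
        = (\<integral>\<^sup>+x. ennreal (loss P (output_map x)) \<partial>(PiM center_labels (center_law X) \<Otimes>\<^sub>M PiM outer_index (outer_law X)))"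
      unfolding estimator_eq by (intro nn_integral_distr om) (simp add: lm del: One_nat_def)
    also have "\<dots> \<le> (\<integral>\<^sup>+x. ennreal ?T \<partial>(PiM center_labels (center_law X) \<Otimes>\<^sub>M PiM outer_index (outer_law X)))"
      by (intro nn_integral_mono ennreal_leI) (metis loss_output_map(2)[OF P A] surj_pair)
    also have "\<dots> = ennreal ?T" using prob_space.emeasure_space_1[OF mR] by simp
    finally show ?thesis .
  qed
  have "(\<integral>\<^sup>+X. (\<integral>\<^sup>+Y. ennreal (loss P Y) \<partial>estimator X) \<partial>?M) \<le> (\<integral>\<^sup>+X. ennreal ?G + ennreal ?T * indicator ?Bad X \<partial>?M)"
  proof (rule nn_integral_mono)
    fix X assume X: "X \<in> space ?M"
    show "(\<integral>\<^sup>+Y. ennreal (loss P Y) \<partial>estimator X) \<le> ennreal ?G + ennreal ?T * indicator ?Bad X"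
    proof (cases "data_good P X")
      case True
      have "(\<integral>\<^sup>+Y. ennreal (loss P Y) \<partial>estimator X) \<le> ennreal ?G"
        using X sp by (intro expected_loss_good_data[OF adm P \<alpha> True]) simp
      then show ?thesis by (rule order_trans) simp
    next
      case False
      then show ?thesis using T'[OF X] X by (simp add: add_increasing)
    qed
  qed
  also have "\<dots> = (\<integral>\<^sup>+X. ennreal ?G \<partial>?M) + (\<integral>\<^sup>+X. ennreal ?T * indicator ?Bad X \<partial>?M)"
    using bad(1) by (intro nn_integral_add borel_measurable_const borel_measurable_times_ennreal borel_measurable_indicator)
  also have "\<dots> = ennreal ?G + ennreal ?T * emeasure ?M ?Bad"
    using bad(1) M.emeasure_space_1 by (simp add: nn_integral_cmult_indicator)
  also have "\<dots> \<le> ennreal ?G + ennreal ?T * ennreal (1 / real n)" by (intro add_left_mono mult_left_mono bad(2)) auto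
  also have "\<dots> = ennreal (?G + ?T * (1 / real n))"
    using G0 by (simp add: ennreal_mult[symmetric] ennreal_plus[symmetric] del: ennreal_plus)
  finally have main: "(\<integral>\<^sup>+X. (\<integral>\<^sup>+Y. ennreal (loss P Y) \<partial>estimator X) \<partial>?M) \<le> ennreal (?G + ?T * (1 / real n))" .
  have "risk n d estimator P = ennreal (1 / real d) * (\<integral>\<^sup>+X. (\<integral>\<^sup>+Y. ennreal (loss P Y) \<partial>estimator X) \<partial>?M)"
    unfolding risk_def inner ..
  also have "\<dots> \<le> ennreal (1 / real d) * ennreal (?G + ?T * (1 / real n))" by (intro mult_left_mono main) auto
  also have "\<dots> = ennreal (1 / real d * (?G + ?T * (1 / real n)))" by (rule ennreal_mult'[symmetric]) simp
  also have "\<dots> \<le> ennreal ((loss_factor + 16 * M\<^sub>0\<^sup>2) * ?rt)"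
  proof (rule ennreal_leI)
    have "1 / real d * (?G + ?T * (1 / real n)) = loss_factor * ?rt + 16 * M\<^sub>0\<^sup>2 * (1 / real n)"
      using d1 by (simp add: field_simps)
    also have "\<dots> \<le> loss_factor * ?rt + 16 * M\<^sub>0\<^sup>2 * ?rt" using rn by (intro add_left_mono mult_left_mono) auto
    finally show "1 / real d * (?G + ?T * (1 / real n)) \<le> (loss_factor + 16 * M\<^sub>0\<^sup>2) * ?rt" by (simp add: distrib_right)
  qed
  finally show ?thesis .
qed

end

section \<open>The asymptotic statement\<close>

context center_outer
begin

text \<open>Separates the dependence on the sample size, a power of \<open>ell\<close>, from the
  fixed constants.\<close>

lemma loss_factor_le:
  assumes adm: "admissible M" and E_D: "6 \<le> E_D"
  shows "loss_factor + 16 * M\<^sub>0\<^sup>2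
    \<le> (16 * (2 + 24 * C_L\<^sup>2 * K ^ 4 + 144 * C_R\<^sup>2 * K ^ 4 + 1152 * C_1\<^sup>2 * K ^ 4)
        + 216 * C_D * (8 * C_G\<^sup>2 + 16 * (4 * (\<alpha>_hi - \<alpha>_lo) + 1) + 1) + 16 * M\<^sub>0\<^sup>2) * ell powr (E_D + 3)"
    (is "_ \<le> (16 * ?e + 216 * C_D * (_ + ?g + 1) + _) * ?P")
proof -
  have A: tuned "0 \<le> C_D" "\<alpha>_lo \<le> \<alpha>_hi" using adm by (auto simp: admissible_def)
  have l: "1 \<le> ell" using tunedD(7)[OF A(1)] by simp
  have P1: "1 \<le> ?P" using l E_D by (intro ge_one_powr_ge_zero) auto
  have "ell ^ 6 = ell powr 6" using l by (simp add: powr_numeral)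
  also have "\<dots> \<le> ?P" using l E_D by (intro powr_mono) auto
  finally have "16 * ?e * ell ^ 6 \<le> 16 * ?e * ?P"
    by (rule mult_left_mono) (intro mult_nonneg_nonneg add_nonneg_nonneg, auto)
  then have 1: "16 * err_factor \<le> 16 * ?e * ?P" unfolding err_factor_def by (simp only: mult.assoc)
  have P: "ell * ell powr E_D * ell\<^sup>2 = ?P"
  proof -
    have "ell\<^sup>2 = ell powr 2" using l by (simp add: powr_numeral)
    then have "ell * ell powr E_D * ell\<^sup>2 = ell powr 1 * ell powr E_D * ell powr 2" using l by simp
    also have "\<dots> = ?P" by (simp only: powr_add[symmetric]) (simp add: add.commute)
    finally show ?thesis .
  qed
  have l2: "1 \<le> ell\<^sup>2" using l by simp
  have "8 * C_G\<^sup>2 + budget_factor + 1 \<le> (8 * C_G\<^sup>2 + ?g + 1) * ell\<^sup>2"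
  proof -
    have "8 * C_G\<^sup>2 * 1 \<le> 8 * C_G\<^sup>2 * ell\<^sup>2" using l2 by (intro mult_left_mono) auto
    then show ?thesis unfolding budget_factor_def using l2 by (simp add: distrib_right)
  qed
  then have "216 * ell * (C_D * ell powr E_D) * (8 * C_G\<^sup>2 + budget_factor + 1)
      \<le> 216 * ell * (C_D * ell powr E_D) * ((8 * C_G\<^sup>2 + ?g + 1) * ell\<^sup>2)"
    using A l by (intro mult_left_mono) auto
  also have "\<dots> = 216 * C_D * (8 * C_G\<^sup>2 + ?g + 1) * (ell * ell powr E_D * ell\<^sup>2)" by (simp only: mult_ac)
  finally have 2: "216 * ell * (C_D * ell powr E_D) * (8 * C_G\<^sup>2 + budget_factor + 1)
      \<le> 216 * C_D * (8 * C_G\<^sup>2 + ?g + 1) * ?P" unfolding P .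
  have 3: "16 * M\<^sub>0\<^sup>2 * 1 \<le> 16 * M\<^sub>0\<^sup>2 * ?P" using P1 by (intro mult_left_mono) auto
  show ?thesis unfolding loss_factor_def using add_mono[OF add_mono[OF 1 2] 3] by (simp only: distrib_right mult_1_right)
qed

end

text \<open>All conditions on the sample size reduce to \<open>ln n\<close> exceeding a constant
  and \<open>d/(\<rho> n\<^sup>2)\<close> falling below another. The lower bound on
  \<open>d\<close> makes \<open>d\<close> exceed \<open>\<rho>\<close>, and \<open>d \<le>
  n\<^sup>2\<close> follows from the vanishing ratio.\<close>

lemma regime_eventually:
  assumes reg: "regime c \<rho>max n d \<rho>" and c: "0 < c" and \<rho>max: "0 < \<rho>max"
  shows "\<forall>\<^sub>F m in sequentially. T \<le> ln (real (n m)) \<and> T \<le> real (d m) \<and> 0 < \<rho> m \<and> \<rho> m \<le> real (d m)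
    \<and> d m \<le> (n m)\<^sup>2 \<and> real (d m) / (\<rho> m * (real (n m))\<^sup>2) \<le> 1"
proof -
  have r: "filterlim n at_top sequentially" "\<forall>\<^sub>F m in sequentially. c * ln (real (n m)) \<le> real (d m)"
    "\<forall>\<^sub>F m in sequentially. 0 < \<rho> m \<and> \<rho> m \<le> \<rho>max"
    "(\<lambda>m. real (d m) / (\<rho> m * (real (n m))\<^sup>2)) \<longlonglongrightarrow> 0" using reg by (auto simp: regime_def)
  have "filterlim (\<lambda>m. ln (real (n m))) at_top sequentially"
    by (rule filterlim_compose[OF ln_at_top filterlim_compose[OF filterlim_real_sequentially r(1)]])
  then have "\<forall>\<^sub>F m in sequentially. max (max T 1) (max T \<rho>max / c) \<le> ln (real (n m))"
    unfolding filterlim_at_top by blast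
  moreover have "\<forall>\<^sub>F m in sequentially. real (d m) / (\<rho> m * (real (n m))\<^sup>2) < min 1 (1 / \<rho>max)"
    using \<rho>max by (intro order_tendstoD(2)[OF r(4)]) auto
  ultimately show ?thesis using r(2,3)
  proof eventually_elim
    case (elim m)
    have l: "T \<le> ln (real (n m))" "1 \<le> ln (real (n m))" "max T \<rho>max \<le> c * ln (real (n m))"
      using elim(1) c by (auto simp: pos_divide_le_eq mult.commute)
    have n: "1 < real (n m)"
    proof (rule ccontr)
      assume "\<not> 1 < real (n m)"
      then have "n m = 0 \<or> n m = 1" by auto
      then show False using l(2) by auto
    qed
    have \<rho>: "0 < \<rho> m" "\<rho> m \<le> \<rho>max" using elim by auto
    have "real (d m) / (\<rho> m * (real (n m))\<^sup>2) \<le> 1 / \<rho>max" using elim(2) by simp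
    then have "real (d m) \<le> (\<rho> m * (real (n m))\<^sup>2) / \<rho>max"
      using \<rho> n by (simp add: divide_le_eq)
    also have "\<dots> \<le> (\<rho>max * (real (n m))\<^sup>2) / \<rho>max" using \<rho> by (intro divide_right_mono mult_right_mono) auto
    also have "\<dots> = real ((n m)\<^sup>2)" using \<rho> by simp
    finally have "d m \<le> (n m)\<^sup>2" by (simp only: of_nat_le_iff)
    then show ?case using l \<rho> elim by auto
  qed
qed

theorem theorem5p4:
  fixes \<alpha>_lo \<alpha>_hi K M\<^sub>0 M :: real
  assumes "0 < \<alpha>_lo" and "\<alpha>_lo \<le> \<alpha>_hi" and "0 < K" and "0 < M\<^sub>0" and "0 < M"
  shows "\<exists>c\<^sub>0 :: real. \<forall>C_L\<ge>c\<^sub>0. \<forall>C_1\<ge>c\<^sub>0. \<forall>C_G\<ge>c\<^sub>0. \<forall>C_R\<ge>c\<^sub>0. \<forall>C_D\<ge>c\<^sub>0. \<forall>E_D\<ge>c\<^sub>0.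
    \<forall>c>0. \<forall>\<rho>max>0. \<exists>C A :: real. \<forall>n d \<rho>. regime c \<rho>max n d \<rho> \<longrightarrow>
      (\<forall>\<^sub>F m in sequentially.
        let est = center_outer.estimator \<alpha>_lo \<alpha>_hi K M\<^sub>0 C_L C_1 C_G C_R C_D E_D (n m) (d m) (\<rho> m)
        in zCDP (n m) (vec_space (d m)) (mat_space (d m)) (\<rho> m) est \<and>
           (\<forall>\<alpha>\<in>{\<alpha>_lo..\<alpha>_hi}.
              (SUP P\<in>P_class (d m) \<alpha> K M\<^sub>0 M. risk (n m) (d m) est P)
              \<le> ennreal (C * ln (exp 1 * real (d m) * real (n m) / \<rho> m) powr A
                          * rate \<alpha> (n m) (d m) (\<rho> m))))"
proof (rule exI[of _ "max 64 M"], intro allI impI)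
  (* The constant 64 covers the thresholds on the clipping constants, and M makes the radii up to
     the resolved level dominate the class bound. *)
  fix C_L C_1 C_G C_R C_D E_D c \<rho>max :: real
  assume C: "max 64 M \<le> C_L" "max 64 M \<le> C_1" "max 64 M \<le> C_G" "max 64 M \<le> C_R" "max 64 M \<le> C_D" "max 64 M \<le> E_D"
    and c: "0 < c" "0 < \<rho>max"
  define e where "e = 2 + 24 * C_L\<^sup>2 * K ^ 4 + 144 * C_R\<^sup>2 * K ^ 4 + 1152 * C_1\<^sup>2 * K ^ 4"
  define C where "C = 16 * e + 216 * C_D * (8 * C_G\<^sup>2 + 16 * (4 * (\<alpha>_hi - \<alpha>_lo) + 1) + 1) + 16 * M\<^sub>0\<^sup>2"
  have C0: "0 \<le> C" unfolding C_def e_def using C assms(2) by (intro add_nonneg_nonneg mult_nonneg_nonneg) auto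
  define T where "T = max 100 (max e (4 * (\<alpha>_hi - \<alpha>_lo) + 1))"
  show "\<exists>C A :: real. \<forall>n d \<rho>. regime c \<rho>max n d \<rho> \<longrightarrow>
      (\<forall>\<^sub>F m in sequentially.
        let est = center_outer.estimator \<alpha>_lo \<alpha>_hi K M\<^sub>0 C_L C_1 C_G C_R C_D E_D (n m) (d m) (\<rho> m)
        in zCDP (n m) (vec_space (d m)) (mat_space (d m)) (\<rho> m) est \<and>
           (\<forall>\<alpha>\<in>{\<alpha>_lo..\<alpha>_hi}.
              (SUP P\<in>P_class (d m) \<alpha> K M\<^sub>0 M. risk (n m) (d m) est P)
              \<le> ennreal (C * ln (exp 1 * real (d m) * real (n m) / \<rho> m) powr A
                          * rate \<alpha> (n m) (d m) (\<rho> m))))"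
  proof (rule exI[of _ C], rule exI[of _ "E_D + 3"], intro allI impI)
    fix n d :: "nat \<Rightarrow> nat" and \<rho> :: "nat \<Rightarrow> real"
    assume "regime c \<rho>max n d \<rho>"
    from regime_eventually[OF this c, of T]
    show "\<forall>\<^sub>F m in sequentially.
        let est = center_outer.estimator \<alpha>_lo \<alpha>_hi K M\<^sub>0 C_L C_1 C_G C_R C_D E_D (n m) (d m) (\<rho> m)
        in zCDP (n m) (vec_space (d m)) (mat_space (d m)) (\<rho> m) est \<and>
           (\<forall>\<alpha>\<in>{\<alpha>_lo..\<alpha>_hi}.
              (SUP P\<in>P_class (d m) \<alpha> K M\<^sub>0 M. risk (n m) (d m) est P)
              \<le> ennreal (C * ln (exp 1 * real (d m) * real (n m) / \<rho> m) powr (E_D + 3)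
                          * rate \<alpha> (n m) (d m) (\<rho> m)))"
    proof eventually_elim
      case (elim m)
      interpret center_outer \<alpha>_lo \<alpha>_hi K M\<^sub>0 C_L C_1 C_G C_R C_D E_D "n m" "d m" "\<rho> m" .
      have l: "100 \<le> ell" "e \<le> ell" "4 * (\<alpha>_hi - \<alpha>_lo) + 1 \<le> ell" and d: "4 \<le> d m" "d m \<le> (n m)\<^sup>2"
        and \<rho>: "0 < \<rho> m" "\<rho> m \<le> real (d m)" and s: "real (d m) / (\<rho> m * (real (n m))\<^sup>2) \<le> 1"
        using elim by (auto simp: T_def ell_def)
      have tun: tuned unfolding tuned_def using assms C l d \<rho> by auto
      note TT = tunedD[OF tun]
      have "err_factor \<le> C_D * ell powr E_D"
      proof -
        (* One power of the logarithm absorbs the constants, so the exponent 7 in the tolerance is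
           enough. *)
        have "err_factor = e * ell ^ 6" by (simp add: err_factor_def e_def)
        also have "\<dots> \<le> ell * ell ^ 6" using l by (intro mult_right_mono) auto
        also have "\<dots> = ell powr 7" using l by (simp add: powr_numeral power_numeral_reduce)
        also have "\<dots> \<le> ell powr E_D" using l C by (intro powr_mono) auto
        also have "\<dots> \<le> C_D * ell powr E_D" using C mult_right_mono[of 1 C_D "ell powr E_D"] by auto
        finally show ?thesis .
      qed
      then have adm: "admissible M" unfolding admissible_def using tun assms C s l by auto
      have n2: "2 \<le> n m" using TT(10) by simp
      have "zCDP (n m) (vec_space (d m)) (mat_space (d m)) (\<rho> m) estimator"
        using n2 d \<rho> assms C by (intro zCDP_estimator) auto
      moreover have "(SUP P\<in>P_class (d m) \<alpha> K M\<^sub>0 M. risk (n m) (d m) estimator P)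
          \<le> ennreal (C * ln (exp 1 * real (d m) * real (n m) / \<rho> m) powr (E_D + 3) * rate \<alpha> (n m) (d m) (\<rho> m))"
        if \<alpha>: "\<alpha> \<in> {\<alpha>_lo..\<alpha>_hi}" for \<alpha>
      proof (rule SUP_least)
        fix P assume P: "P \<in> P_class (d m) \<alpha> K M\<^sub>0 M"
        have rt0: "0 \<le> rate \<alpha> (n m) (d m) (\<rho> m)" unfolding rate_def using \<rho> by (intro add_nonneg_nonneg min.boundedI) auto
        have "real (n m) \<le> exp 1 * real (d m) * real (n m) / \<rho> m"
        proof -
          have "\<rho> m * real (n m) \<le> real (d m) * real (n m)" using \<rho> by (intro mult_right_mono) auto
          also have "\<dots> \<le> exp 1 * (real (d m) * real (n m))"
            using mult_right_mono[of 1 "exp 1" "real (d m) * real (n m)"] by simp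
          finally show ?thesis using \<rho> by (simp add: pos_le_divide_eq mult_ac)
        qed
        then have ll: "ell \<le> ln (exp 1 * real (d m) * real (n m) / \<rho> m)"
          unfolding ell_def using n2 by (intro ln_mono) auto
        have "risk (n m) (d m) estimator P \<le> ennreal ((loss_factor + 16 * M\<^sub>0\<^sup>2) * rate \<alpha> (n m) (d m) (\<rho> m))"
          using \<alpha> by (intro risk_le[OF adm P]) auto
        also have "\<dots> \<le> ennreal (C * ln (exp 1 * real (d m) * real (n m) / \<rho> m) powr (E_D + 3) * rate \<alpha> (n m) (d m) (\<rho> m))"
        proof (intro ennreal_leI mult_right_mono rt0)
          have "loss_factor + 16 * M\<^sub>0\<^sup>2 \<le> C * ell powr (E_D + 3)"
            unfolding C_def e_def using C by (intro loss_factor_le[OF adm]) auto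
          also have "\<dots> \<le> C * ln (exp 1 * real (d m) * real (n m) / \<rho> m) powr (E_D + 3)"
            using ll l C C0 by (intro mult_left_mono powr_mono2) auto
          finally show "loss_factor + 16 * M\<^sub>0\<^sup>2 \<le> C * ln (exp 1 * real (d m) * real (n m) / \<rho> m) powr (E_D + 3)" .
        qed
        finally show "risk (n m) (d m) estimator P
            \<le> ennreal (C * ln (exp 1 * real (d m) * real (n m) / \<rho> m) powr (E_D + 3) * rate \<alpha> (n m) (d m) (\<rho> m))" .
      qed
      ultimately show ?case by (simp add: Let_def)
    qed
  qed
qed

end
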